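(* Let $(X,\mathfrak m,\mathscr E,\mathscr F(X))$ be a locally smoothing strongly local Dirichlet space, let $\lambda\ge 0$ and let $f\in L^1_{\mathrm{loc}}(X,\mathfrak m)$ be locally $\lambda$-shift defective. Given an open set $U\Subset X$, let $g\in C_b(U)$ be a weakly $\lambda$-harmonic function on $U$ with $e^{-t\lambda}P^U_t(f|_U-g)\ge f|_U-g$ for all $t>0$ (which exists by the definition of local $\lambda$-shift defectivity). Then for every $k\in\mathbb N$ the function $$f^U_k:=e^{-\lambda/k}P^U_{1/k}(f|_U-g)+g$$ belongs to $\mathscr F_{\mathrm{loc}}(U)\cap C_b(U)$, is locally $\lambda$-shift defective and weakly $\lambda$-subharmonic on $U$, and one has $f^U_k\downarrow f|_U$ $\mathfrak m$-a.e. as $k\to\infty$; consequently $f^\bullet_U:=\inf_{k\in\mathbb N}f^U_k$ is an upper semicontinuous $\mathfrak m$-representative of $f|_U$. In particular, the function $f$ has an upper semicontinuous $\mathfrak m$-representative.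
   Context: Function spaces are real; inequalities between classes of functions hold $\mathfrak m$-a.e. A strongly local Dirichlet space is a quadruple $(X,\mathfrak m,\mathscr E,\mathscr F(X))$, where $X$ is a locally compact, separable, metrizable space, $\mathfrak m$ is a Radon measure on $X$ with full support, and $\mathscr E$ is a closed, symmetric, nonnegative bilinear form in $L^2(X,\mathfrak m)$ with dense domain $\mathscr F(X)$ such that: (Markov) for all contractions $T:\mathbb R\to\mathbb R$ with $T(0)=0$ and $f\in\mathscr F(X)$ one has $T\circ f\in\mathscr F(X)$ and $\mathscr E(T\circ f,T\circ f)\le\mathscr E(f,f)$; (regular) $\mathscr F(X)\cap C_c(X)$ is dense in $C_c(X)$ w.r.t. $\|\cdot\|_\infty$ and in $\mathscr F(X)$ w.r.t. $\mathscr E_1(u,v)=\mathscr E(u,v)+\int uv\,d\mathfrak m$; (strongly local) $\mathscr E(u,v)=0$ whenever $u,v\in\mathscr F(X)$ and $u$ is constant on the support of $v$. For open $U,V\subset X$, $U\Subset V$ means that $\overline U$ is a compact subset of $X$ with $\overline U\subset V$. $\mathscr F_{\mathrm{loc}}(X)$ is the set of $f\in L^2_{\mathrm{loc}}(X,\mathfrak m)$ such that for every open $U\Subset X$ there is $h\in\mathscr F(X)$ with $f=h$ on $U$; $\mathscr F_c(X)$ is the set of elements of $\mathscr F(X)$ with compact $\mathfrak m$-support. $\mathscr E$ extends to $\mathscr F_{\mathrm{loc}}(X)\times\mathscr F_c(X)$ by $\mathscr E(f,\phi):=\mathscr E(h,\phi)$ with $h\in\mathscr F(X)$ equal to $f$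 in an open neighbourhood of the support of $\phi$; $\mathscr E_\lambda(u,v):=\mathscr E(u,v)+\lambda\int uv\,d\mathfrak m$. A function $f\in\mathscr F_{\mathrm{loc}}(X)$ is weakly $\lambda$-subharmonic if $\mathscr E_\lambda(f,\phi)\le 0$ for all $0\le\phi\in\mathscr F_c(X)$, and weakly $\lambda$-harmonic if both $f$ and $-f$ are weakly $\lambda$-subharmonic. The prefix $\lambda$ is dropped if $\lambda=0$. $H\ge0$ is the self-adjoint operator in $L^2(X,\mathfrak m)$ induced by $\mathscr E$, and $P_t=e^{-tH}$, extended consistently to a positivity preserving contraction semigroup on all $L^q(X,\mathfrak m)$, $q\in[1,\infty]$. For open $U\subset X$, $\mathscr F(U)$ is the closure of $C_c(U)\cap\mathscr F(X)$ w.r.t. $\mathscr E_1$; then $(U,\mathfrak m,\mathscr E,\mathscr F(U))$ is again a strongly local Dirichlet space, with semigroup denoted $P^U_t$; notions "on $U$" refer to this space. For $f\in\mathscr F(X)\cap L^\infty$ the energy measure $\Gamma(f)$ is defined by $\int\phi\,d\Gamma(f)=\mathscr E(f,\phi f)-\frac12\mathscr E(f^2,\phi)$ for $\phi\in\mathscr F(X)\cap C_c(X)$; it extends to $\mathscr F(X)$ and, by locality, to $\mathscr F_{\mathrm{loc}}(X)$. The space is: ultracontractive if $P_t(L^1(X,\mathfrak m))\subset L^\infty(X,\mathfrak m)$ for all $t>0$; doubly Feller if $P_t:C_0(X)\to C_0(X)$ for all $t\ge0$, $P_t:L^\infty(X,\mathfrak m)\to C(X)$ for all $t>0$, and $\lim_{t\to0+}P_tf(x)=f(x)$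 for all $f\in C_0(X)$, $x\in X$ ($C_0$ = continuous functions vanishing at infinity); irreducible if every $f\in\mathscr F_{\mathrm{loc}}(X)$ with $\Gamma(f)=0$ is constant. It is locally smoothing if for every open $U\Subset X$: $(U,\mathfrak m,\mathscr E,\mathscr F(U))$ is ultracontractive, and there is an open $U'\subset X$ with $U\subset U'$, $U'\setminus\overline U\ne\emptyset$, such that $(U',\mathfrak m,\mathscr E,\mathscr F(U'))$ is doubly Feller and irreducible. A function $f\in L^1_{\mathrm{loc}}(X,\mathfrak m)$ is locally $\lambda$-shift defective if for every open $U\Subset X$ there is a weakly $\lambda$-harmonic $g\in C_b(U)$ on $U$ with $e^{-t\lambda}P^U_t(f|_U-g)\ge f|_U-g$ for all $t>0$. Upper semicontinuous functions may take the value $-\infty$. *)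

theory Defs
  imports "HOL-Analysis.Analysis"
begin

text \<open>
  Elements of function spaces are represented by functions \<open>'a \<Rightarrow> real\<close> that are compared
  almost everywhere; values outside the underlying space \<open>topspace X = space M\<close> are irrelevant.
  The topology is a carrier-based one, so that the Dirichlet space on an open subset
  is an object of the same type and every notion below applies to it verbatim.
\<close>

section \<open>Function spaces\<close>

definition L1 :: "'a measure \<Rightarrow> ('a \<Rightarrow> real) set" where
  "L1 M = {f. integrable M f}"

definition L2 :: "'a measure \<Rightarrow> ('a \<Rightarrow> real) set" where
  "L2 M = {f. f \<in> borel_measurable M \<and> integrable M (\<lambda>x. (f x)\<^sup>2)}"

definition Linf :: "'a measure \<Rightarrow> ('a \<Rightarrow> real) set" where
  "Linf M = {f. f \<in> borel_measurable M \<and> (\<exists>C. AE x in M. \<bar>f x\<bar> \<le> C)}"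

definition sqnorm2 :: "'a measure \<Rightarrow> ('a \<Rightarrow> real) \<Rightarrow> real" where
  "sqnorm2 M f = (\<integral>x. (f x)\<^sup>2 \<partial>M)"

definition L1loc :: "'a topology \<Rightarrow> 'a measure \<Rightarrow> ('a \<Rightarrow> real) set" where
  "L1loc X M = {f. f \<in> borel_measurable M \<and>
     (\<forall>K. compactin X K \<longrightarrow> set_integrable M K f)}"

definition L2loc :: "'a topology \<Rightarrow> 'a measure \<Rightarrow> ('a \<Rightarrow> real) set" where
  "L2loc X M = {f. f \<in> borel_measurable M \<and>
     (\<forall>K. compactin X K \<longrightarrow> set_integrable M K (\<lambda>x. (f x)\<^sup>2))}"

definition C_space :: "'a topology \<Rightarrow> ('a \<Rightarrow> real) set" where
  "C_space X = {f. continuous_map X euclideanreal f}"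

definition C_b :: "'a topology \<Rightarrow> ('a \<Rightarrow> real) set" where
  "C_b X = {f \<in> C_space X. \<exists>C. \<forall>x\<in>topspace X. \<bar>f x\<bar> \<le> C}"

definition C_0 :: "'a topology \<Rightarrow> ('a \<Rightarrow> real) set" where
  "C_0 X = {f \<in> C_space X. \<forall>\<epsilon>>0. compactin X {x \<in> topspace X. \<epsilon> \<le> \<bar>f x\<bar>}}"

definition C_c :: "'a topology \<Rightarrow> ('a \<Rightarrow> real) set" where
  "C_c X = {f \<in> C_space X. compactin X (X closure_of {x \<in> topspace X. f x \<noteq> 0})}"

text \<open>The \<open>M\<close>-support: complement of the largest open set on which \<open>f\<close> vanishes a.e.\<close>

definition msupport :: "'a topology \<Rightarrow> 'a measure \<Rightarrow> ('a \<Rightarrow> real) \<Rightarrow> 'a set" where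
  "msupport X M f = topspace X - \<Union>{V. openin X V \<and> (AE x in M. x \<in> V \<longrightarrow> f x = 0)}"

definition relcompact_open :: "'a topology \<Rightarrow> 'a set \<Rightarrow> bool" where
  "relcompact_open X U \<longleftrightarrow> openin X U \<and> compactin X (X closure_of U)"

definition upper_semicontinuous :: "'a topology \<Rightarrow> ('a \<Rightarrow> ereal) \<Rightarrow> bool" where
  "upper_semicontinuous X h \<longleftrightarrow>
     (\<forall>x\<in>topspace X. h x < \<infinity>) \<and> (\<forall>a. openin X {x \<in> topspace X. h x < a})"

definition radon_measure :: "'a topology \<Rightarrow> 'a measure \<Rightarrow> bool" where
  "radon_measure X M \<longleftrightarrow>
     space M = topspace X \<and> sets M = sigma_sets (topspace X) {U. openin X U} \<and>
     (\<forall>K. compactin X K \<longrightarrow> emeasure M K < \<infinity>) \<and>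
     (\<forall>A\<in>sets M. emeasure M A = (SUP K\<in>{K. compactin X K \<and> K \<subseteq> A}. emeasure M K))"

section \<open>Dirichlet spaces\<close>

record 'a form_space =
  topo :: "'a topology"
  meas :: "'a measure"
  form :: "('a \<Rightarrow> real) \<Rightarrow> ('a \<Rightarrow> real) \<Rightarrow> real"
  fdom :: "('a \<Rightarrow> real) set"

definition form_add :: "'a form_space \<Rightarrow> real \<Rightarrow> ('a \<Rightarrow> real) \<Rightarrow> ('a \<Rightarrow> real) \<Rightarrow> real" where
  "form_add D lam u v = form D u v + lam * (\<integral>x. u x * v x \<partial>meas D)"

abbreviation sqnormE1 :: "'a form_space \<Rightarrow> ('a \<Rightarrow> real) \<Rightarrow> real" where
  "sqnormE1 D u \<equiv> form_add D 1 u u"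

text \<open>
  The third and fourth conjuncts say that domain and form live on a.e. equivalence classes.
\<close>

definition closed_form :: "'a form_space \<Rightarrow> bool" where
  "closed_form D \<longleftrightarrow>
     fdom D \<subseteq> L2 (meas D) \<and>
     (\<forall>u\<in>fdom D. \<forall>v\<in>fdom D. \<forall>a b. (\<lambda>x. a * u x + b * v x) \<in> fdom D) \<and>
     (\<forall>u\<in>fdom D. \<forall>v\<in>borel_measurable (meas D). (AE x in meas D. u x = v x) \<longrightarrow> v \<in> fdom D) \<and>
     (\<forall>u\<in>fdom D. \<forall>v\<in>fdom D. (AE x in meas D. u x = v x) \<longrightarrow>
        (\<forall>w\<in>fdom D. form D u w = form D v w)) \<and>
     (\<forall>u\<in>fdom D. \<forall>v\<in>fdom D. \<forall>w\<in>fdom D. \<forall>a b.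
        form D (\<lambda>x. a * u x + b * v x) w = a * form D u w + b * form D v w) \<and>
     (\<forall>u\<in>fdom D. \<forall>v\<in>fdom D. form D u v = form D v u) \<and>
     (\<forall>u\<in>fdom D. 0 \<le> form D u u) \<and>
     (\<forall>f\<in>L2 (meas D). \<forall>\<epsilon>>0. \<exists>u\<in>fdom D. sqnorm2 (meas D) (\<lambda>x. f x - u x) < \<epsilon>) \<and>
     (\<forall>u. (\<forall>n::nat. u n \<in> fdom D) \<and>
          (\<forall>\<epsilon>>0. \<exists>N. \<forall>m\<ge>N. \<forall>n\<ge>N. sqnormE1 D (\<lambda>x. u m x - u n x) < \<epsilon>) \<longrightarrow>
          (\<exists>v\<in>fdom D. (\<lambda>n. sqnormE1 D (\<lambda>x. u n x - v x)) \<longlonglongrightarrow> 0))"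

definition markovian :: "'a form_space \<Rightarrow> bool" where
  "markovian D \<longleftrightarrow>
     (\<forall>T :: real \<Rightarrow> real. T 0 = 0 \<and> (\<forall>s t. \<bar>T s - T t\<bar> \<le> \<bar>s - t\<bar>) \<longrightarrow>
        (\<forall>f\<in>fdom D. T \<circ> f \<in> fdom D \<and> form D (T \<circ> f) (T \<circ> f) \<le> form D f f))"

definition regular_form :: "'a form_space \<Rightarrow> bool" where
  "regular_form D \<longleftrightarrow>
     (\<forall>f\<in>C_c (topo D). \<forall>\<epsilon>>0. \<exists>\<phi>\<in>fdom D \<inter> C_c (topo D).
        \<forall>x\<in>topspace (topo D). \<bar>f x - \<phi> x\<bar> < \<epsilon>) \<and>
     (\<forall>f\<in>fdom D. \<forall>\<epsilon>>0. \<exists>\<phi>\<in>fdom D \<inter> C_c (topo D). sqnormE1 D (\<lambda>x. f x - \<phi> x) < \<epsilon>)"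

definition strongly_local :: "'a form_space \<Rightarrow> bool" where
  "strongly_local D \<longleftrightarrow>
     (\<forall>u\<in>fdom D. \<forall>v\<in>fdom D.
        (\<exists>c. AE x in meas D. x \<in> msupport (topo D) (meas D) v \<longrightarrow> u x = c) \<longrightarrow> form D u v = 0)"

definition strongly_local_dirichlet_space :: "'a form_space \<Rightarrow> bool" where
  "strongly_local_dirichlet_space D \<longleftrightarrow>
     locally_compact_space (topo D) \<and> separable_space (topo D) \<and> metrizable_space (topo D) \<and>
     radon_measure (topo D) (meas D) \<and>
     (\<forall>U. openin (topo D) U \<and> U \<noteq> {} \<longrightarrow> 0 < emeasure (meas D) U) \<and>
     closed_form D \<and> markovian D \<and> regular_form D \<and> strongly_local D"

text \<open>
  The part of \<open>D\<close> on an open set \<open>U\<close>. Its domain, the closure of \<open>C_c(U) \<inter> \<F>(X)\<close>, is a space of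
  functions on \<open>X\<close> vanishing a.e. off \<open>U\<close>; it is identified with a space of functions on \<open>U\<close>
  through extension by zero.
\<close>

definition zero_ext :: "'a set \<Rightarrow> ('a \<Rightarrow> real) \<Rightarrow> 'a \<Rightarrow> real" where
  "zero_ext U f = (\<lambda>x. if x \<in> U then f x else 0)"

definition part_closure :: "'a form_space \<Rightarrow> 'a set \<Rightarrow> ('a \<Rightarrow> real) set" where
  "part_closure D U = {f \<in> fdom D. \<forall>\<epsilon>>0. \<exists>\<phi>\<in>fdom D \<inter> C_c (topo D).
     topo D closure_of {x \<in> topspace (topo D). \<phi> x \<noteq> 0} \<subseteq> U \<and>
     sqnormE1 D (\<lambda>x. f x - \<phi> x) < \<epsilon>}"

definition part_space :: "'a form_space \<Rightarrow> 'a set \<Rightarrow> 'a form_space" where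
  "part_space D U =
     \<lparr>topo = subtopology (topo D) U,
      meas = restrict_space (meas D) U,
      form = (\<lambda>u v. form D (zero_ext U u) (zero_ext U v)),
      fdom = {f. zero_ext U f \<in> part_closure D U}\<rparr>"

definition F_loc :: "'a form_space \<Rightarrow> ('a \<Rightarrow> real) set" where
  "F_loc D = {f \<in> L2loc (topo D) (meas D).
     \<forall>U. relcompact_open (topo D) U \<longrightarrow> (\<exists>h\<in>fdom D. AE x in meas D. x \<in> U \<longrightarrow> f x = h x)}"

definition F_c :: "'a form_space \<Rightarrow> ('a \<Rightarrow> real) set" where
  "F_c D = {f \<in> fdom D. compactin (topo D) (msupport (topo D) (meas D) f)}"

definition form_loc :: "'a form_space \<Rightarrow> ('a \<Rightarrow> real) \<Rightarrow> ('a \<Rightarrow> real) \<Rightarrow> real" where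
  "form_loc D f \<phi> = (THE r. \<exists>h\<in>fdom D. \<exists>W. openin (topo D) W \<and>
     msupport (topo D) (meas D) \<phi> \<subseteq> W \<and> (AE x in meas D. x \<in> W \<longrightarrow> f x = h x) \<and>
     r = form D h \<phi>)"

definition weakly_subharmonic :: "'a form_space \<Rightarrow> real \<Rightarrow> ('a \<Rightarrow> real) \<Rightarrow> bool" where
  "weakly_subharmonic D lam f \<longleftrightarrow> f \<in> F_loc D \<and>
     (\<forall>\<phi>\<in>F_c D. (AE x in meas D. 0 \<le> \<phi> x) \<longrightarrow>
        form_loc D f \<phi> + lam * (\<integral>x. f x * \<phi> x \<partial>meas D) \<le> 0)"

definition weakly_harmonic :: "'a form_space \<Rightarrow> real \<Rightarrow> ('a \<Rightarrow> real) \<Rightarrow> bool" where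
  "weakly_harmonic D lam f \<longleftrightarrow>
     weakly_subharmonic D lam f \<and> weakly_subharmonic D lam (\<lambda>x. - f x)"

section \<open>The semigroup\<close>

text \<open>\<open>operator_graph D u w\<close> means \<open>H u = w\<close>, for the operator \<open>H\<close> induced by the form.\<close>

definition operator_graph :: "'a form_space \<Rightarrow> ('a \<Rightarrow> real) \<Rightarrow> ('a \<Rightarrow> real) \<Rightarrow> bool" where
  "operator_graph D u w \<longleftrightarrow> u \<in> fdom D \<and> w \<in> L2 (meas D) \<and>
     (\<forall>v\<in>fdom D. form D u v = (\<integral>x. w x * v x \<partial>meas D))"

text \<open>
  \<open>e^{-tH}\<close> is the strongly continuous contraction semigroup on \<open>L2\<close> with generator \<open>-H\<close>.
  It is unique up to a.e. equality.
\<close>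

definition is_L2_semigroup ::
    "'a form_space \<Rightarrow> (real \<Rightarrow> ('a \<Rightarrow> real) \<Rightarrow> 'a \<Rightarrow> real) \<Rightarrow> bool" where
  "is_L2_semigroup D T \<longleftrightarrow> (let M = meas D in
     (\<forall>t\<ge>0. \<forall>f\<in>L2 M. T t f \<in> L2 M \<and> sqnorm2 M (T t f) \<le> sqnorm2 M f) \<and>
     (\<forall>t\<ge>0. \<forall>f\<in>L2 M. \<forall>g\<in>L2 M. \<forall>a b.
        AE x in M. T t (\<lambda>y. a * f y + b * g y) x = a * T t f x + b * T t g x) \<and>
     (\<forall>f\<in>L2 M. AE x in M. T 0 f x = f x) \<and>
     (\<forall>s\<ge>0. \<forall>t\<ge>0. \<forall>f\<in>L2 M. AE x in M. T (s + t) f x = T s (T t f) x) \<and>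
     (\<forall>f\<in>L2 M. ((\<lambda>t. sqnorm2 M (\<lambda>x. T t f x - f x)) \<longlongrightarrow> 0) (at_right 0)) \<and>
     (\<forall>u\<in>L2 M. \<forall>w\<in>L2 M.
        ((\<lambda>t. sqnorm2 M (\<lambda>x. (T t u x - u x) / t + w x)) \<longlongrightarrow> 0) (at_right 0)
        \<longleftrightarrow> operator_graph D u w))"

definition heat_L2 :: "'a form_space \<Rightarrow> real \<Rightarrow> ('a \<Rightarrow> real) \<Rightarrow> 'a \<Rightarrow> real" where
  "heat_L2 D = (SOME T. is_L2_semigroup D T)"

text \<open>
  The consistent extension to all \<open>L^q\<close>, \<open>1 \<le> q \<le> \<infinity>\<close>, is obtained for nonnegative functions
  by monotone approximation from \<open>L2\<close>, and in general through positive and negative parts. For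
  \<open>q < \<infinity>\<close> this is the extension by \<open>L^q\<close>-continuity, for \<open>q = \<infinity>\<close> the adjoint of the
  semigroup on \<open>L^1\<close>. \<open>heat D t f\<close> is some representative of the class \<open>P_t f\<close>.
\<close>

definition is_heat_nonneg ::
    "'a form_space \<Rightarrow> real \<Rightarrow> ('a \<Rightarrow> real) \<Rightarrow> ('a \<Rightarrow> real) \<Rightarrow> bool" where
  "is_heat_nonneg D t f g \<longleftrightarrow> g \<in> borel_measurable (meas D) \<and>
     (\<exists>u. (\<forall>n::nat. u n \<in> L2 (meas D)) \<and>
          (AE x in meas D. 0 \<le> u 0 x \<and> incseq (\<lambda>n. u n x) \<and> (\<lambda>n. u n x) \<longlonglongrightarrow> f x) \<and>
          (AE x in meas D. (\<lambda>n. heat_L2 D t (u n) x) \<longlonglongrightarrow> g x))"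

definition heat :: "'a form_space \<Rightarrow> real \<Rightarrow> ('a \<Rightarrow> real) \<Rightarrow> 'a \<Rightarrow> real" where
  "heat D t f = (SOME g. g \<in> borel_measurable (meas D) \<and>
     (\<exists>p q. is_heat_nonneg D t (\<lambda>x. max (f x) 0) p \<and>
            is_heat_nonneg D t (\<lambda>x. max (- f x) 0) q \<and>
            (AE x in meas D. g x = p x - q x)))"

section \<open>Energy measures\<close>

definition energy_bdd :: "'a form_space \<Rightarrow> ('a \<Rightarrow> real) \<Rightarrow> 'a measure" where
  "energy_bdd D f = (THE \<mu>. radon_measure (topo D) \<mu> \<and>
     (\<forall>\<phi>\<in>fdom D \<inter> C_c (topo D).
        (\<integral>x. \<phi> x \<partial>\<mu>) = form D f (\<lambda>x. \<phi> x * f x) - 1 / 2 * form D (\<lambda>x. (f x)\<^sup>2) \<phi>))"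

text \<open>Extension to the whole domain by continuity with respect to the form norm.\<close>

definition energy_dom :: "'a form_space \<Rightarrow> ('a \<Rightarrow> real) \<Rightarrow> 'a measure" where
  "energy_dom D f = (THE \<mu>. radon_measure (topo D) \<mu> \<and>
     (\<forall>u. (\<forall>n::nat. u n \<in> fdom D \<inter> Linf (meas D)) \<and>
          (\<lambda>n. sqnormE1 D (\<lambda>x. u n x - f x)) \<longlonglongrightarrow> 0 \<longrightarrow>
          (\<forall>A\<in>sets (meas D). (\<lambda>n. emeasure (energy_bdd D (u n)) A) \<longlonglongrightarrow> emeasure \<mu> A)))"

definition energy :: "'a form_space \<Rightarrow> ('a \<Rightarrow> real) \<Rightarrow> 'a measure" where
  "energy D f = (THE \<mu>. radon_measure (topo D) \<mu> \<and>
     (\<forall>V h. relcompact_open (topo D) V \<and> h \<in> fdom D \<and> (AE x in meas D. x \<in> V \<longrightarrow> f x = h x) \<longrightarrow>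
        (\<forall>A\<in>sets (meas D). A \<subseteq> V \<longrightarrow> emeasure \<mu> A = emeasure (energy_dom D h) A)))"

section \<open>Smoothing properties and shift defectivity\<close>

definition ultracontractive :: "'a form_space \<Rightarrow> bool" where
  "ultracontractive D \<longleftrightarrow> (\<forall>t>0. \<forall>f\<in>L1 (meas D). heat D t f \<in> Linf (meas D))"

text \<open>
  Here \<open>u t\<close> is the continuous representative of \<open>P_t f\<close>, unique on \<open>topspace (topo D)\<close>
  as the measure has full support.
\<close>

definition doubly_feller :: "'a form_space \<Rightarrow> bool" where
  "doubly_feller D \<longleftrightarrow>
     (\<forall>f\<in>C_0 (topo D). \<exists>u.
        (\<forall>t\<ge>0. u t \<in> C_0 (topo D) \<and> (AE x in meas D. u t x = heat D t f x)) \<and>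
        (\<forall>x\<in>topspace (topo D). ((\<lambda>t. u t x) \<longlongrightarrow> f x) (at_right 0))) \<and>
     (\<forall>t>0. \<forall>f\<in>Linf (meas D). \<exists>v\<in>C_space (topo D). AE x in meas D. v x = heat D t f x)"

definition irreducible_form :: "'a form_space \<Rightarrow> bool" where
  "irreducible_form D \<longleftrightarrow>
     (\<forall>f\<in>F_loc D. (\<forall>A\<in>sets (meas D). emeasure (energy D f) A = 0) \<longrightarrow>
        (\<exists>c. AE x in meas D. f x = c))"

definition locally_smoothing :: "'a form_space \<Rightarrow> bool" where
  "locally_smoothing D \<longleftrightarrow>
     (\<forall>U. relcompact_open (topo D) U \<longrightarrow>
        ultracontractive (part_space D U) \<and>
        (\<exists>U'. openin (topo D) U' \<and> U \<subseteq> U' \<and> U' - topo D closure_of U \<noteq> {} \<and>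
              doubly_feller (part_space D U') \<and> irreducible_form (part_space D U')))"

definition shift_corrector ::
    "'a form_space \<Rightarrow> real \<Rightarrow> ('a \<Rightarrow> real) \<Rightarrow> 'a set \<Rightarrow> ('a \<Rightarrow> real) \<Rightarrow> bool" where
  "shift_corrector D lam f U g \<longleftrightarrow>
     g \<in> C_b (topo (part_space D U)) \<and> weakly_harmonic (part_space D U) lam g \<and>
     (\<forall>t>0. AE x in meas (part_space D U).
        f x - g x \<le> exp (- t * lam) * heat (part_space D U) t (\<lambda>y. f y - g y) x)"

definition locally_shift_defective :: "'a form_space \<Rightarrow> real \<Rightarrow> ('a \<Rightarrow> real) \<Rightarrow> bool" where
  "locally_shift_defective D lam f \<longleftrightarrow>
     f \<in> L1loc (topo D) (meas D) \<and>
     (\<forall>U. relcompact_open (topo D) U \<longrightarrow> (\<exists>g. shift_corrector D lam f U g))"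

definition usc_representative :: "'a form_space \<Rightarrow> ('a \<Rightarrow> real) \<Rightarrow> ('a \<Rightarrow> ereal) \<Rightarrow> bool" where
  "usc_representative D f h \<longleftrightarrow>
     upper_semicontinuous (topo D) h \<and> (AE x in meas D. h x = ereal (f x))"

end

theory Submission
  imports Defs
begin

text \<open>
  Put \<open>h = f - g\<close> and \<open>w\<^sub>t = e\<^sup>-\<^sup>\<lambda>\<^sup>t P\<^sup>U\<^sub>t h\<close>. Shift defectivity makes \<open>w\<^sub>t\<close> decrease to \<open>h\<close> as \<open>t \<rightarrow> 0\<close>, the
  limit being identified by strong continuity in \<open>L\<^sup>1\<close>; it also makes \<open>w\<^sub>t\<close> excessive, hence
  \<open>\<lambda>\<close>-subharmonic, and on \<open>V \<Subset> U\<close> the domination \<open>P\<^sup>V \<le> P\<^sup>U\<close> lets \<open>g + C\<close> with \<open>C = sup w\<^sub>t\<^sup>+\<close> serve as a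
  corrector (for \<open>\<lambda> > 0\<close> one has \<open>w\<^sub>t \<le> 0\<close>, so \<open>C = 0\<close>).

  The point is that \<open>w\<^sub>t\<close> is continuous although only a larger space \<open>U'\<close> is Feller. There the
  resolvent \<open>J\<^sub>c = (1 + c H)\<^sup>-\<^sup>1\<close> maps bounded functions to continuous ones, and near a point of \<open>U\<close> the
  resolvents of \<open>U\<close> and \<open>U'\<close> are uniformly close for small \<open>c\<close>: this is a maximum principle with a
  barrier made from finitely many resolvents. By ultracontractivity \<open>v = P\<^sup>U\<^sub>t h\<close> is the uniform limit of
  its resolvents on \<open>U\<close>, so it is locally within any \<open>\<epsilon>\<close> of a continuous function.

  The semigroup is constructed from the resolvents by the Euler scheme and identified with every
  strongly continuous semigroup generated by \<open>-H\<close>; this gives access to the form from \<open>P\<^sub>t\<close>.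
\<close>

text \<open>Sub-Markov bounds, positivity and the domination of the part on \<open>U\<close> by the
  whole space are proved for a single resolvent step, by testing its variational equation with an
  excess; the sign of the form comes from the Markov property through a reflection. Powers and
  limits inherit these order properties, which is why the semigroup is built by the Euler scheme and
  not by spectral calculus.

  \<open>heat_L2\<close> selects any semigroup generated by -H, and \<open>heat\<close> any monotone
  approximation, so each property has to be shown for every admissible choice. The function
  \<open>f - g\<close> is merely integrable: on sets of finite measure the L1 contraction controls
  its evolution, and half of the time is spent on reaching bounded functions.

  The obstacle in comparing \<open>U\<close> with \<open>U'\<close> is the boundary of
  \<open>U\<close>: the two resolvents need not become close there as \<open>c\<close> tends to 0.
  The error must be kept out of the interior by a function that is nearly 1 at the given point,
  small on a compact set around it, and still almost excessive.\<close>

section \<open>Semidefinite bilinear forms on spaces of functions\<close>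

text \<open>Elements are functions, not classes modulo null sets, so \<open>B\<close> may vanish on
  nonzero elements and \<open>N\<close> is only a seminorm. The instances are \<open>L2\<close> with
  its scalar product and the form domain with \<open>form\<close> and with
  \<open>form_add D 1\<close>.\<close>

locale psd_form =
  fixes S :: "('a \<Rightarrow> real) set" and B :: "('a \<Rightarrow> real) \<Rightarrow> ('a \<Rightarrow> real) \<Rightarrow> real"
  assumes lin_mem: "u \<in> S \<Longrightarrow> v \<in> S \<Longrightarrow> (\<lambda>x. a * u x + b * v x) \<in> S"
    and lin_left: "u \<in> S \<Longrightarrow> v \<in> S \<Longrightarrow> w \<in> S \<Longrightarrow>
      B (\<lambda>x. a * u x + b * v x) w = a * B u w + b * B v w"
    and sym: "u \<in> S \<Longrightarrow> v \<in> S \<Longrightarrow> B u v = B v u"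
    and nonneg: "u \<in> S \<Longrightarrow> 0 \<le> B u u"
begin

lemma add_mem: "u \<in> S \<Longrightarrow> v \<in> S \<Longrightarrow> (\<lambda>x. u x + v x) \<in> S"
  using lin_mem[of u v 1 1] by simp

lemma diff_mem: "u \<in> S \<Longrightarrow> v \<in> S \<Longrightarrow> (\<lambda>x. u x - v x) \<in> S"
  using lin_mem[of u v 1 "-1"] by simp

lemma scale_mem: "u \<in> S \<Longrightarrow> (\<lambda>x. c * u x) \<in> S"
  using lin_mem[of u u c 0] by simp

lemma uminus_mem: "u \<in> S \<Longrightarrow> (\<lambda>x. - u x) \<in> S"
  using lin_mem[of u u "-1" 0] by simp

lemma zero_mem: "u \<in> S \<Longrightarrow> (\<lambda>x. 0) \<in> S"
  using lin_mem[of u u 0 0] by simp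

lemma div_mem: "u \<in> S \<Longrightarrow> (\<lambda>x. u x / c) \<in> S"
  using scale_mem[of u "1 / c"] by simp

lemmas mem = add_mem diff_mem scale_mem uminus_mem div_mem

lemma add_left: "u \<in> S \<Longrightarrow> v \<in> S \<Longrightarrow> w \<in> S \<Longrightarrow> B (\<lambda>x. u x + v x) w = B u w + B v w"
  using lin_left[of u v w 1 1] by simp

lemma diff_left: "u \<in> S \<Longrightarrow> v \<in> S \<Longrightarrow> w \<in> S \<Longrightarrow> B (\<lambda>x. u x - v x) w = B u w - B v w"
  using lin_left[of u v w 1 "-1"] by simp

lemma scale_left: "u \<in> S \<Longrightarrow> w \<in> S \<Longrightarrow> B (\<lambda>x. c * u x) w = c * B u w"
  using lin_left[of u u w c 0] by simp

lemma uminus_left: "u \<in> S \<Longrightarrow> w \<in> S \<Longrightarrow> B (\<lambda>x. - u x) w = - B u w"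
  using lin_left[of u u w "-1" 0] by simp

lemma div_left: "u \<in> S \<Longrightarrow> w \<in> S \<Longrightarrow> B (\<lambda>x. u x / c) w = B u w / c"
  using scale_left[of u w "1 / c"] by simp

lemma add_right: "u \<in> S \<Longrightarrow> v \<in> S \<Longrightarrow> w \<in> S \<Longrightarrow> B w (\<lambda>x. u x + v x) = B w u + B w v"
  using add_left[of u v w] sym[of w] add_mem[of u v] by simp

lemma diff_right: "u \<in> S \<Longrightarrow> v \<in> S \<Longrightarrow> w \<in> S \<Longrightarrow> B w (\<lambda>x. u x - v x) = B w u - B w v"
  using diff_left[of u v w] sym[of w] diff_mem[of u v] by simp

lemma scale_right: "u \<in> S \<Longrightarrow> w \<in> S \<Longrightarrow> B w (\<lambda>x. c * u x) = c * B w u"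
  using scale_left[of u w c] sym[of w] scale_mem[of u c] by simp

lemma uminus_right: "u \<in> S \<Longrightarrow> w \<in> S \<Longrightarrow> B w (\<lambda>x. - u x) = - B w u"
  using uminus_left[of u w] sym[of w] uminus_mem[of u] by simp

lemma div_right: "u \<in> S \<Longrightarrow> w \<in> S \<Longrightarrow> B w (\<lambda>x. u x / c) = B w u / c"
  using scale_right[of u w "1 / c"] by simp

lemmas bilin = add_left diff_left scale_left uminus_left div_left
  add_right diff_right scale_right uminus_right div_right

definition N :: "('a \<Rightarrow> real) \<Rightarrow> real" where "N u = sqrt (B u u)"

lemma N_nonneg [simp]: "u \<in> S \<Longrightarrow> 0 \<le> N u"
  by (simp add: N_def nonneg)

lemma N_square: "u \<in> S \<Longrightarrow> (N u)\<^sup>2 = B u u"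
  by (simp add: N_def nonneg)

lemma B_lin_square:
  assumes "u \<in> S" "v \<in> S"
  shows "B (\<lambda>x. u x - t * v x) (\<lambda>x. u x - t * v x) = B u u - 2 * t * B u v + t\<^sup>2 * B v v"
  using assms sym[of u v] by (simp add: bilin mem power2_eq_square algebra_simps)

text \<open>A seminorm needs the separate case \<open>B v v = 0\<close>: there the quadratic
  polynomial in \<open>t\<close> is affine and nonnegative, so its slope \<open>B u v\<close>
  vanishes. Otherwise the polynomial is evaluated at its minimiser.\<close>

lemma cauchy_schwarz:
  assumes u: "u \<in> S" and v: "v \<in> S"
  shows "\<bar>B u v\<bar> \<le> N u * N v"
proof -
  have q: "0 \<le> B u u - 2 * t * B u v + t\<^sup>2 * B v v" for t
    using nonneg[OF diff_mem[OF u scale_mem[OF v, of t]]] B_lin_square[OF u v, of t] by simp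
  have "(B u v)\<^sup>2 \<le> B u u * B v v"
  proof (cases "B v v = 0")
    case True
    have "B u v = 0"
    proof (rule ccontr)
      assume n: "B u v \<noteq> 0"
      have "2 * ((B u u + 1) / (2 * B u v)) * B u v = B u u + 1" using n by simp
      with q[of "(B u u + 1) / (2 * B u v)"] True show False by simp
    qed
    with True show ?thesis by simp
  next
    case False
    with nonneg[OF v] have p: "0 < B v v" by simp
    have "B u u - 2 * (B u v / B v v) * B u v + (B u v / B v v)\<^sup>2 * B v v
        = B u u - (B u v)\<^sup>2 / B v v"
      using p by (simp add: power2_eq_square field_simps)
    with q[of "B u v / B v v"] have "(B u v)\<^sup>2 / B v v \<le> B u u" by linarith
    with p show ?thesis by (simp add: field_simps)
  qed
  hence "sqrt ((B u v)\<^sup>2) \<le> sqrt (B u u * B v v)" by (rule real_sqrt_le_mono)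
  thus ?thesis by (simp add: N_def real_sqrt_mult)
qed

lemma N_triangle:
  assumes u: "u \<in> S" and v: "v \<in> S"
  shows "N (\<lambda>x. u x + v x) \<le> N u + N v"
proof (rule power2_le_imp_le)
  have "(N (\<lambda>x. u x + v x))\<^sup>2 = B u u + 2 * B u v + B v v"
    using u v sym[OF u v] by (simp add: N_square mem bilin)
  also have "\<dots> \<le> (N u)\<^sup>2 + 2 * (N u * N v) + (N v)\<^sup>2"
    using cauchy_schwarz[OF u v] by (simp add: N_square u v)
  also have "\<dots> = (N u + N v)\<^sup>2" by (simp add: power2_eq_square algebra_simps)
  finally show "(N (\<lambda>x. u x + v x))\<^sup>2 \<le> (N u + N v)\<^sup>2" .
qed (use u v in simp)

lemma N_scale: "u \<in> S \<Longrightarrow> N (\<lambda>x. c * u x) = \<bar>c\<bar> * N u"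
  by (simp add: N_def bilin mem real_sqrt_mult flip: mult.assoc)

lemma N_uminus: "u \<in> S \<Longrightarrow> N (\<lambda>x. - u x) = N u"
  by (simp add: N_def bilin mem)

lemma N_diff_commute: "u \<in> S \<Longrightarrow> v \<in> S \<Longrightarrow> N (\<lambda>x. u x - v x) = N (\<lambda>x. v x - u x)"
  using N_uminus[of "\<lambda>x. u x - v x"] by (simp add: mem)

lemma N_diff_triangle:
  assumes "u \<in> S" "v \<in> S" "w \<in> S"
  shows "N (\<lambda>x. u x - w x) \<le> N (\<lambda>x. u x - v x) + N (\<lambda>x. v x - w x)"
  using N_triangle[of "\<lambda>x. u x - v x" "\<lambda>x. v x - w x"] assms by (simp add: mem)

lemma N_triangle_diff:
  assumes "u \<in> S" "v \<in> S"
  shows "N (\<lambda>x. u x - v x) \<le> N u + N v"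
  using N_triangle[of u "\<lambda>x. - v x"] assms by (simp add: mem N_uminus)

lemma N_diff_abs:
  assumes u: "u \<in> S" and v: "v \<in> S"
  shows "\<bar>N u - N v\<bar> \<le> N (\<lambda>x. u x - v x)"
proof -
  have "N u \<le> N (\<lambda>x. u x - v x) + N v"
    using N_triangle[of "\<lambda>x. u x - v x" v] u v by (simp add: mem)
  moreover have "N v \<le> N (\<lambda>x. v x - u x) + N u"
    using N_triangle[of "\<lambda>x. v x - u x" u] u v by (simp add: mem)
  ultimately show ?thesis using N_diff_commute[OF u v] by linarith
qed

lemma parallelogram:
  assumes "u \<in> S" "v \<in> S"
  shows "B (\<lambda>x. u x - v x) (\<lambda>x. u x - v x)
    = 2 * B u u + 2 * B v v - 4 * B (\<lambda>x. u x / 2 + v x / 2) (\<lambda>x. u x / 2 + v x / 2)"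
  using assms sym[of u v] by (simp add: bilin mem field_simps)

lemma N_tendsto_B:
  assumes "\<And>n. u n \<in> S" "v \<in> S" "w \<in> S" and "(\<lambda>n::nat. N (\<lambda>x. u n x - v x)) \<longlonglongrightarrow> 0"
  shows "(\<lambda>n. B (u n) w) \<longlonglongrightarrow> B v w"
proof -
  have "(\<lambda>n. B (u n) w - B v w) \<longlonglongrightarrow> 0"
  proof (rule Lim_null_comparison)
    show "\<forall>\<^sub>F n in sequentially. norm (B (u n) w - B v w) \<le> N (\<lambda>x. u n x - v x) * N w"
      using cauchy_schwarz[of "\<lambda>x. u n x - v x" w for n] assms by (auto simp: bilin mem)
    show "(\<lambda>n. N (\<lambda>x. u n x - v x) * N w) \<longlonglongrightarrow> 0"
      using assms(4) tendsto_mult_left_zero by blast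
  qed
  thus ?thesis by (rule LIM_zero_cancel)
qed

lemma N_tendsto_N:
  assumes "\<And>n. u n \<in> S" "v \<in> S" and "(\<lambda>n::nat. N (\<lambda>x. u n x - v x)) \<longlonglongrightarrow> 0"
  shows "(\<lambda>n. N (u n)) \<longlonglongrightarrow> N v"
proof -
  have "(\<lambda>n. N (u n) - N v) \<longlonglongrightarrow> 0"
    by (rule Lim_null_comparison[OF _ assms(3)]) (use N_diff_abs assms in auto)
  thus ?thesis by (rule LIM_zero_cancel)
qed

end

section \<open>Square-integrable functions\<close>

definition ip :: "'a measure \<Rightarrow> ('a \<Rightarrow> real) \<Rightarrow> ('a \<Rightarrow> real) \<Rightarrow> real" where
  "ip M f g = (\<integral>x. f x * g x \<partial>M)"

definition l2n :: "'a measure \<Rightarrow> ('a \<Rightarrow> real) \<Rightarrow> real" where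
  "l2n M f = sqrt (sqnorm2 M f)"

abbreviation l2d :: "'a measure \<Rightarrow> ('a \<Rightarrow> real) \<Rightarrow> ('a \<Rightarrow> real) \<Rightarrow> real" where
  "l2d M f g \<equiv> l2n M (\<lambda>x. f x - g x)"

abbreviation l2_tendsto :: "'a measure \<Rightarrow> (nat \<Rightarrow> 'a \<Rightarrow> real) \<Rightarrow> ('a \<Rightarrow> real) \<Rightarrow> bool" where
  "l2_tendsto M u f \<equiv> (\<lambda>n. l2d M (u n) f) \<longlonglongrightarrow> 0"

lemma sqnorm2_ip: "sqnorm2 M f = ip M f f"
  by (simp add: sqnorm2_def ip_def power2_eq_square)

lemma L2_measurable [measurable_dest]: "f \<in> L2 M \<Longrightarrow> f \<in> borel_measurable M"
  by (simp add: L2_def)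

lemma L2_integrable_sq: "f \<in> L2 M \<Longrightarrow> integrable M (\<lambda>x. (f x)\<^sup>2)"
  by (simp add: L2_def)

lemma L2_integrable_mult:
  assumes f: "f \<in> L2 M" and g: "g \<in> L2 M"
  shows "integrable M (\<lambda>x. f x * g x)"
proof (rule Bochner_Integration.integrable_bound)
  note [measurable] = L2_measurable[OF f] L2_measurable[OF g]
  show "integrable M (\<lambda>x. (f x)\<^sup>2 + (g x)\<^sup>2)"
    using f g by (simp add: L2_integrable_sq)
  show "(\<lambda>x. f x * g x) \<in> borel_measurable M" by measurable
  have "\<bar>a * b\<bar> \<le> a\<^sup>2 + b\<^sup>2" for a b :: real
  proof -
    have "0 \<le> (\<bar>a\<bar> - \<bar>b\<bar>)\<^sup>2" by simp
    hence "2 * (\<bar>a\<bar> * \<bar>b\<bar>) \<le> a\<^sup>2 + b\<^sup>2" by (simp add: power2_diff)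
    moreover have "0 \<le> \<bar>a\<bar> * \<bar>b\<bar>" by simp
    ultimately show ?thesis unfolding abs_mult by linarith
  qed
  thus "AE x in M. norm (f x * g x) \<le> norm ((f x)\<^sup>2 + (g x)\<^sup>2)"
    by (auto intro!: AE_I2)
qed

lemma L2_lin:
  assumes f: "f \<in> L2 M" and g: "g \<in> L2 M"
  shows "(\<lambda>x. a * f x + b * g x) \<in> L2 M"
proof -
  note [measurable] = L2_measurable[OF f] L2_measurable[OF g]
  have eq: "(\<lambda>x. (a * f x + b * g x)\<^sup>2)
      = (\<lambda>x. a\<^sup>2 * (f x)\<^sup>2 + (2 * a * b) * (f x * g x) + b\<^sup>2 * (g x)\<^sup>2)"
    by (simp add: fun_eq_iff power2_eq_square algebra_simps)
  have "integrable M (\<lambda>x. (a * f x + b * g x)\<^sup>2)" unfolding eq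
    using L2_integrable_sq[OF f] L2_integrable_sq[OF g] L2_integrable_mult[OF f g] by simp
  moreover have "(\<lambda>x. a * f x + b * g x) \<in> borel_measurable M" by measurable
  ultimately show ?thesis by (simp add: L2_def)
qed

lemma L2_bound:
  assumes f: "f \<in> L2 M" and g: "g \<in> borel_measurable M" and le: "AE x in M. \<bar>g x\<bar> \<le> \<bar>f x\<bar>"
  shows "g \<in> L2 M"
proof -
  have "integrable M (\<lambda>x. (g x)\<^sup>2)"
    by (rule Bochner_Integration.integrable_bound[OF L2_integrable_sq[OF f]])
      (use g le in \<open>auto simp: abs_le_square_iff\<close>)
  thus ?thesis using g by (simp add: L2_def)
qed

lemma psd_L2: "psd_form (L2 M) (ip M)"
proof
  fix u v w :: "'a \<Rightarrow> real" and a b :: real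
  show "u \<in> L2 M \<Longrightarrow> v \<in> L2 M \<Longrightarrow> (\<lambda>x. a * u x + b * v x) \<in> L2 M" by (rule L2_lin)
  show "ip M (\<lambda>x. a * u x + b * v x) w = a * ip M u w + b * ip M v w"
    if "u \<in> L2 M" "v \<in> L2 M" "w \<in> L2 M"
  proof -
    have "(\<lambda>x. (a * u x + b * v x) * w x) = (\<lambda>x. a * (u x * w x) + b * (v x * w x))"
      by (simp add: fun_eq_iff algebra_simps)
    thus ?thesis unfolding ip_def
      using L2_integrable_mult[OF that(1,3)] L2_integrable_mult[OF that(2,3)] by simp
  qed
  show "ip M u v = ip M v u" by (simp add: ip_def mult.commute)
  show "0 \<le> ip M u u" by (simp add: ip_def)
qed

text \<open>\<open>M\<close> stays a parameter, so that a measure and its restrictions share all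
  facts; the rewrite makes them speak of \<open>l2n\<close>.\<close>

interpretation L2: psd_form "L2 M" "ip M"
  rewrites "psd_form.N (ip M) = l2n M" for M
proof -
  interpret psd_form "L2 M" "ip M" by (rule psd_L2)
  show "psd_form (L2 M) (ip M)" by (rule psd_L2)
  show "psd_form.N (ip M) = l2n M"
    by (simp add: fun_eq_iff N_def l2n_def sqnorm2_ip)
qed

lemma l2n_square: "f \<in> L2 M \<Longrightarrow> (l2n M f)\<^sup>2 = sqnorm2 M f"
  by (simp add: L2.N_square sqnorm2_ip)

lemma sqnorm2_nonneg [simp]: "0 \<le> sqnorm2 M f"
  by (simp add: sqnorm2_def)

lemma sqnorm2_tendsto_iff: "((\<lambda>n. sqnorm2 M (u n)) \<longlongrightarrow> 0) F \<longleftrightarrow> ((\<lambda>n. l2n M (u n)) \<longlongrightarrow> 0) F"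
proof
  show "((\<lambda>n. sqnorm2 M (u n)) \<longlongrightarrow> 0) F \<Longrightarrow> ((\<lambda>n. l2n M (u n)) \<longlongrightarrow> 0) F"
    unfolding l2n_def using tendsto_real_sqrt by fastforce
  show "((\<lambda>n. l2n M (u n)) \<longlongrightarrow> 0) F \<Longrightarrow> ((\<lambda>n. sqnorm2 M (u n)) \<longlongrightarrow> 0) F"
    unfolding l2n_def using tendsto_power[of _ 0 F 2] by fastforce
qed

lemma L2_zero: "(\<lambda>x. 0) \<in> L2 M"
  by (simp add: L2_def)

lemma L2_abs: "f \<in> L2 M \<Longrightarrow> (\<lambda>x. \<bar>f x\<bar>) \<in> L2 M"
  by (rule L2_bound) auto

lemma L2_max0: "f \<in> L2 M \<Longrightarrow> (\<lambda>x. max (f x) 0) \<in> L2 M"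
  by (rule L2_bound) (auto simp: max_def)

lemma L2_min:
  assumes "f \<in> L2 M" "g \<in> L2 M"
  shows "(\<lambda>x. min (f x) (g x)) \<in> L2 M"
proof (rule L2_bound)
  show "(\<lambda>x. \<bar>f x\<bar> + \<bar>g x\<bar>) \<in> L2 M" using assms by (intro L2.add_mem L2_abs)
  show "(\<lambda>x. min (f x) (g x)) \<in> borel_measurable M"
    using assms[THEN L2_measurable] by measurable
qed (auto simp: min_def)

lemma L2_cong_AE:
  assumes f: "f \<in> L2 M" and g: "g \<in> borel_measurable M" and eq: "AE x in M. f x = g x"
  shows "g \<in> L2 M"
  by (rule L2_bound[OF f g]) (use eq in auto)

lemma ip_cong_AE:
  assumes "f \<in> borel_measurable M" "f' \<in> borel_measurable M" "g \<in> borel_measurable M"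
    "g' \<in> borel_measurable M"
    and "AE x in M. f x = f' x" "AE x in M. g x = g' x"
  shows "ip M f g = ip M f' g'"
  unfolding ip_def by (rule integral_cong_AE) (use assms in auto)

lemma l2n_eq_0_iff: "f \<in> L2 M \<Longrightarrow> l2n M f = 0 \<longleftrightarrow> (AE x in M. f x = 0)"
  unfolding l2n_def sqnorm2_def
  using integral_nonneg_eq_0_iff_AE[OF L2_integrable_sq, of f M] by simp

lemma l2n_cong_AE:
  assumes "f \<in> borel_measurable M" "g \<in> borel_measurable M" "AE x in M. f x = g x"
  shows "l2n M f = l2n M g"
  unfolding l2n_def sqnorm2_ip using ip_cong_AE[OF assms(1,2,1,2,3,3)] by simp

lemma l2n_mono_AE:
  assumes f: "f \<in> L2 M" and g: "g \<in> borel_measurable M" and le: "AE x in M. \<bar>g x\<bar> \<le> \<bar>f x\<bar>"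
  shows "l2n M g \<le> l2n M f"
  unfolding l2n_def sqnorm2_def
  by (intro real_sqrt_le_mono integral_mono_AE L2_integrable_sq f L2_bound[OF f g le])
    (use le in \<open>auto simp: abs_le_square_iff\<close>)

lemma l2n_diff_eq_0_iff:
  "f \<in> L2 M \<Longrightarrow> g \<in> L2 M \<Longrightarrow> l2d M f g = 0 \<longleftrightarrow> (AE x in M. f x = g x)"
  by (subst l2n_eq_0_iff) (auto simp: L2.mem)

lemma L2_tendsto_AE_subseq:
  assumes u: "\<And>n. u n \<in> L2 M" and f: "f \<in> L2 M" and lim: "l2_tendsto M u f"
  obtains r where "strict_mono r" "AE x in M. (\<lambda>n. u (r n) x) \<longlonglongrightarrow> f x"
proof -
  have d: "(\<lambda>x. u n x - f x) \<in> L2 M" for n by (intro L2.mem u f)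
  have "(\<lambda>n. \<integral>x. norm ((u n x - f x)\<^sup>2) \<partial>M) \<longlonglongrightarrow> 0"
    using lim unfolding sqnorm2_tendsto_iff[symmetric] by (simp add: sqnorm2_def)
  from tendsto_L1_AE_subseq[OF L2_integrable_sq[OF d] this]
  obtain r where r: "strict_mono r" "AE x in M. (\<lambda>n. (u (r n) x - f x)\<^sup>2) \<longlonglongrightarrow> 0" by auto
  have "AE x in M. (\<lambda>n. u (r n) x) \<longlonglongrightarrow> f x"
    using r(2)
  proof eventually_elim
    case (elim x)
    hence "(\<lambda>n. sqrt ((u (r n) x - f x)\<^sup>2)) \<longlonglongrightarrow> 0"
      using tendsto_real_sqrt by fastforce
    hence "(\<lambda>n. u (r n) x - f x) \<longlonglongrightarrow> 0" by (simp add: tendsto_rabs_zero_iff)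
    thus ?case by (rule LIM_zero_cancel)
  qed
  with r(1) that show ?thesis by blast
qed

text \<open>Order is read off along a subsequence of a subsequence on which both sequences converge
  almost everywhere.\<close>

lemma L2_limit_le_AE:
  assumes u: "\<And>n. u n \<in> L2 M" and f: "f \<in> L2 M" and lim: "l2_tendsto M u f"
    and v: "\<And>n. v n \<in> L2 M" and g: "g \<in> L2 M" and lim2: "l2_tendsto M v g"
    and le: "\<And>n. AE x in M. u n x \<le> v n x"
  shows "AE x in M. f x \<le> g x"
proof -
  obtain r where r: "strict_mono r" "AE x in M. (\<lambda>n. u (r n) x) \<longlonglongrightarrow> f x"
    using L2_tendsto_AE_subseq[OF u f lim] by blast
  have "l2_tendsto M (\<lambda>n. v (r n)) g"
    using LIMSEQ_subseq_LIMSEQ[OF lim2 r(1)] by (simp add: o_def)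
  then obtain r' where r': "strict_mono r'" "AE x in M. (\<lambda>n. v (r (r' n)) x) \<longlonglongrightarrow> g x"
    using L2_tendsto_AE_subseq[of "\<lambda>n. v (r n)" M g] v g by blast
  have "AE x in M. \<forall>n. u n x \<le> v n x" using le by (simp add: AE_all_countable)
  with r(2) r'(2) show ?thesis
  proof eventually_elim
    case (elim x)
    have "(\<lambda>n. u (r (r' n)) x) \<longlonglongrightarrow> f x"
      using LIMSEQ_subseq_LIMSEQ[OF elim(1) r'(1)] by (simp add: o_def)
    thus ?case by (rule LIMSEQ_le[OF _ elim(2)]) (use elim(3) in auto)
  qed
qed

lemma L2_limit_le_const_AE:
  assumes u: "\<And>n. u n \<in> L2 M" and f: "f \<in> L2 M" and lim: "l2_tendsto M u f"
    and le: "\<And>n. AE x in M. u n x \<le> c"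
  shows "AE x in M. f x \<le> c"
proof -
  obtain r where r: "strict_mono r" "AE x in M. (\<lambda>n. u (r n) x) \<longlonglongrightarrow> f x"
    using L2_tendsto_AE_subseq[OF u f lim] by blast
  have "AE x in M. \<forall>n. u n x \<le> c" using le by (simp add: AE_all_countable)
  with r(2) show ?thesis
  proof eventually_elim
    case (elim x)
    thus ?case by (intro LIMSEQ_le_const2[OF elim(1)]) auto
  qed
qed

lemma L2_limit_unique:
  assumes u: "\<And>n. u n \<in> L2 M" and f: "f \<in> L2 M" and g: "g \<in> L2 M"
    and lim: "l2_tendsto M u f" "l2_tendsto M u g"
  shows "AE x in M. f x = g x"
proof -
  have "AE x in M. f x \<le> g x" by (rule L2_limit_le_AE[OF u f lim(1) u g lim(2)]) simp
  moreover have "AE x in M. g x \<le> f x" by (rule L2_limit_le_AE[OF u g lim(2) u f lim(1)]) simp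
  ultimately show ?thesis by eventually_elim simp
qed

lemma L2_dominated:
  assumes u: "\<And>n. u n \<in> borel_measurable M" and f: "f \<in> borel_measurable M" and g: "g \<in> L2 M"
    and bd: "\<And>n. AE x in M. \<bar>u n x\<bar> \<le> g x" and lim: "AE x in M. (\<lambda>n::nat. u n x) \<longlonglongrightarrow> f x"
  shows "f \<in> L2 M" "l2_tendsto M u f"
proof -
  have bda: "AE x in M. \<forall>n. \<bar>u n x\<bar> \<le> g x" using bd by (simp add: AE_all_countable)
  have fb: "AE x in M. \<bar>f x\<bar> \<le> g x"
    using bda lim
  proof eventually_elim
    case (elim x)
    have "(\<lambda>n. \<bar>u n x\<bar>) \<longlonglongrightarrow> \<bar>f x\<bar>" using elim(2) by (rule tendsto_rabs)
    thus ?case by (rule LIMSEQ_le_const2) (use elim in auto)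
  qed
  show "f \<in> L2 M" by (rule L2_bound[OF g f]) (use fb in auto)
  have "(\<lambda>n. \<integral>x. (u n x - f x)\<^sup>2 \<partial>M) \<longlonglongrightarrow> (\<integral>x. 0 \<partial>M)"
  proof (rule integral_dominated_convergence[where w = "\<lambda>x. (2 * g x)\<^sup>2"])
    show "integrable M (\<lambda>x. (2 * g x)\<^sup>2)" by (intro L2_integrable_sq L2.mem g)
    show "AE x in M. (\<lambda>n. (u n x - f x)\<^sup>2) \<longlonglongrightarrow> 0" using lim
    proof eventually_elim
      case (elim x)
      hence "(\<lambda>n. u n x - f x) \<longlonglongrightarrow> 0" by (rule LIM_zero)
      thus ?case using tendsto_power[of _ 0 sequentially 2] by fastforce
    qed
    show "AE x in M. norm ((u n x - f x)\<^sup>2) \<le> (2 * g x)\<^sup>2" for n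
      using bda fb
    proof eventually_elim
      case (elim x)
      from elim(1)[rule_format, of n] elim(2) have "\<bar>u n x - f x\<bar> \<le> \<bar>2 * g x\<bar>" by arith
      thus ?case by (simp add: abs_le_square_iff)
    qed
  qed (use u f in measurable)
  thus "l2_tendsto M u f"
    unfolding sqnorm2_tendsto_iff[symmetric] by (simp add: sqnorm2_def)
qed

lemma summable_abs_diff_imp_convergent:
  fixes a :: "nat \<Rightarrow> real"
  assumes "summable (\<lambda>k. \<bar>a (Suc k) - a k\<bar>)"
  shows "convergent a"
proof -
  have "summable (\<lambda>k. a (Suc k) - a k)" using assms by (rule summable_rabs_cancel)
  hence "convergent (\<lambda>n. \<Sum>k<n. a (Suc k) - a k)" by (simp add: summable_iff_convergent)
  moreover have "(\<Sum>k<n. a (Suc k) - a k) = a n - a 0" for n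
    by (rule sum_lessThan_telescope)
  ultimately have "convergent (\<lambda>n. a n - a 0)" by simp
  thus ?thesis
    using convergent_add[of "\<lambda>n. a n - a 0" "\<lambda>_. a 0"] by (simp add: convergent_const)
qed

text \<open>Riesz-Fischer. A subsequence with increments below \<open>(1/2)^k\<close> has almost
  everywhere summable increments and so defines \<open>f\<close>; Fatou's lemma along it then gives
  a rate for the whole sequence.\<close>

lemma L2_complete:
  assumes u: "\<And>n::nat. u n \<in> L2 M"
    and cau: "\<And>e. e > 0 \<Longrightarrow> \<exists>N. \<forall>m\<ge>N. \<forall>n\<ge>N. l2d M (u m) (u n) < e"
  obtains f where "f \<in> L2 M" "l2_tendsto M u f"
proof -
  note [measurable] = L2_measurable[OF u]
  have "\<exists>N. \<forall>m\<ge>N. \<forall>n\<ge>N. l2d M (u m) (u n) < (1/2)^k" for k :: nat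
    by (rule cau) simp
  then obtain K where K: "\<And>k m n. m \<ge> K k \<Longrightarrow> n \<ge> K k \<Longrightarrow> l2d M (u m) (u n) < (1/2)^k"
    by metis
  define r where "r = rec_nat (K 0) (\<lambda>k p. max (Suc p) (K (Suc k)))"
  have r0: "r 0 = K 0" and rS: "r (Suc k) = max (Suc (r k)) (K (Suc k))" for k
    by (simp_all add: r_def)
  have rK: "K k \<le> r k" for k by (cases k) (simp_all add: r0 rS)
  have rmono: "strict_mono r" by (rule strict_monoI_Suc) (simp add: rS)
  define d where "d k x = \<bar>u (r (Suc k)) x - u (r k) x\<bar>" for k x
  define s where "s n x = (\<Sum>k<n. d k x)" for n x
  have d: "d k \<in> L2 M" for k unfolding d_def by (intro L2_abs L2.mem u)
  have dn: "l2n M (d k) \<le> (1/2)^k" for k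
  proof -
    have "l2n M (d k) \<le> l2d M (u (r (Suc k))) (u (r k))"
      by (rule l2n_mono_AE[OF _ L2_measurable[OF d]]) (auto simp: d_def intro!: L2.mem u)
    also have "\<dots> < (1/2)^k"
      by (rule K) (use rK[of k] in \<open>auto simp: rS intro: le_trans\<close>)
    finally show ?thesis by simp
  qed
  have s: "s n \<in> L2 M \<and> l2n M (s n) \<le> (\<Sum>k<n. (1/2)^k)" for n
  proof (induction n)
    case 0
    have "l2n M (\<lambda>x. 0) = 0" by (simp add: l2n_def sqnorm2_def)
    thus ?case by (simp add: s_def[abs_def] L2_zero)
  next
    case (Suc n)
    have "s (Suc n) = (\<lambda>x. s n x + d n x)" by (simp add: s_def fun_eq_iff)
    thus ?case using Suc L2.N_triangle[of "s n" M "d n"] d[of n] dn[of n]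
      by (simp add: L2.mem)
  qed
  have s2: "l2n M (s n) \<le> 2" for n
  proof -
    have "(\<Sum>k<n. (1/2::real)^k) \<le> (\<Sum>k. (1/2)^k)" by (rule sum_le_suminf) auto
    also have "\<dots> = 2" by (simp add: suminf_geometric)
    finally show ?thesis using s[of n] by simp
  qed
  \<comment> \<open>The partial sums have norm at most 2, the value of the geometric series; 4 is
    its square.\<close>
  have s4: "(\<integral>\<^sup>+x. ennreal ((s n x)\<^sup>2) \<partial>M) \<le> 4" for n
  proof -
    have "(\<integral>\<^sup>+x. ennreal ((s n x)\<^sup>2) \<partial>M) = ennreal (sqnorm2 M (s n))"
      unfolding sqnorm2_def using s[of n] by (intro nn_integral_eq_integral L2_integrable_sq) auto
    also have "\<dots> = ennreal ((l2n M (s n))\<^sup>2)" using s[of n] by (simp add: l2n_square)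
    also have "\<dots> \<le> ennreal (2\<^sup>2)"
      using s2[of n] s[of n] by (intro ennreal_leI power_mono) auto
    finally show ?thesis by simp
  qed
  have smeas [measurable]: "s n \<in> borel_measurable M" for n using s by (blast dest: L2_measurable)
  have sinc: "s m x \<le> s n x" if "m \<le> n" for m n x
    unfolding s_def using that by (intro sum_mono2) (auto simp: d_def)
  have snn: "0 \<le> s n x" for n x unfolding s_def by (intro sum_nonneg) (auto simp: d_def)
  have "(\<integral>\<^sup>+x. (SUP n. ennreal ((s n x)\<^sup>2)) \<partial>M) = (SUP n. \<integral>\<^sup>+x. ennreal ((s n x)\<^sup>2) \<partial>M)"
    by (rule nn_integral_monotone_convergence_SUP)
      (auto intro!: incseq_SucI le_funI ennreal_leI power_mono sinc snn)
  also have "\<dots> \<le> 4" by (intro SUP_least s4)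
  finally have le4: "(\<integral>\<^sup>+x. (SUP n. ennreal ((s n x)\<^sup>2)) \<partial>M) \<le> 4" .
  have "(4::ennreal) < \<infinity>" by simp
  from le_less_trans[OF le4 this] have "(\<integral>\<^sup>+x. (SUP n. ennreal ((s n x)\<^sup>2)) \<partial>M) \<noteq> \<infinity>"
    by simp
  hence "AE x in M. (SUP n. ennreal ((s n x)\<^sup>2)) \<noteq> \<infinity>"
    by (intro nn_integral_PInf_AE) auto
  hence conv: "AE x in M. convergent (\<lambda>k. u (r k) x)"
  proof eventually_elim
    case (elim x)
    then obtain c where c: "(SUP n. ennreal ((s n x)\<^sup>2)) = ennreal c" "0 \<le> c"
      by (cases "SUP n. ennreal ((s n x)\<^sup>2)") auto
    have "s n x \<le> sqrt c" for n
    proof -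
      have "ennreal ((s n x)\<^sup>2) \<le> ennreal c" unfolding c(1)[symmetric] by (rule SUP_upper) simp
      hence "(s n x)\<^sup>2 \<le> c" using c(2) by (simp add: ennreal_le_iff)
      thus ?thesis by (rule real_le_rsqrt)
    qed
    hence "summable (\<lambda>k. d k x)"
      by (intro summableI_nonneg_bounded[where x = "sqrt c"]) (auto simp: s_def d_def)
    thus ?case unfolding d_def by (intro summable_abs_diff_imp_convergent[of "\<lambda>k. u (r k) x"])
  qed
  define f where "f x = lim (\<lambda>k. u (r k) x)" for x
  have fm [measurable]: "f \<in> borel_measurable M" unfolding f_def by measurable
  have flim: "AE x in M. (\<lambda>k. u (r k) x) \<longlonglongrightarrow> f x"
    using conv by eventually_elim (simp add: f_def convergent_LIMSEQ_iff)
  \<comment> \<open>Here \<open>n\<close> is fixed and only the index of the subsequence runs, so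
    the bound holds for all \<open>n \<ge> K j\<close> and not only along \<open>r\<close>.\<close>
  have key: "(\<lambda>x. u n x - f x) \<in> L2 M \<and> l2d M (u n) f \<le> (1/2)^j" if nj: "n \<ge> K j" for n j
  proof -
    have "(\<integral>\<^sup>+x. ennreal ((u n x - f x)\<^sup>2) \<partial>M) = (\<integral>\<^sup>+x. liminf (\<lambda>k. ennreal ((u n x - u (r k) x)\<^sup>2)) \<partial>M)"
    proof (rule nn_integral_cong_AE)
      show "AE x in M. ennreal ((u n x - f x)\<^sup>2) = liminf (\<lambda>k. ennreal ((u n x - u (r k) x)\<^sup>2))"
        using flim
      proof eventually_elim
        case (elim x)
        have "(\<lambda>k. ennreal ((u n x - u (r k) x)\<^sup>2)) \<longlonglongrightarrow> ennreal ((u n x - f x)\<^sup>2)"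
          by (intro tendsto_ennrealI tendsto_power tendsto_diff tendsto_const elim)
        thus ?case by (intro lim_imp_Liminf[symmetric]) simp_all
      qed
    qed
    also have "\<dots> \<le> liminf (\<lambda>k. \<integral>\<^sup>+x. ennreal ((u n x - u (r k) x)\<^sup>2) \<partial>M)"
      by (rule nn_integral_liminf) measurable
    also have "\<dots> \<le> ennreal (((1/2)^j)\<^sup>2)"
    proof (rule Liminf_le)
      show "\<forall>\<^sub>F k in sequentially. (\<integral>\<^sup>+x. ennreal ((u n x - u (r k) x)\<^sup>2) \<partial>M) \<le> ennreal (((1/2)^j)\<^sup>2)"
        using eventually_ge_at_top[of j]
      proof eventually_elim
        case (elim k)
        have "K j \<le> r j" by (rule rK)
        also have "r j \<le> r k" using rmono elim by (simp add: strict_mono_less_eq)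
        finally have "l2d M (u n) (u (r k)) < (1/2)^j" using nj by (intro K)
        moreover have m: "(\<lambda>x. u n x - u (r k) x) \<in> L2 M" by (intro L2.mem u)
        ultimately have "sqnorm2 M (\<lambda>x. u n x - u (r k) x) \<le> ((1/2)^j)\<^sup>2"
          unfolding l2n_square[OF m, symmetric] by (intro power_mono) auto
        moreover have "(\<integral>\<^sup>+x. ennreal ((u n x - u (r k) x)\<^sup>2) \<partial>M) = ennreal (sqnorm2 M (\<lambda>x. u n x - u (r k) x))"
          unfolding sqnorm2_def by (intro nn_integral_eq_integral L2_integrable_sq m) auto
        ultimately show ?case by (simp add: ennreal_leI)
      qed
    qed simp
    finally have le: "(\<integral>\<^sup>+x. ennreal ((u n x - f x)\<^sup>2) \<partial>M) \<le> ennreal (((1/2)^j)\<^sup>2)" .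
    hence "integrable M (\<lambda>x. (u n x - f x)\<^sup>2)"
      by (intro integrableI_bounded) (auto simp: le_less_trans[OF le])
    hence m: "(\<lambda>x. u n x - f x) \<in> L2 M" by (simp add: L2_def)
    moreover have "ennreal (sqnorm2 M (\<lambda>x. u n x - f x)) \<le> ennreal (((1/2)^j)\<^sup>2)"
      using le nn_integral_eq_integral[OF L2_integrable_sq[OF m]] by (simp add: sqnorm2_def)
    hence "sqnorm2 M (\<lambda>x. u n x - f x) \<le> ((1/2)^j)\<^sup>2" by (simp add: ennreal_le_iff)
    hence "l2d M (u n) f \<le> (1/2)^j" unfolding l2n_def
      by (intro real_le_lsqrt) auto
    ultimately show ?thesis by simp
  qed
  have "f \<in> L2 M"
  proof -
    have "(\<lambda>x. u (K 0) x - (u (K 0) x - f x)) \<in> L2 M" by (rule L2.diff_mem[OF u]) (use key[of 0 "K 0"] in simp)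
    thus ?thesis by simp
  qed
  moreover have "l2_tendsto M u f"
  proof (rule LIMSEQ_I)
    fix e :: real assume "0 < e"
    then obtain j where j: "(1/2)^j < e" using real_arch_pow_inv[of e "1/2"] by auto
    have "\<forall>n\<ge>K j. norm (l2d M (u n) f - 0) < e"
      using key[of j] j by (auto simp: L2.N_nonneg intro: le_less_trans)
    thus "\<exists>no. \<forall>n\<ge>no. norm (l2d M (u n) f - 0) < e" by blast
  qed
  ultimately show thesis by (rule that)
qed

section \<open>Closed forms and their resolvents\<close>

locale cform =
  fixes D :: "'a form_space"
  assumes closed: "closed_form D"
begin

abbreviation "M \<equiv> meas D"

lemma fdom_L2: "u \<in> fdom D \<Longrightarrow> u \<in> L2 M"
  using closed[unfolded closed_form_def, THEN conjunct1] by blast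

lemma fdom_cong_AE:
  "u \<in> fdom D \<Longrightarrow> v \<in> borel_measurable M \<Longrightarrow> AE x in M. u x = v x \<Longrightarrow> v \<in> fdom D"
  using closed[unfolded closed_form_def, THEN conjunct2, THEN conjunct2, THEN conjunct1] by blast

lemma form_cong_AE:
  "u \<in> fdom D \<Longrightarrow> v \<in> fdom D \<Longrightarrow> w \<in> fdom D \<Longrightarrow> AE x in M. u x = v x \<Longrightarrow> form D u w = form D v w"
  using closed[unfolded closed_form_def, THEN conjunct2, THEN conjunct2, THEN conjunct2, THEN conjunct1] by blast

lemma fdom_dense:
  "f \<in> L2 M \<Longrightarrow> 0 < e \<Longrightarrow> \<exists>u\<in>fdom D. sqnorm2 M (\<lambda>x. f x - u x) < e"
  using closed[unfolded closed_form_def, THEN conjunct2, THEN conjunct2, THEN conjunct2, THEN conjunct2, THEN conjunct2, THEN conjunct2, THEN conjunct2, THEN conjunct1] by blast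

lemma psd_form_D: "psd_form (fdom D) (form D)"
proof
  fix u v w :: "'a \<Rightarrow> real" and a b :: real
  show "u \<in> fdom D \<Longrightarrow> v \<in> fdom D \<Longrightarrow> (\<lambda>x. a * u x + b * v x) \<in> fdom D"
    using closed[unfolded closed_form_def, THEN conjunct2, THEN conjunct1] by blast
  show "u \<in> fdom D \<Longrightarrow> v \<in> fdom D \<Longrightarrow> w \<in> fdom D \<Longrightarrow>
      form D (\<lambda>x. a * u x + b * v x) w = a * form D u w + b * form D v w"
    using closed[unfolded closed_form_def, THEN conjunct2, THEN conjunct2, THEN conjunct2, THEN conjunct2, THEN conjunct1] by blast
  show "u \<in> fdom D \<Longrightarrow> v \<in> fdom D \<Longrightarrow> form D u v = form D v u"
    using closed[unfolded closed_form_def, THEN conjunct2, THEN conjunct2, THEN conjunct2, THEN conjunct2, THEN conjunct2, THEN conjunct1] by blast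
  show "u \<in> fdom D \<Longrightarrow> 0 \<le> form D u u"
    using closed[unfolded closed_form_def, THEN conjunct2, THEN conjunct2, THEN conjunct2, THEN conjunct2, THEN conjunct2, THEN conjunct2, THEN conjunct1] by blast
qed

sublocale E: psd_form "fdom D" "form D"
  by (rule psd_form_D)

lemma form_add_ip: "form_add D lam u v = form D u v + lam * ip M u v"
  by (simp add: form_add_def ip_def)

lemma psd_form_add: "0 \<le> a \<Longrightarrow> 0 \<le> b \<Longrightarrow> psd_form (fdom D) (\<lambda>u v. a * form D u v + b * ip M u v)"
proof
  fix u v w :: "'a \<Rightarrow> real" and c d :: real
  show "u \<in> fdom D \<Longrightarrow> v \<in> fdom D \<Longrightarrow> (\<lambda>x. c * u x + d * v x) \<in> fdom D"
    by (rule E.lin_mem)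
  show "u \<in> fdom D \<Longrightarrow> v \<in> fdom D \<Longrightarrow> w \<in> fdom D \<Longrightarrow>
    a * form D (\<lambda>x. c * u x + d * v x) w + b * ip M (\<lambda>x. c * u x + d * v x) w =
    c * (a * form D u w + b * ip M u w) + d * (a * form D v w + b * ip M v w)"
    by (simp add: E.lin_left L2.lin_left fdom_L2 algebra_simps)
  show "u \<in> fdom D \<Longrightarrow> v \<in> fdom D \<Longrightarrow>
    a * form D u v + b * ip M u v = a * form D v u + b * ip M v u"
    using E.sym[of u v] L2.sym[of u "M" v] by (simp add: fdom_L2)
  show "0 \<le> a \<Longrightarrow> 0 \<le> b \<Longrightarrow> u \<in> fdom D \<Longrightarrow> 0 \<le> a * form D u u + b * ip M u u"
    by (simp add: E.nonneg L2.nonneg fdom_L2)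
qed

sublocale E1: psd_form "fdom D" "form_add D 1"
  using psd_form_add[of 1 1] by (simp add: form_add_ip[abs_def])

abbreviation "E1d u v \<equiv> E1.N (\<lambda>x. u x - v x)"

lemma E1_N_square: "u \<in> fdom D \<Longrightarrow> (E1.N u)\<^sup>2 = (E.N u)\<^sup>2 + (l2n M u)\<^sup>2"
  by (simp add: E1.N_square E.N_square form_add_ip L2.N_square fdom_L2)

lemma l2n_le_E1: "u \<in> fdom D \<Longrightarrow> l2n M u \<le> E1.N u"
  by (rule power2_le_imp_le) (simp_all add: E1_N_square)

lemma E_le_E1: "u \<in> fdom D \<Longrightarrow> E.N u \<le> E1.N u"
  by (rule power2_le_imp_le) (simp_all add: E1_N_square)

lemma E1_tendsto_l2n:
  assumes "\<And>n. u n \<in> fdom D" "v \<in> fdom D" "((\<lambda>n. E1d (u n) v) \<longlongrightarrow> 0) G"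
  shows "((\<lambda>n. l2d M (u n) v) \<longlongrightarrow> 0) G"
  by (rule Lim_null_comparison[OF _ assms(3)])
    (use assms in \<open>auto simp: L2.N_nonneg fdom_L2 E.mem intro!: l2n_le_E1 always_eventually\<close>)

lemma E1_tendsto_E:
  assumes "\<And>n. u n \<in> fdom D" "v \<in> fdom D" "((\<lambda>n. E1d (u n) v) \<longlongrightarrow> 0) G"
  shows "((\<lambda>n. E.N (\<lambda>x. u n x - v x)) \<longlongrightarrow> 0) G"
  by (rule Lim_null_comparison[OF _ assms(3)])
    (use assms in \<open>auto simp: E.mem intro!: E_le_E1 always_eventually\<close>)

lemma form_add_cong_AE:
  assumes "u \<in> fdom D" "v \<in> fdom D" "w \<in> fdom D" "AE x in M. u x = v x"
  shows "form_add D lam u w = form_add D lam v w"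
proof -
  note [measurable] = assms(1-3)[THEN fdom_L2, THEN L2_measurable]
  have "ip M u w = ip M v w" by (rule ip_cong_AE) (use assms in auto)
  thus ?thesis using form_cong_AE[OF assms] by (simp add: form_add_ip)
qed

lemma E1_N_cong_AE:
  assumes "u \<in> fdom D" "v \<in> fdom D" "AE x in M. u x = v x"
  shows "E1.N u = E1.N v"
  unfolding E1.N_def using form_add_cong_AE[OF assms(1,2,1,3)] form_add_cong_AE[OF assms(1,2,2,3)]
    E1.sym[OF assms(1,2)] by simp

lemma complete:
  assumes u: "\<And>n::nat. u n \<in> fdom D"
    and cau: "\<And>e. e > 0 \<Longrightarrow> \<exists>N. \<forall>m\<ge>N. \<forall>n\<ge>N. E1d (u m) (u n) < e"
  obtains v where "v \<in> fdom D" "(\<lambda>n. E1d (u n) v) \<longlonglongrightarrow> 0"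
proof -
  have "\<exists>N. \<forall>m\<ge>N. \<forall>n\<ge>N. sqnormE1 D (\<lambda>x. u m x - u n x) < e" if e: "e > 0" for e
  proof -
    obtain N where N: "\<forall>m\<ge>N. \<forall>n\<ge>N. E1d (u m) (u n) < sqrt e"
      using cau[of "sqrt e"] e by auto
    hence "\<forall>m\<ge>N. \<forall>n\<ge>N. sqnormE1 D (\<lambda>x. u m x - u n x) < e"
      by (auto simp: E1.N_def)
    thus ?thesis by blast
  qed
  then obtain v where v: "v \<in> fdom D" "(\<lambda>n. sqnormE1 D (\<lambda>x. u n x - v x)) \<longlonglongrightarrow> 0"
    using closed[unfolded closed_form_def, THEN conjunct2, THEN conjunct2, THEN conjunct2, THEN conjunct2, THEN conjunct2, THEN conjunct2, THEN conjunct2, THEN conjunct2] u by blast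
  have "(\<lambda>n. E1d (u n) v) \<longlonglongrightarrow> 0"
    unfolding E1.N_def using tendsto_real_sqrt[OF v(2)] by simp
  with v(1) that show thesis by blast
qed

text \<open>
  Almost minimisers of a quadratic functional over a decreasing sequence of convex sets form a
  Cauchy sequence. This gives both the resolvent and the Mazur-type lemma \<open>weak_limit\<close>.
\<close>

lemma almost_minimisers:
  fixes h :: real and f :: "'a \<Rightarrow> real" and A :: "nat \<Rightarrow> ('a \<Rightarrow> real) set"
  defines "\<Psi> \<equiv> \<lambda>v. h * form D v v + sqnorm2 M (\<lambda>x. v x - f x)"
  assumes h: "0 < h" and f: "f \<in> L2 M"
    and A: "\<And>n. A n \<subseteq> fdom D" "\<And>n. A (Suc n) \<subseteq> A n"
    and mid: "\<And>n u v. u \<in> A n \<Longrightarrow> v \<in> A n \<Longrightarrow> (\<lambda>x. u x / 2 + v x / 2) \<in> A n"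
    and bdd: "\<And>n. \<exists>v\<in>A n. \<Psi> v \<le> C"
  obtains u v where "\<And>n. u n \<in> A n" "v \<in> fdom D" "(\<lambda>n. E1d (u n) v) \<longlonglongrightarrow> 0"
    "\<And>n w. w \<in> A n \<Longrightarrow> \<Psi> (u n) \<le> \<Psi> w + 1 / real (Suc n)"
proof -
  have Psi0: "0 \<le> \<Psi> v" if "v \<in> fdom D" for v using h that by (simp add: \<Psi>_def E.nonneg)
  define I where "I n = Inf (\<Psi> ` A n)" for n
  have bb: "bdd_below (\<Psi> ` A n)" for n using A(1)[of n] by (intro bdd_belowI2[of _ 0] Psi0) auto
  have ne: "\<Psi> ` A n \<noteq> {}" for n using bdd[of n] by auto
  have I_le: "I n \<le> \<Psi> w" if "w \<in> A n" for n w
    unfolding I_def using that bb by (intro cInf_lower) auto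
  have "\<exists>u\<in>A n. \<Psi> u < I n + 1 / real (Suc n)" for n
    using cInf_lessD[OF ne[of n], of "I n + 1 / real (Suc n)"] unfolding I_def by auto
  then obtain u where u: "\<And>n. u n \<in> A n" "\<And>n. \<Psi> (u n) < I n + 1 / real (Suc n)" by metis
  have uF: "u n \<in> fdom D" for n using u A by blast
  have Iinc: "incseq I"
    unfolding I_def using A(2) by (intro incseq_SucI cInf_superset_mono ne bb) auto
  have Adec: "decseq A" using A(2) by (simp add: decseq_Suc_iff)
  have IC: "I n \<le> C" for n using bdd[of n] I_le[of _ n] by (meson order_trans)
  obtain L where L: "I \<longlonglongrightarrow> L" using incseq_convergent[OF Iinc] IC by blast
  \<comment> \<open>The parallelogram identity is applied to \<open>p - f\<close> and
    \<open>q - f\<close>; the shift by \<open>f\<close> cancels in the difference.\<close>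
  have key: "h * form D (\<lambda>x. p x - q x) (\<lambda>x. p x - q x) + sqnorm2 M (\<lambda>x. p x - q x)
      = 2 * \<Psi> p + 2 * \<Psi> q - 4 * \<Psi> (\<lambda>x. p x / 2 + q x / 2)" if p: "p \<in> fdom D" and q: "q \<in> fdom D" for p q
  proof -
    have pf: "(\<lambda>x. p x - f x) \<in> L2 M" and qf: "(\<lambda>x. q x - f x) \<in> L2 M"
      using p q f by (auto intro: L2.mem fdom_L2)
    have e: "(\<lambda>x. p x / 2 + q x / 2 - f x) = (\<lambda>x. (p x - f x) / 2 + (q x - f x) / 2)"
      by (simp add: fun_eq_iff field_simps)
    have e2: "(\<lambda>x. p x - q x) = (\<lambda>x. (p x - f x) - (q x - f x))" by simp
    have "sqnorm2 M (\<lambda>x. p x - q x) = 2 * sqnorm2 M (\<lambda>x. p x - f x) + 2 * sqnorm2 M (\<lambda>x. q x - f x)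
        - 4 * sqnorm2 M (\<lambda>x. p x / 2 + q x / 2 - f x)"
      unfolding e e2 sqnorm2_ip by (rule L2.parallelogram[OF pf qf])
    moreover have "form D (\<lambda>x. p x - q x) (\<lambda>x. p x - q x) = 2 * form D p p + 2 * form D q q
        - 4 * form D (\<lambda>x. p x / 2 + q x / 2) (\<lambda>x. p x / 2 + q x / 2)"
      by (rule E.parallelogram[OF p q])
    moreover have "h * X + Y = 2 * (h * P + P') + 2 * (h * Q + Q') - 4 * (h * R + R')"
      if "Y = 2 * P' + 2 * Q' - 4 * R'" "X = 2 * P + 2 * Q - 4 * R" for X Y P Q R P' Q' R' :: real
      unfolding that by (simp add: algebra_simps)
    ultimately show ?thesis unfolding \<Psi>_def by blast
  qed
  \<comment> \<open>Both almost minimisers lie in the larger set \<open>A (min m n)\<close>, so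
    their midpoint costs at least \<open>I (min m n)\<close>. As \<open>I\<close> increases, one of
    the two gaps to this value is 0 and the other is the distance of \<open>I m\<close> and
    \<open>I n\<close>.\<close>
  have est: "h * form D (\<lambda>x. u m x - u n x) (\<lambda>x. u m x - u n x) + sqnorm2 M (\<lambda>x. u m x - u n x)
     \<le> 2 * \<bar>I m - I n\<bar> + 2 / real (Suc m) + 2 / real (Suc n)" for m n
  proof -
    have "u m \<in> A (min m n)" "u n \<in> A (min m n)"
      using u(1)[of m] u(1)[of n] decseqD[OF Adec, of "min m n" m] decseqD[OF Adec, of "min m n" n] by auto
    hence "I (min m n) \<le> \<Psi> (\<lambda>x. u m x / 2 + u n x / 2)" by (intro I_le mid)
    moreover have "I m - I (min m n) + (I n - I (min m n)) = \<bar>I m - I n\<bar>"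
      using incseqD[OF Iinc, of m n] incseqD[OF Iinc, of n m] by (auto simp: min_def)
    moreover have "2 / real (Suc m) = 2 * (1 / real (Suc m))" "2 / real (Suc n) = 2 * (1 / real (Suc n))"
      by simp_all
    moreover have "X \<le> 2 * d + m2 + n2" if "X = 2 * p + 2 * q - 4 * r" "p < im + m1" "q < jn + n1"
      "m2 = 2 * m1" "n2 = 2 * n1" "im - i0 + (jn - i0) = d" "i0 \<le> r"
      for X d m1 m2 n1 n2 p q r im jn i0 :: real
      using that by linarith
    ultimately show ?thesis using key[OF uF uF, of m n] u(2)[of m] u(2)[of n] by blast
  qed
  have "\<exists>N. \<forall>m\<ge>N. \<forall>n\<ge>N. E1d (u m) (u n) < e" if e: "e > 0" for e
  proof -
    \<comment> \<open>\<open>K\<close> undoes the weight \<open>h\<close>: the squared E1-norm is at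
      most \<open>K\<close> times the weighted expression. The 7 in \<open>d\<close> exceeds the 2 +
      2 + 2 coming from the three terms of \<open>est\<close>.\<close>
    define K where "K = max 1 (1 / h)"
    have K: "0 < K" "1 \<le> K" "1 \<le> K * h" using h by (auto simp: K_def max_def field_simps)
    define d where "d = e\<^sup>2 / (K * 7)"
    have d: "0 < d" using e K by (simp add: d_def)
    obtain N1 where N1: "\<And>m n. m \<ge> N1 \<Longrightarrow> n \<ge> N1 \<Longrightarrow> \<bar>I m - I n\<bar> < d"
      using LIMSEQ_imp_Cauchy[OF L] d unfolding Cauchy_def dist_real_def by metis
    obtain N2 where N2: "1 / real (Suc N2) < d" using d by (meson nat_approx_posE)
    have inv: "1 / real (Suc n) < d" if "n \<ge> N2" for n
    proof -
      have "1 / real (Suc n) \<le> 1 / real (Suc N2)" using that by (simp add: frac_le)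
      with N2 show ?thesis by simp
    qed
    show ?thesis
    proof (intro exI allI impI)
      fix m n assume mn: "m \<ge> max N1 N2" "n \<ge> max N1 N2"
      let ?d = "\<lambda>x. u m x - u n x"
      have dF: "?d \<in> fdom D" using uF by (intro E.mem)
      have "(E1.N ?d)\<^sup>2 = form D ?d ?d + sqnorm2 M ?d"
        using dF by (simp add: E1_N_square E.N_square l2n_square fdom_L2)
      also have "\<dots> \<le> K * (h * form D ?d ?d + sqnorm2 M ?d)"
      proof -
        have "1 * form D ?d ?d \<le> (K * h) * form D ?d ?d"
          by (intro mult_right_mono K E.nonneg dF)
        moreover have "1 * sqnorm2 M ?d \<le> K * sqnorm2 M ?d"
          by (intro mult_right_mono K) simp
        ultimately show ?thesis by (simp add: algebra_simps)
      qed
      also have "\<dots> \<le> K * (2 * \<bar>I m - I n\<bar> + 2 / real (Suc m) + 2 / real (Suc n))"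
        using K by (intro mult_left_mono est) auto
      also have "\<dots> < K * (7 * d)"
      proof (rule mult_strict_left_mono[OF _ K(1)])
        have two: "2 / real (Suc j) = 2 * (1 / real (Suc j))" for j by simp
        have arith: "2 * a + m2 + n2 < 7 * d" if "a < d" "m1 < d" "n1 < d" "m2 = 2 * m1" "n2 = 2 * n1" "0 < d"
          for a m1 m2 n1 n2 :: real
          using that by linarith
        show "2 * \<bar>I m - I n\<bar> + 2 / real (Suc m) + 2 / real (Suc n) < 7 * d"
          by (rule arith[OF N1 inv inv two two d]) (use mn in auto)
      qed
      also have "\<dots> = e\<^sup>2" using K by (simp add: d_def)
      finally show "E1.N ?d < e" using e by (simp add: power2_less_imp_less)
    qed
  qed
  then obtain v where v: "v \<in> fdom D" "(\<lambda>n. E1d (u n) v) \<longlonglongrightarrow> 0"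
    using complete[of u] uF by blast
  have "\<Psi> (u n) \<le> \<Psi> w + 1 / real (Suc n)" if "w \<in> A n" for n w
    using I_le[OF that] u(2)[of n] by simp
  from that[OF u(1) v this] show thesis .
qed

text \<open>Plays the role of weak compactness and convex combinations: almost minimisers of the
  E1-norm among those elements of \<open>S\<close> that are close to \<open>g\<close> in L2 converge
  in the form norm, and their limit can only be \<open>g\<close>. That the approximants stay in
  \<open>S\<close> is what later uses rely on, with \<open>S\<close> a part closure, a set of
  nonnegative elements of the operator domain, or the annihilator of a function.\<close>

lemma weak_limit:
  assumes S: "S \<subseteq> fdom D" and mid: "\<And>u v. u \<in> S \<Longrightarrow> v \<in> S \<Longrightarrow> (\<lambda>x. u x / 2 + v x / 2) \<in> S"
    and w: "\<And>n::nat. w n \<in> S" and bd: "\<And>n. E.N (w n) \<le> C"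
    and g: "g \<in> L2 M" and lim: "l2_tendsto M w g"
  obtains v where "g \<in> fdom D" "\<And>n::nat. v n \<in> S" "(\<lambda>n. E1d (v n) g) \<longlonglongrightarrow> 0"
proof -
  define A where "A n = {v \<in> S. l2d M v g \<le> 1 / real (Suc n)}" for n
  have SL: "v \<in> L2 M" if "v \<in> S" for v using S that fdom_L2 by blast
  have C0: "0 \<le> C" using bd[of 0] E.N_nonneg[of "w 0"] w S by (meson order_trans subsetD)
  \<comment> \<open>With weight 1 and target 0 the functional is the squared E1-norm. A late
    \<open>w k\<close> satisfies the bound: its energy is at most \<open>C\<^sup>2\<close>, and its
    distance to \<open>g\<close> is below \<open>1 / real (Suc n)\<close>, hence below 1.\<close>
  obtain v u where u: "\<And>n. u n \<in> A n" "v \<in> fdom D" "(\<lambda>n. E1d (u n) v) \<longlonglongrightarrow> 0"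
  proof (rule almost_minimisers[of 1 "\<lambda>x. 0" A "C\<^sup>2 + (l2n M g + 1)\<^sup>2"])
    show "(\<lambda>x. u x / 2 + v x / 2) \<in> A n" if "u \<in> A n" "v \<in> A n" for u v n
    proof -
      have uS: "u \<in> S" and vS: "v \<in> S" using that by (auto simp: A_def)
      have m: "(\<lambda>x. u x - g x) \<in> L2 M" "(\<lambda>x. v x - g x) \<in> L2 M" using SL uS vS g by (auto intro: L2.mem)
      have e: "(\<lambda>x. u x / 2 + v x / 2 - g x) = (\<lambda>x. (1/2) * (u x - g x) + (1/2) * (v x - g x))"
        by (simp add: fun_eq_iff field_simps)
      have "l2n M (\<lambda>x. u x / 2 + v x / 2 - g x)
          \<le> (1/2) * l2d M u g + (1/2) * l2d M v g"
        unfolding e using L2.N_triangle[OF L2.scale_mem[OF m(1), of "1/2"] L2.scale_mem[OF m(2), of "1/2"]]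
        by (simp only: L2.N_scale[OF m(1)] L2.N_scale[OF m(2)])
      also have "\<dots> \<le> 1 / real (Suc n)" using that by (simp add: A_def)
      finally show ?thesis using mid[OF uS vS] by (simp add: A_def)
    qed
    show "\<exists>v\<in>A n. 1 * form D v v + sqnorm2 M (\<lambda>x. v x - 0) \<le> C\<^sup>2 + (l2n M g + 1)\<^sup>2" for n
    proof -
      have "\<forall>\<^sub>F k in sequentially. l2d M (w k) g < 1 / real (Suc n)"
        using order_tendstoD(2)[OF lim, of "1 / real (Suc n)"] by simp
      then obtain k where k: "l2d M (w k) g < 1 / real (Suc n)"
        by (auto simp: eventually_sequentially)
      have wF: "w k \<in> fdom D" using w S by blast
      have wL: "w k \<in> L2 M" using SL w by blast
      have "1 / real (Suc n) \<le> 1" by simp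
      hence "l2n M (w k) \<le> l2n M g + 1"
        using k L2.N_diff_abs[OF wL g] by linarith
      hence "sqnorm2 M (w k) \<le> (l2n M g + 1)\<^sup>2"
        unfolding l2n_square[OF wL, symmetric] by (intro power_mono) (simp_all add: L2.N_nonneg wL)
      moreover have "form D (w k) (w k) \<le> C\<^sup>2"
        unfolding E.N_square[OF wF, symmetric] by (intro power_mono bd) (simp add: wF)
      moreover have "w k \<in> A n" using k w by (simp add: A_def)
      ultimately show ?thesis by (intro bexI[of _ "w k"]) auto
    qed
    have "1 / real (Suc (Suc n)) \<le> 1 / real (Suc n)" for n by (simp add: frac_le)
    thus "A (Suc n) \<subseteq> A n" for n unfolding A_def using order_trans by blast
  qed (use S in \<open>auto simp: A_def L2_zero\<close>)
  have uS: "u n \<in> S" for n using u(1)[of n] by (simp add: A_def)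
  have uF: "u n \<in> fdom D" for n using uS S by blast
  have l1: "l2_tendsto M u g"
  proof (rule Lim_null_comparison)
    show "\<forall>\<^sub>F n in sequentially. norm (l2d M (u n) g) \<le> 1 / real (Suc n)"
      using u(1) SL[OF uS] g by (auto simp: A_def L2.N_nonneg L2.mem)
    show "(\<lambda>n. 1 / real (Suc n)) \<longlonglongrightarrow> 0" using LIMSEQ_inverse_real_of_nat by (simp add: inverse_eq_divide)
  qed
  have l2: "l2_tendsto M u v" by (rule E1_tendsto_l2n[OF uF u(2,3)])
  have eq: "AE x in M. v x = g x" by (rule L2_limit_unique[OF SL[OF uS] fdom_L2[OF u(2)] g l2 l1])
  have gF: "g \<in> fdom D" by (rule fdom_cong_AE[OF u(2) L2_measurable[OF g] eq])
  have "E1d (u n) v = E1d (u n) g" for n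
    by (rule E1_N_cong_AE) (use eq uF u(2) gF in \<open>auto intro: E.mem\<close>)
  with u(3) have "(\<lambda>n. E1d (u n) g) \<longlonglongrightarrow> 0" by simp
  with gF uS show thesis by (rule that)
qed

end

section \<open>Resolvents: existence, resolvent equation, commutation, strong continuity\<close>

text \<open>The weak form of \<open>u + h H u = f\<close>. It is a relation because solutions are
  determined only up to null sets.\<close>

definition is_res :: "'a form_space \<Rightarrow> real \<Rightarrow> ('a \<Rightarrow> real) \<Rightarrow> ('a \<Rightarrow> real) \<Rightarrow> bool" where
  "is_res D h f u \<longleftrightarrow> u \<in> fdom D \<and>
     (\<forall>v\<in>fdom D. h * form D u v + ip (meas D) u v = ip (meas D) f v)"

text \<open>\<open>res D h f\<close> is (a representative of) \<open>(1 + h H)\<^sup>-\<^sup>1 f\<close>.\<close>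

definition res :: "'a form_space \<Rightarrow> real \<Rightarrow> ('a \<Rightarrow> real) \<Rightarrow> 'a \<Rightarrow> real" where
  "res D h f = (SOME u. is_res D h f u)"

context cform
begin

abbreviation "J \<equiv> res D"

text \<open>The resolvent equation is the Euler-Lagrange equation of \<open>\<Psi>\<close>. A
  minimiser comes from \<open>almost_minimisers\<close> with a constant sequence of sets, and its
  first variation in every direction \<open>w\<close> vanishes.\<close>

lemma is_res_exists:
  assumes h: "0 < h" and f: "f \<in> L2 M"
  shows "\<exists>u. is_res D h f u"
proof -
  define \<Psi> where "\<Psi> v = h * form D v v + sqnorm2 M (\<lambda>x. v x - f x)" for v
  obtain v0 where "v0 \<in> fdom D" using fdom_dense[OF f, of 1] by auto
  hence z: "(\<lambda>x. 0) \<in> fdom D" by (rule E.zero_mem)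
  obtain v u where u: "\<And>n::nat. u n \<in> fdom D" "v \<in> fdom D" "(\<lambda>n. E1d (u n) v) \<longlonglongrightarrow> 0"
    "\<And>n w. w \<in> fdom D \<Longrightarrow> \<Psi> (u n) \<le> \<Psi> w + 1 / real (Suc n)"
  proof (rule almost_minimisers[of h f "\<lambda>_. fdom D" "\<Psi> (\<lambda>x. 0)"])
    show "\<exists>v\<in>fdom D. h * form D v v + sqnorm2 M (\<lambda>x. v x - f x) \<le> \<Psi> (\<lambda>x. 0)" for n :: nat
      using z unfolding \<Psi>_def by blast
  qed (use h f in \<open>auto simp: \<Psi>_def E.mem intro: E.mem\<close>)
  have vL: "(\<lambda>x. v x - f x) \<in> L2 M" by (rule L2.diff_mem[OF fdom_L2[OF u(2)] f])
  have uL: "(\<lambda>x. u n x - f x) \<in> L2 M" for n by (rule L2.diff_mem[OF fdom_L2[OF u(1)] f])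
  have "(\<lambda>n. E.N (u n)) \<longlonglongrightarrow> E.N v"
    by (rule E.N_tendsto_N[OF u(1,2) E1_tendsto_E[OF u(1,2,3)]])
  moreover have "(\<lambda>n. l2d M (u n) f) \<longlonglongrightarrow> l2d M v f"
    by (rule L2.N_tendsto_N[OF uL vL]) (use E1_tendsto_l2n[OF u(1,2,3)] in simp)
  ultimately have "(\<lambda>n. h * (E.N (u n))\<^sup>2 + (l2d M (u n) f)\<^sup>2)
      \<longlonglongrightarrow> h * (E.N v)\<^sup>2 + (l2d M v f)\<^sup>2"
    by (intro tendsto_intros)
  hence "(\<lambda>n. \<Psi> (u n)) \<longlonglongrightarrow> \<Psi> v"
    using u(1,2) vL uL by (simp add: \<Psi>_def E.N_square l2n_square)
  moreover have "(\<lambda>n. \<Psi> w + 1 / real (Suc n)) \<longlonglongrightarrow> \<Psi> w + 0" for w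
    by (intro tendsto_add tendsto_const) (use LIMSEQ_inverse_real_of_nat in \<open>simp add: inverse_eq_divide\<close>)
  ultimately have min: "\<Psi> v \<le> \<Psi> w" if "w \<in> fdom D" for w
    using LIMSEQ_le[of "\<lambda>n. \<Psi> (u n)" "\<Psi> v" "\<lambda>n. \<Psi> w + 1 / real (Suc n)" "\<Psi> w + 0"] u(4)[OF that] by auto
  have "h * form D v w + ip M v w = ip M f w" if w: "w \<in> fdom D" for w
  proof -
    define b where "b = h * form D v w + ip M (\<lambda>x. v x - f x) w"
    define c where "c = h * form D w w + ip M w w"
    have c0: "0 \<le> c" using h w by (simp add: c_def E.nonneg L2.nonneg fdom_L2)
    have exp: "\<Psi> (\<lambda>x. v x - t * w x) = \<Psi> v - 2 * t * b + t\<^sup>2 * c" for t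
    proof -
      have "(\<lambda>x. v x - t * w x - f x) = (\<lambda>x. (v x - f x) - t * w x)" by (simp add: fun_eq_iff)
      thus ?thesis
        unfolding \<Psi>_def sqnorm2_ip b_def c_def
        by (simp only: E.B_lin_square[OF u(2) w, of t] L2.B_lin_square[OF vL fdom_L2[OF w], of t])
          (simp add: algebra_simps)
    qed
    have le: "0 \<le> - 2 * t * b + t\<^sup>2 * c" for t
      using min[of "\<lambda>x. v x - t * w x"] exp[of t] u(2) w by (simp add: E.mem)
    have "b = 0"
    proof (rule ccontr)
      assume b: "b \<noteq> 0"
      \<comment> \<open>The parabola would be lowest at \<open>b / c\<close>; the added 1 covers
        \<open>c = 0\<close> and still gives a negative value.\<close>
      define t where "t = b / (c + 1)"
      define X where "X = c / (c+1)"
      have 1: "t\<^sup>2 * c = t * b * X" and 2: "t * b = b\<^sup>2 / (c+1)"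
        by (simp_all add: t_def X_def power2_eq_square)
      have "- 2 * t * b + t\<^sup>2 * c = t * b * (X - 2)"
        unfolding 1 by (simp add: algebra_simps)
      hence "- 2 * t * b + t\<^sup>2 * c = b\<^sup>2 / (c+1) * (X - 2)"
        unfolding 2 .
      moreover have "X < 2" using c0 by (simp add: X_def field_simps)
      moreover have "0 < b\<^sup>2 / (c+1)" using b c0 by simp
      ultimately have "- 2 * t * b + t\<^sup>2 * c < 0" using mult_pos_neg[of "b\<^sup>2 / (c+1)" "X - 2"] by linarith
      with le[of t] show False by simp
    qed
    thus ?thesis using w u(2) f by (simp add: b_def L2.bilin fdom_L2)
  qed
  thus ?thesis using u(2) by (auto simp: is_res_def)
qed

lemma is_res_res: "0 < h \<Longrightarrow> f \<in> L2 M \<Longrightarrow> is_res D h f (J h f)"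
  unfolding res_def using is_res_exists by (rule someI_ex)

lemma res_mem: "0 < h \<Longrightarrow> f \<in> L2 M \<Longrightarrow> J h f \<in> fdom D"
  using is_res_res by (simp add: is_res_def)

lemma res_L2: "0 < h \<Longrightarrow> f \<in> L2 M \<Longrightarrow> J h f \<in> L2 M"
  using res_mem fdom_L2 by blast

lemma res_eq:
  "0 < h \<Longrightarrow> f \<in> L2 M \<Longrightarrow> v \<in> fdom D \<Longrightarrow>
    h * form D (J h f) v + ip M (J h f) v = ip M f v"
  using is_res_res by (simp add: is_res_def)

lemma res_form:
  "0 < h \<Longrightarrow> f \<in> L2 M \<Longrightarrow> v \<in> fdom D \<Longrightarrow>
    h * form D (J h f) v = ip M (\<lambda>x. f x - J h f x) v"
  using res_eq[of h f v] by (simp add: L2.bilin fdom_L2 res_mem)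

lemma is_res_contraction:
  assumes h: "0 \<le> h" and f: "f \<in> L2 M" and u: "is_res D h f u"
  shows "l2n M u \<le> l2n M f"
proof -
  have uF: "u \<in> fdom D" and e: "h * form D u u + ip M u u = ip M f u"
    using u by (auto simp: is_res_def)
  have "(l2n M u)\<^sup>2 \<le> ip M f u"
    using e h E.nonneg[OF uF] by (simp add: L2.N_square fdom_L2 uF flip: e)
  also have "\<dots> \<le> l2n M f * l2n M u"
    using L2.cauchy_schwarz[OF f fdom_L2[OF uF]] by simp
  finally show ?thesis
    using L2.N_nonneg[OF fdom_L2[OF uF]] L2.N_nonneg[OF f]
    by (cases "l2n M u = 0") (auto simp: power2_eq_square)
qed

lemma is_res_lin:
  assumes "is_res D h f u" "is_res D h g v" "f \<in> L2 M" "g \<in> L2 M"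
  shows "is_res D h (\<lambda>x. a * f x + b * g x) (\<lambda>x. a * u x + b * v x)"
proof -
  have uF: "u \<in> fdom D" and vF: "v \<in> fdom D" using assms by (auto simp: is_res_def)
  have "h * form D (\<lambda>x. a * u x + b * v x) w + ip M (\<lambda>x. a * u x + b * v x) w
      = ip M (\<lambda>x. a * f x + b * g x) w" if w: "w \<in> fdom D" for w
  proof -
    have e: "ip M f w = h * form D u w + ip M u w"
      "ip M g w = h * form D v w + ip M v w"
      using assms w by (auto simp: is_res_def)
    show ?thesis
      by (simp add: E.lin_left L2.lin_left fdom_L2 uF vF w assms(3,4) e algebra_simps)
  qed
  thus ?thesis by (simp add: is_res_def E.lin_mem uF vF)
qed

lemma is_res_diff:
  assumes "is_res D h f u" "is_res D h g v" "f \<in> L2 M" "g \<in> L2 M"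
  shows "is_res D h (\<lambda>x. f x - g x) (\<lambda>x. u x - v x)"
  using is_res_lin[OF assms, of 1 "-1"] by simp

lemma is_res_unique:
  assumes h: "0 < h" and f: "f \<in> L2 M" and u: "is_res D h f u"
  shows "AE x in M. J h f x = u x"
proof -
  have "is_res D h (\<lambda>x. f x - f x) (\<lambda>x. J h f x - u x)"
    by (rule is_res_diff[OF is_res_res[OF h f] u f f])
  from is_res_contraction[OF _ _ this] h have "l2d M (J h f) u \<le> l2n M (\<lambda>x. 0)"
    by (simp add: L2_zero)
  also have "\<dots> = 0" by (simp add: l2n_def sqnorm2_def)
  finally have "l2d M (J h f) u = 0"
    using u L2.N_nonneg[OF L2.diff_mem[OF res_L2[OF h f] fdom_L2, of u]] by (simp add: is_res_def)
  thus ?thesis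
    using u by (subst (asm) l2n_diff_eq_0_iff) (auto simp: is_res_def intro!: fdom_L2 res_mem h f)
qed

lemma res_contraction: "0 < h \<Longrightarrow> f \<in> L2 M \<Longrightarrow> l2n M (J h f) \<le> l2n M f"
  by (rule is_res_contraction[OF _ _ is_res_res]) auto

lemma res_lin:
  assumes h: "0 < h" and f: "f \<in> L2 M" and g: "g \<in> L2 M"
  shows "AE x in M. J h (\<lambda>x. a * f x + b * g x) x = a * J h f x + b * J h g x"
  by (rule is_res_unique[OF h L2_lin[OF f g] is_res_lin[OF is_res_res[OF h f] is_res_res[OF h g] f g]])

lemma res_diff:
  assumes h: "0 < h" and f: "f \<in> L2 M" and g: "g \<in> L2 M"
  shows "AE x in M. J h (\<lambda>x. f x - g x) x = J h f x - J h g x"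
  using res_lin[OF assms, of 1 "-1"] by simp

lemma res_nonexp:
  assumes h: "0 < h" and f: "f \<in> L2 M" and g: "g \<in> L2 M"
  shows "l2d M (J h f) (J h g) \<le> l2d M f g"
  by (rule is_res_contraction[OF _ _ is_res_diff[OF is_res_res[OF h f] is_res_res[OF h g] f g]])
    (use h f g in \<open>auto intro: L2.mem\<close>)

lemma res_cong_AE:
  assumes h: "0 < h" and f: "f \<in> L2 M" and g: "g \<in> borel_measurable M"
    and eq: "AE x in M. f x = g x"
  shows "AE x in M. J h f x = J h g x"
proof -
  have gL: "g \<in> L2 M" by (rule L2_cong_AE[OF f g eq])
  have "l2d M f g = 0" using eq by (simp add: l2n_diff_eq_0_iff f gL)
  with res_nonexp[OF h f gL] have "l2d M (J h f) (J h g) = 0"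
    by (intro antisym L2.N_nonneg L2.mem res_L2 h f gL) simp
  thus ?thesis by (simp add: l2n_diff_eq_0_iff res_L2 h f gL)
qed

lemma res_sym:
  assumes h: "0 < h" and f: "f \<in> L2 M" and g: "g \<in> L2 M"
  shows "ip M (J h f) g = ip M f (J h g)"
  using res_eq[OF h f res_mem[OF h g]] res_eq[OF h g res_mem[OF h f]]
    E.sym[OF res_mem[OF h f] res_mem[OF h g]]
    L2.sym[OF res_L2[OF h f] res_L2[OF h g]] L2.sym[OF res_L2[OF h f] g] by simp

text \<open>The resolvent equation in mixed form: with step \<open>k\<close>, the function
  \<open>J h f\<close> is the resolvent of a mixture of \<open>f\<close> and itself. For
  \<open>k \<le> h\<close> both weights are nonnegative, so that positivity can be used to compare
  resolvents with different steps.\<close>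

lemma res_identity:
  assumes h: "0 < h" and k: "0 < k" and f: "f \<in> L2 M"
  shows "AE x in M. J k (\<lambda>x. (k / h) * f x + (1 - k / h) * J h f x) x = J h f x"
proof (rule is_res_unique[OF k L2_lin[OF f res_L2[OF h f]]])
  have "k * form D (J h f) v + ip M (J h f) v
      = ip M (\<lambda>x. (k / h) * f x + (1 - k / h) * J h f x) v" if v: "v \<in> fdom D" for v
  proof -
    have 1: "form D (J h f) v = (ip M f v - ip M (J h f) v) / h"
      using res_eq[OF h f v] h by (simp add: field_simps)
    have "k * form D (J h f) v + ip M (J h f) v
        = (k / h) * ip M f v + (1 - k / h) * ip M (J h f) v"
      unfolding 1 using h by (simp add: field_simps)
    thus ?thesis
      unfolding L2.lin_left[OF f res_L2[OF h f] fdom_L2[OF v], of "k / h" "1 - k / h"] .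
  qed
  thus "is_res D k (\<lambda>x. (k / h) * f x + (1 - k / h) * J h f x) (J h f)"
    by (simp add: is_res_def res_mem h f)
qed

lemma res_graph:
  assumes h: "0 < h" and f: "f \<in> L2 M"
  shows "operator_graph D (J h f) (\<lambda>x. (f x - J h f x) / h)"
  unfolding operator_graph_def
proof (intro conjI ballI)
  show "(\<lambda>x. (f x - J h f x) / h) \<in> L2 M" by (intro L2.mem f res_L2 h)
  fix v assume v: "v \<in> fdom D"
  have d: "(\<lambda>x. f x - J h f x) \<in> L2 M" by (intro L2.mem f res_L2 h)
  have "ip M (\<lambda>x. (f x - J h f x) / h) v = ip M (\<lambda>x. f x - J h f x) v / h"
    by (rule L2.div_left[OF d fdom_L2[OF v]])
  also have "\<dots> = form D (J h f) v" using res_form[OF h f v] h by (simp add: field_simps)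
  finally show "form D (J h f) v = (\<integral>x. (f x - J h f x) / h * v x \<partial>M)"
    by (simp add: ip_def)
qed (rule res_mem[OF h f])

lemma operator_graph_ip:
  "operator_graph D u w \<longleftrightarrow> u \<in> fdom D \<and> w \<in> L2 M \<and> (\<forall>v\<in>fdom D. form D u v = ip M w v)"
  by (simp add: operator_graph_def ip_def)

lemma graph_is_res: "operator_graph D u w \<Longrightarrow> is_res D h (\<lambda>x. u x + h * w x) u"
  by (auto simp: operator_graph_ip is_res_def L2.bilin L2.mem fdom_L2)

text \<open>For \<open>w = H u\<close> the displacement of \<open>u\<close> under \<open>J h\<close>
  is \<open>h * J h w\<close>. Iterating this expansion produces all rates of the Euler
  scheme.\<close>

lemma graph_res:
  assumes h: "0 < h" and g: "operator_graph D u w"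
  shows "AE x in M. J h u x = u x - h * J h w x"
proof -
  have uF: "u \<in> fdom D" and w: "w \<in> L2 M" using g by (auto simp: operator_graph_ip)
  note u = fdom_L2[OF uF]
  have "AE x in M. J h (\<lambda>x. u x + h * w x) x = u x"
    by (rule is_res_unique[OF h _ graph_is_res[OF g]]) (intro L2.mem u w)
  moreover have "AE x in M. J h (\<lambda>x. 1 * u x + h * w x) x = 1 * J h u x + h * J h w x"
    by (rule res_lin[OF h u w])
  ultimately show ?thesis by eventually_elim simp
qed

lemma graph_lin:
  assumes "operator_graph D u w" "operator_graph D u' w'"
  shows "operator_graph D (\<lambda>x. a * u x + b * u' x) (\<lambda>x. a * w x + b * w' x)"
  using assms by (auto simp: operator_graph_ip E.lin_mem E.lin_left L2.lin_left fdom_L2 L2_lin)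

lemma graph_cong_AE:
  assumes g: "operator_graph D u w" and "u' \<in> borel_measurable M" "w' \<in> borel_measurable M"
    and eq: "AE x in M. u x = u' x" "AE x in M. w x = w' x"
  shows "operator_graph D u' w'"
proof -
  have uF: "u \<in> fdom D" and w: "w \<in> L2 M" using g by (auto simp: operator_graph_ip)
  have u': "u' \<in> fdom D" by (rule fdom_cong_AE[OF uF assms(2) eq(1)])
  have w': "w' \<in> L2 M" by (rule L2_cong_AE[OF w assms(3) eq(2)])
  have "form D u' v = ip M w' v" if v: "v \<in> fdom D" for v
    using g v form_cong_AE[OF uF u' v eq(1)]
      ip_cong_AE[of w "M" w' v v] eq(2) w assms(3) L2_measurable[OF fdom_L2[OF v]]
    by (auto simp: operator_graph_ip)
  with u' w' show ?thesis by (simp add: operator_graph_ip)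
qed

lemma res_res_graph:
  assumes h: "0 < h" and g: "operator_graph D u w"
  shows "operator_graph D (J h u) (J h w)"
proof -
  have u: "u \<in> L2 M" and w: "w \<in> L2 M" using g fdom_L2 by (auto simp: operator_graph_ip)
  have "AE x in M. (u x - J h u x) / h = J h w x"
    using graph_res[OF h g] by eventually_elim (use h in simp)
  thus ?thesis
    by (intro graph_cong_AE[OF res_graph[OF h u]]) (auto intro!: L2_measurable[OF res_L2] h u w)
qed

text \<open>\<open>J h\<close> maps the graph of \<open>H\<close> into itself, so
  \<open>J h (J k f)\<close> solves the equation that characterises
  \<open>J k (J h f)\<close>.\<close>

lemma res_commute:
  assumes h: "0 < h" and k: "0 < k" and f: "f \<in> L2 M"
  shows "AE x in M. J h (J k f) x = J k (J h f) x"
proof -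
  let ?u = "J k f"
  have u: "?u \<in> L2 M" by (rule res_L2[OF k f])
  let ?w = "\<lambda>x. (f x - ?u x) / k"
  have "operator_graph D (J h ?u) (J h ?w)" by (rule res_res_graph[OF h res_graph[OF k f]])
  from graph_is_res[OF this, of k]
  have 1: "is_res D k (\<lambda>x. J h ?u x + k * J h ?w x) (J h ?u)" .
  have w: "?w \<in> L2 M" by (intro L2.mem f u)
  have "AE x in M. J h (\<lambda>x. 1 * ?u x + k * ?w x) x = 1 * J h ?u x + k * J h ?w x"
    by (rule res_lin[OF h u w])
  moreover have "(\<lambda>x. 1 * ?u x + k * ?w x) = f" using k by (simp add: fun_eq_iff)
  ultimately have "AE x in M. J h f x = 1 * J h ?u x + k * J h ?w x" by simp
  hence eq: "AE x in M. J h ?u x + k * J h ?w x = J h f x"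
    by eventually_elim simp
  have m: "(\<lambda>x. J h ?u x + k * J h ?w x) \<in> L2 M" by (intro L2.mem res_L2 h u w)
  have "AE x in M. J k (\<lambda>x. J h ?u x + k * J h ?w x) x = J h ?u x"
    by (rule is_res_unique[OF k m 1])
  moreover have "AE x in M. J k (\<lambda>x. J h ?u x + k * J h ?w x) x = J k (J h f) x"
    by (rule res_cong_AE[OF k m L2_measurable[OF res_L2[OF h f]] eq])
  ultimately show ?thesis by eventually_elim simp
qed

text \<open>Both bounds come from testing with \<open>u - J h u\<close>: the pairing of
  \<open>J h u\<close> with it is the squared L2 distance divided by \<open>h\<close>. Its upper
  bound gives the first claim, its sign the decrease of energy.\<close>

lemma res_form_diff_le:
  assumes h: "0 < h" and u: "u \<in> fdom D"
  shows "(l2d M u (J h u))\<^sup>2 \<le> h * form D u u" "E.N (J h u) \<le> E.N u"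
proof -
  let ?J = "J h u"
  have J: "?J \<in> fdom D" by (rule res_mem[OF h fdom_L2[OF u]])
  have d: "(\<lambda>x. u x - ?J x) \<in> fdom D" by (intro E.mem u J)
  have e: "h * form D ?J (\<lambda>x. u x - ?J x) = (l2d M u ?J)\<^sup>2"
    using res_form[OF h fdom_L2[OF u] d] by (simp add: l2n_square fdom_L2 d sqnorm2_ip)
  have cs: "form D ?J u \<le> E.N ?J * E.N u" using E.cauchy_schwarz[OF J u] by simp
  have "form D ?J (\<lambda>x. u x - ?J x) = form D ?J u - (E.N ?J)\<^sup>2"
    by (simp add: E.bilin u J E.N_square)
  hence le: "form D ?J (\<lambda>x. u x - ?J x) \<le> E.N ?J * E.N u - (E.N ?J)\<^sup>2" using cs by simp
  also have "\<dots> \<le> (E.N u)\<^sup>2"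
  proof -
    have "0 \<le> (E.N ?J - E.N u)\<^sup>2" by simp
    hence "2 * (E.N ?J * E.N u) \<le> (E.N ?J)\<^sup>2 + (E.N u)\<^sup>2" by (simp add: power2_diff)
    moreover have "0 \<le> E.N ?J * E.N u" using J u by simp
    ultimately show ?thesis using zero_le_power2[of "E.N ?J"] zero_le_power2[of "E.N u"] by linarith
  qed
  finally have "form D ?J (\<lambda>x. u x - ?J x) \<le> form D u u" by (simp add: E.N_square u)
  thus "(l2d M u ?J)\<^sup>2 \<le> h * form D u u"
    unfolding e[symmetric] using h by simp
  have "0 \<le> form D ?J (\<lambda>x. u x - ?J x)" using e h by (metis zero_le_mult_iff zero_le_power2 not_le)
  with le have "E.N ?J * E.N ?J \<le> E.N ?J * E.N u" by (simp add: power2_eq_square)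
  thus "E.N ?J \<le> E.N u"
    using E.N_nonneg[OF J] E.N_nonneg[OF u] by (cases "E.N ?J = 0") auto
qed

text \<open>On the form domain the error is of order \<open>sqrt h\<close> by the energy bound;
  density and nonexpansiveness extend the convergence to all of \<open>L2 M\<close>.\<close>

lemma res_tendsto:
  assumes f: "f \<in> L2 M"
  shows "((\<lambda>h. l2d M (J h f) f) \<longlongrightarrow> 0) (at_right 0)"
proof (rule tendstoI)
  fix e :: real assume e: "0 < e"
  obtain u where u: "u \<in> fdom D" "sqnorm2 M (\<lambda>x. f x - u x) < (e/3)\<^sup>2"
    using fdom_dense[OF f, of "(e/3)\<^sup>2"] e by auto
  have uL: "u \<in> L2 M" by (rule fdom_L2[OF u(1)])
  have "sqrt (sqnorm2 M (\<lambda>x. f x - u x)) < sqrt ((e/3)\<^sup>2)" by (rule real_sqrt_less_mono[OF u(2)])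
  also have "\<dots> = e / 3" using e by simp
  finally have d: "l2d M f u < e / 3" by (simp add: l2n_def)
  define h0 where "h0 = (e/3)\<^sup>2 / (form D u u + 1)"
  have p: "0 < form D u u + 1" using E.nonneg[OF u(1)] by simp
  have h0: "0 < h0" using e p by (simp add: h0_def)
  have "\<forall>\<^sub>F h in at_right (0::real). h \<in> {0<..<h0}"
    by (rule eventually_at_right_real[OF h0])
  thus "\<forall>\<^sub>F h in at_right 0. dist (l2d M (J h f) f) 0 < e"
  proof eventually_elim
    case (elim h)
    hence h: "0 < h" "h < h0" by auto
    have "(l2d M u (J h u))\<^sup>2 \<le> h * form D u u" by (rule res_form_diff_le(1)[OF h(1) u(1)])
    also have "\<dots> \<le> h * (form D u u + 1)" using h by simp
    also have "\<dots> < h0 * (form D u u + 1)" using h p by simp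
    also have "\<dots> = (e/3)\<^sup>2" using p by (simp add: h0_def)
    finally have a: "l2d M u (J h u) < e/3" by (rule power2_less_imp_less) (use e in simp)
    have b: "l2d M (J h f) (J h u) \<le> l2d M f u"
      by (rule res_nonexp[OF h(1) f uL])
    note J = res_L2[OF h(1) f] res_L2[OF h(1) uL]
    have "l2d M (J h f) f \<le> l2d M (J h f) (J h u)
        + (l2d M (J h u) u + l2d M u f)"
      using L2.N_diff_triangle[OF J f] L2.N_diff_triangle[OF J(2) uL f] by simp
    also have "\<dots> < e"
      using a b d L2.N_diff_commute[OF f uL] L2.N_diff_commute[OF uL J(2)] by simp
    finally show ?case using L2.N_nonneg[OF L2.diff_mem[OF J(1) f]] by simp
  qed
qed

end

section \<open>Markovian forms\<close>

locale mform = cform +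
  assumes markov: "markovian D"
begin

lemma contraction:
  fixes T :: "real \<Rightarrow> real"
  assumes "T 0 = 0" "\<And>s t. \<bar>T s - T t\<bar> \<le> \<bar>s - t\<bar>" "u \<in> fdom D"
  shows "(\<lambda>x. T (u x)) \<in> fdom D" "form D (\<lambda>x. T (u x)) (\<lambda>x. T (u x)) \<le> form D u u"
proof -
  have "T 0 = 0 \<and> (\<forall>s t. \<bar>T s - T t\<bar> \<le> \<bar>s - t\<bar>)" using assms by blast
  hence "T \<circ> u \<in> fdom D \<and> form D (T \<circ> u) (T \<circ> u) \<le> form D u u"
    using markov[unfolded markovian_def] assms(3) by blast
  thus "(\<lambda>x. T (u x)) \<in> fdom D" "form D (\<lambda>x. T (u x)) (\<lambda>x. T (u x)) \<le> form D u u"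
    by (simp_all add: o_def)
qed

lemma contraction_N:
  fixes T :: "real \<Rightarrow> real"
  assumes "T 0 = 0" "\<And>s t. \<bar>T s - T t\<bar> \<le> \<bar>s - t\<bar>" "u \<in> fdom D"
  shows "E.N (\<lambda>x. T (u x)) \<le> E.N u"
  unfolding E.N_def using contraction(2)[OF assms] by simp

lemma abs_mem: "u \<in> fdom D \<Longrightarrow> (\<lambda>x. \<bar>u x\<bar>) \<in> fdom D"
  by (rule contraction(1)[of "\<lambda>t. \<bar>t\<bar>"]) auto

lemma abs_N: "u \<in> fdom D \<Longrightarrow> E.N (\<lambda>x. \<bar>u x\<bar>) \<le> E.N u"
  by (rule contraction_N[of "\<lambda>t. \<bar>t\<bar>"]) auto

lemma max0_mem: "u \<in> fdom D \<Longrightarrow> (\<lambda>x. max (u x) 0) \<in> fdom D"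
  by (rule contraction(1)[of "\<lambda>t. max t 0"]) auto

lemma max0_N: "u \<in> fdom D \<Longrightarrow> E.N (\<lambda>x. max (u x) 0) \<le> E.N u"
  by (rule contraction_N[of "\<lambda>t. max t 0"]) auto

lemma excess_mem: "0 \<le> c \<Longrightarrow> u \<in> fdom D \<Longrightarrow> (\<lambda>x. max (u x - c) 0) \<in> fdom D"
  by (rule contraction(1)[of "\<lambda>t. max (t - c) 0"]) auto

lemma cut_mem: "0 \<le> c \<Longrightarrow> u \<in> fdom D \<Longrightarrow> (\<lambda>x. min (u x) c) \<in> fdom D"
  by (rule contraction(1)[of "\<lambda>t. min t c"]) auto

text \<open>The Markov property concerns functions of one real variable. The minimum of two
  functions is reached through the absolute value of their difference.\<close>

lemma min_eq_abs: "(\<lambda>x. min (u x) (v x)) = (\<lambda>x. (1/2) * (u x + v x) + (-1/2) * \<bar>u x - v x\<bar>)" for u v :: "'b \<Rightarrow> real"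
  by (auto simp: fun_eq_iff min_def field_simps)

lemma min_mem:
  assumes "u \<in> fdom D" "v \<in> fdom D"
  shows "(\<lambda>x. min (u x) (v x)) \<in> fdom D"
  unfolding min_eq_abs by (intro E.lin_mem E.add_mem abs_mem E.diff_mem assms)

lemma min_N:
  assumes u: "u \<in> fdom D" and v: "v \<in> fdom D"
  shows "E.N (\<lambda>x. min (u x) (v x)) \<le> E.N u + E.N v"
proof -
  have s: "(\<lambda>x. u x + v x) \<in> fdom D" and d: "(\<lambda>x. u x - v x) \<in> fdom D"
    by (intro E.add_mem E.diff_mem u v)+
  have "E.N (\<lambda>x. min (u x) (v x)) \<le> E.N (\<lambda>x. (1/2) * (u x + v x)) + E.N (\<lambda>x. (-1/2) * \<bar>u x - v x\<bar>)"
    unfolding min_eq_abs by (intro E.N_triangle E.scale_mem abs_mem s d)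
  also have "\<dots> = (1/2) * E.N (\<lambda>x. u x + v x) + (1/2) * E.N (\<lambda>x. \<bar>u x - v x\<bar>)"
    unfolding E.N_scale[OF s] E.N_scale[OF abs_mem[OF d]] by simp
  also have "\<dots> \<le> (1/2) * (E.N u + E.N v) + (1/2) * (E.N u + E.N v)"
    using E.N_triangle[OF u v] E.N_triangle_diff[OF u v] abs_N[OF d] by simp
  finally show ?thesis by simp
qed

text \<open>The reflection \<open>t \<mapsto> c - \<bar>t - c\<bar>\<close> is a contraction fixing \<open>0\<close> that maps \<open>p + q\<close> to \<open>p - q\<close>.\<close>

lemma form_reflection_nonneg:
  assumes p: "p \<in> fdom D" and q: "q \<in> fdom D" and c: "0 \<le> c"
    and pq: "AE x in M. p x \<le> c \<and> 0 \<le> q x \<and> (q x \<noteq> 0 \<longrightarrow> p x = c)"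
  shows "0 \<le> form D p q"
proof -
  let ?T = "\<lambda>t. c - \<bar>t - c\<bar>"
  let ?u = "\<lambda>x. p x + q x"
  let ?v = "\<lambda>x. p x - q x"
  have u: "?u \<in> fdom D" and v: "?v \<in> fdom D" by (intro E.mem p q)+
  have T: "(\<lambda>x. ?T (?u x)) \<in> fdom D" "form D (\<lambda>x. ?T (?u x)) (\<lambda>x. ?T (?u x)) \<le> form D ?u ?u"
    using c by (intro contraction[of ?T] u; auto)+
  have eq: "AE x in M. ?T (?u x) = ?v x"
    using pq
  proof eventually_elim
    case (elim x)
    thus ?case by (cases "q x = 0") auto
  qed
  have "form D (\<lambda>x. ?T (?u x)) (\<lambda>x. ?T (?u x)) = form D ?v ?v"
    using form_cong_AE[OF T(1) v T(1) eq] form_cong_AE[OF T(1) v v eq] E.sym[OF T(1) v] by simp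
  hence "form D ?v ?v \<le> form D ?u ?u" using T(2) by simp
  thus ?thesis using E.sym[OF p q] by (simp add: E.bilin E.mem p q)
qed

text \<open>Split \<open>u\<close> into \<open>min u c\<close> and its excess over \<open>c\<close>:
  the cross term is nonnegative by the reflection, the diagonal term since the form is.\<close>

lemma form_excess_nonneg:
  assumes u: "u \<in> fdom D" and c: "0 \<le> c"
  shows "0 \<le> form D u (\<lambda>x. max (u x - c) 0)"
proof -
  let ?p = "\<lambda>x. min (u x) c" and ?q = "\<lambda>x. max (u x - c) 0"
  note p = cut_mem[OF c u] and q = excess_mem[OF c u]
  have "0 \<le> form D ?p ?q"
    by (rule form_reflection_nonneg[OF p q c]) (auto simp: min_def max_def)
  moreover have "u = (\<lambda>x. ?p x + ?q x)" by (auto simp: fun_eq_iff min_def max_def)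
  hence "form D u ?q = form D ?p ?q + form D ?q ?q"
    using E.add_left[OF p q q] by simp
  ultimately show ?thesis using E.nonneg[OF q] by simp
qed

text \<open>The closing step of every maximum principle below: \<open>q\<close> is an excess used as
  test function, \<open>w\<close> the residual of an equation, and the pointwise bound puts the
  squared norm of \<open>q\<close> below the nonpositive pairing.\<close>

lemma ip_nonpos_imp_zero_AE:
  assumes q: "q \<in> L2 M" and w: "w \<in> L2 M" and le: "ip M w q \<le> 0" and ge: "AE x in M. (q x)\<^sup>2 \<le> w x * q x"
  shows "AE x in M. q x = 0"
proof -
  have "sqnorm2 M q \<le> ip M w q" unfolding sqnorm2_def ip_def
    by (rule integral_mono_AE[OF L2_integrable_sq[OF q] L2_integrable_mult[OF w q] ge])
  with le have "l2n M q = 0" by (simp add: l2n_def order_antisym)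
  thus ?thesis by (simp add: l2n_eq_0_iff q)
qed

lemma res_le_const:
  assumes h: "0 < h" and f: "f \<in> L2 M" and c: "0 \<le> c" and le: "AE x in M. f x \<le> c"
  shows "AE x in M. J h f x \<le> c"
proof -
  let ?u = "J h f" and ?q = "\<lambda>x. max (J h f x - c) 0"
  note u = res_mem[OF h f]
  note q = excess_mem[OF c u]
  have "AE x in M. ?q x = 0"
  proof (rule ip_nonpos_imp_zero_AE[OF fdom_L2[OF q]])
    show "(\<lambda>x. ?u x - f x) \<in> L2 M" by (intro L2.mem fdom_L2 u f)
    have "ip M (\<lambda>x. ?u x - f x) ?q = - (h * form D ?u ?q)"
      using res_eq[OF h f q] by (simp add: L2.diff_left fdom_L2 u f q)
    also have "\<dots> \<le> 0" using h form_excess_nonneg[OF u c] by simp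
    finally show "ip M (\<lambda>x. ?u x - f x) ?q \<le> 0" .
    show "AE x in M. (?q x)\<^sup>2 \<le> (?u x - f x) * ?q x" using le
    proof eventually_elim
      case (elim x)
      thus ?case by (auto simp: power2_eq_square max_def intro!: mult_right_mono)
    qed
  qed
  thus ?thesis by eventually_elim (simp add: max_def split: if_splits)
qed

lemma res_uminus:
  assumes h: "0 < h" and f: "f \<in> L2 M"
  shows "AE x in M. J h (\<lambda>x. - f x) x = - J h f x"
  using res_lin[OF h f f, of "-1" 0] by simp

lemma res_nonneg:
  assumes h: "0 < h" and f: "f \<in> L2 M" and le: "AE x in M. 0 \<le> f x"
  shows "AE x in M. 0 \<le> J h f x"
proof -
  have "AE x in M. J h (\<lambda>x. - f x) x \<le> 0"
    by (rule res_le_const[OF h L2.uminus_mem[OF f]]) (use le in auto)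
  with res_uminus[OF h f] show ?thesis by eventually_elim simp
qed

lemma res_mono:
  assumes h: "0 < h" and f: "f \<in> L2 M" and g: "g \<in> L2 M"
    and le: "AE x in M. f x \<le> g x"
  shows "AE x in M. J h f x \<le> J h g x"
proof -
  have "AE x in M. 0 \<le> J h (\<lambda>x. g x - f x) x"
    by (rule res_nonneg[OF h L2.diff_mem[OF g f]]) (use le in auto)
  with res_diff[OF h g f] show ?thesis by eventually_elim simp
qed

text \<open>Lets inequalities checked against nonnegative elements of the operator domain pass to
  all nonnegative elements of the form domain. The resolvents of \<open>u\<close> have bounded
  energy and converge in L2; \<open>weak_limit\<close> turns this into convergence in the form norm
  inside the convex set of such elements.\<close>

lemma res_tendsto_E1:
  assumes u: "u \<in> fdom D" and pos: "AE x in M. 0 \<le> u x"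
  obtains v w where "\<And>n::nat. operator_graph D (v n) (w n)" "\<And>n. AE x in M. 0 \<le> v n x"
    "(\<lambda>n. E1d (v n) u) \<longlonglongrightarrow> 0"
proof -
  let ?S = "{v. (\<exists>w. operator_graph D v w) \<and> (AE x in M. 0 \<le> v x)}"
  let ?w = "\<lambda>n::nat. J (1 / real (Suc n)) u"
  note uL = fdom_L2[OF u]
  obtain v where "u \<in> fdom D" "\<And>n::nat. v n \<in> ?S" "(\<lambda>n. E1d (v n) u) \<longlonglongrightarrow> 0"
  proof (rule weak_limit[of ?S ?w "E.N u" u])
    show "?S \<subseteq> fdom D" by (auto simp: operator_graph_def)
    show "(\<lambda>x. p x / 2 + q x / 2) \<in> ?S" if pq: "p \<in> ?S" "q \<in> ?S" for p q
    proof -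
      obtain w w' where g: "operator_graph D p w" "operator_graph D q w'" using pq by auto
      have "AE x in M. 0 \<le> p x" "AE x in M. 0 \<le> q x" using pq by auto
      hence "AE x in M. 0 \<le> p x / 2 + q x / 2" by eventually_elim simp
      moreover have "(\<lambda>x. p x / 2 + q x / 2) = (\<lambda>x. (1/2) * p x + (1/2) * q x)" by simp
      ultimately show ?thesis using graph_lin[OF g, of "1/2" "1/2"] by auto
    qed
    show "?w n \<in> ?S" for n
      using res_graph[OF _ uL, of "1 / real (Suc n)"] res_nonneg[OF _ uL pos, of "1 / real (Suc n)"] by auto
    show "E.N (?w n) \<le> E.N u" for n by (rule res_form_diff_le(2)[OF _ u]) simp
    have "filterlim (\<lambda>n. 1 / real (Suc n)) (at_right 0) sequentially"
      unfolding filterlim_at using LIMSEQ_inverse_real_of_nat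
      by (auto simp: inverse_eq_divide)
    from filterlim_compose[OF res_tendsto[OF uL] this]
    show "l2_tendsto M ?w u" .
  qed (rule uL, rule that)
  hence "\<forall>n. \<exists>w. operator_graph D (v n) w" "\<And>n. AE x in M. 0 \<le> v n x"
    and l: "(\<lambda>n. E1d (v n) u) \<longlonglongrightarrow> 0" by auto
  moreover from this(1) obtain w where "\<And>n. operator_graph D (v n) (w n)" by metis
  ultimately show thesis using that by blast
qed

end

section \<open>The semigroup on square-integrable functions\<close>

lemma l2n_nonneg [simp]: "0 \<le> l2n M f"
  by (simp add: l2n_def)

lemma l2n_triangle3:
  assumes "a \<in> L2 M" "b \<in> L2 M" "c \<in> L2 M" "d \<in> L2 M"
  shows "l2d M a d \<le> l2d M a b + l2d M b c + l2d M c d"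
  using L2.N_diff_triangle[OF assms(1,2,4)] L2.N_diff_triangle[OF assms(2,3,4)] by linarith

lemma l2n_diff_cong_AE:
  assumes "a \<in> borel_measurable M" "a' \<in> borel_measurable M" "b \<in> borel_measurable M" "b' \<in> borel_measurable M"
    and "AE x in M. a x = a' x" "AE x in M. b x = b' x"
  shows "l2d M a b = l2d M a' b'"
  by (rule l2n_cong_AE) (use assms in auto)

text \<open>The pattern for statements known on a dense set: a fixed approximation error plus a term
  that tends to 0.\<close>

lemma tendsto_zero_of_approx:
  fixes a :: "'b \<Rightarrow> real"
  assumes "\<And>x. 0 \<le> a x" and "\<And>e. 0 < e \<Longrightarrow> \<exists>b. (b \<longlongrightarrow> 0) F \<and> (\<forall>\<^sub>F x in F. a x \<le> e + b x)"
  shows "(a \<longlongrightarrow> 0) F"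
proof (rule tendstoI)
  fix e :: real assume e: "0 < e"
  then obtain b where b: "(b \<longlongrightarrow> 0) F" "\<forall>\<^sub>F x in F. a x \<le> e/2 + b x" using assms(2)[of "e/2"] by auto
  have "\<forall>\<^sub>F x in F. b x < e/2" using order_tendstoD(2)[OF b(1), of "e/2"] e by simp
  with b(2) show "\<forall>\<^sub>F x in F. dist (a x) 0 < e"
    by eventually_elim (use assms(1) in \<open>simp add: field_simps\<close>)
qed

lemma nonexp_funpow:
  assumes A: "\<And>f. f \<in> L2 M \<Longrightarrow> A f \<in> L2 M"
    and An: "\<And>f g. f \<in> L2 M \<Longrightarrow> g \<in> L2 M \<Longrightarrow> l2d M (A f) (A g) \<le> l2d M f g"
  shows "f \<in> L2 M \<Longrightarrow> (A ^^ k) f \<in> L2 M"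
    and "f \<in> L2 M \<Longrightarrow> g \<in> L2 M \<Longrightarrow> l2d M ((A ^^ k) f) ((A ^^ k) g) \<le> l2d M f g"
proof -
  show *: "f \<in> L2 M \<Longrightarrow> (A ^^ k) f \<in> L2 M" for f k by (induction k) (auto simp: A)
  show "f \<in> L2 M \<Longrightarrow> g \<in> L2 M \<Longrightarrow> l2d M ((A ^^ k) f) ((A ^^ k) g) \<le> l2d M f g"
  proof (induction k)
    case (Suc k)
    thus ?case using An[OF *[of f k] *[of g k]] by simp
  qed simp
qed

text \<open>Chernoff's telescoping estimate. Commutation moves the difference of \<open>A\<close>
  and \<open>B\<close> to the innermost place, so each of the \<open>k\<close> steps contributes the
  same error; nonexpansiveness does the work of linearity.\<close>

lemma commuting_powers_compare:
  assumes A: "\<And>f. f \<in> L2 M \<Longrightarrow> A f \<in> L2 M"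
    and An: "\<And>f g. f \<in> L2 M \<Longrightarrow> g \<in> L2 M \<Longrightarrow> l2d M (A f) (A g) \<le> l2d M f g"
    and B: "\<And>f. f \<in> L2 M \<Longrightarrow> B f \<in> L2 M"
    and Bn: "\<And>f g. f \<in> L2 M \<Longrightarrow> g \<in> L2 M \<Longrightarrow> l2d M (B f) (B g) \<le> l2d M f g"
    and com: "\<And>f. f \<in> L2 M \<Longrightarrow> AE x in M. A (B f) x = B (A f) x"
  shows "f \<in> L2 M \<Longrightarrow> l2d M ((A ^^ k) f) ((B ^^ k) f) \<le> real k * l2d M (A f) (B f)"
proof (induction k arbitrary: f)
  case 0
  thus ?case by (simp add: l2n_def sqnorm2_def)
next
  case (Suc k)
  note f = Suc.prems
  note pA = nonexp_funpow[of M A, OF A An] and pB = nonexp_funpow[of M B, OF B Bn]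
  have "l2d M ((A ^^ Suc k) f) ((B ^^ Suc k) f)
      = l2d M ((A ^^ k) (A f)) ((B ^^ k) (B f))"
    by (simp add: funpow_swap1)
  also have "\<dots> \<le> l2d M ((A ^^ k) (A f)) ((A ^^ k) (B f)) + l2d M ((A ^^ k) (B f)) ((B ^^ k) (B f))"
    by (intro L2.N_diff_triangle pA(1) pB(1) A B f)
  finally have 1: "l2d M ((A ^^ Suc k) f) ((B ^^ Suc k) f) \<le> l2d M ((A ^^ k) (A f)) ((A ^^ k) (B f))
      + l2d M ((A ^^ k) (B f)) ((B ^^ k) (B f))" .
  have 2: "l2d M ((A ^^ k) (A f)) ((A ^^ k) (B f)) \<le> l2d M (A f) (B f)"
    by (intro pA(2) A B f)
  have "l2d M ((A ^^ k) (B f)) ((B ^^ k) (B f)) \<le> real k * l2d M (A (B f)) (B (B f))"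
    by (intro Suc.IH B f)
  also have "l2d M (A (B f)) (B (B f)) = l2d M (B (A f)) (B (B f))"
    by (intro l2n_diff_cong_AE L2_measurable[of _ M] A B f com) simp
  also have "real k * \<dots> \<le> real k * l2d M (A f) (B f)"
    by (intro mult_left_mono Bn A B f) simp
  finally have 3: "l2d M ((A ^^ k) (B f)) ((B ^^ k) (B f)) \<le> real k * l2d M (A f) (B f)" .
  have e: "real (Suc k) * a = a + real k * a" for a by (simp add: algebra_simps)
  from 1 2 3 show ?case unfolding e by linarith
qed

lemma l2n_geometric_Cauchy:
  assumes u: "\<And>n::nat. u n \<in> L2 M" and step: "\<And>n. l2d M (u n) (u (Suc n)) \<le> K * (1/2)^n"
    and mn: "m \<le> n"
  shows "l2d M (u m) (u n) \<le> 2 * K * (1/2)^m"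
proof -
  \<comment> \<open>The factor \<open>1 - (1/2)^k\<close> is the exact partial geometric sum; with
    it the induction closes.\<close>
  have "l2d M (u m) (u (m + k)) \<le> 2 * K * (1/2)^m * (1 - (1/2)^k)" for k
  proof (induction k)
    case 0
    thus ?case by (simp add: l2n_def sqnorm2_def)
  next
    case (Suc k)
    have "l2d M (u m) (u (m + Suc k))
        \<le> l2d M (u m) (u (m + k)) + l2d M (u (m + k)) (u (Suc (m + k)))"
      using L2.N_diff_triangle[OF u[of m] u[of "m+k"] u[of "Suc (m+k)"]] by simp
    also have "\<dots> \<le> 2 * K * (1/2)^m * (1 - (1/2)^k) + K * (1/2)^(m+k)"
      by (intro add_mono Suc step)
    also have "\<dots> = 2 * K * (1/2)^m * (1 - (1/2)^Suc k)"
      by (simp add: power_add algebra_simps)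
    finally show ?case .
  qed
  from this[of "n - m"] mn have le: "l2d M (u m) (u n) \<le> 2 * K * (1/2)^m * (1 - (1/2)^(n-m))" by simp
  have "0 \<le> K" using order_trans[OF l2n_nonneg step[of 0]] by simp
  hence "2 * K * (1/2)^m * (1 - (1/2)^(n-m)) \<le> 2 * K * (1/2)^m * 1"
    by (intro mult_left_mono) auto
  with le show ?thesis by simp
qed

section \<open>The Euler scheme and its convergence\<close>

context cform
begin

lemma resn:
  assumes h: "0 < h"
  shows "f \<in> L2 M \<Longrightarrow> (J h ^^ k) f \<in> L2 M"
    and "f \<in> L2 M \<Longrightarrow> g \<in> L2 M \<Longrightarrow>
      l2d M ((J h ^^ k) f) ((J h ^^ k) g) \<le> l2d M f g"
  using nonexp_funpow[of "M" "J h", OF res_L2[OF h] res_nonexp[OF h]] by blast+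

lemma resn_graph:
  "0 < h \<Longrightarrow> operator_graph D u w \<Longrightarrow> operator_graph D ((J h ^^ k) u) ((J h ^^ k) w)"
  by (induction k) (auto intro: res_res_graph)

lemma graph_L2: "operator_graph D u w \<Longrightarrow> u \<in> L2 M" "operator_graph D u w \<Longrightarrow> w \<in> L2 M"
  by (auto simp: operator_graph_def fdom_L2)

lemma graph_res_step:
  assumes h: "0 < h" and g: "operator_graph D u w"
  shows "l2d M (J h u) u \<le> h * l2n M w"
proof -
  note u = graph_L2(1)[OF g] and w = graph_L2(2)[OF g]
  have "l2d M (J h u) u = l2n M (\<lambda>x. - h * J h w x)"
    by (rule l2n_cong_AE)
      (use graph_res[OF h g] in \<open>auto intro!: L2_measurable[of _ "M"] L2.mem res_L2 h u w\<close>)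
  also have "\<dots> = h * l2n M (J h w)" using h L2.N_scale[OF res_L2[OF h w], of "-h"] by simp
  also have "\<dots> \<le> h * l2n M w" using h res_contraction[OF h w] by simp
  finally show ?thesis .
qed

lemma resn_displacement:
  assumes h: "0 < h" and f: "f \<in> L2 M"
  shows "l2d M ((J h ^^ k) f) f \<le> real k * l2d M (J h f) f"
proof -
  have "l2d M ((J h ^^ k) f) (((\<lambda>f. f) ^^ k) f) \<le> real k * l2d M (J h f) f"
    by (rule commuting_powers_compare[of _ "J h" "\<lambda>f. f"]) (auto intro: res_L2 res_nonexp h f)
  moreover have "((\<lambda>f. f) ^^ k) f = f" by (induction k) auto
  ultimately show ?thesis by simp
qed

lemma resn_graph_displacement:
  assumes h: "0 < h" and g: "operator_graph D u w"
  shows "l2d M ((J h ^^ k) u) u \<le> real k * h * l2n M w"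
proof -
  have "l2d M ((J h ^^ k) u) u \<le> real k * l2d M (J h u) u"
    by (rule resn_displacement[OF h graph_L2(1)[OF g]])
  also have "\<dots> \<le> real k * (h * l2n M w)"
    by (intro mult_left_mono graph_res_step[OF h g]) simp
  finally show ?thesis by simp
qed

text \<open>Expanding both sides with \<open>graph_res\<close> down to \<open>z = H (H u)\<close>,
  the terms of order 0 and 1 in \<open>h\<close> cancel. What remains is bounded by
  \<open>h\<^sup>2\<close> plus three times \<open>(h/2)\<^sup>2\<close>, all times the norm of
  \<open>z\<close>.\<close>

lemma res_halving:
  assumes h: "0 < h" and g1: "operator_graph D u w" and g2: "operator_graph D w z"
  shows "l2d M (J h u) (J (h/2) (J (h/2) u)) \<le> 2 * h\<^sup>2 * l2n M z"
proof -
  define k where "k = h / 2"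
  have k: "0 < k" "h = 2 * k" using h by (auto simp: k_def)
  note u = graph_L2(1)[OF g1] and w = graph_L2(2)[OF g1] and z = graph_L2(2)[OF g2]
  have ed: "AE x in M. J h u x - J k (J k u) x
      = h\<^sup>2 * J h z x - (2 * k\<^sup>2 * J k z x + k\<^sup>2 * J k (J k z) x)"
    using graph_res[OF h g1] graph_res[OF h g2] graph_res[OF k(1) g1] graph_res[OF k(1) g2]
      graph_res[OF k(1) res_res_graph[OF k(1) g1]] graph_res[OF k(1) res_res_graph[OF k(1) g2]]
  proof eventually_elim
    case (elim x)
    show ?case by (simp only: elim) (simp add: k(2) power2_eq_square algebra_simps)
  qed
  note Jz = res_L2[OF h z] res_L2[OF k(1) z] res_L2[OF k(1) res_L2[OF k(1) z]]
  have "l2d M (J h u) (J k (J k u))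
      = l2n M (\<lambda>x. h\<^sup>2 * J h z x - (2 * k\<^sup>2 * J k z x + k\<^sup>2 * J k (J k z) x))"
    by (rule l2n_cong_AE[OF _ _ ed]; rule L2_measurable; intro L2.mem res_L2 h k u z)
  also have "\<dots> \<le> l2n M (\<lambda>x. h\<^sup>2 * J h z x) + l2n M (\<lambda>x. 2 * k\<^sup>2 * J k z x + k\<^sup>2 * J k (J k z) x)"
    by (intro L2.N_triangle_diff L2.mem Jz)
  also have "\<dots> \<le> l2n M (\<lambda>x. h\<^sup>2 * J h z x) + (l2n M (\<lambda>x. 2 * k\<^sup>2 * J k z x) + l2n M (\<lambda>x. k\<^sup>2 * J k (J k z) x))"
    by (intro add_left_mono L2.N_triangle L2.mem Jz)
  also have "\<dots> = h\<^sup>2 * l2n M (J h z) + (2 * k\<^sup>2 * l2n M (J k z) + k\<^sup>2 * l2n M (J k (J k z)))"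
    unfolding L2.N_scale[OF Jz(1)] L2.N_scale[OF Jz(2)] L2.N_scale[OF Jz(3)] by simp
  also have "\<dots> \<le> h\<^sup>2 * l2n M z + (2 * k\<^sup>2 * l2n M z + k\<^sup>2 * l2n M z)"
    using res_contraction[OF h z] res_contraction[OF k(1) z] res_contraction[OF k(1) Jz(2)]
    by (intro add_mono mult_left_mono) auto
  also have "\<dots> \<le> 2 * h\<^sup>2 * l2n M z"
    using k by (simp add: power2_eq_square algebra_simps)
  finally show ?thesis by (simp add: k_def)
qed

text \<open>Two applications of \<open>J s\<close> lead into the domain of \<open>H\<^sup>2\<close>,
  where halving the step produces only a second-order error.\<close>

lemma dom_H2_dense:
  assumes f: "f \<in> L2 M" and e: "0 < e"
  obtains u w z where "operator_graph D u w" "operator_graph D w z" "l2d M f u < e"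
proof -
  have "\<forall>\<^sub>F s in at_right 0. l2d M (J s f) f < e / 2"
    using order_tendstoD(2)[OF res_tendsto[OF f], of "e/2"] e by simp
  moreover have "\<forall>\<^sub>F s in at_right (0::real). 0 < s" by (simp add: eventually_at_right_less)
  ultimately have "\<forall>\<^sub>F s in at_right 0. 0 < s \<and> l2d M (J s f) f < e / 2"
    by eventually_elim simp
  then obtain s where s: "0 < s" "l2d M (J s f) f < e / 2"
    using eventually_happens[of _ "at_right (0::real)"] trivial_limit_at_right_real by blast
  let ?g = "J s f" and ?w0 = "\<lambda>x. (f x - J s f x) / s"
  have g: "operator_graph D ?g ?w0" by (rule res_graph[OF s(1) f])
  have 1: "operator_graph D (J s ?g) (J s ?w0)" by (rule res_res_graph[OF s(1) g])
  have 2: "operator_graph D (J s ?w0) (\<lambda>x. (?w0 x - J s ?w0 x) / s)"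
    by (rule res_graph[OF s(1) graph_L2(2)[OF g]])
  note L = f res_L2[OF s(1) f] res_L2[OF s(1) res_L2[OF s(1) f]]
  have "l2d M f (J s ?g) \<le> l2d M f ?g + l2d M ?g (J s ?g)"
    by (rule L2.N_diff_triangle[OF L])
  also have "\<dots> \<le> l2d M f ?g + l2d M f ?g"
    using res_nonexp[OF s(1) L(1,2)] by simp
  also have "\<dots> < e" using s(2) L2.N_diff_commute[OF L(1,2)] by simp
  finally show thesis using that[OF 1 2] by simp
qed

text \<open>\<open>e\<^sup>-\<^sup>t\<^sup>H\<close> is the limit of the implicit Euler scheme; dyadic steps make successive stages comparable.\<close>

definition steps :: "nat \<Rightarrow> real \<Rightarrow> nat" where "steps n t = nat \<lfloor>2 ^ n * t\<rfloor>"

definition euler :: "nat \<Rightarrow> real \<Rightarrow> ('a \<Rightarrow> real) \<Rightarrow> 'a \<Rightarrow> real" where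
  "euler n t f = (J ((1/2) ^ n) ^^ steps n t) f"

lemma steps_le: "0 \<le> t \<Longrightarrow> real (steps n t) * (1/2)^n \<le> t"
proof -
  assume t: "0 \<le> t"
  hence "real (steps n t) \<le> 2^n * t" by (simp add: steps_def)
  hence "real (steps n t) * (1/2)^n \<le> (2^n * t) * (1/2)^n" by (intro mult_right_mono) auto
  thus ?thesis by (simp add: power_one_over)
qed

lemma steps_ge: "0 \<le> t \<Longrightarrow> t - (1/2)^n \<le> real (steps n t) * (1/2)^n"
proof -
  assume t: "0 \<le> t"
  hence "2^n * t - 1 \<le> real (steps n t)" unfolding steps_def by linarith
  hence "(2^n * t - 1) * (1/2)^n \<le> real (steps n t) * (1/2)^n" by (intro mult_right_mono) auto
  thus ?thesis by (simp add: power_one_over diff_divide_distrib)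
qed

lemma steps_Suc: "0 \<le> t \<Longrightarrow> steps (Suc n) t = 2 * steps n t \<or> steps (Suc n) t = Suc (2 * steps n t)"
proof -
  assume t: "0 \<le> t"
  hence "0 \<le> 2^n * t" by simp
  moreover have "2 ^ Suc n * t = 2 * (2^n * t)" by simp
  ultimately show ?thesis unfolding steps_def by linarith
qed

lemma steps_add: "0 \<le> s \<Longrightarrow> 0 \<le> t \<Longrightarrow>
  steps n (s + t) = steps n s + steps n t \<or> steps n (s + t) = Suc (steps n s + steps n t)"
proof -
  assume "0 \<le> s" "0 \<le> t"
  hence "0 \<le> 2^n * s" "0 \<le> 2^n * t" by auto
  moreover have "2 ^ n * (s + t) = 2^n * s + 2^n * t" by (simp add: algebra_simps)
  ultimately show ?thesis unfolding steps_def by linarith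
qed

lemma half_pos: "0 < (1/2::real)^n" by simp

lemma euler_L2: "f \<in> L2 M \<Longrightarrow> euler n t f \<in> L2 M"
  unfolding euler_def by (rule resn(1)[OF half_pos])

lemma euler_nonexp:
  "f \<in> L2 M \<Longrightarrow> g \<in> L2 M \<Longrightarrow>
    l2d M (euler n t f) (euler n t g) \<le> l2d M f g"
  unfolding euler_def by (rule resn(2)[OF half_pos])

lemma resn_Suc_close:
  assumes h: "0 < h" and f: "f \<in> L2 M"
  shows "l2d M ((J h ^^ Suc k) f) ((J h ^^ k) f) \<le> l2d M (J h f) f"
proof -
  have "(J h ^^ Suc k) f = (J h ^^ k) (J h f)" by (simp add: funpow_swap1)
  thus ?thesis using resn(2)[OF h res_L2[OF h f] f, of k] by simp
qed

text \<open>One halving costs \<open>2 * h\<^sup>2\<close> times the norm of \<open>z\<close>, and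
  there are at most \<open>t / h\<close> of them. Rounding may add one step of length
  \<open>h / 2\<close>, whose cost is covered by the term with \<open>w\<close>.\<close>

lemma euler_step:
  assumes t: "0 \<le> t" and g1: "operator_graph D u w" and g2: "operator_graph D w z"
  shows "l2d M (euler n t u) (euler (Suc n) t u)
    \<le> (2 * t * l2n M z + l2n M w) * (1/2)^n"
proof -
  define h where "h = (1/2::real)^n"
  define k where "k = steps n t"
  have h: "0 < h" and h2: "0 < h / 2" by (simp_all add: h_def)
  note u = graph_L2(1)[OF g1]
  have hS: "(1/2::real)^Suc n = h / 2" by (simp add: h_def)
  have e1: "euler n t u = (J h ^^ k) u" by (simp add: euler_def h_def k_def)
  let ?B = "\<lambda>f. J (h/2) (J (h/2) f)"
  have B: "(?B ^^ k) u = (J (h/2) ^^ (2 * k)) u"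
  proof -
    have "?B = J (h/2) ^^ 2" by (simp add: numeral_2_eq_2 o_def)
    thus ?thesis by (simp add: funpow_mult)
  qed
  have "l2d M ((J h ^^ k) u) ((?B ^^ k) u) \<le> real k * l2d M (J h u) (?B u)"
  proof (rule commuting_powers_compare[of M "J h" ?B])
    fix f assume f: "f \<in> L2 M"
    show "J h f \<in> L2 M" "?B f \<in> L2 M" by (intro res_L2 h h2 f)+
    show "l2d M (J h f) (J h g) \<le> l2d M f g" if "g \<in> L2 M" for g
      by (rule res_nonexp[OF h f that])
    show "l2d M (?B f) (?B g) \<le> l2d M f g" if g: "g \<in> L2 M" for g
      using res_nonexp[OF h2 res_L2[OF h2 f] res_L2[OF h2 g]] res_nonexp[OF h2 f g] by linarith
    have "AE x in M. J h (?B f) x = J (h/2) (J h (J (h/2) f)) x"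
      by (rule res_commute[OF h h2 res_L2[OF h2 f]])
    moreover have "AE x in M. J (h/2) (J h (J (h/2) f)) x = ?B (J h f) x"
      by (rule res_cong_AE[OF h2 _ _ res_commute[OF h h2 f]])
        (intro res_L2 h h2 f L2_measurable)+
    ultimately show "AE x in M. J h (?B f) x = ?B (J h f) x" by eventually_elim simp
  qed (rule u)
  also have "\<dots> \<le> real k * (2 * h\<^sup>2 * l2n M z)"
    by (intro mult_left_mono res_halving[OF h g1 g2]) simp
  also have "\<dots> = (real k * h) * (2 * h * l2n M z)" by (simp add: power2_eq_square)
  also have "\<dots> \<le> t * (2 * h * l2n M z)"
    using steps_le[OF t, of n] h by (intro mult_right_mono) (auto simp: k_def h_def)
  finally have a: "l2d M ((J h ^^ k) u) ((J (h/2) ^^ (2 * k)) u) \<le> t * (2 * h * l2n M z)"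
    unfolding B .
  have b: "l2d M ((J (h/2) ^^ (2 * k)) u) (euler (Suc n) t u) \<le> h * l2n M w"
  proof (cases "steps (Suc n) t = 2 * k")
    case True
    hence "euler (Suc n) t u = (J (h/2) ^^ (2 * k)) u" by (simp only: euler_def hS)
    thus ?thesis using h by (simp add: l2n_def sqnorm2_def)
  next
    case False
    with steps_Suc[OF t, of n] have "steps (Suc n) t = Suc (2 * k)" by (simp add: k_def)
    hence e2: "euler (Suc n) t u = (J (h/2) ^^ Suc (2 * k)) u" by (simp only: euler_def hS)
    have "l2d M ((J (h/2) ^^ Suc (2 * k)) u) ((J (h/2) ^^ (2 * k)) u) \<le> h / 2 * l2n M w"
      using resn_Suc_close[OF h2 u] graph_res_step[OF h2 g1] by (rule order_trans)
    also have "\<dots> \<le> h * l2n M w" using h by (intro mult_right_mono) auto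
    finally show ?thesis
      unfolding e2 L2.N_diff_commute[OF resn(1)[OF h2 u, of "2 * k"] resn(1)[OF h2 u, of "Suc (2 * k)"]] .
  qed
  have "l2d M (euler n t u) (euler (Suc n) t u) \<le> t * (2 * h * l2n M z) + h * l2n M w"
    using L2.N_diff_triangle[OF euler_L2[OF u, of n t] resn(1)[OF h2 u, of "2 * k"] euler_L2[OF u, of "Suc n" t]] a b
    unfolding e1 by linarith
  thus ?thesis by (simp add: h_def algebra_simps)
qed

lemma euler_converges:
  assumes t: "0 \<le> t" and f: "f \<in> L2 M"
  shows "\<exists>g\<in>L2 M. l2_tendsto M (\<lambda>n. euler n t f) g"
proof -
  have "\<exists>N. \<forall>m\<ge>N. \<forall>n\<ge>N. l2d M (euler m t f) (euler n t f) < e" if e: "0 < e" for e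
  proof -
    obtain u w z where g: "operator_graph D u w" "operator_graph D w z" "l2d M f u < e / 3"
      using dom_H2_dense[OF f, of "e/3"] e by auto
    note u = graph_L2(1)[OF g(1)]
    define K where "K = 2 * t * l2n M z + l2n M w"
    have K: "0 \<le> K" using t by (simp add: K_def)
    obtain N where N: "(1/2)^N < e / (3 * (2 * K + 1))"
      using real_arch_pow_inv[of "e / (3 * (2 * K + 1))" "1/2"] e K by auto
    have N': "2 * K * (1/2)^N < e / 3"
    proof -
      have "2 * K * (1/2)^N \<le> (2 * K + 1) * (1/2)^N" by (intro mult_right_mono) auto
      also have "\<dots> < (2 * K + 1) * (e / (3 * (2 * K + 1)))" using N K by (intro mult_strict_left_mono) auto
      also have "\<dots> = e / 3" using K by (simp add: field_simps)
      finally show ?thesis .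
    qed
    have "l2d M (euler m t u) (euler n t u) \<le> 2 * K * (1/2)^m" if "m \<le> n" for m n
      using that by (intro l2n_geometric_Cauchy euler_L2 u) (auto simp: K_def intro: euler_step[OF t g(1,2)])
    moreover have "2 * K * (1/2)^m \<le> 2 * K * (1/2::real)^N" if "N \<le> m" for m
      using K that by (intro mult_left_mono power_decreasing) auto
    ultimately have ord: "l2d M (euler m t u) (euler n t u) < e / 3" if "N \<le> m" "m \<le> n" for m n
      using that N' by (meson le_less_trans order_trans)
    have ord2: "l2d M (euler m t u) (euler n t u) < e / 3" if mn: "N \<le> m" "N \<le> n" for m n
    proof (cases "m \<le> n")
      case True
      thus ?thesis using ord mn by blast
    next
      case False
      hence "l2d M (euler n t u) (euler m t u) < e / 3" using ord[of n m] mn by simp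
      thus ?thesis using L2.N_diff_commute[OF euler_L2[OF u] euler_L2[OF u]] by simp
    qed
    have "l2d M (euler m t f) (euler n t f) < e" if mn: "N \<le> m" "N \<le> n" for m n
      using l2n_triangle3[OF euler_L2[OF f, of m t] euler_L2[OF u, of m t] euler_L2[OF u, of n t] euler_L2[OF f, of n t]]
        euler_nonexp[OF f u, of m t] euler_nonexp[OF u f, of n t] L2.N_diff_commute[OF f u] g(3) ord2[OF mn]
      by linarith
    thus ?thesis by blast
  qed
  thus ?thesis by (rule L2_complete[of "\<lambda>n. euler n t f" M, OF euler_L2[OF f]]) (assumption, rule bexI)
qed

definition semi :: "real \<Rightarrow> ('a \<Rightarrow> real) \<Rightarrow> 'a \<Rightarrow> real" where
  "semi t f = (SOME g. g \<in> L2 M \<and> (\<lambda>n. l2d M (euler n t f) g) \<longlonglongrightarrow> 0)"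

lemma semi_props:
  assumes t: "0 \<le> t" and f: "f \<in> L2 M"
  shows semi_L2: "semi t f \<in> L2 M"
    and euler_tendsto: "l2_tendsto M (\<lambda>n. euler n t f) (semi t f)"
proof -
  have "\<exists>g. g \<in> L2 M \<and> l2_tendsto M (\<lambda>n. euler n t f) g"
    using euler_converges[OF assms] by blast
  from someI_ex[OF this]
  show "semi t f \<in> L2 M" "l2_tendsto M (\<lambda>n. euler n t f) (semi t f)"
    unfolding semi_def by blast+
qed

end

lemma le_of_le_add_null:
  fixes a b :: real
  assumes "\<And>n::nat. a \<le> b + x n" "x \<longlonglongrightarrow> 0"
  shows "a \<le> b"
proof -
  have "(\<lambda>n. b + x n) \<longlonglongrightarrow> b + 0" by (intro tendsto_add tendsto_const assms)
  thus ?thesis using assms(1) by (intro LIMSEQ_le_const[of "\<lambda>n. b + x n"]) auto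
qed

lemma l2n_add3:
  assumes "a \<in> L2 M" "b \<in> L2 M" "c \<in> L2 M"
  shows "l2n M (\<lambda>x. a x + b x + c x) \<le> l2n M a + l2n M b + l2n M c"
  using L2.N_triangle[OF L2.add_mem[OF assms(1,2)] assms(3)] L2.N_triangle[OF assms(1,2)] by linarith

section \<open>The limit is a semigroup with generator -H\<close>

context cform
begin

lemma resn_lin:
  assumes h: "0 < h" and f: "f \<in> L2 M" and g: "g \<in> L2 M"
  shows "AE x in M. (J h ^^ k) (\<lambda>x. a * f x + b * g x) x = a * (J h ^^ k) f x + b * (J h ^^ k) g x"
proof (induction k)
  case (Suc k)
  note fk = resn(1)[OF h f, of k] and gk = resn(1)[OF h g, of k] and lk = resn(1)[OF h L2_lin[OF f g], of k]
  have "AE x in M. J h ((J h ^^ k) (\<lambda>x. a * f x + b * g x)) x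
      = J h (\<lambda>x. a * (J h ^^ k) f x + b * (J h ^^ k) g x) x"
    by (rule res_cong_AE[OF h lk L2_measurable[OF L2_lin[OF fk gk]] Suc.IH])
  with res_lin[OF h fk gk, of a b] show ?case by eventually_elim simp
qed simp

lemma resn_sym:
  assumes h: "0 < h" and f: "f \<in> L2 M" and g: "g \<in> L2 M"
  shows "ip M ((J h ^^ k) f) g = ip M f ((J h ^^ k) g)"
  using f g
proof (induction k arbitrary: g)
  case (Suc k)
  have "ip M ((J h ^^ Suc k) f) g = ip M ((J h ^^ k) f) (J h g)"
    using res_sym[OF h resn(1)[OF h Suc.prems(1)] Suc.prems(2)] by simp
  also have "\<dots> = ip M f ((J h ^^ k) (J h g))" by (intro Suc.IH res_L2 h Suc.prems)
  finally show ?case by (simp add: funpow_swap1)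
qed simp

lemma half_at_right: "filterlim (\<lambda>n. (1/2::real) ^ n) (at_right 0) sequentially"
  unfolding filterlim_at by (auto intro!: LIMSEQ_realpow_zero)

lemma semi_nonexp:
  assumes t: "0 \<le> t" and f: "f \<in> L2 M" and g: "g \<in> L2 M"
  shows "l2d M (semi t f) (semi t g) \<le> l2d M f g"
proof (rule le_of_le_add_null)
  let ?x = "\<lambda>n. l2d M (euler n t f) (semi t f) + l2d M (euler n t g) (semi t g)"
  note sf = semi_L2[OF t f] and sg = semi_L2[OF t g]
  show "l2d M (semi t f) (semi t g) \<le> l2d M f g + ?x n" for n
    using l2n_triangle3[OF sf euler_L2[OF f, of n t] euler_L2[OF g, of n t] sg]
      euler_nonexp[OF f g, of n t] L2.N_diff_commute[OF sf euler_L2[OF f, of n t]] by linarith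
  show "?x \<longlonglongrightarrow> 0"
    using tendsto_add[OF euler_tendsto[OF t f] euler_tendsto[OF t g]] by simp
qed

lemma euler_lin_tendsto:
  assumes t: "0 \<le> t" and f: "f \<in> L2 M" and g: "g \<in> L2 M"
  shows "(\<lambda>n. l2n M (\<lambda>x. euler n t (\<lambda>y. a * f y + b * g y) x - (a * semi t f x + b * semi t g x))) \<longlonglongrightarrow> 0"
proof (rule Lim_null_comparison)
  let ?x = "\<lambda>n. \<bar>a\<bar> * l2d M (euler n t f) (semi t f) + \<bar>b\<bar> * l2d M (euler n t g) (semi t g)"
  note sf = semi_L2[OF t f] and sg = semi_L2[OF t g]
  have "l2n M (\<lambda>x. euler n t (\<lambda>y. a * f y + b * g y) x - (a * semi t f x + b * semi t g x)) \<le> ?x n" for n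
  proof -
    note ef = euler_L2[OF f, of n t] and eg = euler_L2[OF g, of n t] and el = euler_L2[OF L2_lin[OF f g], of n t]
    have "l2n M (\<lambda>x. euler n t (\<lambda>y. a * f y + b * g y) x - (a * semi t f x + b * semi t g x))
       = l2n M (\<lambda>x. a * (euler n t f x - semi t f x) + b * (euler n t g x - semi t g x))"
    proof (rule l2n_cong_AE)
      show "AE x in M. euler n t (\<lambda>y. a * f y + b * g y) x - (a * semi t f x + b * semi t g x)
          = a * (euler n t f x - semi t f x) + b * (euler n t g x - semi t g x)"
        using resn_lin[OF half_pos[of n] f g, of "steps n t" a b] unfolding euler_def[symmetric]
        by eventually_elim (simp add: algebra_simps)
    qed (rule L2_measurable; intro L2.mem L2_lin el ef eg sf sg)+
    also have "\<dots> \<le> l2n M (\<lambda>x. a * (euler n t f x - semi t f x)) + l2n M (\<lambda>x. b * (euler n t g x - semi t g x))"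
      by (intro L2.N_triangle L2.mem ef eg sf sg)
    also have "\<dots> = ?x n"
      by (simp only: L2.N_scale[OF L2.diff_mem[OF ef sf]] L2.N_scale[OF L2.diff_mem[OF eg sg]])
    finally show ?thesis .
  qed
  thus "\<forall>\<^sub>F n in sequentially. norm (l2n M (\<lambda>x. euler n t (\<lambda>y. a * f y + b * g y) x - (a * semi t f x + b * semi t g x))) \<le> ?x n"
    by simp
  show "?x \<longlonglongrightarrow> 0"
    using tendsto_add[OF tendsto_mult_right_zero[OF euler_tendsto[OF t f], of "\<bar>a\<bar>"]
      tendsto_mult_right_zero[OF euler_tendsto[OF t g], of "\<bar>b\<bar>"]] by simp
qed

lemma semi_lin:
  assumes t: "0 \<le> t" and f: "f \<in> L2 M" and g: "g \<in> L2 M"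
  shows "AE x in M. semi t (\<lambda>y. a * f y + b * g y) x = a * semi t f x + b * semi t g x"
  by (rule L2_limit_unique[OF euler_L2 _ _ euler_tendsto euler_lin_tendsto])
    (intro L2_lin f g t semi_L2)+

lemma semi_0:
  assumes f: "f \<in> L2 M"
  shows "AE x in M. semi 0 f x = f x"
proof (rule L2_limit_unique[OF euler_L2 _ _ euler_tendsto])
  have "euler n 0 f = f" for n by (simp add: euler_def steps_def)
  thus "l2_tendsto M (\<lambda>n. euler n 0 f) f"
    by (simp add: l2n_def sqnorm2_def)
qed (use f in \<open>auto intro: semi_L2\<close>)

text \<open>The rounded step numbers for \<open>s\<close> and \<open>t\<close> add up to the one for
  \<open>s + t\<close>, except for at most one further step. Its effect is bounded by the distance
  of \<open>J h f\<close> from \<open>f\<close>, which vanishes in the limit.\<close>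

lemma semi_add:
  assumes s: "0 \<le> s" and t: "0 \<le> t" and f: "f \<in> L2 M"
  shows "AE x in M. semi (s + t) f x = semi s (semi t f) x"
proof (rule L2_limit_unique[OF euler_L2 _ _ euler_tendsto])
  note stf = semi_L2[OF t f]
  note sstf = semi_L2[OF s stf]
  show "l2_tendsto M (\<lambda>n. euler n (s + t) f) (semi s (semi t f))"
  proof (rule Lim_null_comparison)
    let ?x = "\<lambda>n. l2d M (J ((1/2)^n) f) f + l2d M (euler n t f) (semi t f)
      + l2d M (euler n s (semi t f)) (semi s (semi t f))"
    have "l2d M (euler n (s + t) f) (semi s (semi t f)) \<le> ?x n" for n
    proof -
      let ?h = "(1/2::real)^n"
      have e: "euler n s (euler n t f) = (J ?h ^^ (steps n s + steps n t)) f"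
        by (simp add: euler_def funpow_add)
      have 1: "l2d M (euler n (s + t) f) (euler n s (euler n t f)) \<le> l2d M (J ?h f) f"
      proof (cases "steps n (s + t) = steps n s + steps n t")
        case True
        hence "euler n (s + t) f = euler n s (euler n t f)" unfolding e by (simp only: euler_def)
        thus ?thesis by (simp add: l2n_def sqnorm2_def)
      next
        case False
        with steps_add[OF s t, of n] have "steps n (s + t) = Suc (steps n s + steps n t)" by simp
        hence "euler n (s + t) f = (J ?h ^^ Suc (steps n s + steps n t)) f" by (simp only: euler_def)
        thus ?thesis unfolding e using resn_Suc_close[OF half_pos[of n] f, of "steps n s + steps n t"] by simp
      qed
      note E1 = euler_L2[OF f, of n "s+t"] and E2 = euler_L2[OF euler_L2[OF f, of n t], of n s]
        and E3 = euler_L2[OF stf, of n s]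
      show ?thesis
        using l2n_triangle3[OF E1 E2 E3 sstf] 1 euler_nonexp[OF euler_L2[OF f, of n t] stf, of n s] by linarith
    qed
    thus "\<forall>\<^sub>F n in sequentially. norm (l2d M (euler n (s + t) f) (semi s (semi t f))) \<le> ?x n"
      by simp
    show "?x \<longlonglongrightarrow> 0"
      using tendsto_add[OF tendsto_add[OF filterlim_compose[OF res_tendsto[OF f] half_at_right]
        euler_tendsto[OF t f]] euler_tendsto[OF s stf]] by simp
  qed
qed (use assms in \<open>auto intro: semi_L2\<close>)

lemma semi_sym:
  assumes t: "0 \<le> t" and f: "f \<in> L2 M" and g: "g \<in> L2 M"
  shows "ip M (semi t f) g = ip M f (semi t g)"
proof -
  have "(\<lambda>n. ip M (euler n t f) g) \<longlonglongrightarrow> ip M (semi t f) g"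
    by (rule L2.N_tendsto_B[OF euler_L2[OF f] semi_L2[OF t f] g euler_tendsto[OF t f]])
  moreover have "(\<lambda>n. ip M (euler n t g) f) \<longlonglongrightarrow> ip M (semi t g) f"
    by (rule L2.N_tendsto_B[OF euler_L2[OF g] semi_L2[OF t g] f euler_tendsto[OF t g]])
  moreover have "ip M (euler n t f) g = ip M (euler n t g) f" for n
    using resn_sym[OF half_pos[of n] f g, of "steps n t"] L2.sym[OF f euler_L2[OF g, of n t]]
    by (simp add: euler_def)
  ultimately have "ip M (semi t f) g = ip M (semi t g) f" using LIMSEQ_unique by simp
  thus ?thesis using L2.sym[OF f semi_L2[OF t g]] by simp
qed

lemma semi_graph_displacement:
  assumes t: "0 \<le> t" and g: "operator_graph D u w"
  shows "l2d M (semi t u) u \<le> t * l2n M w"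
proof (rule le_of_le_add_null[OF _ euler_tendsto[OF t graph_L2(1)[OF g]]])
  fix n
  note u = graph_L2(1)[OF g]
  note su = semi_L2[OF t u] and eu = euler_L2[OF u, of n t]
  have "l2d M (euler n t u) u \<le> real (steps n t) * (1/2)^n * l2n M w"
    unfolding euler_def by (rule resn_graph_displacement[OF half_pos g])
  also have "\<dots> \<le> t * l2n M w" by (intro mult_right_mono steps_le t) simp
  finally have "l2d M (euler n t u) u \<le> t * l2n M w" .
  thus "l2d M (semi t u) u \<le> t * l2n M w + l2d M (euler n t u) (semi t u)"
    using L2.N_diff_triangle[OF su eu u] L2.N_diff_commute[OF su eu] by linarith
qed

lemma semi_tendsto:
  assumes f: "f \<in> L2 M"
  shows "((\<lambda>t. l2d M (semi t f) f) \<longlongrightarrow> 0) (at_right 0)"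
proof (rule tendsto_zero_of_approx)
  fix e :: real assume e: "0 < e"
  obtain u w z where g: "operator_graph D u w" "operator_graph D w z" "l2d M f u < e / 2"
    using dom_H2_dense[OF f, of "e/2"] e by auto
  note u = graph_L2(1)[OF g(1)]
  have "l2d M (semi t f) f \<le> e + t * l2n M w" if t: "0 < t" for t
    using l2n_triangle3[OF semi_L2[OF _ f, of t] semi_L2[OF _ u, of t] u f] t
      semi_nonexp[OF _ f u, of t] semi_graph_displacement[OF _ g(1), of t] g(3) L2.N_diff_commute[OF f u]
    by simp
  hence "\<forall>\<^sub>F t in at_right 0. l2d M (semi t f) f \<le> e + t * l2n M w"
    by (auto simp: eventually_at_filter)
  moreover have "((\<lambda>t. t * l2n M w) \<longlongrightarrow> 0) (at_right 0)"
    by (intro tendsto_mult_left_zero tendsto_ident_at)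
  ultimately show "\<exists>b. (b \<longlongrightarrow> 0) (at_right 0) \<and> (\<forall>\<^sub>F t in at_right 0. l2d M (semi t f) f \<le> e + b t)"
    by blast
qed simp

text \<open>By \<open>graph_res\<close> the deviation from the first-order expansion is the sum of
  \<open>- h * ((J h ^^ j) w - w)\<close> over \<open>j\<close> from 1 to \<open>k\<close>, and
  \<open>d\<close> bounds each displacement.\<close>

lemma resn_second_order:
  assumes h: "0 < h" and g: "operator_graph D u w"
    and d: "\<And>j. j \<le> k \<Longrightarrow> l2d M ((J h ^^ j) w) w \<le> d"
  shows "l2n M (\<lambda>x. (J h ^^ k) u x - u x + real k * h * w x) \<le> real k * h * d"
  using d
proof (induction k)
  case 0
  thus ?case by (simp add: l2n_def sqnorm2_def)
next
  case (Suc k)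
  note u = graph_L2(1)[OF g] and w = graph_L2(2)[OF g]
  note uk = resn(1)[OF h u, of k] and wk = resn(1)[OF h w, of "Suc k"]
  let ?a = "\<lambda>x. (J h ^^ k) u x - u x + real k * h * w x"
  let ?b = "\<lambda>x. - h * ((J h ^^ Suc k) w x - w x)"
  have aL: "?a \<in> L2 M" and bL: "?b \<in> L2 M" by (intro L2.mem uk wk u w)+
  have "l2n M (\<lambda>x. (J h ^^ Suc k) u x - u x + real (Suc k) * h * w x) = l2n M (\<lambda>x. ?a x + ?b x)"
  proof (rule l2n_cong_AE)
    show "AE x in M. (J h ^^ Suc k) u x - u x + real (Suc k) * h * w x = ?a x + ?b x"
      using graph_res[OF h resn_graph[OF h g, of k]] by eventually_elim (simp add: algebra_simps)
  qed (rule L2_measurable; intro L2.mem resn(1)[OF h] u w)+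
  also have "\<dots> \<le> l2n M ?a + l2n M ?b" by (rule L2.N_triangle[OF aL bL])
  also have "l2n M ?b = h * l2d M ((J h ^^ Suc k) w) w"
    using h by (subst L2.N_scale[OF L2.diff_mem[OF wk w]]) simp
  also have "l2n M ?a + \<dots> \<le> real k * h * d + h * d"
    using h by (intro add_mono Suc.IH Suc.prems mult_left_mono) auto
  also have "\<dots> = real (Suc k) * h * d" by (simp add: algebra_simps)
  finally show ?case .
qed

text \<open>\<open>w\<close> itself need not lie in the operator domain, so its displacement is
  estimated through a substitute \<open>w'\<close> with \<open>H w' = z'\<close>; passing to
  \<open>w'\<close> and back costs twice their distance.\<close>

lemma semi_second_order:
  assumes t: "0 \<le> t" and g: "operator_graph D u w" and g': "operator_graph D w' z'"
  shows "l2n M (\<lambda>x. semi t u x - u x + t * w x)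
    \<le> t * (2 * l2d M w w' + t * l2n M z')"
proof (rule le_of_le_add_null)
  let ?x = "\<lambda>n. l2d M (euler n t u) (semi t u) + (1/2)^n * l2n M w"
  define d where "d = 2 * l2d M w w' + t * l2n M z'"
  have d0: "0 \<le> d" using t by (simp add: d_def)
  note u = graph_L2(1)[OF g] and w = graph_L2(2)[OF g] and w' = graph_L2(1)[OF g']
  note su = semi_L2[OF t u]
  show "l2n M (\<lambda>x. semi t u x - u x + t * w x) \<le> t * d + ?x n" for n
  proof -
    define h where "h = (1/2::real)^n"
    define k where "k = steps n t"
    have h: "0 < h" by (simp add: h_def)
    have kh: "real k * h \<le> t" "t - h \<le> real k * h"
      using steps_le[OF t, of n] steps_ge[OF t, of n] by (simp_all add: h_def k_def)
    note eu = euler_L2[OF u, of n t]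
    have eul: "euler n t u = (J h ^^ k) u" by (simp add: euler_def h_def k_def)
    have dj: "l2d M ((J h ^^ j) w) w \<le> d" if j: "j \<le> k" for j
    proof -
      have "real j * h \<le> t" using kh(1) j h by (meson mult_right_mono of_nat_mono less_imp_le order_trans)
      hence "real j * h * l2n M z' \<le> t * l2n M z'" by (intro mult_right_mono) auto
      thus ?thesis unfolding d_def
        using l2n_triangle3[OF resn(1)[OF h w, of j] resn(1)[OF h w', of j] w' w]
          resn(2)[OF h w w', of j] resn_graph_displacement[OF h g', of j] L2.N_diff_commute[OF w w']
        by linarith
    qed
    have "(\<lambda>x. semi t u x - u x + t * w x)
      = (\<lambda>x. (semi t u x - euler n t u x) + ((J h ^^ k) u x - u x + real k * h * w x) + (t - real k * h) * w x)"
      by (simp add: fun_eq_iff eul algebra_simps)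
    hence "l2n M (\<lambda>x. semi t u x - u x + t * w x) = l2n M (\<lambda>x. (semi t u x - euler n t u x)
        + ((J h ^^ k) u x - u x + real k * h * w x) + (t - real k * h) * w x)"
      by (rule arg_cong)
    also have "\<dots> \<le> l2d M (semi t u) (euler n t u)
        + l2n M (\<lambda>x. (J h ^^ k) u x - u x + real k * h * w x) + l2n M (\<lambda>x. (t - real k * h) * w x)"
      by (intro l2n_add3 L2.mem su eu resn(1)[OF h u] u w)
    finally have le: "l2n M (\<lambda>x. semi t u x - u x + t * w x) \<le> l2d M (semi t u) (euler n t u)
        + l2n M (\<lambda>x. (J h ^^ k) u x - u x + real k * h * w x) + l2n M (\<lambda>x. (t - real k * h) * w x)" .
    have c: "l2d M (semi t u) (euler n t u) = l2d M (euler n t u) (semi t u)"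
      by (rule L2.N_diff_commute[OF su eu])
    have c': "l2n M (\<lambda>x. (t - real k * h) * w x) = (t - real k * h) * l2n M w"
      using kh by (subst L2.N_scale[OF w]) simp
    have "(t - real k * h) * l2n M w \<le> h * l2n M w" using kh by (intro mult_right_mono) auto
    moreover have "l2n M (\<lambda>x. (J h ^^ k) u x - u x + real k * h * w x) \<le> real k * h * d"
      by (rule resn_second_order[OF h g dj])
    moreover have "real k * h * d \<le> t * d" using kh d0 by (intro mult_right_mono) auto
    ultimately show ?thesis using le unfolding c c' by (simp add: h_def)
  qed
  show "?x \<longlonglongrightarrow> 0"
    using tendsto_add[OF euler_tendsto[OF t u] tendsto_mult_left_zero[OF LIMSEQ_realpow_zero[of "1/2::real"], of "l2n M w"]]
    by simp
qed

lemma semi_generator: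
  assumes g: "operator_graph D u w"
  shows "((\<lambda>t. l2n M (\<lambda>x. (semi t u x - u x) / t + w x)) \<longlongrightarrow> 0) (at_right 0)"
proof (rule tendsto_zero_of_approx)
  note u = graph_L2(1)[OF g] and w = graph_L2(2)[OF g]
  fix e :: real assume e: "0 < e"
  obtain w' z' z'' where g': "operator_graph D w' z'" "operator_graph D z' z''" "l2d M w w' < e / 2"
    using dom_H2_dense[OF w, of "e/2"] e by auto
  have "l2n M (\<lambda>x. (semi t u x - u x) / t + w x) \<le> e + t * l2n M z'" if t: "0 < t" for t
  proof -
    note su = semi_L2[OF less_imp_le[OF t] u]
    have "(\<lambda>x. (semi t u x - u x) / t + w x) = (\<lambda>x. (1 / t) * (semi t u x - u x + t * w x))"
      using t by (simp add: fun_eq_iff field_simps)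
    hence "l2n M (\<lambda>x. (semi t u x - u x) / t + w x) = (1 / t) * l2n M (\<lambda>x. semi t u x - u x + t * w x)"
      using t L2.N_scale[of "\<lambda>x. semi t u x - u x + t * w x" M "1/t"] by (simp add: L2.mem su u w)
    also have "\<dots> \<le> (1 / t) * (t * (2 * l2d M w w' + t * l2n M z'))"
      using t by (intro mult_left_mono semi_second_order g g') auto
    also have "\<dots> = 2 * l2d M w w' + t * l2n M z'" using t by simp
    finally show ?thesis using g'(3) by simp
  qed
  hence "\<forall>\<^sub>F t in at_right 0. l2n M (\<lambda>x. (semi t u x - u x) / t + w x) \<le> e + t * l2n M z'"
    by (auto simp: eventually_at_filter)
  moreover have "((\<lambda>t. t * l2n M z') \<longlongrightarrow> 0) (at_right 0)"
    by (intro tendsto_mult_left_zero tendsto_ident_at)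
  ultimately show "\<exists>b. (b \<longlongrightarrow> 0) (at_right 0) \<and>
      (\<forall>\<^sub>F t in at_right 0. l2n M (\<lambda>x. (semi t u x - u x) / t + w x) \<le> e + b t)"
    by blast
qed simp

text \<open>This is where self-adjointness is felt. Symmetry of the semigroup places the pair
  \<open>u\<close>, \<open>w\<close> in the adjoint of \<open>H\<close>:
  \<open>ip M w v = ip M u y\<close> whenever \<open>H v = y\<close>. Taking
  \<open>v = J 1 z\<close> for arbitrary \<open>z\<close> turns this into
  \<open>J 1 (u + w) = u\<close>, that is, \<open>H u = w\<close>.\<close>

lemma semi_generator_graph:
  assumes u: "u \<in> L2 M" and w: "w \<in> L2 M"
    and lim: "((\<lambda>t. l2n M (\<lambda>x. (semi t u x - u x) / t + w x)) \<longlongrightarrow> 0) (at_right 0)"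
  shows "operator_graph D u w"
proof -
  have key: "ip M w v = ip M u y" if g: "operator_graph D v y" for v y
  proof -
    note v = graph_L2(1)[OF g] and y = graph_L2(2)[OF g]
    let ?b = "\<lambda>t. l2n M (\<lambda>x. (semi t u x - u x) / t + w x) * l2n M v
      + l2n M u * l2n M (\<lambda>x. (semi t v x - v x) / t + y x)"
    have "\<bar>ip M w v - ip M u y\<bar> \<le> ?b t" if t: "0 < t" for t
    proof -
      note su = semi_L2[OF less_imp_le[OF t] u] and sv = semi_L2[OF less_imp_le[OF t] v]
      let ?A = "\<lambda>x. (semi t u x - u x) / t + w x" and ?B = "\<lambda>x. (semi t v x - v x) / t + y x"
      have A: "?A \<in> L2 M" and B: "?B \<in> L2 M" by (intro L2.mem su sv u v w y)+
      have "ip M ?A v = (ip M (semi t u) v - ip M u v) / t + ip M w v"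
        by (simp add: L2.bilin L2.mem su u v w)
      moreover have "ip M u ?B = (ip M u (semi t v) - ip M u v) / t + ip M u y"
        by (simp add: L2.bilin L2.mem sv u v y)
      ultimately have "ip M w v - ip M u y = ip M ?A v - ip M u ?B"
        using semi_sym[OF less_imp_le[OF t] u v] by simp
      thus ?thesis using L2.cauchy_schwarz[OF A v] L2.cauchy_schwarz[OF u B] by linarith
    qed
    hence ev: "\<forall>\<^sub>F t in at_right 0. \<bar>ip M w v - ip M u y\<bar> \<le> ?b t"
      by (auto simp: eventually_at_filter)
    have "(?b \<longlongrightarrow> 0) (at_right 0)"
      using tendsto_add[OF tendsto_mult_left_zero[OF lim, of "l2n M v"]
        tendsto_mult_right_zero[OF semi_generator[OF g], of "l2n M u"]] by simp
    from tendsto_lowerbound[OF this ev trivial_limit_at_right_real] show ?thesis by simp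
  qed
  define r where "r = (\<lambda>x. u x + w x)"
  have r: "r \<in> L2 M" unfolding r_def by (intro L2.mem u w)
  note Jr = res_L2[OF zero_less_one r]
  have "ip M (\<lambda>x. J 1 r x - u x) z = 0" if z: "z \<in> L2 M" for z
  proof -
    note Jz = res_L2[OF zero_less_one z]
    have "ip M w (J 1 z) = ip M u (\<lambda>x. (z x - J 1 z x) / 1)"
      by (rule key[OF res_graph[OF zero_less_one z]])
    hence "ip M r (J 1 z) = ip M u z"
      unfolding r_def by (simp add: L2.bilin L2.mem u w z Jz)
    moreover have "ip M (J 1 r) z = ip M r (J 1 z)" by (rule res_sym[OF zero_less_one r z])
    ultimately show ?thesis by (simp add: L2.bilin Jr u z)
  qed
  from this[of "\<lambda>x. J 1 r x - u x"] have "l2d M (J 1 r) u = 0"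
    by (simp add: l2n_def sqnorm2_ip L2.mem Jr u)
  hence eq: "AE x in M. J 1 r x = u x" by (simp add: l2n_diff_eq_0_iff Jr u)
  show ?thesis
    by (rule graph_cong_AE[OF res_graph[OF zero_less_one r] L2_measurable[OF u] L2_measurable[OF w] eq])
      (use eq in \<open>auto simp: r_def\<close>)
qed

lemma semi_is_semigroup: "is_L2_semigroup D semi"
proof -
  have contr: "sqnorm2 M (semi t f) \<le> sqnorm2 M f" if t: "0 \<le> t" and f: "f \<in> L2 M" for t f
  proof -
    have "AE x in M. semi t (\<lambda>y. 0 * f y + 0 * f y) x = 0 * semi t f x + 0 * semi t f x"
      by (rule semi_lin[OF t f f])
    hence z: "AE x in M. semi t (\<lambda>y. 0) x = 0" by simp
    note s0 = semi_L2[OF t L2_zero[of "M"]]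
    have "l2d M (semi t f) (semi t (\<lambda>y. 0)) \<le> l2n M (\<lambda>x. f x - 0)"
      by (rule semi_nonexp[OF t f L2_zero])
    also have "l2d M (semi t f) (semi t (\<lambda>y. 0)) = l2n M (\<lambda>x. semi t f x - 0)"
      by (rule l2n_diff_cong_AE) (use z semi_L2[OF t f] s0 in \<open>auto intro: L2_measurable\<close>)
    finally show ?thesis by (simp add: l2n_def)
  qed
  show ?thesis
    unfolding is_L2_semigroup_def Let_def sqnorm2_tendsto_iff
    by (intro conjI allI ballI impI iffI;
      (rule semi_L2 contr semi_lin semi_0 semi_add semi_tendsto semi_generator semi_generator_graph; assumption))
qed

end

section \<open>Uniqueness of the semigroup and smoothing into the form domain\<close>

context cform
begin

context
  fixes T assumes T: "is_L2_semigroup D T"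
begin

private lemmas T' = T[unfolded is_L2_semigroup_def Let_def sqnorm2_tendsto_iff]

private lemma TL: "0 \<le> t \<Longrightarrow> f \<in> L2 M \<Longrightarrow> T t f \<in> L2 M"
  using T'[THEN conjunct1] by blast

private lemma Tc: "0 \<le> t \<Longrightarrow> f \<in> L2 M \<Longrightarrow> l2n M (T t f) \<le> l2n M f"
  using T'[THEN conjunct1] unfolding l2n_def by simp

private lemma Tlin: "0 \<le> t \<Longrightarrow> f \<in> L2 M \<Longrightarrow> g \<in> L2 M \<Longrightarrow>
    AE x in M. T t (\<lambda>y. a * f y + b * g y) x = a * T t f x + b * T t g x"
  using T'[THEN conjunct2, THEN conjunct1] by blast

private lemma T0: "f \<in> L2 M \<Longrightarrow> AE x in M. T 0 f x = f x"
  using T'[THEN conjunct2, THEN conjunct2, THEN conjunct1] by blast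

private lemma Tadd: "0 \<le> s \<Longrightarrow> 0 \<le> t \<Longrightarrow> f \<in> L2 M \<Longrightarrow> AE x in M. T (s + t) f x = T s (T t f) x"
  using T'[THEN conjunct2, THEN conjunct2, THEN conjunct2, THEN conjunct1] by blast

private lemma Tcont: "f \<in> L2 M \<Longrightarrow> ((\<lambda>t. l2d M (T t f) f) \<longlongrightarrow> 0) (at_right 0)"
  using T'[THEN conjunct2, THEN conjunct2, THEN conjunct2, THEN conjunct2, THEN conjunct1] by blast

private lemma Tgen: "u \<in> L2 M \<Longrightarrow> w \<in> L2 M \<Longrightarrow>
    ((\<lambda>t. l2n M (\<lambda>x. (T t u x - u x) / t + w x)) \<longlongrightarrow> 0) (at_right 0) \<longleftrightarrow> operator_graph D u w"
  using T'[THEN conjunct2, THEN conjunct2, THEN conjunct2, THEN conjunct2, THEN conjunct2] by blast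

private lemma Tn:
  assumes t: "0 \<le> t" and f: "f \<in> L2 M" and g: "g \<in> L2 M"
  shows "l2d M (T t f) (T t g) \<le> l2d M f g"
proof -
  have d: "(\<lambda>x. f x - g x) \<in> L2 M" by (intro L2.mem f g)
  have "AE x in M. T t (\<lambda>x. f x - g x) x = T t f x - T t g x"
    using Tlin[OF t f g, of 1 "-1"] by simp
  hence "AE x in M. T t f x - T t g x = T t (\<lambda>x. f x - g x) x"
    by eventually_elim simp
  hence "l2d M (T t f) (T t g) = l2n M (T t (\<lambda>x. f x - g x))"
    by (rule l2n_cong_AE[OF L2_measurable[OF L2.diff_mem[OF TL[OF t f] TL[OF t g]]] L2_measurable[OF TL[OF t d]]])
  also have "\<dots> \<le> l2d M f g" by (rule Tc[OF t d])
  finally show ?thesis .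
qed

private lemma Tcong:
  assumes t: "0 \<le> t" and f: "f \<in> L2 M" and g: "g \<in> L2 M" and eq: "AE x in M. f x = g x"
  shows "AE x in M. T t f x = T t g x"
proof -
  have "l2d M (T t f) (T t g) \<le> 0"
    using Tn[OF t f g] eq by (simp add: l2n_diff_eq_0_iff[THEN iffD2] f g)
  hence "l2d M (T t f) (T t g) = 0" by (simp add: order_antisym)
  thus ?thesis by (simp add: l2n_diff_eq_0_iff TL t f g)
qed

text \<open>\<open>T t\<close> is linear and contractive and commutes with \<open>T s\<close>, so it
  carries the difference quotients at \<open>u\<close> to those at \<open>T t u\<close>.\<close>

lemma semigroup_graph:
  assumes t: "0 \<le> t" and g: "operator_graph D u w"
  shows "operator_graph D (T t u) (T t w)"
proof (rule iffD1[OF Tgen])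
  note u = graph_L2(1)[OF g] and w = graph_L2(2)[OF g]
  note Tu = TL[OF t u] and Tw = TL[OF t w]
  show "((\<lambda>s. l2n M (\<lambda>x. (T s (T t u) x - T t u x) / s + T t w x)) \<longlongrightarrow> 0) (at_right 0)"
  proof (rule Lim_null_comparison)
    show "((\<lambda>s. l2n M (\<lambda>x. (T s u x - u x) / s + w x)) \<longlongrightarrow> 0) (at_right 0)"
      using Tgen[OF u w] g by simp
    have "l2n M (\<lambda>x. (T s (T t u) x - T t u x) / s + T t w x) \<le> l2n M (\<lambda>x. (T s u x - u x) / s + w x)"
      if s: "0 < s" for s
    proof -
      note s0 = less_imp_le[OF s]
      note Tsu = TL[OF s0 u]
      let ?d = "\<lambda>x. (- (1 / s)) * u x + 1 * w x"
      have d: "?d \<in> L2 M" by (intro L2_lin u w)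
      have c: "(\<lambda>x. (T s u x - u x) / s + w x) = (\<lambda>x. (1 / s) * T s u x + 1 * ?d x)"
        by (simp add: fun_eq_iff diff_divide_distrib)
      have cL: "(\<lambda>x. (T s u x - u x) / s + w x) \<in> L2 M" by (intro L2.mem Tsu u w)
      have "AE x in M. (T s (T t u) x - T t u x) / s + T t w x = T t (\<lambda>x. (T s u x - u x) / s + w x) x"
        using Tlin[OF t Tsu d, of "1/s" 1] Tlin[OF t u w, of "- (1 / s)" 1] Tadd[OF s0 t u] Tadd[OF t s0 u]
        unfolding c[symmetric]
      proof eventually_elim
        case (elim x)
        from elim(3,4) have "T s (T t u) x = T t (T s u) x" by (simp add: add.commute)
        with elim(1,2) show ?case by (simp add: diff_divide_distrib)
      qed
      hence "l2n M (\<lambda>x. (T s (T t u) x - T t u x) / s + T t w x) = l2n M (T t (\<lambda>x. (T s u x - u x) / s + w x))"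
        by (rule l2n_cong_AE[rotated 2]; intro L2_measurable[of _ M] L2.mem TL s0 t Tu Tw cL)
      also have "\<dots> \<le> l2n M (\<lambda>x. (T s u x - u x) / s + w x)" by (rule Tc[OF t cL])
      finally show ?thesis .
    qed
    thus "\<forall>\<^sub>F s in at_right 0. norm (l2n M (\<lambda>x. (T s (T t u) x - T t u x) / s + T t w x))
        \<le> l2n M (\<lambda>x. (T s u x - u x) / s + w x)"
      by (auto simp: eventually_at_filter)
  qed
qed (use assms graph_L2 TL in auto)

lemma semigroup_res_commute:
  assumes t: "0 \<le> t" and h: "0 < h" and f: "f \<in> L2 M"
  shows "AE x in M. J h (T t f) x = T t (J h f) x"
proof -
  let ?u = "J h f" and ?w = "\<lambda>x. (f x - J h f x) / h"
  note u = res_L2[OF h f]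
  have g: "operator_graph D ?u ?w" by (rule res_graph[OF h f])
  note w = graph_L2(2)[OF g]
  note Tu = TL[OF t u] and Tw = TL[OF t w] and Tf = TL[OF t f]
  have 1: "AE x in M. J h (\<lambda>x. T t ?u x + h * T t ?w x) x = T t ?u x"
    by (rule is_res_unique[OF h _ graph_is_res[OF semigroup_graph[OF t g]]]) (intro L2.mem Tu Tw)
  have fe: "(\<lambda>x. 1 * ?u x + h * ?w x) = f" using h by (simp add: fun_eq_iff)
  have "AE x in M. T t f x = T t ?u x + h * T t ?w x"
    using Tlin[OF t u w, of 1 h] unfolding fe by simp
  hence "AE x in M. J h (T t f) x = J h (\<lambda>x. T t ?u x + h * T t ?w x) x"
    by (rule res_cong_AE[OF h Tf L2_measurable[OF L2.add_mem[OF Tu L2.scale_mem[OF Tw]]]])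
  with 1 show ?thesis by eventually_elim simp
qed

private lemma Tpow:
  assumes h: "0 \<le> h" and f: "f \<in> L2 M"
  shows "(T h ^^ k) f \<in> L2 M \<and> (AE x in M. (T h ^^ k) f x = T (real k * h) f x)"
proof (induction k)
  case 0
  have "AE x in M. f x = T 0 f x" using T0[OF f] by eventually_elim simp
  thus ?case using f by simp
next
  case (Suc k)
  have kh: "0 \<le> real k * h" using h by simp
  have "AE x in M. T h ((T h ^^ k) f) x = T h (T (real k * h) f) x"
    using Suc by (intro Tcong h TL kh f) auto
  moreover have "AE x in M. T (h + real k * h) f x = T h (T (real k * h) f) x"
    by (rule Tadd[OF h kh f])
  ultimately have "AE x in M. T h ((T h ^^ k) f) x = T (real (Suc k) * h) f x"
    by eventually_elim (simp add: algebra_simps)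
  thus ?case using Suc TL[OF h] by simp
qed

text \<open>On the operator domain \<open>J h u\<close> and \<open>T h u\<close> both equal
  \<open>u - h * w\<close> up to \<open>o(h)\<close>. An error of this size per step is what the
  telescoping estimate needs, since there are about \<open>t / h\<close> steps.\<close>

private lemma res_T_close:
  assumes g: "operator_graph D u w"
  shows "((\<lambda>h. l2d M (J h u) (T h u) / h) \<longlongrightarrow> 0) (at_right 0)"
proof (rule Lim_null_comparison)
  note u = graph_L2(1)[OF g] and w = graph_L2(2)[OF g]
  let ?b = "\<lambda>h. l2d M (J h w) w + l2n M (\<lambda>x. (T h u x - u x) / h + w x)"
  show "(?b \<longlongrightarrow> 0) (at_right 0)"
    using tendsto_add[OF res_tendsto[OF w] Tgen[OF u w, THEN iffD2, OF g]] by simp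
  have "l2d M (J h u) (T h u) / h \<le> ?b h" if h: "0 < h" for h
  proof -
    note Ju = res_L2[OF h u] and Jw = res_L2[OF h w] and Tu = TL[OF less_imp_le[OF h] u]
    let ?a = "\<lambda>x. (- h) * (J h w x - w x)" and ?c = "\<lambda>x. h * ((T h u x - u x) / h + w x)"
    have a: "(\<lambda>x. J h w x - w x) \<in> L2 M" and c: "(\<lambda>x. (T h u x - u x) / h + w x) \<in> L2 M"
      by (intro L2.mem Jw w Tu u)+
    have "l2d M (J h u) (T h u) = l2d M ?a ?c"
    proof (rule l2n_cong_AE)
      show "AE x in M. J h u x - T h u x = ?a x - ?c x"
        using graph_res[OF h g]
      proof eventually_elim
        case (elim x)
        have "h * ((T h u x - u x) / h + w x) = T h u x - u x + h * w x" using h by (simp add: distrib_left)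
        thus ?case using elim by (simp add: algebra_simps)
      qed
    qed (rule L2_measurable; intro L2.mem Ju Tu Jw u w)+
    also have "\<dots> \<le> l2n M ?a + l2n M ?c" by (intro L2.N_triangle_diff L2.scale_mem a c)
    also have "\<dots> = h * ?b h"
      unfolding L2.N_scale[OF a] L2.N_scale[OF c] using h by (simp add: algebra_simps)
    finally show ?thesis using h by (simp add: field_simps)
  qed
  thus "\<forall>\<^sub>F h in at_right 0. norm (l2d M (J h u) (T h u) / h) \<le> ?b h"
    by (auto simp: eventually_at_filter)
qed

private lemma euler_T:
  assumes t: "0 \<le> t" and g: "operator_graph D u w"
  shows "l2_tendsto M (\<lambda>n. euler n t u) (T t u)"
proof (rule Lim_null_comparison)
  note u = graph_L2(1)[OF g]
  let ?p = "\<lambda>h. l2d M (J h u) (T h u) / h"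
  \<comment> \<open>The time left over by rounding, between 0 and one step; strong continuity of
    \<open>T\<close> at 0 absorbs it.\<close>
  define r where "r n = t - real (steps n t) * (1/2)^n" for n
  let ?b = "\<lambda>n. t * ?p ((1/2)^n) + l2d M (T (r n) u) u"
  have r: "0 \<le> r n" "r n \<le> (1/2)^n" for n
    using steps_le[OF t, of n] steps_ge[OF t, of n] by (simp_all add: r_def)
  have "l2d M (euler n t u) (T t u) \<le> ?b n" for n
  proof -
    define h where "h = (1/2::real)^n"
    define k where "k = steps n t"
    have h: "0 < h" by (simp add: h_def)
    note h0 = less_imp_le[OF h]
    have kh0: "0 \<le> real k * h" and kh: "real k * h \<le> t"
      using h steps_le[OF t, of n] by (simp_all add: h_def k_def)
    have eul: "euler n t u = (J h ^^ k) u" by (simp add: euler_def h_def k_def)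
    have 1: "l2d M ((J h ^^ k) u) ((T h ^^ k) u) \<le> real k * l2d M (J h u) (T h u)"
      by (rule commuting_powers_compare[of M "J h" "T h"])
        (intro res_L2 res_nonexp TL Tn semigroup_res_commute h h0 u | assumption)+
    also have "\<dots> = (real k * h) * ?p h" using h by simp
    also have "\<dots> \<le> t * ?p h" using kh h by (intro mult_right_mono) auto
    finally have 1: "l2d M ((J h ^^ k) u) ((T h ^^ k) u) \<le> t * ?p h" .
    note pk = Tpow[OF h0 u, of k]
    note Tk = TL[OF kh0 u] and Tr = TL[OF r(1)[of n] u]
    have "real k * h + r n = t" by (simp add: r_def k_def h_def)
    with Tadd[OF kh0 r(1)[of n] u] have tt: "AE x in M. T t u x = T (real k * h) (T (r n) u) x" by simp
    have "l2d M ((T h ^^ k) u) (T t u) = l2d M (T (real k * h) u) (T (real k * h) (T (r n) u))"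
    proof (rule l2n_diff_cong_AE)
      show "(T h ^^ k) u \<in> borel_measurable M" "AE x in M. (T h ^^ k) u x = T (real k * h) u x"
        using pk by (auto intro: L2_measurable)
    qed (rule tt | rule L2_measurable; intro TL kh0 Tr u t)+
    also have "\<dots> \<le> l2d M u (T (r n) u)" by (rule Tn[OF kh0 u Tr])
    also have "\<dots> = l2d M (T (r n) u) u" by (rule L2.N_diff_commute[OF u Tr])
    finally have 2: "l2d M ((T h ^^ k) u) (T t u) \<le> l2d M (T (r n) u) u" .
    have "l2d M ((J h ^^ k) u) (T t u) \<le> l2d M ((J h ^^ k) u) ((T h ^^ k) u)
        + l2d M ((T h ^^ k) u) (T t u)"
      using pk by (intro L2.N_diff_triangle resn(1) h u TL t) auto
    with 1 2 show ?thesis unfolding eul by (simp add: h_def)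
  qed
  thus "\<forall>\<^sub>F n in sequentially. norm (l2d M (euler n t u) (T t u)) \<le> ?b n"
    by simp
  have "l2_tendsto M (\<lambda>n. T (r n) u) u"
  proof (rule LIMSEQ_I)
    fix e :: real assume e: "0 < e"
    have "\<forall>\<^sub>F s in at_right 0. l2d M (T s u) u < e"
      using order_tendstoD(2)[OF Tcont[OF u] e] .
    then obtain d where d: "0 < d" "\<And>s. 0 < s \<Longrightarrow> s < d \<Longrightarrow> l2d M (T s u) u < e"
      unfolding eventually_at_right[OF zero_less_one] by auto
    obtain N where N: "(1/2)^N < d" using real_arch_pow_inv[of d "1/2"] d(1) by auto
    have "l2d M (T (r n) u) u < e" if n: "N \<le> n" for n
    proof (cases "r n = 0")
      case True
      have "l2d M (T 0 u) u = 0" by (subst l2n_diff_eq_0_iff) (auto intro: T0 TL u)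
      thus ?thesis using e True by simp
    next
      case False
      have "(1/2::real)^n \<le> (1/2)^N" using n by (intro power_decreasing) auto
      hence "r n < d" using r(2)[of n] N by linarith
      thus ?thesis using r(1)[of n] False by (intro d(2)) auto
    qed
    thus "\<exists>no. \<forall>n\<ge>no. norm (l2d M (T (r n) u) u - 0) < e" by auto
  qed
  moreover have "(\<lambda>n. t * ?p ((1/2)^n)) \<longlonglongrightarrow> 0"
    by (intro tendsto_mult_right_zero filterlim_compose[OF res_T_close[OF g] half_at_right])
  ultimately show "?b \<longlonglongrightarrow> 0" using tendsto_add[of "\<lambda>n. t * ?p ((1/2)^n)" 0] by fastforce
qed

text \<open>\<open>heat_L2\<close> is chosen by \<open>SOME\<close>, so only the defining properties
  are available for it. On the operator domain the Euler scheme converges to any such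
  \<open>T\<close>; nonexpansiveness and density identify \<open>T\<close> with \<open>semi\<close>
  everywhere.\<close>

lemma semigroup_unique:
  assumes t: "0 \<le> t" and f: "f \<in> L2 M"
  shows "AE x in M. T t f x = semi t f x"
proof (rule L2_limit_unique[OF euler_L2[OF f] TL[OF t f] semi_L2[OF t f] _ euler_tendsto[OF t f]])
  show "l2_tendsto M (\<lambda>n. euler n t f) (T t f)"
  proof (rule tendsto_zero_of_approx)
    fix e :: real assume e: "0 < e"
    obtain u w z where g: "operator_graph D u w" "operator_graph D w z" "l2d M f u < e / 2"
      using dom_H2_dense[OF f, of "e/2"] e by auto
    note u = graph_L2(1)[OF g(1)]
    have "l2d M (euler n t f) (T t f) \<le> e + l2d M (euler n t u) (T t u)" for n
      using l2n_triangle3[OF euler_L2[OF f, of n t] euler_L2[OF u, of n t] TL[OF t u] TL[OF t f]]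
        euler_nonexp[OF f u, of n t] Tn[OF t u f] g(3) L2.N_diff_commute[OF f u] by simp
    thus "\<exists>b. b \<longlonglongrightarrow> 0 \<and> (\<forall>\<^sub>F n in sequentially. l2d M (euler n t f) (T t f) \<le> e + b n)"
      using euler_T[OF t g(1)] by (intro exI[of _ "\<lambda>n. l2d M (euler n t u) (T t u)"]) simp
  qed simp
qed

end

lemma heat_L2_semigroup: "is_L2_semigroup D (heat_L2 D)"
  unfolding heat_L2_def by (rule someI[of "is_L2_semigroup D", OF semi_is_semigroup])

lemma heat_L2_eq_semi: "0 \<le> t \<Longrightarrow> f \<in> L2 M \<Longrightarrow> AE x in M. heat_L2 D t f x = semi t f x"
  by (rule semigroup_unique[OF heat_L2_semigroup])

lemmas semi_res_commute = semigroup_res_commute[OF semi_is_semigroup]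

lemma semi_cong_AE:
  assumes t: "0 \<le> t" and f: "f \<in> L2 M" and g: "g \<in> borel_measurable M"
    and eq: "AE x in M. f x = g x"
  shows "AE x in M. semi t f x = semi t g x"
proof -
  have gL: "g \<in> L2 M" by (rule L2_cong_AE[OF f g eq])
  have "l2d M f g = 0" using eq by (simp add: l2n_diff_eq_0_iff f gL)
  with semi_nonexp[OF t f gL] have "l2d M (semi t f) (semi t g) = 0"
    by (simp add: order_antisym)
  thus ?thesis by (simp add: l2n_diff_eq_0_iff semi_L2 t f gL)
qed

lemma semi_diff:
  assumes t: "0 \<le> t" and f: "f \<in> L2 M" and g: "g \<in> L2 M"
  shows "AE x in M. semi t (\<lambda>x. f x - g x) x = semi t f x - semi t g x"
  using semi_lin[OF assms, of 1 "-1"] by simp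

lemma semi_uminus:
  assumes t: "0 \<le> t" and f: "f \<in> L2 M"
  shows "AE x in M. semi t (\<lambda>x. - f x) x = - semi t f x"
  using semi_lin[OF t f f, of "-1" 0] by simp

lemma semi_scale:
  assumes t: "0 \<le> t" and f: "f \<in> L2 M"
  shows "AE x in M. semi t (\<lambda>x. c * f x) x = c * semi t f x"
  using semi_lin[OF t f f, of c 0] by simp

lemma semi_contraction:
  assumes t: "0 \<le> t" and f: "f \<in> L2 M"
  shows "l2n M (semi t f) \<le> l2n M f"
proof -
  have "sqnorm2 M (semi t f) \<le> sqnorm2 M f"
    using semi_is_semigroup[unfolded is_L2_semigroup_def Let_def, THEN conjunct1] t f by blast
  thus ?thesis by (simp add: l2n_def)
qed

text \<open>A discrete energy estimate with elapsed time \<open>k * h\<close>. One step follows from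
  testing the resolvent equation with its solution; since energy decreases from step to step, the
  last energy may replace all earlier ones in the sum.\<close>

lemma resn_form_bound:
  assumes h: "0 < h" and f: "f \<in> L2 M"
  shows "2 * (real k * h) * form D ((J h ^^ k) f) ((J h ^^ k) f) + (l2n M ((J h ^^ k) f))\<^sup>2 \<le> (l2n M f)\<^sup>2"
proof (induction k)
  case (Suc k)
  define g where "g = (J h ^^ k) f"
  have g: "g \<in> L2 M" unfolding g_def by (rule resn(1)[OF h f])
  have u: "J h g \<in> fdom D" by (rule res_mem[OF h g])
  note uL = fdom_L2[OF u]
  have e: "h * form D (J h g) (J h g) + ip M (J h g) (J h g) = ip M g (J h g)"
    by (rule res_eq[OF h g u])
  have "0 \<le> ip M (\<lambda>x. g x - J h g x) (\<lambda>x. g x - J h g x)" by (intro L2.nonneg L2.mem g uL)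
  hence "2 * ip M g (J h g) \<le> ip M g g + ip M (J h g) (J h g)"
    using L2.sym[OF g uL] by (simp add: L2.bilin L2.mem g uL)
  with e have 1: "2 * h * form D (J h g) (J h g) + (l2n M (J h g))\<^sup>2 \<le> (l2n M g)\<^sup>2"
    by (simp add: L2.N_square g uL)
  have 2: "real k * form D (J h g) (J h g) \<le> real k * form D g g"
  proof (cases k)
    case (Suc j)
    hence gF: "g \<in> fdom D" unfolding g_def by (simp add: res_mem h resn(1) f)
    have "(E.N (J h g))\<^sup>2 \<le> (E.N g)\<^sup>2"
      by (intro power_mono res_form_diff_le(2) h gF E.N_nonneg u)
    thus ?thesis by (intro mult_left_mono) (simp_all add: E.N_square gF u)
  qed simp
  have "2 * (real (Suc k) * h) * form D (J h g) (J h g) + (l2n M (J h g))\<^sup>2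
      = 2 * h * (real k * form D (J h g) (J h g)) + (2 * h * form D (J h g) (J h g) + (l2n M (J h g))\<^sup>2)"
    by (simp add: algebra_simps)
  also have "\<dots> \<le> 2 * h * (real k * form D g g) + (l2n M g)\<^sup>2"
    using h by (intro add_mono mult_left_mono 1 2) auto
  also have "\<dots> \<le> (l2n M f)\<^sup>2" using Suc.IH by (simp add: g_def algebra_simps)
  finally show ?case by (simp add: g_def)
qed simp

text \<open>The Euler iterates have squared energy norm at most
  \<open>(l2n M f)\<^sup>2 / t\<close>, so \<open>weak_limit\<close> puts their L2 limit into the
  form domain.\<close>

lemma semi_mem:
  assumes t: "0 < t" and f: "f \<in> L2 M"
  shows "semi t f \<in> fdom D"
proof -
  note t0 = less_imp_le[OF t]
  \<comment> \<open>From this level on at least half of \<open>t\<close> is covered by full steps;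
    in particular there is one, so the iterate is a resolvent.\<close>
  obtain N where N: "(1/2)^N < t / 2" using real_arch_pow_inv[of "t/2" "1/2"] t by auto
  define w where "w n = euler (n + N) t f" for n
  have ks: "t / 2 \<le> real (steps (n + N) t) * (1/2)^(n + N)" for n
  proof -
    have "(1/2::real)^(n+N) \<le> (1/2)^N" by (intro power_decreasing) auto
    thus ?thesis using steps_ge[OF t0, of "n + N"] N by linarith
  qed
  have wF: "w n \<in> fdom D" for n
  proof -
    have "0 < real (steps (n + N) t)" using ks[of n] t by (cases "steps (n+N) t") auto
    then obtain j where "steps (n + N) t = Suc j" by (cases "steps (n+N) t") auto
    thus ?thesis unfolding w_def euler_def by (simp add: res_mem resn(1) f)
  qed
  have bd: "E.N (w n) \<le> sqrt ((l2n M f)\<^sup>2 / t)" for n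
  proof -
    let ?k = "steps (n + N) t" and ?h = "(1/2::real)^(n + N)"
    have "t * form D (w n) (w n) \<le> 2 * (real ?k * ?h) * form D (w n) (w n)"
      using ks[of n] by (intro mult_right_mono E.nonneg wF) simp
    also have "\<dots> \<le> (l2n M f)\<^sup>2"
      using resn_form_bound[OF half_pos[of "n + N"] f, of ?k] zero_le_power2[of "l2n M (w n)"]
      unfolding w_def euler_def by linarith
    finally show ?thesis using t unfolding E.N_def by (simp add: field_simps)
  qed
  have lim: "l2_tendsto M w (semi t f)"
    unfolding w_def using euler_tendsto[OF t0 f] by (rule LIMSEQ_ignore_initial_segment)
  show ?thesis
    by (rule weak_limit[of "fdom D" w, OF _ _ wF bd semi_L2[OF t0 f] lim]) (auto intro: E.mem)
qed

end

context mform
begin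

lemma resn_mono:
  assumes h: "0 < h" and f: "f \<in> L2 M" and g: "g \<in> L2 M" and le: "AE x in M. f x \<le> g x"
  shows "AE x in M. (J h ^^ k) f x \<le> (J h ^^ k) g x"
proof (induction k)
  case (Suc k)
  thus ?case using res_mono[OF h resn(1)[OF h f] resn(1)[OF h g]] by simp
qed (simp add: le)

lemma semi_mono:
  assumes t: "0 \<le> t" and f: "f \<in> L2 M" and g: "g \<in> L2 M" and le: "AE x in M. f x \<le> g x"
  shows "AE x in M. semi t f x \<le> semi t g x"
proof (rule L2_limit_le_AE[OF euler_L2[OF f] semi_L2[OF t f] euler_tendsto[OF t f]
      euler_L2[OF g] semi_L2[OF t g] euler_tendsto[OF t g]])
  show "AE x in M. euler n t f x \<le> euler n t g x" for n
    unfolding euler_def by (rule resn_mono[OF half_pos f g le])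
qed

lemma semi_le_const:
  assumes t: "0 \<le> t" and f: "f \<in> L2 M" and c: "0 \<le> c" and le: "AE x in M. f x \<le> c"
  shows "AE x in M. semi t f x \<le> c"
proof (rule L2_limit_le_const_AE[OF euler_L2[OF f] semi_L2[OF t f] euler_tendsto[OF t f]])
  have "AE x in M. (J h ^^ k) f x \<le> c" if h: "0 < h" for h k
  proof (induction k)
    case (Suc k)
    thus ?case using res_le_const[OF h resn(1)[OF h f] c] by simp
  qed (simp add: le)
  thus "AE x in M. euler n t f x \<le> c" for n
    unfolding euler_def by simp
qed

lemma semi_nonneg:
  assumes t: "0 \<le> t" and f: "f \<in> L2 M" and le: "AE x in M. 0 \<le> f x"
  shows "AE x in M. 0 \<le> semi t f x"
proof -
  have "AE x in M. semi t (\<lambda>x. - f x) x \<le> 0"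
    by (rule semi_le_const[OF t L2.uminus_mem[OF f]]) (use le in auto)
  with semi_uminus[OF t f] show ?thesis by eventually_elim simp
qed

lemma semi_abs_le:
  assumes t: "0 \<le> t" and f: "f \<in> L2 M"
  shows "AE x in M. \<bar>semi t f x\<bar> \<le> semi t (\<lambda>x. \<bar>f x\<bar>) x"
proof -
  have "AE x in M. semi t f x \<le> semi t (\<lambda>x. \<bar>f x\<bar>) x"
    by (rule semi_mono[OF t f L2_abs[OF f]]) auto
  moreover have "AE x in M. semi t (\<lambda>x. - f x) x \<le> semi t (\<lambda>x. \<bar>f x\<bar>) x"
    by (rule semi_mono[OF t L2.uminus_mem[OF f] L2_abs[OF f]]) auto
  ultimately show ?thesis using semi_uminus[OF t f] by eventually_elim auto
qed

lemma semi_bounded: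
  assumes t: "0 \<le> t" and f: "f \<in> L2 M" and c: "AE x in M. \<bar>f x\<bar> \<le> c" "0 \<le> c"
  shows "AE x in M. \<bar>semi t f x\<bar> \<le> c"
  using semi_abs_le[OF t f] semi_le_const[OF t L2_abs[OF f] c(2,1)] by eventually_elim simp

end

section \<open>The extended semigroup\<close>

lemma finite_measure_L2_const: "finite_measure M \<Longrightarrow> (\<lambda>x. c) \<in> L2 M"
  by (simp add: L2_def finite_measure.integrable_const)

lemma finite_measure_L2_bounded:
  assumes "finite_measure M" "f \<in> borel_measurable M" "AE x in M. \<bar>f x\<bar> \<le> c"
  shows "f \<in> L2 M"
  by (rule L2_bound[OF finite_measure_L2_const[OF assms(1), of c] assms(2)]) (use assms(3) in auto)

lemma finite_measure_L2_integrable: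
  assumes "finite_measure M" "f \<in> L2 M"
  shows "integrable M f"
  using L2_integrable_mult[OF assms(2) finite_measure_L2_const[OF assms(1), of 1]] by simp

lemma finite_measure_L1_le_L2:
  assumes M: "finite_measure M" and f: "f \<in> L2 M"
  shows "(\<integral>x. \<bar>f x\<bar> \<partial>M) \<le> l2n M (\<lambda>x. 1) * l2n M f"
proof -
  have "(\<integral>x. \<bar>f x\<bar> \<partial>M) = ip M (\<lambda>x. 1) (\<lambda>x. \<bar>f x\<bar>)" by (simp add: ip_def)
  also have "\<dots> \<le> l2n M (\<lambda>x. 1) * l2n M (\<lambda>x. \<bar>f x\<bar>)"
    using L2.cauchy_schwarz[OF finite_measure_L2_const[OF M, of 1] L2_abs[OF f]] by simp
  also have "l2n M (\<lambda>x. \<bar>f x\<bar>) = l2n M f" by (simp add: l2n_def sqnorm2_def)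
  finally show ?thesis .
qed

definition trunc :: "real \<Rightarrow> ('a \<Rightarrow> real) \<Rightarrow> 'a \<Rightarrow> real" where
  "trunc c f x = max (min (f x) c) (- c)"

lemma trunc_measurable [measurable]: "f \<in> borel_measurable M \<Longrightarrow> trunc c f \<in> borel_measurable M"
  unfolding trunc_def[abs_def] by measurable

lemma trunc_L2:
  assumes "finite_measure M" "f \<in> borel_measurable M"
  shows "trunc c f \<in> L2 M"
  by (rule finite_measure_L2_bounded[OF assms(1) trunc_measurable[OF assms(2)], of c "\<bar>c\<bar>"])
    (auto simp: trunc_def)

lemma trunc_tendsto_L1:
  assumes f: "integrable M f" and c: "0 < c"
  shows "(\<lambda>n. \<integral>x. \<bar>f x - trunc (c * real n) f x\<bar> \<partial>M) \<longlonglongrightarrow> 0"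
proof -
  note [measurable] = borel_measurable_integrable[OF f]
  have "(\<lambda>n. \<integral>x. \<bar>f x - trunc (c * real n) f x\<bar> \<partial>M) \<longlonglongrightarrow> (\<integral>x. 0 \<partial>M)"
  proof (rule integral_dominated_convergence[where w = "\<lambda>x. 2 * \<bar>f x\<bar>"])
    show "AE x in M. (\<lambda>n. \<bar>f x - trunc (c * real n) f x\<bar>) \<longlonglongrightarrow> 0"
    proof (rule AE_I2, rule tendsto_eventually)
      fix x
      obtain N :: nat where N: "\<bar>f x\<bar> / c < real N" using reals_Archimedean2 by blast
      have "\<bar>f x - trunc (c * real n) f x\<bar> = 0" if n: "N \<le> n" for n
      proof -
        have "\<bar>f x\<bar> / c < real n" using N n by (meson less_le_trans of_nat_mono)
        hence "\<bar>f x\<bar> < c * real n" using c by (simp add: field_simps)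
        thus ?thesis by (auto simp: trunc_def min_def max_def)
      qed
      thus "\<forall>\<^sub>F n in sequentially. \<bar>f x - trunc (c * real n) f x\<bar> = 0"
        by (auto simp: eventually_sequentially)
    qed
    show "AE x in M. norm \<bar>f x - trunc (c * real n) f x\<bar> \<le> 2 * \<bar>f x\<bar>" for n
    proof (rule AE_I2)
      have "0 \<le> c * real n" using c by simp
      thus "norm \<bar>f x - trunc (c * real n) f x\<bar> \<le> 2 * \<bar>f x\<bar>" for x
        by (auto simp: trunc_def min_def max_def abs_if)
    qed
  qed (use f in auto)
  thus ?thesis by simp
qed

lemma L2_dense_L1:
  assumes M: "finite_measure M" and f: "integrable M f" and e: "0 < e"
  obtains v where "v \<in> L2 M" "(\<integral>x. \<bar>f x - v x\<bar> \<partial>M) < e"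
proof -
  have "\<forall>\<^sub>F n in sequentially. (\<integral>x. \<bar>f x - trunc (1 * real n) f x\<bar> \<partial>M) < e"
    by (rule order_tendstoD(2)[OF trunc_tendsto_L1[OF f zero_less_one] e])
  then obtain n where "(\<integral>x. \<bar>f x - trunc (1 * real n) f x\<bar> \<partial>M) < e"
    by (auto simp: eventually_sequentially)
  with that[OF trunc_L2[OF M borel_measurable_integrable[OF f]]] show thesis by blast
qed

lemma L1_triangle:
  fixes f g h :: "'a \<Rightarrow> real"
  assumes "integrable M f" "integrable M g" "integrable M h"
  shows "(\<integral>x. \<bar>f x - h x\<bar> \<partial>M) \<le> (\<integral>x. \<bar>f x - g x\<bar> \<partial>M) + (\<integral>x. \<bar>g x - h x\<bar> \<partial>M)"
proof -
  have "(\<integral>x. \<bar>f x - h x\<bar> \<partial>M) \<le> (\<integral>x. \<bar>f x - g x\<bar> + \<bar>g x - h x\<bar> \<partial>M)"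
    by (intro integral_mono) (use assms in auto)
  thus ?thesis using assms by simp
qed

lemma L1_diff_commute: "(\<integral>x. \<bar>f x - g x\<bar> \<partial>M) = (\<integral>x. \<bar>g x - f x\<bar> \<partial>M)" for f g :: "'a \<Rightarrow> real"
  by (simp add: abs_minus_commute)

context mform
begin

text \<open>The approximating sequence behind \<open>heat\<close> is unknown. Being monotone, it
  lies between 0 and \<open>f\<close> and converges in L2 by domination, so every choice gives the
  same class.\<close>

lemma heat_nonneg_L2:
  assumes t: "0 \<le> t" and f: "f \<in> L2 M" and g: "is_heat_nonneg D t f g"
  shows "AE x in M. g x = semi t f x"
proof -
  obtain u where gm: "g \<in> borel_measurable M" and u: "\<And>n::nat. u n \<in> L2 M"
    "AE x in M. 0 \<le> u 0 x \<and> incseq (\<lambda>n. u n x) \<and> (\<lambda>n. u n x) \<longlonglongrightarrow> f x"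
    "AE x in M. (\<lambda>n. heat_L2 D t (u n) x) \<longlonglongrightarrow> g x"
    using g unfolding is_heat_nonneg_def by blast
  have bd: "AE x in M. \<bar>u n x\<bar> \<le> \<bar>f x\<bar>" for n
    using u(2)
  proof eventually_elim
    case (elim x)
    hence "0 \<le> u n x" using incseqD[of "\<lambda>n. u n x" 0 n] by simp
    moreover have "u n x \<le> f x" using elim incseq_le[of "\<lambda>n. u n x" "f x"] by blast
    ultimately show ?case by simp
  qed
  have l: "l2_tendsto M u f"
    by (rule L2_dominated(2)[OF L2_measurable[OF u(1)] L2_measurable[OF f] L2_abs[OF f] bd])
      (use u(2) in auto)
  have "l2_tendsto M (\<lambda>n. semi t (u n)) (semi t f)"
    by (rule Lim_null_comparison[OF _ l]) (simp add: semi_nonexp[OF t u(1) f])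
  then obtain r where r: "strict_mono r" "AE x in M. (\<lambda>n. semi t (u (r n)) x) \<longlonglongrightarrow> semi t f x"
    using L2_tendsto_AE_subseq[of "\<lambda>n. semi t (u n)" M "semi t f"] semi_L2[OF t u(1)] semi_L2[OF t f] by blast
  have "AE x in M. \<forall>n. heat_L2 D t (u n) x = semi t (u n) x"
    using heat_L2_eq_semi[OF t u(1)] by (simp add: AE_all_countable)
  with u(3) r(2) show ?thesis
  proof eventually_elim
    case (elim x)
    have "(\<lambda>n. semi t (u n) x) \<longlonglongrightarrow> g x" using elim(1,3) by simp
    hence "(\<lambda>n. semi t (u (r n)) x) \<longlonglongrightarrow> g x" using LIMSEQ_subseq_LIMSEQ[OF _ r(1)] by (fastforce simp: o_def)
    with elim(2) show ?case using LIMSEQ_unique by blast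
  qed
qed

lemma is_heat_nonneg_semi:
  assumes t: "0 \<le> t" and f: "f \<in> L2 M" and pos: "AE x in M. 0 \<le> f x"
  shows "is_heat_nonneg D t f (semi t f)"
  unfolding is_heat_nonneg_def
proof (intro conjI exI[of _ "\<lambda>n. f"] allI)
  show "AE x in M. 0 \<le> f x \<and> incseq (\<lambda>n. f x) \<and> (\<lambda>n. f x) \<longlonglongrightarrow> f x"
    using pos by eventually_elim (simp add: incseq_const)
  show "AE x in M. (\<lambda>n. heat_L2 D t f x) \<longlonglongrightarrow> semi t f x"
    using heat_L2_eq_semi[OF t f] by eventually_elim simp
qed (use f semi_L2[OF t f] L2_measurable in auto)

lemma heat_someI:
  assumes "is_heat_nonneg D t (\<lambda>x. max (f x) 0) p" "is_heat_nonneg D t (\<lambda>x. max (- f x) 0) q"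
  shows "heat D t f \<in> borel_measurable M \<and>
     (\<exists>p q. is_heat_nonneg D t (\<lambda>x. max (f x) 0) p \<and> is_heat_nonneg D t (\<lambda>x. max (- f x) 0) q \<and>
            (AE x in M. heat D t f x = p x - q x))"
proof -
  have pm: "p \<in> borel_measurable M" "q \<in> borel_measurable M"
    using assms by (auto simp: is_heat_nonneg_def)
  define P where "P g \<longleftrightarrow> g \<in> borel_measurable M \<and>
     (\<exists>p q. is_heat_nonneg D t (\<lambda>x. max (f x) 0) p \<and> is_heat_nonneg D t (\<lambda>x. max (- f x) 0) q \<and>
            (AE x in M. g x = p x - q x))" for g
  have "P (\<lambda>x. p x - q x)"
    using assms pm unfolding P_def by auto
  hence "P (SOME g. P g)" by (rule someI[of P])
  thus ?thesis unfolding P_def heat_def .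
qed

lemma heat_eq_semi:
  assumes t: "0 \<le> t" and f: "f \<in> L2 M"
  shows "AE x in M. heat D t f x = semi t f x"
proof -
  let ?p = "\<lambda>x. max (f x) 0" and ?q = "\<lambda>x. max (- f x) 0"
  have p: "?p \<in> L2 M" and q: "?q \<in> L2 M" by (intro L2_max0 L2.mem f)+
  have "is_heat_nonneg D t ?p (semi t ?p)" "is_heat_nonneg D t ?q (semi t ?q)"
    by (intro is_heat_nonneg_semi t p q; simp)+
  from heat_someI[OF this] obtain p' q' where pq: "is_heat_nonneg D t ?p p'" "is_heat_nonneg D t ?q q'"
    "AE x in M. heat D t f x = p' x - q' x" by blast
  have "AE x in M. semi t (\<lambda>x. ?p x - ?q x) x = semi t ?p x - semi t ?q x"
    by (rule semi_diff[OF t p q])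
  moreover have "(\<lambda>x. ?p x - ?q x) = f" by (auto simp: fun_eq_iff max_def)
  ultimately have "AE x in M. semi t f x = semi t ?p x - semi t ?q x" by simp
  with pq(3) heat_nonneg_L2[OF t p pq(1)] heat_nonneg_L2[OF t q pq(2)]
  show ?thesis by eventually_elim simp
qed

end

text \<open>Meant for parts on relatively compact open sets: with finite measure, bounded functions
  are square integrable and square integrable ones integrable.\<close>

locale fmform = mform +
  assumes fin: "finite_measure M"
begin

text \<open>Duality with the constant 1, which is mapped to a function at most 1.\<close>

lemma semi_L1_contraction:
  assumes t: "0 \<le> t" and f: "f \<in> L2 M"
  shows "(\<integral>x. \<bar>semi t f x\<bar> \<partial>M) \<le> (\<integral>x. \<bar>f x\<bar> \<partial>M)"
proof -
  note one = finite_measure_L2_const[OF fin, of 1]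
  note fa = L2_abs[OF f]
  note int = finite_measure_L2_integrable[OF fin]
  have "(\<integral>x. \<bar>semi t f x\<bar> \<partial>M) \<le> (\<integral>x. semi t (\<lambda>x. \<bar>f x\<bar>) x \<partial>M)"
    by (intro integral_mono_AE int L2_abs semi_L2 t f semi_abs_le)
  also have "\<dots> = ip M (semi t (\<lambda>x. \<bar>f x\<bar>)) (\<lambda>x. 1)" by (simp add: ip_def)
  also have "\<dots> = ip M (\<lambda>x. \<bar>f x\<bar>) (semi t (\<lambda>x. 1))" by (rule semi_sym[OF t fa one])
  also have "\<dots> \<le> (\<integral>x. \<bar>f x\<bar> \<partial>M)" unfolding ip_def
  proof (rule integral_mono_AE)
    have "AE x in M. semi t (\<lambda>x. 1) x \<le> 1" by (rule semi_le_const[OF t one]) auto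
    thus "AE x in M. \<bar>f x\<bar> * semi t (\<lambda>x. 1) x \<le> \<bar>f x\<bar>"
      by eventually_elim (simp add: mult_left_le)
  qed (intro L2_integrable_mult fa semi_L2 t one int)+
  finally show ?thesis .
qed

lemma semi_L1_nonexp:
  assumes t: "0 \<le> t" and f: "f \<in> L2 M" and g: "g \<in> L2 M"
  shows "(\<integral>x. \<bar>semi t f x - semi t g x\<bar> \<partial>M) \<le> (\<integral>x. \<bar>f x - g x\<bar> \<partial>M)"
proof -
  have d: "(\<lambda>x. f x - g x) \<in> L2 M" by (intro L2.mem f g)
  have "(\<integral>x. \<bar>semi t f x - semi t g x\<bar> \<partial>M) = (\<integral>x. \<bar>semi t (\<lambda>x. f x - g x) x\<bar> \<partial>M)"
  proof (rule integral_cong_AE)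
    show "AE x in M. \<bar>semi t f x - semi t g x\<bar> = \<bar>semi t (\<lambda>x. f x - g x) x\<bar>"
      using semi_diff[OF t f g] by eventually_elim simp
  qed (use L2_measurable[OF semi_L2[OF t f]] L2_measurable[OF semi_L2[OF t g]] L2_measurable[OF semi_L2[OF t d]] in measurable)
  thus ?thesis using semi_L1_contraction[OF t d] by simp
qed

text \<open>The L1 contraction survives almost everywhere limits: Fatou's lemma bounds the left
  side, dominated convergence evaluates the right side.\<close>

lemma L1_limit_semi:
  assumes t: "0 \<le> t" and d: "\<And>n::nat. d n \<in> L2 M"
    and F: "integrable M F" "\<And>n. AE x in M. \<bar>d n x\<bar> \<le> F x"
    and lim: "AE x in M. (\<lambda>n. d n x) \<longlonglongrightarrow> f x" and f: "f \<in> borel_measurable M"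
    and limg: "AE x in M. (\<lambda>n. semi t (d n) x) \<longlonglongrightarrow> g x" and g: "g \<in> borel_measurable M"
    and v: "v \<in> L2 M"
  shows "integrable M g" "(\<integral>x. \<bar>g x - semi t v x\<bar> \<partial>M) \<le> (\<integral>x. \<bar>f x - v x\<bar> \<partial>M)"
proof -
  note int = finite_measure_L2_integrable[OF fin]
  note sd = semi_L2[OF t d] and sv = semi_L2[OF t v]
  note [measurable] = f g L2_measurable[OF d] L2_measurable[OF v] L2_measurable[OF sd] L2_measurable[OF sv]
  have l: "(\<lambda>n. \<integral>x. \<bar>d n x - v x\<bar> \<partial>M) \<longlonglongrightarrow> (\<integral>x. \<bar>f x - v x\<bar> \<partial>M)"
  proof (rule integral_dominated_convergence[where w = "\<lambda>x. F x + \<bar>v x\<bar>"])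
    show "AE x in M. (\<lambda>n. \<bar>d n x - v x\<bar>) \<longlonglongrightarrow> \<bar>f x - v x\<bar>"
      using lim by eventually_elim (intro tendsto_intros)
    show "AE x in M. norm \<bar>d n x - v x\<bar> \<le> F x + \<bar>v x\<bar>" for n
      using F(2)[of n] by eventually_elim simp
  qed (use F(1) int[OF v] in auto)
  have "(\<integral>\<^sup>+x. ennreal \<bar>g x - semi t v x\<bar> \<partial>M) = (\<integral>\<^sup>+x. liminf (\<lambda>n. ennreal \<bar>semi t (d n) x - semi t v x\<bar>) \<partial>M)"
  proof (rule nn_integral_cong_AE)
    show "AE x in M. ennreal \<bar>g x - semi t v x\<bar> = liminf (\<lambda>n. ennreal \<bar>semi t (d n) x - semi t v x\<bar>)"
      using limg
    proof eventually_elim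
      case (elim x)
      have "(\<lambda>n. ennreal \<bar>semi t (d n) x - semi t v x\<bar>) \<longlonglongrightarrow> ennreal \<bar>g x - semi t v x\<bar>"
        by (intro tendsto_ennrealI tendsto_intros elim)
      thus ?case by (intro lim_imp_Liminf[symmetric]) simp_all
    qed
  qed
  also have "\<dots> \<le> liminf (\<lambda>n. \<integral>\<^sup>+x. ennreal \<bar>semi t (d n) x - semi t v x\<bar> \<partial>M)"
    by (rule nn_integral_liminf) measurable
  also have "\<dots> \<le> liminf (\<lambda>n. ennreal (\<integral>x. \<bar>d n x - v x\<bar> \<partial>M))"
  proof (rule Liminf_mono, rule always_eventually, rule allI)
    fix n
    have "(\<integral>\<^sup>+x. ennreal \<bar>semi t (d n) x - semi t v x\<bar> \<partial>M) = ennreal (\<integral>x. \<bar>semi t (d n) x - semi t v x\<bar> \<partial>M)"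
      using int[OF sd] int[OF sv] by (intro nn_integral_eq_integral) auto
    also have "\<dots> \<le> ennreal (\<integral>x. \<bar>d n x - v x\<bar> \<partial>M)"
      by (intro ennreal_leI semi_L1_nonexp t d v)
    finally show "(\<integral>\<^sup>+x. ennreal \<bar>semi t (d n) x - semi t v x\<bar> \<partial>M) \<le> ennreal (\<integral>x. \<bar>d n x - v x\<bar> \<partial>M)" .
  qed
  also have "\<dots> = ennreal (\<integral>x. \<bar>f x - v x\<bar> \<partial>M)"
    using tendsto_ennrealI[OF l] by (intro lim_imp_Liminf) simp_all
  finally have le: "(\<integral>\<^sup>+x. ennreal \<bar>g x - semi t v x\<bar> \<partial>M) \<le> ennreal (\<integral>x. \<bar>f x - v x\<bar> \<partial>M)" .
  hence i: "integrable M (\<lambda>x. g x - semi t v x)"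
    by (intro integrableI_bounded) (auto intro: le_less_trans[OF le])
  have "integrable M (\<lambda>x. (g x - semi t v x) + semi t v x)"
    by (intro Bochner_Integration.integrable_add i int sv)
  thus "integrable M g" by simp
  have "ennreal (\<integral>x. \<bar>g x - semi t v x\<bar> \<partial>M) \<le> ennreal (\<integral>x. \<bar>f x - v x\<bar> \<partial>M)"
    using le i by (subst (asm) nn_integral_eq_integral) auto
  thus "(\<integral>x. \<bar>g x - semi t v x\<bar> \<partial>M) \<le> (\<integral>x. \<bar>f x - v x\<bar> \<partial>M)"
    by (subst (asm) ennreal_le_iff) auto
qed

text \<open>The images of the truncations increase, and their integrals stay below that of
  \<open>f\<close>; hence their supremum is finite almost everywhere.\<close>

lemma is_heat_nonneg_exists:
  assumes t: "0 \<le> t" and f: "integrable M f" and pos: "\<And>x. 0 \<le> f x"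
  shows "\<exists>g. is_heat_nonneg D t f g"
proof -
  note [measurable] = borel_measurable_integrable[OF f]
  define u where "u n x = min (f x) (real n)" for n x
  have u: "u n \<in> L2 M" for n unfolding u_def
    by (rule finite_measure_L2_bounded[OF fin, of _ "real n"]) (use pos in \<open>auto simp: min_def\<close>)
  have umono: "u m x \<le> u n x" if "m \<le> n" for m n x using that by (auto simp: u_def min_def)
  have ulim: "(\<lambda>n. u n x) \<longlonglongrightarrow> f x" for x
  proof (rule tendsto_eventually)
    obtain N :: nat where "f x < real N" using reals_Archimedean2 by blast
    hence "u n x = f x" if "N \<le> n" for n using that by (auto simp: u_def min_def)
    thus "\<forall>\<^sub>F n in sequentially. u n x = f x" by (auto simp: eventually_sequentially)
  qed
  note su = semi_L2[OF t u]
  note [measurable] = L2_measurable[OF su]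
  have smono: "AE x in M. \<forall>n. semi t (u n) x \<le> semi t (u (Suc n)) x"
    unfolding AE_all_countable by (intro allI semi_mono t u AE_I2 umono) simp
  have spos: "AE x in M. \<forall>n. 0 \<le> semi t (u n) x"
    unfolding AE_all_countable using pos by (intro allI semi_nonneg t u AE_I2) (simp add: u_def)
  have "(\<integral>\<^sup>+x. (SUP n. ennreal (semi t (u n) x)) \<partial>M) = (SUP n. \<integral>\<^sup>+x. ennreal (semi t (u n) x) \<partial>M)"
  proof (rule nn_integral_monotone_convergence_SUP_AE)
    show "AE x in M. ennreal (semi t (u n) x) \<le> ennreal (semi t (u (Suc n)) x)" for n
      using smono by eventually_elim (simp add: ennreal_leI)
  qed measurable
  also have "\<dots> \<le> ennreal (\<integral>x. \<bar>f x\<bar> \<partial>M)"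
  proof (rule SUP_least)
    fix n
    have "(\<integral>\<^sup>+x. ennreal (semi t (u n) x) \<partial>M) = ennreal (\<integral>x. semi t (u n) x \<partial>M)"
      using spos by (intro nn_integral_eq_integral finite_measure_L2_integrable[OF fin su]) auto
    also have "\<dots> \<le> ennreal (\<integral>x. \<bar>f x\<bar> \<partial>M)"
    proof (rule ennreal_leI)
      have "(\<integral>x. semi t (u n) x \<partial>M) \<le> (\<integral>x. \<bar>semi t (u n) x\<bar> \<partial>M)"
        by (intro integral_mono finite_measure_L2_integrable[OF fin] su L2_abs) simp
      also have "\<dots> \<le> (\<integral>x. \<bar>u n x\<bar> \<partial>M)" by (rule semi_L1_contraction[OF t u])
      also have "\<dots> \<le> (\<integral>x. \<bar>f x\<bar> \<partial>M)"
        by (rule integral_mono[OF integrable_abs[OF finite_measure_L2_integrable[OF fin u]] integrable_abs[OF f]])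
          (use pos in \<open>auto simp: u_def min_def\<close>)
      finally show "(\<integral>x. semi t (u n) x \<partial>M) \<le> (\<integral>x. \<bar>f x\<bar> \<partial>M)" .
    qed
    finally show "(\<integral>\<^sup>+x. ennreal (semi t (u n) x) \<partial>M) \<le> ennreal (\<integral>x. \<bar>f x\<bar> \<partial>M)" .
  qed
  finally have le: "(\<integral>\<^sup>+x. (SUP n. ennreal (semi t (u n) x)) \<partial>M) \<le> ennreal (\<integral>x. \<bar>f x\<bar> \<partial>M)" .
  have "AE x in M. (SUP n. ennreal (semi t (u n) x)) \<noteq> \<infinity>"
    by (rule nn_integral_PInf_AE) (use le in \<open>auto simp: top_unique\<close>)
  with smono spos have conv: "AE x in M. convergent (\<lambda>n. semi t (u n) x)"
  proof eventually_elim
    case (elim x)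
    then obtain c where c: "(SUP n. ennreal (semi t (u n) x)) = ennreal c" "0 \<le> c"
      by (cases "SUP n. ennreal (semi t (u n) x)") auto
    have "semi t (u n) x \<le> c" for n
    proof -
      have "ennreal (semi t (u n) x) \<le> ennreal c" unfolding c(1)[symmetric] by (rule SUP_upper) simp
      thus ?thesis using c(2) by (simp add: ennreal_le_iff)
    qed
    moreover have inc: "incseq (\<lambda>n. semi t (u n) x)" using elim(1) by (intro incseq_SucI) simp
    ultimately obtain L where "(\<lambda>n. semi t (u n) x) \<longlonglongrightarrow> L" using incseq_convergent[OF inc] by blast
    thus ?case by (auto simp: convergent_def)
  qed
  have "AE x in M. (\<lambda>n. heat_L2 D t (u n) x) \<longlonglongrightarrow> lim (\<lambda>n. semi t (u n) x)"
  proof -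
    have "AE x in M. \<forall>n. heat_L2 D t (u n) x = semi t (u n) x"
      unfolding AE_all_countable by (intro allI heat_L2_eq_semi t u)
    with conv show ?thesis by eventually_elim (simp add: convergent_LIMSEQ_iff)
  qed
  hence "is_heat_nonneg D t f (\<lambda>x. lim (\<lambda>n. semi t (u n) x))"
    unfolding is_heat_nonneg_def
    by (intro conjI exI[of _ u] allI u) (use pos ulim umono in \<open>auto simp: u_def incseq_def\<close>)
  thus ?thesis by blast
qed

text \<open>The approximations of the positive and the negative part are merged into one sequence
  \<open>d\<close> dominated by the absolute value of \<open>f\<close>. The second bound, valid for
  all \<open>v\<close>, determines the class of \<open>heat D t f\<close> and replaces its
  definition from here on.\<close>

lemma heat_L1:
  assumes t: "0 \<le> t" and f: "integrable M f"
  shows "integrable M (heat D t f)"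
    and "v \<in> L2 M \<Longrightarrow> (\<integral>x. \<bar>heat D t f x - semi t v x\<bar> \<partial>M) \<le> (\<integral>x. \<bar>f x - v x\<bar> \<partial>M)"
proof -
  let ?p = "\<lambda>x. max (f x) 0" and ?q = "\<lambda>x. max (- f x) 0"
  have "integrable M ?p" "integrable M ?q" using f by auto
  then obtain p0 q0 where "is_heat_nonneg D t ?p p0" "is_heat_nonneg D t ?q q0"
    using is_heat_nonneg_exists[OF t, of ?p] is_heat_nonneg_exists[OF t, of ?q] by auto
  from heat_someI[OF this] obtain p q where hm: "heat D t f \<in> borel_measurable M"
    and pq: "is_heat_nonneg D t ?p p" "is_heat_nonneg D t ?q q" "AE x in M. heat D t f x = p x - q x" by blast
  obtain u where u: "\<And>n::nat. u n \<in> L2 M"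
    "AE x in M. 0 \<le> u 0 x \<and> incseq (\<lambda>n. u n x) \<and> (\<lambda>n. u n x) \<longlonglongrightarrow> ?p x"
    "AE x in M. (\<lambda>n. heat_L2 D t (u n) x) \<longlonglongrightarrow> p x"
    using pq(1) unfolding is_heat_nonneg_def by blast
  obtain w where w: "\<And>n::nat. w n \<in> L2 M"
    "AE x in M. 0 \<le> w 0 x \<and> incseq (\<lambda>n. w n x) \<and> (\<lambda>n. w n x) \<longlonglongrightarrow> ?q x"
    "AE x in M. (\<lambda>n. heat_L2 D t (w n) x) \<longlonglongrightarrow> q x"
    using pq(2) unfolding is_heat_nonneg_def by blast
  define d where "d n x = u n x - w n x" for n x
  have d: "d n \<in> L2 M" for n unfolding d_def by (intro L2.mem u w)
  have bd: "AE x in M. \<bar>d n x\<bar> \<le> \<bar>f x\<bar>" for n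
    using u(2) w(2)
  proof eventually_elim
    case (elim x)
    have "0 \<le> u n x" "0 \<le> w n x"
      using elim incseqD[of "\<lambda>n. u n x" 0 n] incseqD[of "\<lambda>n. w n x" 0 n] by auto
    moreover have "u n x \<le> ?p x" "w n x \<le> ?q x"
      using elim incseq_le[of "\<lambda>n. u n x" "?p x"] incseq_le[of "\<lambda>n. w n x" "?q x"] by blast+
    ultimately show ?case by (auto simp: d_def max_def split: if_splits)
  qed
  have lim: "AE x in M. (\<lambda>n. d n x) \<longlonglongrightarrow> f x"
    using u(2) w(2)
  proof eventually_elim
    case (elim x)
    hence "(\<lambda>n. d n x) \<longlonglongrightarrow> ?p x - ?q x" unfolding d_def by (intro tendsto_diff) auto
    thus ?case by (simp add: max_def split: if_splits)
  qed
  have "AE x in M. \<forall>n. semi t (d n) x = heat_L2 D t (u n) x - heat_L2 D t (w n) x"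
    unfolding AE_all_countable
  proof
    fix n
    show "AE x in M. semi t (d n) x = heat_L2 D t (u n) x - heat_L2 D t (w n) x"
      using semi_diff[OF t u(1)[of n] w(1)[of n]] heat_L2_eq_semi[OF t u(1)[of n]] heat_L2_eq_semi[OF t w(1)[of n]]
      unfolding d_def by eventually_elim simp
  qed
  with u(3) w(3) pq(3) have limg: "AE x in M. (\<lambda>n. semi t (d n) x) \<longlonglongrightarrow> heat D t f x"
    by eventually_elim (auto intro: tendsto_diff)
  note * = L1_limit_semi[OF t d integrable_abs[OF f] bd lim borel_measurable_integrable[OF f] limg hm]
  show "integrable M (heat D t f)" by (rule *(1)[OF L2_zero])
  show "v \<in> L2 M \<Longrightarrow> (\<integral>x. \<bar>heat D t f x - semi t v x\<bar> \<partial>M) \<le> (\<integral>x. \<bar>f x - v x\<bar> \<partial>M)"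
    by (rule *(2))
qed

text \<open>A square integrable \<open>v\<close> close to \<open>f\<close> forces both
  \<open>p\<close> and \<open>q\<close> close to \<open>semi t v\<close>.\<close>

lemma L1_class_unique:
  assumes f: "integrable M f" and p: "integrable M p" and q: "integrable M q"
    and t: "0 \<le> t"
    and P: "\<And>v. v \<in> L2 M \<Longrightarrow> (\<integral>x. \<bar>p x - semi t v x\<bar> \<partial>M) \<le> (\<integral>x. \<bar>f x - v x\<bar> \<partial>M)"
    and Q: "\<And>v. v \<in> L2 M \<Longrightarrow> (\<integral>x. \<bar>q x - semi t v x\<bar> \<partial>M) \<le> (\<integral>x. \<bar>f x - v x\<bar> \<partial>M)"
  shows "AE x in M. p x = q x"
proof -
  have "(\<integral>x. \<bar>p x - q x\<bar> \<partial>M) \<le> 0"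
  proof (rule field_le_epsilon)
    fix e :: real assume "0 < e"
    then obtain v where v: "v \<in> L2 M" "(\<integral>x. \<bar>f x - v x\<bar> \<partial>M) < e / 2"
      using L2_dense_L1[OF fin f, of "e/2"] by auto
    note sv = finite_measure_L2_integrable[OF fin semi_L2[OF t v(1)]]
    show "(\<integral>x. \<bar>p x - q x\<bar> \<partial>M) \<le> 0 + e"
      using L1_triangle[OF p sv q] P[OF v(1)] Q[OF v(1)] L1_diff_commute[of M q "semi t v"] v(2) by simp
  qed
  hence "(\<integral>x. \<bar>p x - q x\<bar> \<partial>M) = 0" by (simp add: order_antisym)
  hence "AE x in M. \<bar>p x - q x\<bar> = 0"
    by (subst (asm) integral_nonneg_eq_0_iff_AE) (use p q in auto)
  thus ?thesis by eventually_elim simp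
qed

lemma heat_add:
  assumes s: "0 \<le> s" and t: "0 \<le> t" and f: "integrable M f"
  shows "AE x in M. heat D s (heat D t f) x = heat D (s + t) f x"
proof (rule L1_class_unique[OF f heat_L1(1)[OF s heat_L1(1)[OF t f]] heat_L1(1)[OF _ f], of "s + t"])
  fix v assume v: "v \<in> L2 M"
  note stv = semi_L2[OF t v]
  have "(\<integral>x. \<bar>heat D s (heat D t f) x - semi (s + t) v x\<bar> \<partial>M) = (\<integral>x. \<bar>heat D s (heat D t f) x - semi s (semi t v) x\<bar> \<partial>M)"
  proof (rule integral_cong_AE)
    show "AE x in M. \<bar>heat D s (heat D t f) x - semi (s + t) v x\<bar> = \<bar>heat D s (heat D t f) x - semi s (semi t v) x\<bar>"
      using semi_add[OF s t v] by eventually_elim simp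
  qed (use borel_measurable_integrable[OF heat_L1(1)[OF s heat_L1(1)[OF t f]]] L2_measurable[OF semi_L2[OF s stv]]
      L2_measurable[OF semi_L2[OF _ v, of "s + t"]] s t in auto)
  also have "\<dots> \<le> (\<integral>x. \<bar>heat D t f x - semi t v x\<bar> \<partial>M)"
    by (rule heat_L1(2)[OF s heat_L1(1)[OF t f] stv])
  also have "\<dots> \<le> (\<integral>x. \<bar>f x - v x\<bar> \<partial>M)" by (rule heat_L1(2)[OF t f v])
  finally show "(\<integral>x. \<bar>heat D s (heat D t f) x - semi (s + t) v x\<bar> \<partial>M) \<le> (\<integral>x. \<bar>f x - v x\<bar> \<partial>M)" .
  show "(\<integral>x. \<bar>heat D (s + t) f x - semi (s + t) v x\<bar> \<partial>M) \<le> (\<integral>x. \<bar>f x - v x\<bar> \<partial>M)"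
    using s t by (intro heat_L1(2) f v) simp
qed (use s t in auto)

text \<open>The order is passed on by truncations: cutting \<open>f\<close> at height
  \<open>c * n\<close> and \<open>g\<close> at height \<open>n\<close> keeps the inequality with its
  factor \<open>c\<close>, and both L1 errors vanish. The factor is there for
  \<open>exp (- t * lam)\<close>.\<close>

lemma heat_mono_scale:
  assumes t: "0 \<le> t" and f: "integrable M f" and g: "integrable M g" and c: "0 < c"
    and le: "AE x in M. f x \<le> c * g x"
  shows "AE x in M. heat D t f x \<le> c * heat D t g x"
proof -
  note hf = heat_L1(1)[OF t f] and hg = heat_L1(1)[OF t g]
  let ?F = "\<lambda>n. trunc (c * real n) f" and ?G = "\<lambda>n. trunc (1 * real n) g"
  have F: "?F n \<in> L2 M" and G: "?G n \<in> L2 M" for n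
    by (intro trunc_L2 fin borel_measurable_integrable f g)+
  note sF = semi_L2[OF t F] and sG = semi_L2[OF t G]
  note int = finite_measure_L2_integrable[OF fin]
  let ?x = "\<lambda>x. max (heat D t f x - c * heat D t g x) 0"
  have xi: "integrable M ?x" using hf hg by auto
  have le1: "(\<integral>x. ?x x \<partial>M) \<le> 0 + ((\<integral>x. \<bar>f x - ?F n x\<bar> \<partial>M) + c * (\<integral>x. \<bar>g x - ?G n x\<bar> \<partial>M))" for n
  proof -
    have "AE x in M. ?F n x \<le> c * ?G n x" using le
    proof eventually_elim
      case (elim x)
      have "c * min (g x) (real n) = min (c * g x) (c * real n)"
        "c * max a (- real n) = max (c * a) (- (c * real n))" for a
        using c by (simp_all add: min_mult_distrib_left max_mult_distrib_left)
      hence "c * ?G n x = max (min (c * g x) (c * real n)) (- (c * real n))" by (simp add: trunc_def)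
      thus ?case using elim by (auto simp: trunc_def)
    qed
    hence "AE x in M. semi t (?F n) x \<le> semi t (\<lambda>x. c * ?G n x) x"
      by (intro semi_mono t F L2.mem G)
    with semi_scale[OF t G[of n], of c]
    have "AE x in M. ?x x \<le> \<bar>heat D t f x - semi t (?F n) x\<bar> + c * \<bar>heat D t g x - semi t (?G n) x\<bar>"
    proof eventually_elim
      case (elim x)
      have "c * semi t (?G n) x - c * heat D t g x \<le> c * \<bar>heat D t g x - semi t (?G n) x\<bar>"
        unfolding right_diff_distrib[symmetric] using c by (intro mult_left_mono) auto
      moreover have "0 \<le> c * \<bar>heat D t g x - semi t (?G n) x\<bar>" using c by simp
      moreover have "heat D t f x - semi t (?F n) x \<le> \<bar>heat D t f x - semi t (?F n) x\<bar>"
        "0 \<le> \<bar>heat D t f x - semi t (?F n) x\<bar>" by auto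
      ultimately show ?case using elim by (intro max.boundedI) linarith+
    qed
    hence "(\<integral>x. ?x x \<partial>M) \<le> (\<integral>x. \<bar>heat D t f x - semi t (?F n) x\<bar> + c * \<bar>heat D t g x - semi t (?G n) x\<bar> \<partial>M)"
      by (intro integral_mono_AE xi) (use hf hg int[OF sF] int[OF sG] in auto)
    also have "\<dots> = (\<integral>x. \<bar>heat D t f x - semi t (?F n) x\<bar> \<partial>M) + c * (\<integral>x. \<bar>heat D t g x - semi t (?G n) x\<bar> \<partial>M)"
      using hf hg int[OF sF] int[OF sG] by simp
    also have "\<dots> \<le> (\<integral>x. \<bar>f x - ?F n x\<bar> \<partial>M) + c * (\<integral>x. \<bar>g x - ?G n x\<bar> \<partial>M)"
      using c by (intro add_mono mult_left_mono heat_L1(2) t f g F G) auto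
    finally show ?thesis by simp
  qed
  have "(\<integral>x. ?x x \<partial>M) \<le> 0"
    by (rule le_of_le_add_null[OF le1])
      (use tendsto_add[OF trunc_tendsto_L1[OF f c] tendsto_mult_right_zero[OF trunc_tendsto_L1[OF g zero_less_one], of c]] in simp)
  moreover have "0 \<le> (\<integral>x. ?x x \<partial>M)" by simp
  ultimately have "(\<integral>x. ?x x \<partial>M) = 0" by linarith
  hence "AE x in M. ?x x = 0"
    by (subst (asm) integral_nonneg_eq_0_iff_AE) (use xi in auto)
  thus ?thesis by eventually_elim (simp add: max_def split: if_splits)
qed

lemma heat_tendsto_L1:
  assumes f: "integrable M f"
  shows "((\<lambda>t. \<integral>x. \<bar>heat D t f x - f x\<bar> \<partial>M) \<longlongrightarrow> 0) (at_right 0)"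
proof (rule tendsto_zero_of_approx)
  fix e :: real assume "0 < e"
  then obtain v where v: "v \<in> L2 M" "(\<integral>x. \<bar>f x - v x\<bar> \<partial>M) < e / 2"
    using L2_dense_L1[OF fin f, of "e/2"] by auto
  note int = finite_measure_L2_integrable[OF fin]
  let ?b = "\<lambda>t. l2n M (\<lambda>x. 1) * l2d M (semi t v) v"
  have "(\<integral>x. \<bar>heat D t f x - f x\<bar> \<partial>M) \<le> e + ?b t" if t: "0 < t" for t
  proof -
    note t0 = less_imp_le[OF t]
    note sv = semi_L2[OF t0 v(1)]
    show ?thesis
      using L1_triangle[OF heat_L1(1)[OF t0 f] int[OF sv] f] L1_triangle[OF int[OF sv] int[OF v(1)] f]
        heat_L1(2)[OF t0 f v(1)] finite_measure_L1_le_L2[OF fin L2.diff_mem[OF sv v(1)]]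
        L1_diff_commute[of M v f] v(2) by linarith
  qed
  hence "\<forall>\<^sub>F t in at_right 0. (\<integral>x. \<bar>heat D t f x - f x\<bar> \<partial>M) \<le> e + ?b t"
    by (auto simp: eventually_at_filter)
  moreover have "(?b \<longlongrightarrow> 0) (at_right 0)" by (intro tendsto_mult_right_zero semi_tendsto v)
  ultimately show "\<exists>b. (b \<longlongrightarrow> 0) (at_right 0) \<and> (\<forall>\<^sub>F t in at_right 0. (\<integral>x. \<bar>heat D t f x - f x\<bar> \<partial>M) \<le> e + b t)"
    by blast
qed simp

text \<open>A positive map into \<open>L\<^sup>\<infinity>\<close> is bounded: otherwise it would map a weighted sum of nonnegative worst
  cases outside \<open>L\<^sup>\<infinity>\<close>.\<close>

lemma ultracontractive_bound:
  assumes uc: "ultracontractive D" and t: "0 < t"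
  shows "\<exists>C\<ge>0. \<forall>v\<in>L2 M. AE x in M. \<bar>semi t v x\<bar> \<le> C * l2n M v"
proof (rule ccontr)
  note t0 = less_imp_le[OF t]
  assume "\<not> ?thesis"
  hence "\<exists>v\<in>L2 M. \<not> (AE x in M. \<bar>semi t v x\<bar> \<le> 4 ^ n * l2n M v)" for n :: nat
    by (metis zero_le_numeral zero_le_power)
  then obtain v where v: "\<And>n. v n \<in> L2 M" "\<And>n::nat. \<not> (AE x in M. \<bar>semi t (v n) x\<bar> \<le> 4 ^ n * l2n M (v n))"
    by metis
  have vn: "0 < l2n M (v n)" for n
  proof (rule ccontr)
    assume "\<not> 0 < l2n M (v n)"
    hence z: "l2n M (v n) = 0" using l2n_nonneg[of M "v n"] by linarith
    hence "l2n M (semi t (v n)) = 0" using semi_contraction[OF t0 v(1)[of n]] l2n_nonneg[of M "semi t (v n)"] by linarith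
    hence "AE x in M. semi t (v n) x = 0" by (simp add: l2n_eq_0_iff semi_L2[OF t0 v(1)])
    hence "AE x in M. \<bar>semi t (v n) x\<bar> \<le> 4 ^ n * l2n M (v n)" unfolding z by eventually_elim simp
    with v(2) show False by blast
  qed
  \<comment> \<open>The weights make the series converge in L2. Against an assumed growth beyond
    \<open>4 ^ n\<close> they leave a growth beyond \<open>2 ^ n\<close>, which no bound
    \<open>C\<close> survives.\<close>
  define y where "y n x = ((1/2)^n / l2n M (v n)) * \<bar>v n x\<bar>" for n x
  have y: "y n \<in> L2 M" for n unfolding y_def by (intro L2.mem L2_abs v)
  have ypos: "0 \<le> y n x" for n x unfolding y_def by (intro mult_nonneg_nonneg) (auto intro: less_imp_le[OF vn])
  have yn: "l2n M (y n) \<le> (1/2)^n" for n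
  proof -
    have "l2n M (\<lambda>x. \<bar>v n x\<bar>) = l2n M (v n)" by (simp add: l2n_def sqnorm2_def)
    thus ?thesis unfolding y_def using vn[of n] by (subst L2.N_scale[OF L2_abs[OF v(1)]]) simp
  qed
  define s where "s n x = (\<Sum>k<n. y k x)" for n x
  have sS: "s (Suc n) = (\<lambda>x. s n x + y n x)" for n by (simp add: s_def fun_eq_iff)
  have s: "s n \<in> L2 M" for n
  proof (induction n)
    case 0
    thus ?case by (simp add: s_def[abs_def] L2_zero)
  next
    case (Suc n)
    thus ?case unfolding sS by (intro L2.mem y)
  qed
  have step: "l2d M (s n) (s (Suc n)) \<le> 1 * (1/2)^n" for n
    using yn[of n] by (simp add: sS L2.N_uminus[OF y])
  have "\<exists>N. \<forall>m\<ge>N. \<forall>n\<ge>N. l2d M (s m) (s n) < e" if e: "0 < e" for e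
  proof -
    obtain N where N: "(1/2::real)^N < e / 2" using real_arch_pow_inv[of "e/2" "1/2"] e by auto
    have le: "l2d M (s m) (s n) < e" if mn: "N \<le> m" "m \<le> n" for m n
    proof -
      have "l2d M (s m) (s n) \<le> 2 * 1 * (1/2)^m"
        by (rule l2n_geometric_Cauchy[OF s step mn(2)])
      moreover have "(1/2::real)^m \<le> (1/2)^N" using mn by (intro power_decreasing) auto
      ultimately show ?thesis using N by linarith
    qed
    have "l2d M (s m) (s n) < e" if "N \<le> m" "N \<le> n" for m n
      using le[of m n] le[of n m] that L2.N_diff_commute[OF s[of m] s[of n]] by (cases "m \<le> n") auto
    thus ?thesis by blast
  qed
  then obtain f where f: "f \<in> L2 M" "l2_tendsto M s f"
    using L2_complete[of s M, OF s] by blast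
  have yf: "AE x in M. y n x \<le> f x" for n
  proof (rule L2_limit_le_AE[of "\<lambda>_. y n"])
    show "AE x in M. y n x \<le> s (k + Suc n) x" for k
    proof (rule AE_I2)
      fix x
      have "y n x = (\<Sum>j\<in>{n}. y j x)" by simp
      also have "\<dots> \<le> s (k + Suc n) x" unfolding s_def by (rule sum_mono2) (auto simp: ypos)
      finally show "y n x \<le> s (k + Suc n) x" .
    qed
    show "l2_tendsto M (\<lambda>k. s (k + Suc n)) f"
      using f(2) by (rule LIMSEQ_ignore_initial_segment)
    show "l2_tendsto M (\<lambda>k. y n) (y n)" by (simp add: l2n_def sqnorm2_def)
  qed (intro y s f)+
  have "heat D t f \<in> Linf M"
    using uc t finite_measure_L2_integrable[OF fin f(1)] by (auto simp: ultracontractive_def L1_def)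
  then obtain C where "AE x in M. \<bar>heat D t f x\<bar> \<le> C" by (auto simp: Linf_def)
  with heat_eq_semi[OF t0 f(1)] have C: "AE x in M. semi t f x \<le> C"
    by eventually_elim simp
  obtain n where n: "C < 2 ^ n" using real_arch_pow[of 2 C] by auto
  have "AE x in M. \<bar>semi t (v n) x\<bar> \<le> 4 ^ n * l2n M (v n)"
    using C semi_mono[OF t0 y f(1) yf, of n] semi_abs_le[OF t0 v(1)[of n]]
      semi_scale[OF t0 L2_abs[OF v(1)[of n]], of "(1/2)^n / l2n M (v n)"]
  proof eventually_elim
    case (elim x)
    have "((1/2)^n / l2n M (v n)) * semi t (\<lambda>x. \<bar>v n x\<bar>) x \<le> 2 ^ n"
      using elim(1,2,4) n unfolding y_def[abs_def] by linarith
    hence "semi t (\<lambda>x. \<bar>v n x\<bar>) x \<le> 2 ^ n * (2 ^ n * l2n M (v n))"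
      using vn[of n] by (simp add: field_simps power_one_over)
    also have "\<dots> = 4 ^ n * l2n M (v n)" by (simp flip: power_mult_distrib mult.assoc)
    finally show ?case using elim(3) by linarith
  qed
  with v(2) show False by blast
qed

end

section \<open>Topology and measure of a Dirichlet space\<close>

lemma second_countable_separable_metrizable:
  assumes "metrizable_space X" "separable_space X"
  shows "second_countable X"
proof -
  obtain M d where "Metric_space M d" and X: "X = Metric_space.mtopology M d"
    using assms(1) by (auto simp: metrizable_space_def)
  interpret Metric_space M d by fact
  obtain C where C: "countable C" "C \<subseteq> M" "X closure_of C = M"
    using assms(2) by (auto simp: separable_space_def X)
  let ?B = "(\<lambda>(c, n). mball c (inverse (real (Suc n)))) ` (C \<times> UNIV)"
  have "\<exists>V\<in>?B. x \<in> V \<and> V \<subseteq> U" if U: "openin X U" "x \<in> U" for U x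
  proof -
    have xM: "x \<in> M" using U openin_subset by (fastforce simp: X)
    obtain r where r: "0 < r" "mball x r \<subseteq> U" using U by (auto simp: X openin_mtopology)
    obtain n where n: "inverse (real (Suc n)) < r / 2" using reals_Archimedean[of "r / 2"] r(1) by auto
    let ?e = "inverse (real (Suc n))"
    have "x \<in> X closure_of C" using C(3) xM by simp
    hence "\<exists>y\<in>C. y \<in> mball x ?e"
      unfolding X metric_closure_of by (simp del: of_nat_Suc)
    then obtain c where c: "c \<in> C" "c \<in> mball x ?e" by blast
    have "mball c ?e \<subseteq> mball x r"
    proof
      fix y assume y: "y \<in> mball c ?e"
      hence "d x y \<le> d x c + d c y" using xM c by (intro triangle) auto
      with c y n show "y \<in> mball x r" using xM by auto
    qed
    with r(2) c xM show ?thesis by (intro bexI[of _ "mball c ?e"]) (auto simp: commute)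
  qed
  thus ?thesis unfolding second_countable_def
    by (intro exI[of _ ?B] conjI) (auto simp: C(1) X)
qed

locale dspace =
  fixes D :: "'a form_space"
  assumes ds: "strongly_local_dirichlet_space D"

sublocale dspace \<subseteq> mform
  using ds by unfold_locales (auto simp: strongly_local_dirichlet_space_def)

context dspace
begin

abbreviation "X \<equiv> topo D"

lemma topology:
  shows locally_compact: "locally_compact_space X" and separable: "separable_space X"
    and metrizable: "metrizable_space X" and radon: "radon_measure X M"
    and full_support: "openin X U \<Longrightarrow> U \<noteq> {} \<Longrightarrow> 0 < emeasure M U"
    and regular: "regular_form D" and local: "strongly_local D"
  using ds unfolding strongly_local_dirichlet_space_def by auto

lemma Hausdorff: "Hausdorff_space X"
  by (rule metrizable_imp_Hausdorff_space[OF metrizable])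

lemma radonD:
  shows space_M: "space M = topspace X"
    and sets_M: "sets M = sigma_sets (topspace X) {U. openin X U}"
    and compact_finite: "compactin X K \<Longrightarrow> emeasure M K < \<infinity>"
    and inner_regular: "A \<in> sets M \<Longrightarrow> emeasure M A = (SUP K\<in>{K. compactin X K \<and> K \<subseteq> A}. emeasure M K)"
  using radon unfolding radon_measure_def by auto

lemma open_sets: "openin X U \<Longrightarrow> U \<in> sets M"
  by (auto simp: sets_M)

lemma closed_sets: "closedin X K \<Longrightarrow> K \<in> sets M"
proof -
  assume K: "closedin X K"
  hence "space M - (topspace X - K) \<in> sets M" by (intro sets.compl_sets open_sets) auto
  thus ?thesis using closedin_subset[OF K] by (simp add: space_M Diff_Diff_Int Int_absorb1)
qed

lemma compact_closed: "compactin X K \<Longrightarrow> closedin X K"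
  by (rule compactin_imp_closedin[OF Hausdorff])

lemma compact_sets: "compactin X K \<Longrightarrow> K \<in> sets M"
  by (intro closed_sets compact_closed)

lemma C_space_measurable: "f \<in> C_space X \<Longrightarrow> f \<in> borel_measurable M"
proof (rule borel_measurableI)
  fix S :: "real set" assume f: "f \<in> C_space X" and S: "open S"
  have "openin X {x \<in> topspace X. f x \<in> S}"
    by (rule openin_continuous_map_preimage[of X euclideanreal]) (use f S in \<open>auto simp: C_space_def\<close>)
  moreover have "f -` S \<inter> space M = {x \<in> topspace X. f x \<in> S}" by (auto simp: space_M)
  ultimately show "f -` S \<inter> space M \<in> sets M" using open_sets by simp
qed

lemma base: obtains \<B> where "countable \<B>" "\<And>V. V \<in> \<B> \<Longrightarrow> openin X V"
    "\<And>U x. openin X U \<Longrightarrow> x \<in> U \<Longrightarrow> \<exists>V\<in>\<B>. x \<in> V \<and> V \<subseteq> U"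
proof -
  from second_countable_separable_metrizable[OF metrizable separable, unfolded second_countable_def]
  obtain \<B> where "countable \<B> \<and> (\<forall>V\<in>\<B>. openin X V) \<and>
    (\<forall>U x. openin X U \<and> x \<in> U \<longrightarrow> (\<exists>V\<in>\<B>. x \<in> V \<and> V \<subseteq> U))" by (elim exE)
  thus thesis by (intro that[of \<B>]) simp_all
qed

text \<open>A countable base combines the local exceptional sets into a single null set.\<close>

lemma AE_local:
  assumes "\<And>x. x \<in> U \<Longrightarrow> \<exists>N. openin X N \<and> x \<in> N \<and> (AE y in M. y \<in> N \<longrightarrow> P y)"
  shows "AE y in M. y \<in> U \<longrightarrow> P y"
proof -
  obtain \<B> where B: "countable \<B>" "\<And>V. V \<in> \<B> \<Longrightarrow> openin X V"
    "\<And>U x. openin X U \<Longrightarrow> x \<in> U \<Longrightarrow> \<exists>V\<in>\<B>. x \<in> V \<and> V \<subseteq> U" by (rule base, rule that)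
  let ?B = "{V \<in> \<B>. AE y in M. y \<in> V \<longrightarrow> P y}"
  have "AE y in M. \<forall>V\<in>?B. y \<in> V \<longrightarrow> P y"
    by (subst AE_ball_countable) (use B(1) in auto)
  thus ?thesis
  proof eventually_elim
    case (elim y)
    show ?case
    proof
      assume "y \<in> U"
      then obtain N where N: "openin X N" "y \<in> N" "AE z in M. z \<in> N \<longrightarrow> P z" using assms by blast
      then obtain V where V: "V \<in> \<B>" "y \<in> V" "V \<subseteq> N" using B(3) by blast
      have "AE z in M. z \<in> V \<longrightarrow> P z" using N(3) by eventually_elim (use V(3) in auto)
      with V elim show "P y" by blast
    qed
  qed
qed

lemma AE_open_exists:
  assumes "openin X U" "U \<noteq> {}" "AE x in M. x \<in> U \<longrightarrow> P x"
  shows "\<exists>x\<in>U. P x"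
proof (rule ccontr)
  assume n: "\<not> ?thesis"
  have "AE x in M. x \<notin> U" using assms(3) by eventually_elim (use n in auto)
  hence "emeasure M U = 0" by (subst (asm) AE_iff_measurable[OF open_sets[OF assms(1)]])
    (use openin_subset[OF assms(1)] in \<open>auto simp: space_M\<close>)
  with full_support[OF assms(1,2)] show False by simp
qed

text \<open>By full support the open set where the inequality failed would have positive
  measure.\<close>

lemma AE_le_cont_imp_le:
  assumes "f \<in> C_space X" "g \<in> C_space X" "openin X U" "AE x in M. x \<in> U \<longrightarrow> f x \<le> g x" "x \<in> U"
  shows "f x \<le> g x"
proof (rule ccontr)
  assume n: "\<not> f x \<le> g x"
  let ?V = "{y \<in> topspace X. f y - g y \<in> {0<..}} \<inter> U"
  have "continuous_map X euclideanreal (\<lambda>y. f y - g y)"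
    using assms(1,2) by (auto simp: C_space_def intro: continuous_map_diff)
  hence "openin X ?V"
    by (intro openin_Int openin_continuous_map_preimage[of X euclideanreal] assms(3)) auto
  moreover have "x \<in> ?V" using n assms(5) openin_subset[OF assms(3)] by auto
  ultimately have "\<exists>y\<in>?V. f y \<le> g y"
    by (intro AE_open_exists) (use assms(4) in auto)
  thus False by auto
qed

lemma AE_eq_cont_imp_eq:
  assumes "f \<in> C_space X" "g \<in> C_space X" "AE x in M. f x = g x" "x \<in> topspace X"
  shows "f x = g x"
  by (rule antisym; rule AE_le_cont_imp_le[of _ _ "topspace X"]) (use assms in auto)

lemma compact_nbhd:
  assumes K: "compactin X K" and U: "openin X U" and KU: "K \<subseteq> U"
  obtains W where "openin X W" "K \<subseteq> W" "compactin X (X closure_of W)" "X closure_of W \<subseteq> U"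
proof -
  have "locally_compact_space (subtopology X U)"
    by (rule locally_compact_space_open_subset) (use Hausdorff locally_compact U in auto)
  moreover have "Hausdorff_space (subtopology X U)" by (rule Hausdorff_space_subtopology[OF Hausdorff])
  moreover have "compactin (subtopology X U) K" using K KU by (simp add: compactin_subtopology)
  ultimately obtain W L where W: "openin (subtopology X U) W" "compactin (subtopology X U) L" "K \<subseteq> W" "W \<subseteq> L"
    using locally_compact_space_compact_closed_compact[of "subtopology X U"] by blast
  have WX: "openin X W" using W(1) U openin_trans_full by blast
  have L: "compactin X L" "L \<subseteq> U" using W(2) by (auto simp: compactin_subtopology)
  have cl: "X closure_of W \<subseteq> L" by (rule closure_of_minimal[OF W(4) compact_closed[OF L(1)]])
  show thesis
    by (rule that[OF WX W(3) closed_compactin[OF L(1) cl closedin_closure_of]]) (use cl L(2) in auto)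
qed

definition supp :: "('a \<Rightarrow> real) \<Rightarrow> 'a set" where
  "supp f = X closure_of {x \<in> topspace X. f x \<noteq> 0}"

lemma supp_zero: "x \<in> topspace X \<Longrightarrow> x \<notin> supp f \<Longrightarrow> f x = 0"
  unfolding supp_def using closure_of_subset[of "{x \<in> topspace X. f x \<noteq> 0}" X] by auto

lemma supp_subset:
  assumes "compactin X K" "\<And>x. x \<in> topspace X \<Longrightarrow> x \<notin> K \<Longrightarrow> f x = 0"
  shows "compactin X (supp f)" "supp f \<subseteq> K"
proof -
  show s: "supp f \<subseteq> K" unfolding supp_def
    by (rule closure_of_minimal[OF _ compact_closed[OF assms(1)]]) (use assms(2) in auto)
  show "compactin X (supp f)" by (rule closed_compactin[OF assms(1) s]) (simp add: supp_def)
qed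

lemma C_c_alt: "f \<in> C_c X \<longleftrightarrow> f \<in> C_space X \<and> compactin X (supp f)"
  by (simp add: C_c_def supp_def)

lemma C_space_lattice:
  assumes "f \<in> C_space X" "g \<in> C_space X"
  shows "(\<lambda>x. min (f x) (g x)) \<in> C_space X" "(\<lambda>x. max (f x) (g x)) \<in> C_space X"
    "(\<lambda>x. a * f x + b * g x) \<in> C_space X" "(\<lambda>x. f x * g x) \<in> C_space X"
    "(\<lambda>x. c) \<in> C_space X"
  using assms unfolding C_space_def
  by (auto intro!: continuous_map_real_min continuous_map_real_max continuous_map_add continuous_map_real_mult)

lemma urysohn:
  assumes K: "compactin X K" and U: "openin X U" and KU: "K \<subseteq> U"
  obtains f where "f \<in> C_c X" "supp f \<subseteq> U" "\<And>x. x \<in> topspace X \<Longrightarrow> 0 \<le> f x \<and> f x \<le> 1" "\<And>x. x \<in> K \<Longrightarrow> f x = 1"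
proof -
  obtain W where W: "openin X W" "K \<subseteq> W" "compactin X (X closure_of W)" "X closure_of W \<subseteq> U"
    by (rule compact_nbhd[OF assms], rule that)
  have "disjnt (topspace X - W) K" using W(2) by (auto simp: disjnt_def)
  then obtain f where f: "continuous_map X (subtopology euclideanreal {0..1}) f"
    "f ` (topspace X - W) \<subseteq> {0}" "f ` K \<subseteq> {1}"
    by (rule Urysohn_lemma[OF metrizable_imp_normal_space[OF metrizable], of "topspace X - W" K 0 1, rotated 2])
      (use W compact_closed[OF K] in auto)
  have fC: "f \<in> C_space X" and f01: "\<And>x. x \<in> topspace X \<Longrightarrow> 0 \<le> f x \<and> f x \<le> 1"
    using f(1) by (auto simp: C_space_def continuous_map_in_subtopology)
  have z: "f x = 0" if "x \<in> topspace X" "x \<notin> X closure_of W" for x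
    using that f(2) closure_of_subset[OF openin_subset[OF W(1)]] by auto
  from supp_subset[of _ f, OF W(3) z] have s: "compactin X (supp f)" "supp f \<subseteq> U" using W(4) by auto
  show thesis by (rule that[of f]) (use fC f01 s f(3) in \<open>auto simp: C_c_alt\<close>)
qed

lemma cutoff:
  assumes K: "compactin X K" and U: "openin X U" and KU: "K \<subseteq> U"
  obtains \<eta> where "\<eta> \<in> fdom D" "\<eta> \<in> C_c X" "supp \<eta> \<subseteq> U"
    "\<And>x. x \<in> topspace X \<Longrightarrow> 0 \<le> \<eta> x \<and> \<eta> x \<le> 1" "\<And>x. x \<in> K \<Longrightarrow> \<eta> x = 1"
proof -
  obtain f where f: "f \<in> C_c X" "supp f \<subseteq> U" "\<And>x. x \<in> topspace X \<Longrightarrow> 0 \<le> f x \<and> f x \<le> 1" "\<And>x. x \<in> K \<Longrightarrow> f x = 1"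
    by (rule urysohn[OF assms], rule that)
  obtain \<phi> where p: "\<phi> \<in> fdom D" "\<phi> \<in> C_c X" "\<And>x. x \<in> topspace X \<Longrightarrow> \<bar>f x - \<phi> x\<bar> < 1/4"
    using regular[unfolded regular_form_def, THEN conjunct1, THEN bspec, OF f(1), THEN spec, of "1/4"] by auto
  \<comment> \<open>Off the support of \<open>f\<close> one has \<open>\<phi> < 1/4\<close>, so
    \<open>\<eta>\<close> vanishes; on \<open>K\<close> one has \<open>\<phi> > 3/4\<close>, so
    twice the excess over 1/4 exceeds 1 and is cut there. Both operations stay in the form
    domain.\<close>
  define \<eta> where "\<eta> x = min (2 * max (\<phi> x - 1/4) 0) 1" for x
  have "(\<lambda>x. max (\<phi> x - 1/4) 0) \<in> fdom D" by (rule excess_mem) (use p in auto)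
  hence 1: "\<eta> \<in> fdom D" unfolding \<eta>_def[abs_def] by (intro cut_mem E.scale_mem) auto
  have c: "\<phi> \<in> C_space X" using p(2) by (simp add: C_c_alt)
  have 2: "\<eta> \<in> C_space X" unfolding \<eta>_def[abs_def]
    using c unfolding C_space_def
    by (auto intro!: continuous_map_real_min continuous_map_real_max continuous_map_diff continuous_map_real_mult)
  have "\<eta> x = 0" if x: "x \<in> topspace X" "x \<notin> supp f" for x
    using p(3)[OF x(1)] supp_zero[OF x] by (auto simp: \<eta>_def max_def)
  hence 3: "compactin X (supp \<eta>)" "supp \<eta> \<subseteq> supp f"
    using supp_subset[of "supp f" \<eta>] f(1) by (auto simp: C_c_alt)
  have 4: "\<eta> x = 1" if x: "x \<in> K" for x
  proof -
    have "x \<in> topspace X" using x compactin_subset_topspace[OF K] by blast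
    from p(3)[OF this] f(4)[OF x] have "3/4 < \<phi> x" by linarith
    thus ?thesis by (simp add: \<eta>_def max_def min_def)
  qed
  show thesis by (rule that[of \<eta>]) (use 1 2 3 4 f(2) in \<open>auto simp: C_c_alt \<eta>_def\<close>)
qed

lemma relcompact_cover:
  obtains U :: "nat \<Rightarrow> 'a set" where "\<And>n. relcompact_open X (U n)" "topspace X \<subseteq> (\<Union>n. U n)"
proof -
  obtain \<B> where B: "countable \<B>" "\<And>V. V \<in> \<B> \<Longrightarrow> openin X V"
    "\<And>U x. openin X U \<Longrightarrow> x \<in> U \<Longrightarrow> \<exists>V\<in>\<B>. x \<in> V \<and> V \<subseteq> U" by (rule base, rule that)
  \<comment> \<open>The empty set is added so that the family is nonempty and can be enumerated by
    \<open>nat\<close> even for an empty space.\<close>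
  let ?B = "insert {} {V \<in> \<B>. relcompact_open X V}"
  have cov: "\<exists>V\<in>?B. x \<in> V" if x: "x \<in> topspace X" for x
  proof -
    obtain W where W: "openin X W" "{x} \<subseteq> W" "compactin X (X closure_of W)"
      by (rule compact_nbhd[of "{x}" "topspace X"]) (use x in auto)
    then obtain V where V: "V \<in> \<B>" "x \<in> V" "V \<subseteq> W" using B(3) by blast
    have "compactin X (X closure_of V)"
      by (rule closed_compactin[OF W(3) closure_of_mono[OF V(3)]]) auto
    thus ?thesis using V B(2) by (auto simp: relcompact_open_def)
  qed
  have "countable ?B" using B(1) by simp
  then obtain U :: "nat \<Rightarrow> 'a set" where U: "range U = ?B" by (metis insert_not_empty uncountable_def)
  have "U n \<in> ?B" for n unfolding U[symmetric] by simp
  hence "relcompact_open X (U n)" for n by (cases "U n = {}") (auto simp: relcompact_open_def)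
  moreover have "topspace X \<subseteq> \<Union>(range U)" unfolding U using cov by auto
  ultimately show thesis by (rule that)
qed


section \<open>Cores of open sets and their closures in the form norm\<close>

text \<open>The set whose closure defines the part on \<open>U\<close>. Its elements remain
  functions on all of \<open>X\<close>, and the support is taken in \<open>X\<close>.\<close>

definition core :: "'a set \<Rightarrow> ('a \<Rightarrow> real) set" where
  "core U = {\<phi> \<in> fdom D. \<phi> \<in> C_c X \<and> supp \<phi> \<subseteq> U}"

lemma coreD: "\<phi> \<in> core U \<Longrightarrow> \<phi> \<in> fdom D" "\<phi> \<in> core U \<Longrightarrow> \<phi> \<in> C_space X"
  "\<phi> \<in> core U \<Longrightarrow> compactin X (supp \<phi>)" "\<phi> \<in> core U \<Longrightarrow> supp \<phi> \<subseteq> U"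
  by (auto simp: core_def C_c_alt)

lemma core_lin:
  assumes "\<phi> \<in> core U" "\<psi> \<in> core U"
  shows "(\<lambda>x. a * \<phi> x + b * \<psi> x) \<in> core U"
proof -
  have K: "compactin X (supp \<phi> \<union> supp \<psi>)" using assms by (intro compactin_Un coreD)
  have z: "a * \<phi> x + b * \<psi> x = 0" if "x \<in> topspace X" "x \<notin> supp \<phi> \<union> supp \<psi>" for x
    using supp_zero[of x \<phi>] supp_zero[of x \<psi>] that by simp
  from supp_subset[of _ "\<lambda>x. a * \<phi> x + b * \<psi> x", OF K z] assms show ?thesis
    by (auto simp: core_def C_c_alt intro: E.lin_mem C_space_lattice(3))
qed

lemma core_dominated:
  assumes "\<phi> \<in> core U" "w \<in> fdom D" "w \<in> C_space X" "\<And>x. x \<in> topspace X \<Longrightarrow> \<phi> x = 0 \<Longrightarrow> w x = 0"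
  shows "w \<in> core U"
proof -
  have "w x = 0" if "x \<in> topspace X" "x \<notin> supp \<phi>" for x
    by (rule assms(4)[OF that(1) supp_zero[OF that]])
  from supp_subset[of _ w, OF coreD(3)[OF assms(1)] this] assms show ?thesis
    by (auto simp: core_def C_c_alt)
qed

lemma part_closure_alt:
  "part_closure D U = {f \<in> fdom D. \<forall>e>0. \<exists>\<phi>\<in>core U. E1.N (\<lambda>x. f x - \<phi> x) < e}" (is "_ = ?R")
proof (intro set_eqI iffI)
  fix f
  have sq: "sqnormE1 D (\<lambda>x. f x - \<phi> x) = (E1.N (\<lambda>x. f x - \<phi> x))\<^sup>2" if "f \<in> fdom D" "\<phi> \<in> fdom D" for \<phi>
    using that by (simp add: E1.N_square E.mem)
  { assume f: "f \<in> part_closure D U"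
    have "\<exists>\<phi>\<in>core U. E1.N (\<lambda>x. f x - \<phi> x) < e" if e: "0 < e" for e
    proof -
      have "0 < e\<^sup>2" using e by simp
      then obtain \<phi> where p: "\<phi> \<in> core U" "sqnormE1 D (\<lambda>x. f x - \<phi> x) < e\<^sup>2"
        using f unfolding part_closure_def core_def supp_def by blast
      thus ?thesis using sq[of \<phi>] f e coreD(1)[OF p(1)]
        by (intro bexI[of _ \<phi>]) (auto simp: part_closure_def intro: power2_less_imp_less)
    qed
    thus "f \<in> ?R" using f by (auto simp: part_closure_def) }
  { assume f: "f \<in> ?R"
    have "\<exists>\<phi>\<in>core U. sqnormE1 D (\<lambda>x. f x - \<phi> x) < e" if e: "0 < e" for e
    proof -
      have "0 < sqrt e" using e by simp
      then obtain \<phi> where p: "\<phi> \<in> core U" "E1.N (\<lambda>x. f x - \<phi> x) < sqrt e" using f by blast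
      have "(E1.N (\<lambda>x. f x - \<phi> x))\<^sup>2 < (sqrt e)\<^sup>2"
        using p f by (intro power_strict_mono E1.N_nonneg E.mem) (auto dest: coreD)
      thus ?thesis using sq[of \<phi>] f e coreD(1)[OF p(1)] p(1) by (intro bexI[of _ \<phi>]) auto
    qed
    thus "f \<in> part_closure D U" using f unfolding part_closure_def core_def supp_def by blast }
qed

lemma core_subset_part: "core U \<subseteq> part_closure D U"
proof
  fix f assume "f \<in> core U"
  moreover have "E1d f f = 0" using E1.N_scale[of f 0] coreD(1)[OF calculation] by simp
  ultimately show "f \<in> part_closure D U" unfolding part_closure_alt
    by (auto dest: coreD(1) intro!: bexI[of _ f])
qed

lemma part_closure_limit:
  assumes f: "f \<in> fdom D" and u: "\<And>n::nat. u n \<in> part_closure D U" and l: "(\<lambda>n. E1d (u n) f) \<longlonglongrightarrow> 0"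
  shows "f \<in> part_closure D U"
  unfolding part_closure_alt
proof (intro CollectI conjI allI impI f)
  fix e :: real assume e: "0 < e"
  have "\<forall>\<^sub>F n in sequentially. E1d (u n) f < e / 2" using order_tendstoD(2)[OF l, of "e/2"] e by simp
  then obtain n where n: "E1d (u n) f < e / 2" by (auto simp: eventually_sequentially)
  have uF: "u n \<in> fdom D" using u[of n] by (simp add: part_closure_def)
  obtain \<phi> where p: "\<phi> \<in> core U" "E1.N (\<lambda>x. u n x - \<phi> x) < e / 2"
    using u[of n] e unfolding part_closure_alt by (auto dest!: spec[of _ "e/2"])
  note pF = coreD(1)[OF p(1)]
  show "\<exists>\<phi>\<in>core U. E1.N (\<lambda>x. f x - \<phi> x) < e"
    using E1.N_diff_triangle[OF f uF pF] E1.N_diff_commute[OF f uF] n p by (intro bexI[of _ \<phi>]) auto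
qed

lemma part_closure_lin:
  assumes f: "f \<in> part_closure D U" and g: "g \<in> part_closure D U"
  shows "(\<lambda>x. a * f x + b * g x) \<in> part_closure D U"
proof -
  have fF: "f \<in> fdom D" and gF: "g \<in> fdom D" using f g by (auto simp: part_closure_def)
  have "\<exists>\<phi>\<in>core U. E1.N (\<lambda>x. h x - \<phi> x) < 1 / real (Suc n)" if h: "h \<in> part_closure D U" for h n
    using h[unfolded part_closure_alt] by auto
  then obtain p q where p: "\<And>n. p n \<in> core U" "\<And>n. E1d f (p n) < 1 / real (Suc n)"
    and q: "\<And>n. q n \<in> core U" "\<And>n. E1d g (q n) < 1 / real (Suc n)" using f g by metis
  show ?thesis
  proof (rule part_closure_limit[OF E.lin_mem[OF fF gF]])
    show "(\<lambda>x. a * p n x + b * q n x) \<in> part_closure D U" for n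
      using core_lin[OF p(1) q(1)] core_subset_part by blast
    show "(\<lambda>n. E1.N (\<lambda>x. a * p n x + b * q n x - (a * f x + b * g x))) \<longlonglongrightarrow> 0"
    proof (rule Lim_null_comparison)
      have "(\<lambda>n. (\<bar>a\<bar> + \<bar>b\<bar>) * (1 / real (Suc n))) \<longlonglongrightarrow> 0"
        by (intro tendsto_mult_right_zero) (use LIMSEQ_inverse_real_of_nat in \<open>simp add: inverse_eq_divide\<close>)
      thus "(\<lambda>n. (\<bar>a\<bar> + \<bar>b\<bar>) * (1 / real (Suc n))) \<longlonglongrightarrow> 0" .
      have "E1.N (\<lambda>x. a * p n x + b * q n x - (a * f x + b * g x)) \<le> (\<bar>a\<bar> + \<bar>b\<bar>) * (1 / real (Suc n))" for n
      proof -
        note pF = coreD(1)[OF p(1)[of n]] and qF = coreD(1)[OF q(1)[of n]]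
        have d: "(\<lambda>x. f x - p n x) \<in> fdom D" "(\<lambda>x. g x - q n x) \<in> fdom D" by (intro E.mem fF gF pF qF)+
        have e: "(\<lambda>x. a * p n x + b * q n x - (a * f x + b * g x)) = (\<lambda>x. (- a) * (f x - p n x) + (- b) * (g x - q n x))"
          by (simp add: fun_eq_iff algebra_simps)
        have "E1.N (\<lambda>x. a * p n x + b * q n x - (a * f x + b * g x))
            \<le> \<bar>a\<bar> * E1d f (p n) + \<bar>b\<bar> * E1d g (q n)"
          unfolding e using E1.N_triangle[OF E.scale_mem[OF d(1), of "-a"] E.scale_mem[OF d(2), of "-b"]]
          unfolding E1.N_scale[OF d(1)] E1.N_scale[OF d(2)] by simp
        also have "\<dots> \<le> \<bar>a\<bar> * (1 / real (Suc n)) + \<bar>b\<bar> * (1 / real (Suc n))"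
          by (intro add_mono mult_left_mono) (use less_imp_le[OF p(2)[of n]] less_imp_le[OF q(2)[of n]] in auto)
        finally show ?thesis by (simp only: distrib_right)
      qed
      thus "\<forall>\<^sub>F n in sequentially. norm (E1.N (\<lambda>x. a * p n x + b * q n x - (a * f x + b * g x))) \<le> (\<bar>a\<bar> + \<bar>b\<bar>) * (1 / real (Suc n))"
        using E1.N_nonneg[OF E.diff_mem[OF E.lin_mem[OF coreD(1)[OF p(1)] coreD(1)[OF q(1)]] E.lin_mem[OF fF gF]]] by simp
    qed
  qed
qed

text \<open>A closed convex set is closed under L2 limits of sequences with bounded energy. This
  substitutes for the continuity in the form norm of lattice operations and contractions.\<close>

lemma part_closure_weak:
  assumes u: "\<And>n::nat. u n \<in> part_closure D U" and bd: "\<And>n. E.N (u n) \<le> C"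
    and g: "g \<in> L2 M" and l: "l2_tendsto M u g"
  shows "g \<in> part_closure D U"
proof -
  have mid: "(\<lambda>x. p x / 2 + q x / 2) \<in> part_closure D U" if "p \<in> part_closure D U" "q \<in> part_closure D U" for p q
    using part_closure_lin[OF that, of "1/2" "1/2"] by simp
  obtain v where "g \<in> fdom D" "\<And>n::nat. v n \<in> part_closure D U" "(\<lambda>n. E1d (v n) g) \<longlonglongrightarrow> 0"
    by (rule weak_limit[of "part_closure D U" u, OF _ mid u bd g l]) (auto simp: part_closure_def)
  thus ?thesis by (rule part_closure_limit)
qed

text \<open>Approximants of \<open>w\<close> are clamped between 0 and the positive part of
  \<open>\<phi>\<close>, which puts them into the core. Clamping keeps the energy bounded and does
  not increase the L2 error, so weak closedness applies.\<close>

lemma part_closure_below_core: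
  assumes w: "w \<in> fdom D" and \<phi>: "\<phi> \<in> core U" and le: "AE x in M. 0 \<le> w x \<and> w x \<le> \<phi> x"
  shows "w \<in> part_closure D U"
proof -
  note pF = coreD(1)[OF \<phi>]
  have "\<exists>p\<in>fdom D \<inter> C_c X. sqnormE1 D (\<lambda>x. w x - p x) < e" if "0 < e" for e
    using regular[unfolded regular_form_def, THEN conjunct2, THEN bspec, OF w, THEN spec, of e] that by simp
  hence "\<exists>p\<in>fdom D \<inter> C_c X. sqnormE1 D (\<lambda>x. w x - p x) < (1 / real (Suc n))\<^sup>2" for n by simp
  hence "\<exists>p. p \<in> fdom D \<and> p \<in> C_c X \<and> sqnormE1 D (\<lambda>x. w x - p x) < (1 / real (Suc n))\<^sup>2" for n
    by blast
  then obtain p where p: "\<And>n. p n \<in> fdom D" "\<And>n. p n \<in> C_c X" "\<And>n. sqnormE1 D (\<lambda>x. w x - p n x) < (1 / real (Suc n))\<^sup>2"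
    by metis
  have pn: "E1d (p n) w < 1 / real (Suc n)" for n
  proof -
    have "(E1d w (p n))\<^sup>2 < (1 / real (Suc n))\<^sup>2"
      using p(3)[of n] by (simp add: E1.N_square E.mem w p(1))
    hence "E1d w (p n) < 1 / real (Suc n)" by (rule power2_less_imp_less) simp
    thus ?thesis using E1.N_diff_commute[OF w p(1)] by simp
  qed
  have pl: "(\<lambda>n. E1d (p n) w) \<longlonglongrightarrow> 0"
  proof (rule Lim_null_comparison)
    show "(\<lambda>n. 1 / real (Suc n)) \<longlonglongrightarrow> 0" using LIMSEQ_inverse_real_of_nat by (simp add: inverse_eq_divide)
    show "\<forall>\<^sub>F n in sequentially. norm (E1d (p n) w) \<le> 1 / real (Suc n)"
      using pn by (auto intro!: always_eventually less_imp_le simp: E.mem w p(1))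
  qed
  let ?q = "\<lambda>n x. min (max (p n x) 0) (max (\<phi> x) 0)"
  have mF: "(\<lambda>x. max (p n x) 0) \<in> fdom D" "(\<lambda>x. max (\<phi> x) 0) \<in> fdom D" for n by (intro max0_mem p(1) pF)+
  have qF: "?q n \<in> fdom D" for n by (rule min_mem[OF mF])
  have q: "?q n \<in> core U" for n
  proof (rule core_dominated[OF \<phi> qF])
    show "?q n \<in> C_space X" using p(2)[of n] coreD(2)[OF \<phi>]
      by (auto simp: C_c_alt C_space_def intro!: continuous_map_real_min continuous_map_real_max)
  qed auto
  have "(\<lambda>n. E.N (p n)) \<longlonglongrightarrow> E.N w" by (rule E.N_tendsto_N[OF p(1) w E1_tendsto_E[OF p(1) w pl]])
  then obtain C where C: "\<And>n. \<bar>E.N (p n)\<bar> \<le> C" by (metis convergentI Bseq_def convergent_imp_Bseq real_norm_def)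
  show ?thesis
  proof (rule part_closure_weak[of ?q])
    show "?q n \<in> part_closure D U" for n using q core_subset_part by blast
    show "E.N (?q n) \<le> C + E.N \<phi>" for n
      using min_N[OF mF(1)[of n] mF(2)] max0_N[OF p(1)[of n]] max0_N[OF pF] C[of n] by linarith
    show "l2_tendsto M ?q w"
    proof (rule Lim_null_comparison[OF _ E1_tendsto_l2n[OF p(1) w pl]], rule always_eventually, rule allI)
      fix n
      have "AE x in M. \<bar>?q n x - w x\<bar> \<le> \<bar>p n x - w x\<bar>"
        using le by eventually_elim (auto simp: min_def max_def)
      hence "l2d M (?q n) w \<le> l2d M (p n) w"
        by (intro l2n_mono_AE L2_measurable[of _ M] L2.mem fdom_L2 w p(1) qF)
      thus "norm (l2d M (?q n) w) \<le> l2d M (p n) w" by simp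
    qed
  qed (rule fdom_L2[OF w])
qed

text \<open>The minimum of \<open>w\<close> with the positive part of a core approximant of
  \<open>u\<close> falls under the preceding case. As an order ideal, the part closure admits
  positive parts of differences as test functions on \<open>U\<close>.\<close>

lemma part_closure_ideal:
  assumes w: "w \<in> fdom D" and u: "u \<in> part_closure D U" and le: "AE x in M. 0 \<le> w x \<and> w x \<le> u x"
  shows "w \<in> part_closure D U"
proof -
  have uF: "u \<in> fdom D" using u by (simp add: part_closure_def)
  have "\<exists>\<phi>\<in>core U. E1.N (\<lambda>x. u x - \<phi> x) < 1 / real (Suc n)" for n using u[unfolded part_closure_alt] by auto
  then obtain p where p: "\<And>n. p n \<in> core U" "\<And>n. E1d u (p n) < 1 / real (Suc n)" by metis
  note pF = coreD(1)[OF p(1)]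
  have pl: "(\<lambda>n. E1d (p n) u) \<longlonglongrightarrow> 0"
  proof (rule Lim_null_comparison)
    show "(\<lambda>n. 1 / real (Suc n)) \<longlonglongrightarrow> 0" using LIMSEQ_inverse_real_of_nat by (simp add: inverse_eq_divide)
    show "\<forall>\<^sub>F n in sequentially. norm (E1d (p n) u) \<le> 1 / real (Suc n)"
      using p(2) E1.N_diff_commute[OF uF pF] by (auto intro!: always_eventually less_imp_le simp: E.mem uF pF)
  qed
  have "(\<lambda>n. E.N (p n)) \<longlonglongrightarrow> E.N u" by (rule E.N_tendsto_N[OF pF uF E1_tendsto_E[OF pF uF pl]])
  then obtain C where C: "\<And>n. \<bar>E.N (p n)\<bar> \<le> C" by (metis convergentI Bseq_def convergent_imp_Bseq real_norm_def)
  let ?q = "\<lambda>n x. min (w x) (max (p n x) 0)"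
  have mF: "(\<lambda>x. max (p n x) 0) \<in> core U" for n
    by (rule core_dominated[OF p(1)[of n] max0_mem[OF pF]])
      (use coreD(2)[OF p(1)[of n]] in \<open>auto simp: C_space_def intro!: continuous_map_real_max\<close>)
  have qF: "?q n \<in> fdom D" for n by (intro min_mem w coreD(1)[OF mF])
  show ?thesis
  proof (rule part_closure_weak[of ?q])
    show "?q n \<in> part_closure D U" for n
    proof (rule part_closure_below_core[OF qF mF])
      show "AE x in M. 0 \<le> ?q n x \<and> ?q n x \<le> max (p n x) 0" using le by eventually_elim auto
    qed
    show "E.N (?q n) \<le> E.N w + C" for n
      using min_N[OF w coreD(1)[OF mF[of n]]] max0_N[OF pF[of n]] C[of n] by linarith
    show "l2_tendsto M ?q w"
    proof (rule Lim_null_comparison[OF _ E1_tendsto_l2n[OF pF uF pl]], rule always_eventually, rule allI)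
      fix n
      have "AE x in M. \<bar>?q n x - w x\<bar> \<le> \<bar>p n x - u x\<bar>"
        using le by eventually_elim (auto simp: min_def max_def)
      hence "l2d M (?q n) w \<le> l2d M (p n) u"
        by (intro l2n_mono_AE L2_measurable[of _ M] L2.mem fdom_L2 w uF pF qF)
      thus "norm (l2d M (?q n) w) \<le> l2d M (p n) u" by simp
    qed
  qed (rule fdom_L2[OF w])
qed

end

section \<open>The part of a Dirichlet space on an open set\<close>

lemma zero_ext_lin: "zero_ext U (\<lambda>x. a * u x + b * v x) = (\<lambda>x. a * zero_ext U u x + b * zero_ext U v x)"
  by (simp add: zero_ext_def fun_eq_iff)

lemma zero_ext_diff: "zero_ext U (\<lambda>x. u x - v x) = (\<lambda>x. zero_ext U u x - zero_ext U v x)"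
  by (simp add: zero_ext_def fun_eq_iff)

lemma zero_ext_zero_ext: "zero_ext U (zero_ext W u) = zero_ext (U \<inter> W) u"
  by (simp add: zero_ext_def fun_eq_iff)

lemma part_space_simps [simp]:
  "topo (part_space D U) = subtopology (topo D) U"
  "meas (part_space D U) = restrict_space (meas D) U"
  "form (part_space D U) u v = form D (zero_ext U u) (zero_ext U v)"
  "u \<in> fdom (part_space D U) \<longleftrightarrow> zero_ext U u \<in> part_closure D U"
  by (simp_all add: part_space_def)

context dspace
begin

lemma part_mem: "u \<in> part_closure D U \<Longrightarrow> u \<in> fdom D"
  by (simp add: part_closure_def)

lemma part_closure_approx:
  assumes "u \<in> part_closure D U"
  obtains p C where "\<And>n::nat. p n \<in> core U" "(\<lambda>n. E1d (p n) u) \<longlonglongrightarrow> 0" "\<And>n. E.N (p n) \<le> C"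
proof -
  note uF = part_mem[OF assms]
  have "\<exists>\<phi>\<in>core U. E1.N (\<lambda>x. u x - \<phi> x) < 1 / real (Suc n)" for n using assms[unfolded part_closure_alt] by auto
  then obtain p where p: "\<And>n. p n \<in> core U" "\<And>n. E1d u (p n) < 1 / real (Suc n)" by metis
  note pF = coreD(1)[OF p(1)]
  have pl: "(\<lambda>n. E1d (p n) u) \<longlonglongrightarrow> 0"
  proof (rule Lim_null_comparison)
    show "(\<lambda>n. 1 / real (Suc n)) \<longlonglongrightarrow> 0" using LIMSEQ_inverse_real_of_nat by (simp add: inverse_eq_divide)
    show "\<forall>\<^sub>F n in sequentially. norm (E1d (p n) u) \<le> 1 / real (Suc n)"
      using p(2) E1.N_diff_commute[OF uF pF] by (auto intro!: always_eventually less_imp_le simp: E.mem uF pF)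
  qed
  have "(\<lambda>n. E.N (p n)) \<longlonglongrightarrow> E.N u" by (rule E.N_tendsto_N[OF pF uF E1_tendsto_E[OF pF uF pl]])
  then obtain C where C: "\<And>n. \<bar>E.N (p n)\<bar> \<le> C" by (metis convergentI Bseq_def convergent_imp_Bseq real_norm_def)
  show thesis by (rule that[OF p(1) pl, of C]) (use C in \<open>auto dest: abs_le_D1\<close>)
qed

lemma part_closure_cong_AE:
  assumes u: "u \<in> part_closure D U" and v: "v \<in> borel_measurable M" and eq: "AE x in M. u x = v x"
  shows "v \<in> part_closure D U"
proof -
  note uF = part_mem[OF u]
  obtain p C where p: "\<And>n::nat. p n \<in> core U" "(\<lambda>n. E1d (p n) u) \<longlonglongrightarrow> 0"
    using part_closure_approx[OF u] by metis
  have vF: "v \<in> fdom D" by (rule fdom_cong_AE[OF uF v eq])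
  have "E1d (p n) u = E1d (p n) v" for n
    by (rule E1_N_cong_AE) (use eq in \<open>auto intro: E.mem coreD(1)[OF p(1)] uF vF\<close>)
  with p(2) show ?thesis
    by (intro part_closure_limit[OF vF, of p]) (use p(1) core_subset_part in auto)
qed

lemma core_zero: "\<phi> \<in> core U \<Longrightarrow> x \<in> topspace X \<Longrightarrow> x \<notin> U \<Longrightarrow> \<phi> x = 0"
  using supp_zero[of x \<phi>] coreD(4)[of \<phi> U] by blast

lemma part_closure_zero:
  assumes u: "u \<in> part_closure D U"
  shows "AE x in M. x \<notin> U \<longrightarrow> u x = 0"
proof -
  obtain p C where p: "\<And>n::nat. p n \<in> core U" "(\<lambda>n. E1d (p n) u) \<longlonglongrightarrow> 0"
    using part_closure_approx[OF u] by metis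
  note pF = coreD(1)[OF p(1)] and uF = part_mem[OF u]
  obtain r where r: "strict_mono r" "AE x in M. (\<lambda>n. p (r n) x) \<longlonglongrightarrow> u x"
    using L2_tendsto_AE_subseq[OF fdom_L2[OF pF] fdom_L2[OF uF] E1_tendsto_l2n[OF pF uF p(2)]] by metis
  from r(2) AE_space show ?thesis
  proof eventually_elim
    case (elim x)
    show ?case
    proof
      assume "x \<notin> U"
      hence "(\<lambda>n. p (r n) x) = (\<lambda>n. 0)" using core_zero[OF p(1)] elim(2) by (simp add: space_M)
      with elim(1) show "u x = 0" by (simp add: LIMSEQ_const_iff)
    qed
  qed
qed

lemma part_closure_contraction:
  fixes T :: "real \<Rightarrow> real"
  assumes T: "T 0 = 0" "\<And>s t. \<bar>T s - T t\<bar> \<le> \<bar>s - t\<bar>" and u: "u \<in> part_closure D U"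
  shows "(\<lambda>x. T (u x)) \<in> part_closure D U"
proof -
  note uF = part_mem[OF u]
  obtain p C where p: "\<And>n::nat. p n \<in> core U" "(\<lambda>n. E1d (p n) u) \<longlonglongrightarrow> 0" "\<And>n. E.N (p n) \<le> C"
    using part_closure_approx[OF u] by metis
  note pF = coreD(1)[OF p(1)]
  have Tc: "continuous_on UNIV T"
  proof (rule continuous_onI)
    fix x e :: real assume "0 < e"
    moreover have "\<bar>T y - T x\<bar> \<le> e" if "\<bar>y - x\<bar> < e" for y using T(2)[of y x] that by linarith
    ultimately show "\<exists>d>0. \<forall>y\<in>UNIV. dist y x < d \<longrightarrow> dist (T y) (T x) \<le> e" by (auto simp: dist_real_def)
  qed
  have TF: "(\<lambda>x. T (p n x)) \<in> fdom D" for n by (rule contraction(1)[OF T pF])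
  show ?thesis
  proof (rule part_closure_weak[of "\<lambda>n x. T (p n x)"])
    show "(\<lambda>x. T (p n x)) \<in> part_closure D U" for n
    proof -
      have "continuous_map X euclideanreal (T \<circ> p n)"
        using coreD(2)[OF p(1)[of n]] Tc by (intro continuous_map_compose) (auto simp: C_space_def)
      hence "(\<lambda>x. T (p n x)) \<in> core U"
        by (intro core_dominated[OF p(1)[of n] TF]) (auto simp: C_space_def o_def T(1))
      thus ?thesis using core_subset_part by blast
    qed
    show "E.N (\<lambda>x. T (p n x)) \<le> C" for n using contraction_N[OF T pF[of n]] p(3)[of n] by simp
    show "(\<lambda>x. T (u x)) \<in> L2 M" by (rule fdom_L2[OF contraction(1)[OF T uF]])
    show "(\<lambda>n. l2n M (\<lambda>x. T (p n x) - T (u x))) \<longlonglongrightarrow> 0"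
    proof (rule Lim_null_comparison[OF _ E1_tendsto_l2n[OF pF uF p(2)]], rule always_eventually, rule allI)
      fix n
      have "l2n M (\<lambda>x. T (p n x) - T (u x)) \<le> l2d M (p n) u"
        by (intro l2n_mono_AE L2_measurable[of _ M] L2.mem fdom_L2 uF pF TF contraction(1)[OF T uF] AE_I2 T(2))
      thus "norm (l2n M (\<lambda>x. T (p n x) - T (u x))) \<le> l2d M (p n) u" by simp
    qed
  qed
qed


section \<open>Density of the core in \<open>L2\<close>\<close>

definition core_L2 :: "'a set \<Rightarrow> ('a \<Rightarrow> real) set" where
  "core_L2 U = {f \<in> L2 M. \<forall>e>0. \<exists>\<phi>\<in>core U. l2n M (\<lambda>x. f x - \<phi> x) < e}"

lemma core_L2_limit:
  assumes f: "f \<in> L2 M" and g: "\<And>e. 0 < e \<Longrightarrow> \<exists>g\<in>core_L2 U. l2d M f g < e"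
  shows "f \<in> core_L2 U"
  unfolding core_L2_def
proof (intro CollectI conjI f allI impI)
  fix e :: real assume "0 < e"
  then obtain g where g: "g \<in> core_L2 U" "l2d M f g < e / 2" using assms(2)[of "e/2"] by auto
  then obtain \<phi> where p: "\<phi> \<in> core U" "l2n M (\<lambda>x. g x - \<phi> x) < e / 2"
    using \<open>0 < e\<close> unfolding core_L2_def by (auto dest!: spec[of _ "e/2"])
  show "\<exists>\<phi>\<in>core U. l2n M (\<lambda>x. f x - \<phi> x) < e"
    using L2.N_diff_triangle[OF f _ fdom_L2[OF coreD(1)[OF p(1)]], of g] g p
    by (intro bexI[of _ \<phi>]) (auto simp: core_L2_def)
qed

lemma core_L2_lin:
  assumes f: "f \<in> core_L2 U" and g: "g \<in> core_L2 U"
  shows "(\<lambda>x. a * f x + b * g x) \<in> core_L2 U"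
  unfolding core_L2_def
proof (intro CollectI conjI allI impI)
  have fL: "f \<in> L2 M" and gL: "g \<in> L2 M" using f g by (auto simp: core_L2_def)
  show "(\<lambda>x. a * f x + b * g x) \<in> L2 M" by (rule L2_lin[OF fL gL])
  fix e :: real assume e: "0 < e"
  define d where "d = e / (\<bar>a\<bar> + \<bar>b\<bar> + 1)"
  have d: "0 < d" "(\<bar>a\<bar> + \<bar>b\<bar>) * d < e" using e by (auto simp: d_def field_simps)
  obtain p q where p: "p \<in> core U" "l2d M f p < d" and q: "q \<in> core U" "l2d M g q < d"
    using f g d(1) unfolding core_L2_def by blast
  have df: "(\<lambda>x. f x - p x) \<in> L2 M" and dg: "(\<lambda>x. g x - q x) \<in> L2 M"
    by (intro L2.mem fL gL fdom_L2[OF coreD(1)[OF p(1)]] fdom_L2[OF coreD(1)[OF q(1)]])+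
  have eq: "(\<lambda>x. a * f x + b * g x - (a * p x + b * q x)) = (\<lambda>x. a * (f x - p x) + b * (g x - q x))"
    by (simp add: fun_eq_iff algebra_simps)
  have "l2n M (\<lambda>x. a * f x + b * g x - (a * p x + b * q x)) \<le> \<bar>a\<bar> * l2d M f p + \<bar>b\<bar> * l2d M g q"
    unfolding eq using L2.N_triangle[OF L2.scale_mem[OF df, of a] L2.scale_mem[OF dg, of b]]
    unfolding L2.N_scale[OF df] L2.N_scale[OF dg] .
  also have "\<dots> \<le> \<bar>a\<bar> * d + \<bar>b\<bar> * d" by (intro add_mono mult_left_mono) (use p q in auto)
  also have "\<dots> < e" using d(2) by (simp add: distrib_right)
  finally show "\<exists>\<phi>\<in>core U. l2n M (\<lambda>x. a * f x + b * g x - \<phi> x) < e"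
    by (intro bexI[of _ "\<lambda>x. a * p x + b * q x"] core_lin p q)
qed

lemma l2n_indicator: "A \<in> sets M \<Longrightarrow> emeasure M A < \<infinity> \<Longrightarrow> l2n M (indicat_real A) = sqrt (measure M A)"
  by (simp add: l2n_def sqnorm2_def power2_eq_square indicator_inter_arith[symmetric])

lemma indicator_L2: "A \<in> sets M \<Longrightarrow> emeasure M A < \<infinity> \<Longrightarrow> indicat_real A \<in> L2 M"
  by (simp add: L2_def power2_eq_square indicator_inter_arith[symmetric])

lemma inner_approx:
  assumes A: "A \<in> sets M" "emeasure M A < \<infinity>" and e: "0 < e"
  obtains K where "compactin X K" "K \<subseteq> A" "measure M (A - K) < e"
proof -
  have "emeasure M A = (SUP K\<in>{K. compactin X K \<and> K \<subseteq> A}. emeasure M K)" by (rule inner_regular[OF A(1)])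
  show thesis
  proof (cases "measure M A < e")
    case True
    thus thesis using that[of "{}"] by simp
  next
    case False
    hence "ennreal (measure M A - e) < emeasure M A"
      using A e by (simp add: emeasure_eq_ennreal_measure ennreal_less_iff)
    then obtain K where K: "compactin X K" "K \<subseteq> A" "ennreal (measure M A - e) < emeasure M K"
      unfolding inner_regular[OF A(1)] by (auto simp: less_SUP_iff)
    have Kf: "emeasure M K < \<infinity>" by (rule compact_finite[OF K(1)])
    have "measure M (A - K) = measure M A - measure M K"
      using A Kf K compact_sets by (intro measure_Diff) (auto simp: less_top)
    moreover have "measure M A - e < measure M K"
      using K(3) Kf False by (simp add: emeasure_eq_ennreal_measure less_top ennreal_less_iff)
    ultimately show thesis using that[OF K(1,2)] by simp
  qed
qed

text \<open>Outer approximation of \<open>K\<close> is obtained from inner regularity: a compact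
  \<open>C\<close> fills \<open>W - K\<close> up to measure \<open>e\<^sup>2\<close>, and a cutoff
  supported in \<open>W - C\<close> differs from the indicator of \<open>K\<close> only on the small
  rest.\<close>

lemma compact_core_L2:
  assumes K: "compactin X K" and U: "openin X U" and KU: "K \<subseteq> U"
  shows "indicat_real K \<in> core_L2 U"
  unfolding core_L2_def
proof (intro CollectI conjI allI impI)
  show IL: "indicat_real K \<in> L2 M" by (intro indicator_L2 compact_sets compact_finite K)
  fix e :: real assume e: "0 < e"
  obtain W where W: "openin X W" "K \<subseteq> W" "compactin X (X closure_of W)" "X closure_of W \<subseteq> U"
    by (rule compact_nbhd[OF assms], rule that)
  have "emeasure M W \<le> emeasure M (X closure_of W)"
    by (intro emeasure_mono closure_of_subset openin_subset W(1) compact_sets W(3))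
  hence Wf: "emeasure M W < \<infinity>" using compact_finite[OF W(3)] by simp
  have "emeasure M (W - K) \<le> emeasure M W" by (intro emeasure_mono open_sets W) auto
  hence "emeasure M (W - K) < \<infinity>" using Wf by simp
  moreover have "0 < e\<^sup>2" using e by simp
  ultimately obtain C where C: "compactin X C" "C \<subseteq> W - K" "measure M (W - K - C) < e\<^sup>2"
    using inner_approx[of "W - K" "e\<^sup>2"] open_sets[OF W(1)] compact_sets[OF K] by blast
  have V: "openin X (W - C)" "K \<subseteq> W - C" using W C compact_closed[OF C(1)] by (auto intro: openin_diff)
  obtain \<eta> where k: "\<eta> \<in> fdom D" "\<eta> \<in> C_c X" "supp \<eta> \<subseteq> W - C"
    "\<And>x. x \<in> topspace X \<Longrightarrow> 0 \<le> \<eta> x \<and> \<eta> x \<le> 1" "\<And>x. x \<in> K \<Longrightarrow> \<eta> x = 1"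
    by (rule cutoff[OF K V], rule that)
  have WU: "W \<subseteq> U" using closure_of_subset[OF openin_subset[OF W(1)]] W(4) by blast
  have c: "\<eta> \<in> core U" using k WU by (auto simp: core_def)
  let ?A = "W - K - C"
  have Am: "?A \<in> sets M" using open_sets[OF W(1)] compact_sets[OF K] compact_sets[OF C(1)] by auto
  have "emeasure M ?A \<le> emeasure M W" by (intro emeasure_mono open_sets W) auto
  hence Af: "emeasure M ?A < \<infinity>" using Wf by simp
  have "l2n M (\<lambda>x. indicat_real K x - \<eta> x) \<le> l2n M (indicat_real ?A)"
  proof (rule l2n_mono_AE[OF indicator_L2[OF Am Af]])
    show "(\<lambda>x. indicat_real K x - \<eta> x) \<in> borel_measurable M"
      by (intro L2_measurable[of _ M] L2.mem IL fdom_L2 k)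
    have "\<bar>indicat_real K x - \<eta> x\<bar> \<le> \<bar>indicat_real ?A x\<bar>" if x: "x \<in> topspace X" for x
    proof (cases "x \<in> K")
      case False
      show ?thesis
      proof (cases "x \<in> ?A")
        case True thus ?thesis using k(4)[OF x] False by auto
      next
        case nA: False
        hence "x \<notin> supp \<eta>" using k(3) False by blast
        from supp_zero[OF x this] False show ?thesis by simp
      qed
    qed (simp add: k(5))
    thus "AE x in M. \<bar>indicat_real K x - \<eta> x\<bar> \<le> \<bar>indicat_real ?A x\<bar>" by (auto simp: space_M intro!: AE_I2)
  qed
  also have "\<dots> < e"
    unfolding l2n_indicator[OF Am Af] using C(3) e by (intro real_sqrt_less_mono[THEN less_le_trans, of _ "e\<^sup>2"]) auto
  finally show "\<exists>\<phi>\<in>core U. l2n M (\<lambda>x. indicat_real K x - \<phi> x) < e" using c by blast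
qed

lemma finite_core_L2:
  assumes A: "A \<in> sets M" "emeasure M A < \<infinity>" and U: "openin X U" and AU: "A \<subseteq> U"
  shows "indicat_real A \<in> core_L2 U"
proof (rule core_L2_limit[OF indicator_L2[OF A]])
  fix e :: real assume e: "0 < e"
  hence "0 < e\<^sup>2" by simp
  then obtain K where K: "compactin X K" "K \<subseteq> A" "measure M (A - K) < e\<^sup>2" using inner_approx[OF A] by blast
  have B: "A - K \<in> sets M" using A compact_sets[OF K(1)] by auto
  have "emeasure M (A - K) \<le> emeasure M A" by (intro emeasure_mono A) auto
  hence Bf: "emeasure M (A - K) < \<infinity>" using A by simp
  have "(\<lambda>x. indicat_real A x - indicat_real K x) = indicat_real (A - K)"
    using K(2) by (auto simp: fun_eq_iff indicator_def)
  hence "l2d M (indicat_real A) (indicat_real K) = sqrt (measure M (A - K))"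
    by (simp add: l2n_indicator[OF B Bf])
  also have "\<dots> < e" using K(3) e by (intro real_sqrt_less_mono[THEN less_le_trans, of _ "e\<^sup>2"]) auto
  finally show "\<exists>g\<in>core_L2 U. l2d M (indicat_real A) g < e"
    using compact_core_L2[OF K(1) U] K(2) AU by blast
qed

lemma core_dense_L2:
  assumes U: "openin X U" and f: "f \<in> L2 M" and z: "\<And>x. x \<in> topspace X \<Longrightarrow> x \<notin> U \<Longrightarrow> f x = 0"
  shows "f \<in> core_L2 U"
proof (rule core_L2_limit[OF f])
  fix e :: real assume e: "0 < e"
  \<comment> \<open>The bound by twice the absolute value of \<open>f\<close> makes
    \<open>F i\<close> vanish wherever \<open>f\<close> does, in particular off \<open>U\<close>,
    and gives its nonzero levels finite measure.\<close>
  obtain F where F: "\<And>i::nat. simple_function M (F i)" "\<And>x. x \<in> space M \<Longrightarrow> (\<lambda>i. F i x) \<longlonglongrightarrow> f x"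
    "\<And>i x. x \<in> space M \<Longrightarrow> dist (F i x) 0 \<le> 2 * dist (f x) 0"
    using borel_measurable_implies_sequence_metric[OF L2_measurable[OF f], of 0] by blast
  have Fm: "F i \<in> borel_measurable M" for i by (rule borel_measurable_simple_function[OF F(1)])
  have Fb: "\<bar>F i x\<bar> \<le> 2 * \<bar>f x\<bar>" if "x \<in> space M" for i x using F(3)[OF that, of i] by simp
  have f2: "(\<lambda>x. 2 * \<bar>f x\<bar>) \<in> L2 M" by (intro L2.mem L2_abs f)
  have FL: "F i \<in> L2 M" for i by (rule L2_bound[OF f2 Fm]) (use Fb in \<open>auto intro!: AE_I2\<close>)
  have "l2_tendsto M F f"
    by (rule L2_dominated(2)[OF Fm L2_measurable[OF f] f2]) (use Fb F(2) in \<open>auto intro!: AE_I2\<close>)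
  from order_tendstoD(2)[OF this e] obtain i where "l2d M (F i) f < e"
    by (auto simp: eventually_sequentially)
  hence i: "l2d M f (F i) < e" using L2.N_diff_commute[OF f FL] by simp
  let ?R = "F i ` space M"
  let ?A = "\<lambda>y. F i -` {y} \<inter> space M"
  have piece: "(\<lambda>x. y * indicat_real (?A y) x) \<in> core_L2 U" if y: "y \<in> ?R" for y
  proof (cases "y = 0")
    case True
    have "(\<lambda>x. 0 * indicat_real {} x + 0 * indicat_real {} x) \<in> core_L2 U"
      by (intro core_L2_lin compact_core_L2 U) auto
    thus ?thesis using True by simp
  next
    case False
    have Am: "?A y \<in> sets M" using simple_functionD(2)[OF F(1)] .
    have "integrable M (\<lambda>x. (F i x)\<^sup>2)" by (rule L2_integrable_sq[OF FL])
    hence "(\<integral>\<^sup>+x. ennreal ((F i x)\<^sup>2) \<partial>M) < \<infinity>" by (simp add: integrable_iff_bounded)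
    moreover have "ennreal (y\<^sup>2) * emeasure M (?A y) = (\<integral>\<^sup>+x. ennreal (y\<^sup>2) * indicator (?A y) x \<partial>M)"
      using Am by (simp add: nn_integral_cmult_indicator)
    moreover have "\<dots> \<le> (\<integral>\<^sup>+x. ennreal ((F i x)\<^sup>2) \<partial>M)"
      by (intro nn_integral_mono) (auto simp: indicator_def)
    ultimately have "ennreal (y\<^sup>2) * emeasure M (?A y) < \<infinity>" by simp
    hence Af: "emeasure M (?A y) < \<infinity>" using False by (auto simp: ennreal_mult_less_top less_top)
    have AU: "?A y \<subseteq> U"
    proof
      fix x assume x: "x \<in> ?A y"
      hence "F i x \<noteq> 0" "x \<in> space M" using False by auto
      hence "f x \<noteq> 0" using Fb[of x i] by auto
      thus "x \<in> U" using z x by (auto simp: space_M)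
    qed
    show ?thesis
      using core_L2_lin[OF finite_core_L2[OF Am Af U AU] finite_core_L2[OF Am Af U AU], of y 0] by simp
  qed
  have sum: "(\<lambda>x. \<Sum>y\<in>S. y * indicat_real (?A y) x) \<in> core_L2 U" if "finite S" "S \<subseteq> ?R" for S
    using that
  proof (induction S)
    case empty
    have "(\<lambda>x. 0 * indicat_real {} x + 0 * indicat_real {} x) \<in> core_L2 U"
      by (intro core_L2_lin compact_core_L2 U) auto
    thus ?case by simp
  next
    case (insert y S)
    have "(\<lambda>x. 1 * (y * indicat_real (?A y) x) + 1 * (\<Sum>y\<in>S. y * indicat_real (?A y) x)) \<in> core_L2 U"
      using insert by (intro core_L2_lin piece) auto
    thus ?case unfolding sum.insert[OF insert.hyps] mult_1 .
  qed
  let ?g = "\<lambda>x. \<Sum>y\<in>?R. y * indicat_real (?A y) x"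
  have g: "?g \<in> core_L2 U" by (rule sum) (use simple_functionD(1)[OF F(1)] in auto)
  have eq: "AE x in M. F i x = ?g x"
  proof (rule AE_I2)
    fix x assume x: "x \<in> space M"
    have "?g x = (\<Sum>y\<in>{F i x}. y * indicat_real (?A y) x)"
      by (rule sum.mono_neutral_right) (use simple_functionD(1)[OF F(1)] x in \<open>auto simp: indicator_def\<close>)
    thus "F i x = ?g x" using x by simp
  qed
  have "l2d M f (F i) = l2d M f ?g"
    using g by (intro l2n_diff_cong_AE L2_measurable[of _ M] f FL eq) (auto simp: core_L2_def)
  with i g show "\<exists>g\<in>core_L2 U. l2d M f g < e" by (intro bexI[of _ ?g]) auto
qed

end

section \<open>Transfer between a part and the whole space by extension by zero\<close>

lemma zero_ext_scaleR: "zero_ext U f = (\<lambda>x. indicat_real U x *\<^sub>R f x)"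
  by (simp add: zero_ext_def fun_eq_iff)

context dspace
begin

context
  fixes U assumes U: "openin X U"
begin

lemma U_sets: "U \<inter> space M \<in> sets M"
  using open_sets[OF U] by auto

lemma part_AE: "(AE x in restrict_space M U. Q x) \<longleftrightarrow> (AE x in M. x \<in> U \<longrightarrow> Q x)"
  by (rule AE_restrict_space_iff[OF U_sets])

lemma part_measurable: "f \<in> borel_measurable (restrict_space M U) \<longleftrightarrow> zero_ext U f \<in> borel_measurable M"
  unfolding zero_ext_scaleR by (rule borel_measurable_restrict_space_iff[OF U_sets])

lemma part_integrable: "integrable (restrict_space M U) f \<longleftrightarrow> integrable M (zero_ext U f)"
  unfolding zero_ext_scaleR by (rule integrable_restrict_space[OF U_sets])

lemma part_integral: "integral\<^sup>L (restrict_space M U) f = integral\<^sup>L M (zero_ext U f)"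
  unfolding zero_ext_scaleR by (rule integral_restrict_space[OF U_sets])

lemma part_L2: "f \<in> L2 (restrict_space M U) \<longleftrightarrow> zero_ext U f \<in> L2 M"
proof -
  have "zero_ext U (\<lambda>x. (f x)\<^sup>2) = (\<lambda>x. (zero_ext U f x)\<^sup>2)" by (simp add: zero_ext_def fun_eq_iff)
  thus ?thesis by (simp add: L2_def part_measurable part_integrable)
qed

lemma part_ip: "ip (restrict_space M U) f g = ip M (zero_ext U f) (zero_ext U g)"
proof -
  have "zero_ext U (\<lambda>x. f x * g x) = (\<lambda>x. zero_ext U f x * zero_ext U g x)" by (simp add: zero_ext_def fun_eq_iff)
  thus ?thesis by (simp add: ip_def part_integral)
qed

lemma part_l2n: "sqnorm2 (restrict_space M U) f = sqnorm2 M (zero_ext U f)"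
    "l2n (restrict_space M U) f = l2n M (zero_ext U f)"
  by (simp_all add: l2n_def sqnorm2_ip part_ip)

lemma part_form_add: "form_add (part_space D U) c u v = form_add D c (zero_ext U u) (zero_ext U v)"
  by (simp add: form_add_ip part_ip) (simp add: form_add_def ip_def[symmetric] part_ip)

lemma zero_ext_measurable: "f \<in> borel_measurable M \<Longrightarrow> zero_ext U f \<in> borel_measurable M"
  unfolding zero_ext_scaleR using open_sets[OF U] by measurable

lemma zero_ext_L2: "f \<in> L2 M \<Longrightarrow> zero_ext U f \<in> L2 M"
  by (rule L2_bound[OF _ zero_ext_measurable[OF L2_measurable]]) (auto simp: zero_ext_def)

lemma L2_part: "f \<in> L2 M \<Longrightarrow> f \<in> L2 (restrict_space M U)"
  by (simp add: part_L2 zero_ext_L2)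

lemma part_closure_zero_ext:
  assumes v: "v \<in> part_closure D U"
  shows "AE x in M. v x = zero_ext U v x" "zero_ext U v \<in> part_closure D U"
proof -
  show eq: "AE x in M. v x = zero_ext U v x"
    using part_closure_zero[OF v] by eventually_elim (auto simp: zero_ext_def)
  show "zero_ext U v \<in> part_closure D U"
    by (rule part_closure_cong_AE[OF v zero_ext_measurable[OF L2_measurable[OF fdom_L2[OF part_mem[OF v]]]] eq])
qed

lemma zero_ext_continuous:
  assumes f: "continuous_map (subtopology X U) euclideanreal f" and K: "compactin X K" "K \<subseteq> U"
    and z: "\<And>x. x \<in> U \<Longrightarrow> x \<notin> K \<Longrightarrow> f x = 0"
  shows "zero_ext U f \<in> C_c X" "supp (zero_ext U f) \<subseteq> K"
proof -
  have UX: "U \<subseteq> topspace X" by (rule openin_subset[OF U])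
  have "openin X {x \<in> topspace X. zero_ext U f x \<in> S}" if S: "open S" for S
  proof -
    have "openin (subtopology X U) {x \<in> topspace (subtopology X U). f x \<in> S}"
      by (rule openin_continuous_map_preimage[OF f]) (use S in simp)
    hence o: "openin X {x \<in> U. f x \<in> S}"
      using openin_trans_full[OF _ U] UX by (simp add: Int_absorb1)
    have c: "openin X (topspace X - K)" using compact_closed[OF K(1)] by auto
    have "{x \<in> topspace X. zero_ext U f x \<in> S} = (if 0 \<in> S then {x \<in> U. f x \<in> S} \<union> (topspace X - K) else {x \<in> U. f x \<in> S})"
      using UX K(2) z by (auto simp: zero_ext_def split: if_splits)
    thus ?thesis using o openin_Un[OF o c] by simp
  qed
  hence "continuous_map X euclideanreal (zero_ext U f)" by (simp add: continuous_map_def)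
  moreover have "zero_ext U f x = 0" if "x \<in> topspace X" "x \<notin> K" for x using z that by (simp add: zero_ext_def)
  from supp_subset[of K "zero_ext U f", OF K(1) this] have "compactin X (supp (zero_ext U f))" "supp (zero_ext U f) \<subseteq> K" by auto
  ultimately show "zero_ext U f \<in> C_c X" "supp (zero_ext U f) \<subseteq> K" by (auto simp: C_c_alt C_space_def)
qed

lemma C_c_part:
  assumes "f \<in> C_c (subtopology X U)"
  shows "zero_ext U f \<in> C_c X" "supp (zero_ext U f) \<subseteq> U"
    "supp (zero_ext U f) \<subseteq> subtopology X U closure_of {x \<in> topspace (subtopology X U). f x \<noteq> 0}"
proof -
  let ?K = "subtopology X U closure_of {x \<in> topspace (subtopology X U). f x \<noteq> 0}"
  have K: "compactin X ?K" "?K \<subseteq> U" using assms by (auto simp: C_c_def compactin_subtopology)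
  have "f x = 0" if "x \<in> U" "x \<notin> ?K" for x
    using that closure_of_subset[of "{x \<in> topspace (subtopology X U). f x \<noteq> 0}" "subtopology X U"] openin_subset[OF U]
    by auto
  with zero_ext_continuous[OF _ K] assms K(2) show "zero_ext U f \<in> C_c X" "supp (zero_ext U f) \<subseteq> U"
    "supp (zero_ext U f) \<subseteq> ?K"
    by (auto simp: C_c_def C_space_def)
qed

lemma core_part:
  assumes p: "\<phi> \<in> core V" and V: "V \<subseteq> U"
  shows "\<phi> \<in> fdom (part_space D U)" "\<phi> \<in> C_c (subtopology X U)"
    "subtopology X U closure_of {x \<in> topspace (subtopology X U). \<phi> x \<noteq> 0} \<subseteq> V"
proof -
  have "\<phi> \<in> core U" using p V by (auto simp: core_def)
  thus "\<phi> \<in> fdom (part_space D U)" using part_closure_zero_ext(2) core_subset_part by auto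
  have "{x \<in> topspace (subtopology X U). \<phi> x \<noteq> 0} \<subseteq> {x \<in> topspace X. \<phi> x \<noteq> 0}" by auto
  hence s: "subtopology X U closure_of {x \<in> topspace (subtopology X U). \<phi> x \<noteq> 0} \<subseteq> supp \<phi>"
    unfolding supp_def by (rule order_trans[OF closure_of_subtopology_subset closure_of_mono])
  thus "subtopology X U closure_of {x \<in> topspace (subtopology X U). \<phi> x \<noteq> 0} \<subseteq> V" using coreD(4)[OF p] by blast
  have "compactin (subtopology X U) (supp \<phi>)" using coreD(3,4)[OF p] V by (auto simp: compactin_subtopology)
  hence "compactin (subtopology X U) (subtopology X U closure_of {x \<in> topspace (subtopology X U). \<phi> x \<noteq> 0})"
    by (rule closed_compactin[OF _ s]) simp
  thus "\<phi> \<in> C_c (subtopology X U)" using coreD(2)[OF p]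
    by (auto simp: C_c_def C_space_def intro: continuous_map_from_subtopology)
qed

lemma part_closed: "closed_form (part_space D U)"
proof -
  let ?P = "part_space D U"
  have pF: "zero_ext U u \<in> fdom D" if "u \<in> fdom ?P" for u using that part_mem by simp
  have c1: "fdom ?P \<subseteq> L2 (meas ?P)" using pF fdom_L2 by (auto simp: part_L2)
  have c2: "(\<lambda>x. a * u x + b * v x) \<in> fdom ?P" if "u \<in> fdom ?P" "v \<in> fdom ?P" for u v a b
    using that by (simp add: zero_ext_lin part_closure_lin)
  have AE: "AE x in M. zero_ext U u x = zero_ext U v x" if "AE x in meas ?P. u x = v x" for u v
    using that unfolding part_space_simps part_AE by eventually_elim (simp add: zero_ext_def)
  have c3: "v \<in> fdom ?P" if "u \<in> fdom ?P" "v \<in> borel_measurable (meas ?P)" "AE x in meas ?P. u x = v x" for u v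
    using that part_closure_cong_AE[OF _ _ AE[OF that(3)]] by (simp add: part_measurable)
  have c4: "form ?P u w = form ?P v w" if "u \<in> fdom ?P" "v \<in> fdom ?P" "AE x in meas ?P. u x = v x" "w \<in> fdom ?P" for u v w
    using form_cong_AE[OF pF[OF that(1)] pF[OF that(2)] pF[OF that(4)] AE[OF that(3)]] by simp
  have c5: "form ?P (\<lambda>x. a * u x + b * v x) w = a * form ?P u w + b * form ?P v w"
    if "u \<in> fdom ?P" "v \<in> fdom ?P" "w \<in> fdom ?P" for u v w a b
    using E.lin_left[OF that[THEN pF]] by (simp add: zero_ext_lin)
  have c6: "form ?P u v = form ?P v u" if "u \<in> fdom ?P" "v \<in> fdom ?P" for u v
    using E.sym[OF that[THEN pF]] by simp
  have c7: "0 \<le> form ?P u u" if "u \<in> fdom ?P" for u using E.nonneg[OF pF[OF that]] by simp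
  have c8: "\<exists>u\<in>fdom ?P. sqnorm2 (meas ?P) (\<lambda>x. f x - u x) < e" if f: "f \<in> L2 (meas ?P)" and e: "0 < e" for f e
  proof -
    have zf: "zero_ext U f \<in> L2 M" using f by (simp add: part_L2)
    have "zero_ext U f \<in> core_L2 U" by (rule core_dense_L2[OF U zf]) (simp add: zero_ext_def)
    moreover have "0 < sqrt e" using e by simp
    ultimately obtain \<phi> where p: "\<phi> \<in> core U" "l2n M (\<lambda>x. zero_ext U f x - \<phi> x) < sqrt e"
      unfolding core_L2_def by blast
    note pc = subsetD[OF core_subset_part p(1)]
    have "l2n M (\<lambda>x. zero_ext U f x - \<phi> x) = l2n M (\<lambda>x. zero_ext U f x - zero_ext U \<phi> x)"
      by (rule l2n_diff_cong_AE[OF L2_measurable[OF zf] L2_measurable[OF zf]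
          L2_measurable[OF fdom_L2[OF part_mem[OF pc]]]
          L2_measurable[OF fdom_L2[OF part_mem[OF part_closure_zero_ext(2)[OF pc]]]] _ part_closure_zero_ext(1)[OF pc]]) simp
    hence "sqnorm2 (meas ?P) (\<lambda>x. f x - \<phi> x) < e"
      using p(2) by (simp add: part_l2n l2n_def zero_ext_diff)
    thus ?thesis using core_part(1)[OF p(1) subset_refl] by blast
  qed
  have c9: "\<exists>v\<in>fdom ?P. (\<lambda>n. sqnormE1 ?P (\<lambda>x. u n x - v x)) \<longlonglongrightarrow> 0"
    if a: "(\<forall>n::nat. u n \<in> fdom ?P) \<and> (\<forall>e>0. \<exists>N. \<forall>m\<ge>N. \<forall>n\<ge>N. sqnormE1 ?P (\<lambda>x. u m x - u n x) < e)" for u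
  proof -
    note u = a[THEN conjunct1, rule_format] and cau = a[THEN conjunct2]
    let ?u = "\<lambda>n. zero_ext U (u n)"
    have uF: "?u n \<in> fdom D" for n by (rule pF[OF u])
    have sq: "sqnormE1 ?P (\<lambda>x. p x - q x) = (E1d (zero_ext U p) (zero_ext U q))\<^sup>2"
      if "p \<in> fdom ?P" "q \<in> fdom ?P" for p q
      using that[THEN pF] by (simp add: part_form_add zero_ext_diff E1.N_square E.mem del: part_space_simps(4))
    have "\<exists>N. \<forall>m\<ge>N. \<forall>n\<ge>N. E1d (?u m) (?u n) < e" if e: "0 < e" for e
    proof -
      have "0 < e\<^sup>2" using e by simp
      then obtain N where N: "\<forall>m\<ge>N. \<forall>n\<ge>N. sqnormE1 ?P (\<lambda>x. u m x - u n x) < e\<^sup>2" using cau by blast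
      have "E1d (?u m) (?u n) < e" if mn: "m \<ge> N" "n \<ge> N" for m n
        using N[rule_format, OF mn] unfolding sq[OF u u]
        by (rule power2_less_imp_less) (use e in simp)
      thus ?thesis by blast
    qed
    from complete[of ?u, OF uF this]
    obtain v where v: "v \<in> fdom D" "(\<lambda>n. E1d (?u n) v) \<longlonglongrightarrow> 0" by blast
    have vp: "v \<in> part_closure D U" by (rule part_closure_limit[OF v(1) _ v(2)]) (use u in simp)
    have vP: "v \<in> fdom ?P" using part_closure_zero_ext(2)[OF vp] by simp
    have "E1d (?u n) v = E1d (?u n) (zero_ext U v)" for n
      by (rule E1_N_cong_AE) (use part_closure_zero_ext(1)[OF vp] in
        \<open>auto intro!: E.diff_mem uF v(1) part_mem[OF part_closure_zero_ext(2)[OF vp]]\<close>)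
    hence "sqnormE1 ?P (\<lambda>x. u n x - v x) = (E1d (?u n) v)\<^sup>2" for n
      using sq[OF u vP, of n] by simp
    hence "(\<lambda>n. sqnormE1 ?P (\<lambda>x. u n x - v x)) \<longlonglongrightarrow> 0" using tendsto_power[OF v(2), of 2] by simp
    with vP show ?thesis by blast
  qed
  show ?thesis unfolding closed_form_def
    by (intro conjI c1 ballI allI impI; (rule c2 c3 c4 c5 c6 c7 c8 c9; assumption))
qed

lemma part_markovian: "markovian (part_space D U)"
  unfolding markovian_def
proof (intro allI impI ballI)
  fix T :: "real \<Rightarrow> real" and f
  assume T: "T 0 = 0 \<and> (\<forall>s t. \<bar>T s - T t\<bar> \<le> \<bar>s - t\<bar>)" and f: "f \<in> fdom (part_space D U)"
  have z: "zero_ext U (T \<circ> f) = (\<lambda>x. T (zero_ext U f x))" using T by (simp add: zero_ext_def fun_eq_iff)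
  have p: "zero_ext U f \<in> part_closure D U" using f by simp
  show "T \<circ> f \<in> fdom (part_space D U) \<and> form (part_space D U) (T \<circ> f) (T \<circ> f) \<le> form (part_space D U) f f"
    using T part_closure_contraction[OF _ _ p, of T] contraction(2)[OF _ _ part_mem[OF p], of T] by (simp add: z)
qed

lemma part_regular: "regular_form (part_space D U)"
  unfolding regular_form_def
proof (intro conjI ballI allI impI)
  let ?P = "part_space D U"
  { fix f and e :: real assume f: "f \<in> C_c (topo ?P)" and e: "0 < e"
    have zf: "zero_ext U f \<in> C_c X" "supp (zero_ext U f) \<subseteq> U" using C_c_part[of f] f by auto
    obtain p where p: "p \<in> fdom D" "p \<in> C_c X" "\<And>x. x \<in> topspace X \<Longrightarrow> \<bar>zero_ext U f x - p x\<bar> < e / 2"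
      using regular[unfolded regular_form_def, THEN conjunct1, THEN bspec, OF zf(1), THEN spec, of "e/2"] e by auto
    \<comment> \<open>Soft thresholding: a contraction that kills values of size at most
      \<open>e / 2\<close>. Since \<open>p\<close> is that small off the support of the zero
      extension, the result has compact support in \<open>U\<close>, at the price of another
      \<open>e / 2\<close>.\<close>
    let ?T = "\<lambda>t. max (t - e/2) 0 - max (- t - e/2) 0"
    let ?q = "\<lambda>x. ?T (p x)"
    have T0: "?T 0 = 0" and TL: "\<bar>?T s - ?T t\<bar> \<le> \<bar>s - t\<bar>" for s t using e by (auto simp: max_def)
    have qF: "?q \<in> fdom D" by (rule contraction(1)[of ?T, OF T0 TL p(1)])
    have qC: "?q \<in> C_space X" using p(2)
      by (auto simp: C_c_alt C_space_def intro!: continuous_map_diff continuous_map_real_max continuous_map_minus)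
    have "?q x = 0" if "x \<in> topspace X" "x \<notin> supp (zero_ext U f)" for x
      using p(3)[OF that(1)] supp_zero[OF that] by (auto simp: max_def)
    from supp_subset[of _ ?q, OF _ this] zf have q: "?q \<in> core U" using qF qC by (auto simp: core_def C_c_alt)
    have "\<bar>f x - ?q x\<bar> < e" if x: "x \<in> U" for x
    proof -
      have "\<bar>f x - p x\<bar> < e / 2" using p(3)[of x] x openin_subset[OF U] by (auto simp: zero_ext_def)
      moreover have "\<bar>p x - ?q x\<bar> \<le> e / 2" using e by (auto simp: max_def)
      ultimately show ?thesis by linarith
    qed
    thus "\<exists>\<phi>\<in>fdom ?P \<inter> C_c (topo ?P). \<forall>x\<in>topspace (topo ?P). \<bar>f x - \<phi> x\<bar> < e"
      using core_part(1,2)[OF q subset_refl] by (intro bexI[of _ ?q]) auto }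
  { fix f and e :: real assume f: "f \<in> fdom ?P" and e: "0 < e"
    have zf: "zero_ext U f \<in> part_closure D U" using f by simp
    have "0 < sqrt e" using e by simp
    then obtain \<phi> where p: "\<phi> \<in> core U" "E1.N (\<lambda>x. zero_ext U f x - \<phi> x) < sqrt e"
      using zf unfolding part_closure_alt by blast
    note pc = subsetD[OF core_subset_part p(1)]
    note F = part_mem[OF zf] coreD(1)[OF p(1)] part_mem[OF part_closure_zero_ext(2)[OF pc]]
    have "E1.N (\<lambda>x. zero_ext U f x - \<phi> x) = E1.N (\<lambda>x. zero_ext U f x - zero_ext U \<phi> x)"
      by (rule E1_N_cong_AE) (use part_closure_zero_ext(1)[OF pc] in \<open>auto intro!: E.mem F\<close>)
    hence "sqrt (sqnormE1 ?P (\<lambda>x. f x - \<phi> x)) < sqrt e"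
      using p(2) by (simp add: part_form_add zero_ext_diff E1.N_def)
    thus "\<exists>\<phi>\<in>fdom ?P \<inter> C_c (topo ?P). sqnormE1 ?P (\<lambda>x. f x - \<phi> x) < e"
      using core_part(1,2)[OF p(1) subset_refl] by (intro bexI[of _ \<phi>]) auto }
qed

lemma part_radon: "radon_measure (subtopology X U) (restrict_space M U)"
  unfolding radon_measure_def
proof (intro conjI allI impI ballI)
  have UX: "U \<subseteq> topspace X" by (rule openin_subset[OF U])
  hence tU: "topspace (subtopology X U) = U" by auto
  show "space (restrict_space M U) = topspace (subtopology X U)"
    by (simp add: space_restrict_space space_M Int_commute)
  have "sets (restrict_space M U) = (\<inter>) U ` sigma_sets (topspace X) {V. openin X V}"
    by (simp add: sets_restrict_space sets_M)
  also have "\<dots> = sigma_sets U ((\<inter>) U ` {V. openin X V})"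
    using open_sets[OF U] UX by (intro sigma_sets_Int) (auto simp: sets_M)
  also have "(\<inter>) U ` {V. openin X V} = {V. openin (subtopology X U) V}"
    by (auto simp: openin_subtopology Int_commute)
  finally show "sets (restrict_space M U) = sigma_sets (topspace (subtopology X U)) {V. openin (subtopology X U) V}"
    unfolding tU .
  have em: "emeasure (restrict_space M U) A = emeasure M A" if "A \<subseteq> U" for A
    using that U_sets by (intro emeasure_restrict_space) auto
  show "emeasure (restrict_space M U) K < \<infinity>" if "compactin (subtopology X U) K" for K
    using that compact_finite[of K] by (simp add: compactin_subtopology em)
  fix A assume A: "A \<in> sets (restrict_space M U)"
  hence AU: "A \<subseteq> U" and AM: "A \<in> sets M"
    using sets_restrict_space_iff[OF U_sets] by auto
  have "{K. compactin (subtopology X U) K \<and> K \<subseteq> A} = {K. compactin X K \<and> K \<subseteq> A}"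
    using AU by (auto simp: compactin_subtopology)
  thus "emeasure (restrict_space M U) A = (SUP K\<in>{K. compactin (subtopology X U) K \<and> K \<subseteq> A}. emeasure (restrict_space M U) K)"
    unfolding em[OF AU] inner_regular[OF AM]
    by (intro SUP_cong) (use em[OF order_trans[OF _ AU]] in auto)
qed

lemma msupport_AE:
  assumes "v \<in> borel_measurable M" shows "AE x in M. x \<notin> msupport X M v \<longrightarrow> v x = 0"
proof -
  have "AE x in M. x \<in> \<Union>{V. openin X V \<and> (AE x in M. x \<in> V \<longrightarrow> v x = 0)} \<longrightarrow> v x = 0"
    by (rule AE_local) auto
  with AE_space show ?thesis by eventually_elim (auto simp: msupport_def space_M)
qed

text \<open>The support of the extended \<open>v\<close> in \<open>X\<close> may contain boundary
  points of \<open>U\<close>, where the support relative to \<open>U\<close> says nothing, so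
  locality of \<open>D\<close> does not apply directly. Clamping \<open>v\<close> by functions of
  the core makes the support compact in \<open>U\<close>; as these clamped functions annihilate
  \<open>?u\<close>, so does their weak limit.\<close>

lemma part_strongly_local: "strongly_local (part_space D U)"
  unfolding strongly_local_def
proof (intro ballI impI)
  let ?P = "part_space D U"
  fix u v assume u: "u \<in> fdom ?P" and v: "v \<in> fdom ?P"
    and "\<exists>c. AE x in meas ?P. x \<in> msupport (topo ?P) (meas ?P) v \<longrightarrow> u x = c"
  then obtain c where "AE x in meas ?P. x \<in> msupport (topo ?P) (meas ?P) v \<longrightarrow> u x = c" by blast
  hence c: "AE x in M. x \<in> U \<longrightarrow> x \<in> msupport (subtopology X U) (restrict_space M U) v \<longrightarrow> u x = c"
    unfolding part_space_simps part_AE .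
  let ?u = "zero_ext U u" and ?v = "zero_ext U v"
  let ?S = "{w \<in> fdom D. form D ?u w = 0}"
  have uF: "?u \<in> fdom D" and vc: "?v \<in> part_closure D U" using u v part_mem by auto
  note vF = part_mem[OF vc]
  have ac: "(\<lambda>x. \<bar>?v x\<bar>) \<in> part_closure D U"
    by (rule part_closure_contraction[of "\<lambda>t. \<bar>t\<bar>", OF _ _ vc]) auto
  obtain p C where p: "\<And>n::nat. p n \<in> core U" "(\<lambda>n. E1.N (\<lambda>x. p n x - \<bar>?v x\<bar>)) \<longlonglongrightarrow> 0" "\<And>n. E.N (p n) \<le> C"
    using part_closure_approx[OF ac] by metis
  note pF = coreD(1)[OF p(1)]
  let ?p = "\<lambda>n x. max (p n x) 0"
  \<comment> \<open>Together \<open>?m\<close> and \<open>?w\<close> clamp \<open>?v\<close> between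
    \<open>- ?p n\<close> and \<open>?p n\<close>. Writing this with two minima gives the energy
    bound through \<open>min_N\<close>.\<close>
  let ?m = "\<lambda>n x. - min (?v x) (?p n x)"
  let ?w = "\<lambda>n x. - min (?m n x) (?p n x)"
  have ppF: "?p n \<in> fdom D" for n by (rule max0_mem[OF pF])
  have mF: "?m n \<in> fdom D" for n by (intro E.mem min_mem vF ppF)
  have wF: "?w n \<in> fdom D" for n by (rule E.uminus_mem[OF min_mem[OF mF ppF]])
  have "form D ?u (?w n) = 0" for n
  proof -
    have "msupport X M (?w n) \<subseteq> U \<inter> msupport (subtopology X U) (restrict_space M U) v"
    proof
      fix x assume x: "x \<in> msupport X M (?w n)"
      hence xX: "x \<in> topspace X" and
        nz: "\<And>V. openin X V \<Longrightarrow> x \<in> V \<Longrightarrow> \<not> (AE y in M. y \<in> V \<longrightarrow> ?w n y = 0)" by (auto simp: msupport_def)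
      have "openin X (topspace X - supp (p n))" using compact_closed[OF coreD(3)[OF p(1)[of n]]] by auto
      moreover have "AE y in M. y \<in> topspace X - supp (p n) \<longrightarrow> ?w n y = 0"
        using supp_zero[of _ "p n"] by (auto intro!: AE_I2 simp: min_def)
      ultimately have xU: "x \<in> U" using nz coreD(4)[OF p(1)[of n]] xX by blast
      have "\<not> (openin (subtopology X U) V \<and> (AE y in restrict_space M U. y \<in> V \<longrightarrow> v y = 0))" if xV: "x \<in> V" for V
      proof
        assume V: "openin (subtopology X U) V \<and> (AE y in restrict_space M U. y \<in> V \<longrightarrow> v y = 0)"
        hence "AE y in M. y \<in> U \<longrightarrow> y \<in> V \<longrightarrow> v y = 0" by (simp add: part_AE)
        hence "AE y in M. y \<in> V \<longrightarrow> ?w n y = 0"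
          by eventually_elim (auto simp: zero_ext_def min_def max_def)
        moreover have "openin X V" using V openin_trans_full[OF _ U] by blast
        ultimately show False using nz xV by blast
      qed
      thus "x \<in> U \<inter> msupport (subtopology X U) (restrict_space M U) v"
        using xU xX by (auto simp: msupport_def)
    qed
    hence "AE x in M. x \<in> msupport X M (?w n) \<longrightarrow> ?u x = c"
      using c by (auto elim!: eventually_mono simp: zero_ext_def)
    thus ?thesis using local[unfolded strongly_local_def] uF wF by blast
  qed
  hence wS: "?w n \<in> ?S" for n using wF by blast
  have lim: "l2_tendsto M ?w ?v"
  proof (rule Lim_null_comparison[OF _ E1_tendsto_l2n[OF pF part_mem[OF ac] p(2)]], rule always_eventually, rule allI)
    fix n
    have "l2d M (?w n) ?v \<le> l2n M (\<lambda>x. p n x - \<bar>?v x\<bar>)"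
      by (intro l2n_mono_AE L2_measurable[OF L2.diff_mem[OF fdom_L2[OF wF] fdom_L2[OF vF]]]
          L2.diff_mem fdom_L2 pF part_mem[OF ac] AE_I2) (auto simp: min_def max_def)
    thus "norm (l2d M (?w n) ?v) \<le> l2n M (\<lambda>x. p n x - \<bar>?v x\<bar>)" by simp
  qed
  have bd: "E.N (?w n) \<le> E.N ?v + C + C" for n
    using min_N[OF mF[of n] ppF[of n]] min_N[OF vF ppF[of n]] max0_N[OF pF[of n]] p(3)[of n]
      E.N_uminus[OF min_mem[OF mF[of n] ppF[of n]]] E.N_uminus[OF min_mem[OF vF ppF[of n]]] by linarith
  have mid: "(\<lambda>x. p x / 2 + q x / 2) \<in> ?S" if "p \<in> ?S" "q \<in> ?S" for p q
    using that uF by (simp add: E.mem E.bilin)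
  obtain y where y: "\<And>n::nat. y n \<in> ?S" "(\<lambda>n. E1d (y n) ?v) \<longlonglongrightarrow> 0"
    by (rule weak_limit[of ?S ?w, OF _ mid wS bd fdom_L2[OF vF] lim]) (blast, assumption, assumption, rule that)
  have yF: "y n \<in> fdom D" and y0: "form D ?u (y n) = 0" for n using y(1)[of n] by auto
  have "(\<lambda>n. form D (y n) ?u) \<longlonglongrightarrow> form D ?v ?u"
    by (rule E.N_tendsto_B[OF yF vF uF E1_tendsto_E[OF yF vF y(2)]])
  hence "form D ?v ?u = 0" using y0 E.sym[OF uF yF] by (simp add: LIMSEQ_const_iff)
  thus "form ?P u v = 0" using E.sym[OF uF vF] by simp
qed

lemma dspace_part: "dspace (part_space D U)"
proof (unfold dspace_def strongly_local_dirichlet_space_def, intro conjI allI impI)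
  show "locally_compact_space (topo (part_space D U))"
    using locally_compact_space_open_subset[OF _ locally_compact U] Hausdorff by simp
  show "separable_space (topo (part_space D U))" using separable_space_open_subset[OF separable U] by simp
  show "metrizable_space (topo (part_space D U))" using metrizable_space_subtopology[OF metrizable] by simp
  fix V assume V: "openin (topo (part_space D U)) V \<and> V \<noteq> {}"
  hence "openin X V" "V \<subseteq> U" using openin_trans_full[OF _ U] openin_subset[of "subtopology X U" V] by auto
  thus "0 < emeasure (meas (part_space D U)) V"
    using V full_support[of V] U_sets by (simp add: emeasure_restrict_space)
qed (use part_closed part_markovian part_regular part_strongly_local part_radon in auto)

end

text \<open>Allows the continuity argument to run inside a larger Feller part and to speak of the
  same space on \<open>U\<close>. Equality of records is possible because domain and form see a
  function only through its extension by zero.\<close>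

lemma part_part:
  assumes W: "openin X W" and U: "openin X U" and UW: "U \<subseteq> W"
  shows "part_space (part_space D W) U = part_space D U"
proof -
  interpret W: dspace "part_space D W" by (rule dspace_part[OF W])
  have WU: "W \<inter> U = U" "U \<inter> W = U" using UW by auto
  have t: "subtopology (subtopology X W) U = subtopology X U" by (simp add: subtopology_subtopology WU)
  have m: "restrict_space (restrict_space M W) U = restrict_space M U"
    using U_sets[OF U] UW by (subst restrict_restrict_space) (auto simp: U_sets[OF W] WU)
  have f: "form D (zero_ext W (zero_ext U u)) (zero_ext W (zero_ext U v)) = form D (zero_ext U u) (zero_ext U v)" for u v
    by (simp add: zero_ext_zero_ext WU)
  have coreU: "core U \<subseteq> core W" using UW by (auto simp: core_def)
  have eq: "W.E1.N (\<lambda>x. zero_ext U f x - \<phi> x) = E1.N (\<lambda>x. zero_ext U f x - zero_ext W \<phi> x)" for f \<phi>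
    by (simp add: W.E1.N_def E1.N_def part_form_add[OF W] zero_ext_diff zero_ext_zero_ext WU)
  have eq2: "E1.N (\<lambda>x. zero_ext U f x - zero_ext W \<phi> x) = E1.N (\<lambda>x. zero_ext U f x - \<phi> x)"
    if f: "zero_ext U f \<in> fdom D" and p: "\<phi> \<in> core U" for f \<phi>
  proof -
    note pc = subsetD[OF core_subset_part subsetD[OF coreU p]]
    note F = f coreD(1)[OF p] part_mem[OF part_closure_zero_ext(2)[OF W pc]]
    show ?thesis
      by (rule E1_N_cong_AE) (use part_closure_zero_ext(1)[OF W pc] in \<open>auto intro!: E.mem F\<close>)
  qed
  have 1: "\<phi> \<in> W.core U" if p: "\<phi> \<in> core U" for \<phi>
    using core_part[OF W p UW] by (auto simp: W.core_def W.supp_def)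
  have 2: "zero_ext W \<phi> \<in> core U" if p: "\<phi> \<in> W.core U" for \<phi>
  proof -
    have p': "zero_ext W \<phi> \<in> fdom D" "\<phi> \<in> C_c (subtopology X W)" "W.supp \<phi> \<subseteq> U"
      using p part_mem by (auto simp: W.core_def)
    from C_c_part[OF W p'(2)] p'(1,3) show ?thesis by (auto simp: core_def W.supp_def)
  qed
  have "zero_ext U f \<in> part_closure (part_space D W) U \<longleftrightarrow> zero_ext U f \<in> part_closure D U" for f
  proof
    assume a: "zero_ext U f \<in> part_closure (part_space D W) U"
    hence fF: "zero_ext U f \<in> fdom D"
      using part_mem[of "zero_ext W (zero_ext U f)" W] by (simp add: W.part_closure_alt zero_ext_zero_ext WU)
    have "\<exists>\<phi>\<in>core U. E1.N (\<lambda>x. zero_ext U f x - \<phi> x) < e" if e: "0 < e" for e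
    proof -
      obtain \<phi> where p: "\<phi> \<in> W.core U" "W.E1.N (\<lambda>x. zero_ext U f x - \<phi> x) < e"
        using a[unfolded W.part_closure_alt] e by auto
      thus ?thesis unfolding eq by (intro bexI[of _ "zero_ext W \<phi>"] 2)
    qed
    with fF show "zero_ext U f \<in> part_closure D U" by (simp add: part_closure_alt)
  next
    assume a: "zero_ext U f \<in> part_closure D U"
    note fF = part_mem[OF a]
    have "zero_ext U f \<in> part_closure D W"
      unfolding part_closure_alt
    proof (intro CollectI conjI fF allI impI)
      fix e :: real assume "0 < e"
      hence "\<exists>\<phi>\<in>core U. E1.N (\<lambda>x. zero_ext U f x - \<phi> x) < e" using a[unfolded part_closure_alt] by simp
      thus "\<exists>\<phi>\<in>core W. E1.N (\<lambda>x. zero_ext U f x - \<phi> x) < e" using coreU by blast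
    qed
    hence "zero_ext U f \<in> fdom (part_space D W)" by (simp add: zero_ext_zero_ext WU)
    moreover have "\<exists>\<phi>\<in>W.core U. W.E1.N (\<lambda>x. zero_ext U f x - \<phi> x) < e" if e: "0 < e" for e
    proof -
      obtain \<phi> where p: "\<phi> \<in> core U" "E1.N (\<lambda>x. zero_ext U f x - \<phi> x) < e"
        using a[unfolded part_closure_alt] e by auto
      thus ?thesis using eq2[OF fF p(1)] by (intro bexI[of _ \<phi>] 1) (simp_all add: eq)
    qed
    ultimately show "zero_ext U f \<in> part_closure (part_space D W) U" unfolding W.part_closure_alt by blast
  qed
  thus ?thesis unfolding part_space_def[of "part_space D W"] part_space_def[of D U]
    by (simp add: t m f)
qed


section \<open>Domination of the part by the whole space\<close>

text \<open>The extended resolvent of the part solves the equation of the whole space, but only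
  against test functions \<open>q\<close> in the part closure. Comparison arguments therefore have
  to produce test functions that belong to \<open>U\<close>.\<close>

lemma part_res_eq:
  assumes U: "openin X U" and h: "0 < h" and f: "f \<in> L2 M" and q: "q \<in> part_closure D U"
  shows "h * form D (zero_ext U (res (part_space D U) h f)) q + ip M (zero_ext U (res (part_space D U) h f)) q = ip M f q"
proof -
  interpret P: dspace "part_space D U" by (rule dspace_part[OF U])
  have fP: "f \<in> L2 (meas (part_space D U))" using L2_part[OF U f] by simp
  let ?u = "zero_ext U (res (part_space D U) h f)"
  have uF: "?u \<in> fdom D" using part_mem[of ?u U] P.res_mem[OF h fP] by simp
  note qF = part_mem[OF q] and qz = part_closure_zero_ext[OF U q]
  note zF = part_mem[OF qz(2)]
  have ipq: "ip M g (zero_ext U q) = ip M g q" if "g \<in> L2 M" for g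
    by (rule ip_cong_AE[OF L2_measurable[OF that] L2_measurable[OF that]
        L2_measurable[OF fdom_L2[OF zF]] L2_measurable[OF fdom_L2[OF qF]]]) (use qz(1) in auto)
  have fq: "form D ?u (zero_ext U q) = form D ?u q"
    using form_cong_AE[OF qF zF uF qz(1)] E.sym[OF uF qF] E.sym[OF uF zF] by linarith
  have "h * form (part_space D U) (res (part_space D U) h f) q + ip (meas (part_space D U)) (res (part_space D U) h f) q
      = ip (meas (part_space D U)) f q"
    by (rule P.res_eq[OF h fP]) (use qz in simp)
  hence "h * form D ?u (zero_ext U q) + ip M ?u (zero_ext U q) = ip M (zero_ext U f) (zero_ext U q)"
    by (simp add: part_ip[OF U])
  moreover have "ip M (zero_ext U f) (zero_ext U q) = ip M f (zero_ext U q)"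
    unfolding ip_def by (intro Bochner_Integration.integral_cong) (auto simp: zero_ext_def)
  ultimately show ?thesis using ipq[OF f] ipq[OF fdom_L2[OF uF]] fq by simp
qed

lemma part_res_nonneg:
  assumes U: "openin X U" and h: "0 < h" and f: "f \<in> L2 M" and pos: "AE x in M. 0 \<le> f x"
  shows "AE x in M. 0 \<le> zero_ext U (res (part_space D U) h f) x"
proof -
  interpret P: dspace "part_space D U" by (rule dspace_part[OF U])
  have fP: "f \<in> L2 (meas (part_space D U))" using L2_part[OF U f] by simp
  have "AE x in meas (part_space D U). 0 \<le> f x"
    unfolding part_space_simps part_AE[OF U] using pos by eventually_elim simp
  from P.res_nonneg[OF h fP this] show ?thesis
    unfolding part_space_simps part_AE[OF U] by eventually_elim (auto simp: zero_ext_def)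
qed

lemma part_res_part:
  assumes U: "openin X U" and h: "0 < h" and f: "f \<in> L2 M"
  shows "zero_ext U (res (part_space D U) h f) \<in> part_closure D U"
proof -
  interpret P: dspace "part_space D U" by (rule dspace_part[OF U])
  show ?thesis using P.res_mem[OF h, of f] L2_part[OF U f] by simp
qed

text \<open>The positive part of the difference lies below the resolvent of the part, hence in the
  part closure by the ideal property. It is admissible in both equations, and the right sides
  cancel.\<close>

lemma part_res_le:
  assumes U: "openin X U" and h: "0 < h" and f: "f \<in> L2 M" and pos: "AE x in M. 0 \<le> f x"
  shows "AE x in M. zero_ext U (res (part_space D U) h f) x \<le> J h f x"
proof -
  let ?u = "zero_ext U (res (part_space D U) h f)" and ?v = "J h f"
  let ?d = "\<lambda>x. ?u x - ?v x"
  let ?q = "\<lambda>x. max (?d x - 0) 0"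
  note uc = part_res_part[OF U h f]
  note uF = part_mem[OF uc] and vF = res_mem[OF h f]
  have dF: "?d \<in> fdom D" by (intro E.mem uF vF)
  note qF = excess_mem[OF order_refl dF]
  from part_res_nonneg[OF U h f pos] res_nonneg[OF h f pos]
  have "AE x in M. 0 \<le> ?q x \<and> ?q x \<le> ?u x" by eventually_elim auto
  hence qc: "?q \<in> part_closure D U" by (rule part_closure_ideal[OF qF uc])
  have "AE x in M. ?q x = 0"
  proof (rule ip_nonpos_imp_zero_AE[OF fdom_L2[OF qF] fdom_L2[OF dF]])
    have "ip M ?d ?q = - (h * form D ?d ?q)"
      using part_res_eq[OF U h f qc] res_eq[OF h f qF]
      unfolding E.diff_left[OF uF vF qF] L2.diff_left[OF fdom_L2[OF uF] fdom_L2[OF vF] fdom_L2[OF qF]]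
        right_diff_distrib by linarith
    also have "\<dots> \<le> 0" using h form_excess_nonneg[OF dF, of 0] by simp
    finally show "ip M ?d ?q \<le> 0" .
  qed (auto simp: power2_eq_square max_def)
  thus ?thesis by eventually_elim (simp add: max_def split: if_splits)
qed

lemma part_semi_le:
  assumes U: "openin X U" and t: "0 \<le> t" and f: "f \<in> L2 M" and pos: "AE x in M. 0 \<le> f x"
  shows "AE x in M. x \<in> U \<longrightarrow> cform.semi (part_space D U) t f x \<le> semi t f x"
proof -
  interpret P: dspace "part_space D U" by (rule dspace_part[OF U])
  let ?P = "part_space D U"
  have fP: "f \<in> L2 (meas ?P)" using L2_part[OF U f] by simp
  have resP: "f \<in> L2 (meas ?P)" if "f \<in> L2 M" for f using L2_part[OF U that] by simp
  \<comment> \<open>Each step replaces the outer resolvent by domination and its argument by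
    monotonicity of the resolvent of the part.\<close>
  have pw: "AE x in meas ?P. (res ?P h ^^ k) f x \<le> (J h ^^ k) f x" if h: "0 < h" for h k
  proof (induction k)
    case (Suc k)
    have g: "(J h ^^ k) f \<in> L2 M" by (rule resn(1)[OF h f])
    have "AE x in M. 0 \<le> (J h ^^ k) f x"
      by (induction k) (simp_all add: pos res_nonneg[OF h resn(1)[OF h f]])
    from part_res_le[OF U h g this] have "AE x in meas ?P. res ?P h ((J h ^^ k) f) x \<le> J h ((J h ^^ k) f) x"
      unfolding part_space_simps part_AE[OF U] by eventually_elim (auto simp: zero_ext_def)
    moreover have "AE x in meas ?P. res ?P h ((res ?P h ^^ k) f) x \<le> res ?P h ((J h ^^ k) f) x"
      by (rule P.res_mono[OF h P.resn(1)[OF h fP] resP[OF g] Suc.IH])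
    ultimately show ?case by (simp, eventually_elim) simp
  qed simp
  have "AE x in meas ?P. P.semi t f x \<le> semi t f x"
  proof (rule L2_limit_le_AE[OF P.euler_L2[OF fP] P.semi_L2[OF t fP] P.euler_tendsto[OF t fP]])
    show "euler n t f \<in> L2 (meas ?P)" "semi t f \<in> L2 (meas ?P)" for n by (intro resP euler_L2 semi_L2 t f)+
    show "AE x in meas ?P. P.euler n t f x \<le> euler n t f x" for n
      unfolding P.euler_def euler_def P.steps_def steps_def by (rule pw[OF half_pos])
    show "(\<lambda>n. l2n (meas ?P) (\<lambda>x. euler n t f x - semi t f x)) \<longlonglongrightarrow> 0"
    proof (rule Lim_null_comparison[OF _ euler_tendsto[OF t f]], rule always_eventually, rule allI)
      fix n
      have d: "(\<lambda>x. euler n t f x - semi t f x) \<in> L2 M" by (intro L2.mem euler_L2 semi_L2 t f)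
      have "l2n (meas ?P) (\<lambda>x. euler n t f x - semi t f x) \<le> l2d M (euler n t f) (semi t f)"
        unfolding part_space_simps part_l2n[OF U]
        by (rule l2n_mono_AE[OF d L2_measurable[OF zero_ext_L2[OF U d]]]) (auto simp: zero_ext_def)
      thus "norm (l2n (meas ?P) (\<lambda>x. euler n t f x - semi t f x)) \<le> l2d M (euler n t f) (semi t f)" by simp
    qed
  qed
  thus ?thesis unfolding part_space_simps part_AE[OF U] .
qed

end

section \<open>Resolvents as Laplace transforms\<close>

context cform
begin

lemma semi_increment:
  assumes b: "0 \<le> b" and t: "0 \<le> t" and w: "w \<in> L2 M"
  shows "l2d M (semi (b + t) w) (semi b w) \<le> l2d M (semi t w) w"
proof -
  note st = semi_L2[OF t w]
  have "l2d M (semi (b + t) w) (semi b w) = l2d M (semi b (semi t w)) (semi b w)"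
    by (rule l2n_diff_cong_AE[OF _ _ _ _ semi_add[OF b t w]])
      (use semi_L2[OF _ w] semi_L2[OF b st] b t in \<open>auto intro: L2_measurable\<close>)
  thus ?thesis using semi_nonexp[OF b st w] by simp
qed

lemma abs_diff_at_right: "filterlim (\<lambda>a. \<bar>a - s\<bar>) (at_right 0) (at s within S)" for s :: real
  unfolding filterlim_at
proof (intro conjI)
  show "((\<lambda>a. \<bar>a - s\<bar>) \<longlongrightarrow> 0) (at s within S)"
    by (auto intro!: tendsto_eq_intros)
qed (auto simp: eventually_at_filter)

lemma ip_semi_continuous:
  assumes f: "f \<in> L2 M" and g: "g \<in> L2 M"
  shows "continuous_on {0..} (\<lambda>s. ip M (semi s f) g)"
  unfolding continuous_on_def
proof (intro ballI, rule LIM_zero_cancel, rule Lim_null_comparison)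
  fix s :: real assume s: "s \<in> {0..}"
  show "((\<lambda>a. l2n M (\<lambda>x. semi \<bar>a - s\<bar> f x - f x) * l2n M g) \<longlongrightarrow> 0) (at s within {0..})"
    by (rule tendsto_mult_left_zero[OF filterlim_compose[OF semi_tendsto[OF f] abs_diff_at_right]])
  have "norm (ip M (semi a f) g - ip M (semi s f) g) \<le> l2n M (\<lambda>x. semi \<bar>a - s\<bar> f x - f x) * l2n M g" if a: "0 \<le> a" for a
  proof -
    have sa: "semi a f \<in> L2 M" and ss: "semi s f \<in> L2 M" using a s f by (auto intro: semi_L2)
    have "l2d M (semi a f) (semi s f) \<le> l2n M (\<lambda>x. semi \<bar>a - s\<bar> f x - f x)"
      using semi_increment[of s "a - s" f] semi_increment[of a "s - a" f] L2.N_diff_commute[OF sa ss] a s f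
      by (cases "s \<le> a") (auto simp: abs_if)
    hence "l2d M (semi a f) (semi s f) * l2n M g \<le> l2n M (\<lambda>x. semi \<bar>a - s\<bar> f x - f x) * l2n M g"
      by (intro mult_right_mono) auto
    thus ?thesis using L2.cauchy_schwarz[OF L2.diff_mem[OF sa ss] g] by (simp add: L2.diff_left sa ss g)
  qed
  thus "\<forall>\<^sub>F a in at s within {0..}. norm (ip M (semi a f) g - ip M (semi s f) g) \<le> l2n M (\<lambda>x. semi \<bar>a - s\<bar> f x - f x) * l2n M g"
    by (auto simp: eventually_at_filter)
qed

text \<open>Pairing with a fixed \<open>g\<close> keeps the calculus scalar. Difference quotients
  are expanded at the smaller of the two times; for quotients from the left this base point moves,
  which costs the displacement of \<open>w\<close>.\<close>

lemma ip_semi_derivative: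
  assumes gr: "operator_graph D v w" and g: "g \<in> L2 M" and s: "0 \<le> s"
  shows "((\<lambda>s. ip M (semi s v) g) has_real_derivative - ip M (semi s w) g) (at s within {0..})"
  unfolding has_field_derivative_iff
proof (rule LIM_zero_cancel, rule Lim_null_comparison)
  note v = graph_L2(1)[OF gr] and w = graph_L2(2)[OF gr]
  let ?k = "\<lambda>s. ip M (semi s v) g"
  let ?y = "\<lambda>t x. (semi t v x - v x) / t + w x"
  let ?o = "\<lambda>t. (l2n M (?y t) + l2d M (semi t w) w) * l2n M g"
  have "((\<lambda>t. l2n M (?y t) + l2d M (semi t w) w) \<longlongrightarrow> 0 + 0) (at_right 0)"
    by (intro tendsto_add semi_generator gr semi_tendsto w)
  hence "(?o \<longlongrightarrow> 0) (at_right 0)" by (intro tendsto_mult_left_zero) simp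
  from filterlim_compose[OF this abs_diff_at_right]
  show "((\<lambda>a. ?o \<bar>a - s\<bar>) \<longlongrightarrow> 0) (at s within {0..})" .
  have R: "\<bar>(?k (b + t) - ?k b) / t + ip M (semi b w) g\<bar> \<le> l2n M (?y t) * l2n M g" if b: "0 \<le> b" and t: "0 < t" for b t
  proof -
    note t0 = less_imp_le[OF t]
    note st = semi_L2[OF t0 v]
    note m = semi_L2[OF b st] semi_L2[OF b v] semi_L2[OF b w]
    let ?d = "\<lambda>x. (- (1 / t)) * v x + 1 * w x"
    have d: "?d \<in> L2 M" by (intro L2_lin v w)
    have ye: "?y t = (\<lambda>x. (1 / t) * semi t v x + 1 * ?d x)" by (simp add: fun_eq_iff diff_divide_distrib)
    have y: "?y t \<in> L2 M" unfolding ye by (intro L2_lin st d)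
    have bt: "semi (b + t) v \<in> L2 M" using b t0 by (intro semi_L2 v) simp
    have "AE x in M. semi b (?y t) x = (semi (b + t) v x - semi b v x) / t + semi b w x"
      using semi_lin[OF b st d, of "1/t" 1] semi_lin[OF b v w, of "- (1/t)" 1] semi_add[OF b t0 v]
      unfolding ye by eventually_elim (simp add: diff_divide_distrib)
    hence "ip M (semi b (?y t)) g = ip M (\<lambda>x. (semi (b + t) v x - semi b v x) / t + semi b w x) g"
      by (intro ip_cong_AE L2_measurable[of _ M] L2.mem semi_L2[OF b y] bt m g) auto
    also have "\<dots> = (?k (b + t) - ?k b) / t + ip M (semi b w) g"
      using bt m g by (simp add: L2.bilin L2.mem)
    finally have "\<bar>(?k (b + t) - ?k b) / t + ip M (semi b w) g\<bar> \<le> l2n M (semi b (?y t)) * l2n M g"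
      using L2.cauchy_schwarz[OF semi_L2[OF b y] g] by simp
    also have "\<dots> \<le> l2n M (?y t) * l2n M g" by (intro mult_right_mono semi_contraction b y) simp
    finally show ?thesis .
  qed
  have "norm ((?k a - ?k s) / (a - s) - - ip M (semi s w) g) \<le> ?o \<bar>a - s\<bar>" if a: "0 \<le> a" "a \<noteq> s" for a
  proof (cases "s < a")
    case True
    have "?o \<bar>a - s\<bar> \<ge> l2n M (?y \<bar>a - s\<bar>) * l2n M g" by (intro mult_right_mono) auto
    thus ?thesis using R[OF s, of "a - s"] True by simp
  next
    case False
    define t where "t = s - a"
    have t: "0 < t" "s = a + t" using False a by (auto simp: t_def)
    have sw: "semi s w \<in> L2 M" and aw: "semi a w \<in> L2 M" using s a w by (auto intro: semi_L2)
    have "\<bar>ip M (semi s w) g - ip M (semi a w) g\<bar> \<le> l2d M (semi s w) (semi a w) * l2n M g"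
      using L2.cauchy_schwarz[OF L2.diff_mem[OF sw aw] g] by (simp add: L2.diff_left sw aw g)
    also have "\<dots> \<le> l2d M (semi t w) w * l2n M g"
      using semi_increment[OF a(1) less_imp_le[OF t(1)] w] t(2) by (intro mult_right_mono) auto
    finally have 1: "\<bar>ip M (semi s w) g - ip M (semi a w) g\<bar> \<le> l2d M (semi t w) w * l2n M g" .
    have e: "(?k a - ?k s) / (a - s) = (?k (a + t) - ?k a) / t"
      using minus_divide_divide[of "?k s - ?k a" t] by (simp add: t_def)
    have "\<bar>a - s\<bar> = t" using t by simp
    thus ?thesis using R[OF a(1) t(1)] 1 unfolding e by (simp add: distrib_right)
  qed
  thus "\<forall>\<^sub>F a in at s within {0..}. norm ((?k a - ?k s) / (a - s) - - ip M (semi s w) g) \<le> ?o \<bar>a - s\<bar>"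
    by (auto simp: eventually_at_filter)
qed

text \<open>Since \<open>J c f + c * H (J c f) = f\<close>, the discounted flow of
  \<open>J c f\<close> has as derivative minus the discounted flow of \<open>f\<close>.\<close>

lemma res_semi_derivative:
  assumes f: "f \<in> L2 M" and g: "g \<in> L2 M" and c: "0 < c" and r: "0 \<le> r"
  shows "((\<lambda>r. exp (- r) * ip M (semi (c * r) (J c f)) g) has_real_derivative
    - (exp (- r) * ip M (semi (c * r) f) g)) (at r within {0..})"
proof -
  let ?w = "\<lambda>x. (f x - J c f x) / c"
  have cr: "0 \<le> c * r" using c r by simp
  note v = res_L2[OF c f]
  have gr: "operator_graph D (J c f) ?w" by (rule res_graph[OF c f])
  note w = graph_L2(2)[OF gr]
  have sub: "((\<lambda>r. c * r) ` {0..}) \<subseteq> {0..}" using c by auto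
  have "((\<lambda>s. ip M (semi s (J c f)) g) \<circ> (\<lambda>r. c * r) has_real_derivative - ip M (semi (c * r) ?w) g * c) (at r within {0..})"
    by (rule DERIV_image_chain[OF has_field_derivative_subset[OF ip_semi_derivative[OF gr g cr] sub]])
      (auto intro!: derivative_eq_intros)
  hence d: "((\<lambda>r. ip M (semi (c * r) (J c f)) g) has_real_derivative - ip M (semi (c * r) ?w) g * c) (at r within {0..})"
    by (simp add: o_def)
  have "(\<lambda>x. 1 * J c f x + c * ?w x) = f" using c by (simp add: fun_eq_iff)
  hence "AE x in M. semi (c * r) f x = 1 * semi (c * r) (J c f) x + c * semi (c * r) ?w x"
    using semi_lin[OF cr v w, of 1 c] by simp
  hence "ip M (semi (c * r) f) g = ip M (\<lambda>x. 1 * semi (c * r) (J c f) x + c * semi (c * r) ?w x) g"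
    by (intro ip_cong_AE L2_measurable[of _ M] L2_lin semi_L2 cr f v w g) auto
  also have "\<dots> = ip M (semi (c * r) (J c f)) g + c * ip M (semi (c * r) ?w) g"
    by (simp only: L2.lin_left[OF semi_L2[OF cr v] semi_L2[OF cr w] g])
  finally have e: "ip M (semi (c * r) f) g = ip M (semi (c * r) (J c f)) g + c * ip M (semi (c * r) ?w) g" .
  show ?thesis unfolding e
    by (rule derivative_eq_intros d refl)+ (simp add: algebra_simps)
qed

lemma exp_minus_integral: "has_bochner_integral lborel (\<lambda>r::real. indicator {0..} r * exp (- r)) 1"
proof -
  have "(\<integral>\<^sup>+r. ennreal (exp (- r)) * indicator {0..} r \<partial>lborel) = 0 - (- exp (- (0::real)))"
  proof (rule nn_integral_FTC_atLeast)
    show "((\<lambda>r::real. - exp (- r)) \<longlongrightarrow> 0) at_top"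
      using tendsto_minus[OF filterlim_compose[OF exp_at_bot filterlim_uminus_at_bot_at_top]] by simp
  qed (auto intro!: derivative_eq_intros)
  moreover have "ennreal (exp (- r)) * indicator {0..} r = ennreal (indicator {0..} r * exp (- r))" for r :: real
    by (simp add: indicator_def)
  ultimately show ?thesis by (intro has_bochner_integral_nn_integral) auto
qed

lemma ip_semi_bound:
  assumes "f \<in> L2 M" "g \<in> L2 M" "0 \<le> s"
  shows "\<bar>ip M (semi s f) g\<bar> \<le> l2n M f * l2n M g"
  using L2.cauchy_schwarz[OF semi_L2[OF assms(3,1)] assms(2)]
    mult_right_mono[OF semi_contraction[OF assms(3,1)], of "l2n M g"] by simp

text \<open>The fundamental theorem of calculus on \<open>[0, n]\<close>; the discount makes the
  boundary term at \<open>n\<close> vanish and dominates the integrands.\<close>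

lemma res_laplace:
  assumes f: "f \<in> L2 M" and g: "g \<in> L2 M" and c: "0 < c"
  shows "(\<integral>r. indicator {0..} r * (exp (- r) * ip M (semi (c * r) f) g) \<partial>lborel) = ip M (J c f) g"
proof -
  let ?F = "\<lambda>r. exp (- r) * ip M (semi (c * r) (J c f)) g"
  let ?m = "\<lambda>r. exp (- r) * ip M (semi (c * r) f) g"
  note v = res_L2[OF c f]
  have cont: "continuous_on {0..b} ?m" for b
    using c by (intro continuous_intros continuous_on_compose2[OF ip_semi_continuous[OF f g]]) auto
  have fin: "(\<integral>r. indicator {0..real n} r *\<^sub>R ?m r \<partial>lborel) = ?F 0 - ?F (real n)" for n
  proof -
    have "(\<integral>r. indicator {0..real n} r *\<^sub>R (- ?m r) \<partial>lborel) = ?F (real n) - ?F 0"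
    proof (rule integral_FTC_Icc)
      show "(?F has_vector_derivative - ?m r) (at r within {0..real n})" if "0 \<le> r" for r
        unfolding has_real_derivative_iff_has_vector_derivative[symmetric]
        by (rule has_field_derivative_subset[OF res_semi_derivative[OF f g c that]]) auto
    qed (auto intro: continuous_on_minus cont)
    thus ?thesis by simp
  qed
  have "(\<lambda>n. \<integral>r. indicator {0..real n} r *\<^sub>R ?m r \<partial>lborel) \<longlonglongrightarrow> (\<integral>r. indicator {0..} r * ?m r \<partial>lborel)"
  proof (rule integral_dominated_convergence[where w = "\<lambda>r. indicator {0..} r * exp (- r) * (l2n M f * l2n M g)"])
    have ms: "(\<lambda>r. indicator {0..real n} r *\<^sub>R ?m r) \<in> borel_measurable lborel" for n
      using borel_measurable_continuous_on_indicator[OF _ cont] by simp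
    thus "(\<lambda>r. indicator {0..real n} r *\<^sub>R ?m r) \<in> borel_measurable lborel" for n .
    have lim: "(\<lambda>n. indicator {0..real n} r *\<^sub>R ?m r) \<longlonglongrightarrow> indicator {0..} r * ?m r" for r
    proof (rule tendsto_eventually)
      obtain N :: nat where "r < real N" using reals_Archimedean2 by blast
      thus "\<forall>\<^sub>F n in sequentially. indicator {0..real n} r *\<^sub>R ?m r = indicator {0..} r * ?m r"
        by (auto simp: eventually_sequentially indicator_def intro!: exI[of _ N])
    qed
    show "(\<lambda>r. indicator {0..} r * ?m r) \<in> borel_measurable lborel"
      by (rule borel_measurable_LIMSEQ_real[OF lim ms])
    show "AE r in lborel. (\<lambda>n. indicator {0..real n} r *\<^sub>R ?m r) \<longlonglongrightarrow> indicator {0..} r * ?m r" using lim by simp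
    show "integrable lborel (\<lambda>r. indicator {0..} r * exp (- r) * (l2n M f * l2n M g))"
      using exp_minus_integral by (auto simp: has_bochner_integral_iff)
    show "AE r in lborel. norm (indicator {0..real n} r *\<^sub>R ?m r) \<le> indicator {0..} r * exp (- r) * (l2n M f * l2n M g)" for n
    proof (rule AE_I2)
      fix r :: real
      show "norm (indicator {0..real n} r *\<^sub>R ?m r) \<le> indicator {0..} r * exp (- r) * (l2n M f * l2n M g)"
        using ip_semi_bound[OF f g, of "c * r"] c by (auto simp: indicator_def abs_mult)
    qed
  qed
  moreover have "(\<lambda>n. ?F 0 - ?F (real n)) \<longlonglongrightarrow> ?F 0 - 0"
  proof (intro tendsto_diff tendsto_const)
    have "((\<lambda>r::real. exp (- r)) \<longlongrightarrow> 0) at_top" by (rule filterlim_compose[OF exp_at_bot filterlim_uminus_at_bot_at_top])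
    hence "((\<lambda>r. exp (- r) * (l2n M (J c f) * l2n M g)) \<longlongrightarrow> 0) at_top" by (rule tendsto_mult_left_zero)
    moreover have "\<forall>\<^sub>F r in at_top. norm (?F r) \<le> exp (- r) * (l2n M (J c f) * l2n M g)"
      using eventually_ge_at_top[of 0] by eventually_elim (use ip_semi_bound[OF v g] c in \<open>auto simp: abs_mult\<close>)
    ultimately have "(?F \<longlongrightarrow> 0) at_top" by (rule Lim_null_comparison[rotated])
    from filterlim_compose[OF this filterlim_real_sequentially] show "(\<lambda>n. ?F (real n)) \<longlonglongrightarrow> 0" .
  qed
  ultimately have "(\<integral>r. indicator {0..} r * ?m r \<partial>lborel) = ?F 0" using fin LIMSEQ_unique by simp
  also have "\<dots> = ip M (J c f) g"
    using semi_0[OF v] by (simp, intro ip_cong_AE L2_measurable[of _ M] semi_L2 v g) auto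
  finally show ?thesis .
qed

text \<open>A mean value bound on \<open>[0, r]\<close>. \<open>B\<close> is left open so that, for
  \<open>g\<close> an indicator, it can be taken from the sup norm of \<open>f\<close> and not from
  its L2 norm.\<close>

lemma res_semi_close_ip:
  assumes f: "f \<in> L2 M" and g: "g \<in> L2 M" and c: "0 < c" and r: "0 \<le> r"
    and B: "\<And>s. 0 \<le> s \<Longrightarrow> \<bar>ip M (semi s f) g\<bar> \<le> B"
  shows "\<bar>ip M (J c f) g - exp (- r) * ip M (semi (c * r) (J c f)) g\<bar> \<le> r * B"
proof -
  let ?F = "\<lambda>r. exp (- r) * ip M (semi (c * r) (J c f)) g"
  have B0: "0 \<le> B" using order_trans[OF abs_ge_zero B[of 0]] by simp
  have "norm (?F 0 - ?F r) \<le> B * norm (0 - r)"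
  proof (rule field_differentiable_bound[OF _ res_semi_derivative[OF f g c]])
    fix s :: real assume s: "s \<in> {0..}"
    have "exp (- s) * \<bar>ip M (semi (c * s) f) g\<bar> \<le> 1 * B" using s c by (intro mult_mono B) auto
    thus "norm (- (exp (- s) * ip M (semi (c * s) f) g)) \<le> B" by (simp add: abs_mult)
  qed (use r in auto)
  moreover have "?F 0 = ip M (J c f) g"
    using semi_0[OF res_L2[OF c f]] by (simp, intro ip_cong_AE L2_measurable[of _ M] semi_L2 res_L2 c f g) auto
  ultimately show ?thesis using r by (simp add: mult.commute)
qed

end

lemma AE_le_of_integrals:
  assumes u: "u \<in> L2 M" and B: "0 \<le> B"
    and le: "\<And>A. A \<in> sets M \<Longrightarrow> emeasure M A < \<infinity> \<Longrightarrow> ip M u (indicator A) \<le> B * measure M A"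
  shows "AE x in M. u x \<le> B"
proof -
  note [measurable] = L2_measurable[OF u]
  have "AE x in M. u x \<le> B + 1 / real (Suc n)" for n
  proof -
    let ?d = "B + 1 / real (Suc n)"
    \<comment> \<open>The threshold \<open>?d\<close> is positive even for \<open>B = 0\<close>, so
      Chebyshev's inequality makes this set finite although the measure need not be.\<close>
    let ?A = "{x \<in> space M. ?d < u x}"
    have d: "0 < ?d" "0 \<le> ?d" "B < ?d" using B by (auto intro: add_nonneg_pos)
    have A: "?A \<in> sets M" by measurable
    have "ennreal (?d\<^sup>2) * emeasure M ?A = (\<integral>\<^sup>+x. ennreal (?d\<^sup>2) * indicator ?A x \<partial>M)"
      using A by (simp add: nn_integral_cmult_indicator)
    also have "\<dots> \<le> (\<integral>\<^sup>+x. ennreal ((u x)\<^sup>2) \<partial>M)"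
      using d by (intro nn_integral_mono) (auto simp: indicator_def intro!: ennreal_leI power_mono)
    also have "\<dots> < \<infinity>" using L2_integrable_sq[OF u] by (simp add: integrable_iff_bounded)
    finally have Af: "emeasure M ?A < \<infinity>" using d by (auto simp: ennreal_mult_less_top less_top)
    have iA: "integrable M (indicat_real ?A)" using A Af by simp
    have "indicat_real ?A \<in> L2 M" using iA by (simp add: L2_def power2_eq_square indicator_inter_arith[symmetric])
    hence iu: "integrable M (\<lambda>x. u x * indicat_real ?A x)" by (rule L2_integrable_mult[OF u])
    have "?d * measure M ?A = (\<integral>x. ?d * indicat_real ?A x \<partial>M)" using A Af by simp
    also have "\<dots> \<le> ip M u (indicator ?A)" unfolding ip_def
      by (intro integral_mono iu integrable_mult_right iA) (auto simp: indicator_def)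
    also have "\<dots> \<le> B * measure M ?A" by (rule le[OF A Af])
    finally have "measure M ?A = 0" using d measure_nonneg[of M ?A] by (smt (verit) mult_strict_right_mono)
    hence "emeasure M ?A = 0" using Af by (simp add: emeasure_eq_ennreal_measure less_top)
    thus ?thesis using A by (subst AE_iff_measurable[of ?A]) (auto simp: not_le)
  qed
  hence "AE x in M. \<forall>n. u x \<le> B + 1 / real (Suc n)" by (simp add: AE_all_countable)
  thus ?thesis
  proof eventually_elim
    case (elim x)
    show ?case
      by (rule le_of_le_add_null[of _ _ "\<lambda>n. 1 / real (Suc n)"])
        (use elim LIMSEQ_inverse_real_of_nat in \<open>auto simp: inverse_eq_divide\<close>)
  qed
qed

lemma AE_eq_of_integrals:
  assumes u: "u \<in> L2 M" and v: "v \<in> L2 M"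
    and eq: "\<And>A. A \<in> sets M \<Longrightarrow> emeasure M A < \<infinity> \<Longrightarrow> ip M u (indicator A) = ip M v (indicator A)"
  shows "AE x in M. u x = v x"
proof -
  have I: "indicat_real A \<in> L2 M" if "A \<in> sets M" "emeasure M A < \<infinity>" for A
    using that by (simp add: L2_def power2_eq_square indicator_inter_arith[symmetric])
  have "AE x in M. u x - v x \<le> 0" by (rule AE_le_of_integrals) (use u v eq I in \<open>auto intro: L2.mem simp: L2.bilin\<close>)
  moreover have "AE x in M. v x - u x \<le> 0"
    by (rule AE_le_of_integrals) (use u v eq I in \<open>auto intro: L2.mem simp: L2.bilin\<close>)
  ultimately show ?thesis by eventually_elim simp
qed

text \<open>Approximates \<open>J c f\<close> uniformly, as \<open>r\<close> tends to 0, by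
  functions on which the semigroup has acted for a positive time; in a Feller space these are
  continuous. The uniform bound is assembled from pairings with indicators of sets of finite
  measure.\<close>

lemma (in mform) res_semi_close:
  assumes f: "f \<in> L2 M" and c: "0 < c" and r: "0 \<le> r" and C: "0 \<le> C" "AE x in M. \<bar>f x\<bar> \<le> C"
  shows "AE x in M. \<bar>J c f x - exp (- r) * semi (c * r) (J c f) x\<bar> \<le> r * C"
proof -
  let ?u = "\<lambda>x. J c f x - exp (- r) * semi (c * r) (J c f) x"
  have cr: "0 \<le> c * r" using c r by simp
  note v = res_L2[OF c f]
  note sv = semi_L2[OF cr v]
  have u: "?u \<in> L2 M" by (intro L2.mem v sv)
  have B: "\<bar>ip M ?u (indicator A)\<bar> \<le> r * C * measure M A" if A: "A \<in> sets M" "emeasure M A < \<infinity>" for A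
  proof -
    have I: "indicat_real A \<in> L2 M" using A by (simp add: L2_def power2_eq_square indicator_inter_arith[symmetric])
    have "\<bar>ip M (semi s f) (indicator A)\<bar> \<le> C * measure M A" if s: "0 \<le> s" for s
    proof -
      have "\<bar>ip M (semi s f) (indicator A)\<bar> \<le> (\<integral>x. \<bar>semi s f x * indicat_real A x\<bar> \<partial>M)"
        unfolding ip_def by (rule integral_abs_bound)
      also have "\<dots> \<le> (\<integral>x. C * indicat_real A x \<partial>M)"
      proof (rule integral_mono_AE)
        show "AE x in M. \<bar>semi s f x * indicat_real A x\<bar> \<le> C * indicat_real A x"
          using semi_bounded[OF s f C(2,1)] by eventually_elim (auto simp: indicator_def)
      qed (use A I in \<open>auto intro!: integrable_abs L2_integrable_mult semi_L2 s f\<close>)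
      finally show ?thesis using A by simp
    qed
    from res_semi_close_ip[OF f I c r this] show ?thesis
      by (simp add: L2.bilin L2.mem v sv I mult.assoc)
  qed
  have 1: "AE x in M. ?u x \<le> r * C"
    by (rule AE_le_of_integrals[OF u]) (use r C B in \<open>force dest: abs_le_D1\<close>)+
  have "AE x in M. - ?u x \<le> r * C"
  proof (rule AE_le_of_integrals[OF L2.uminus_mem[OF u]])
    fix A assume A: "A \<in> sets M" "emeasure M A < \<infinity>"
    hence I: "indicat_real A \<in> L2 M" by (simp add: L2_def power2_eq_square indicator_inter_arith[symmetric])
    show "ip M (\<lambda>x. - ?u x) (indicator A) \<le> r * C * measure M A"
      using B[OF A] unfolding L2.uminus_left[OF u I] by linarith
  qed (use r C in simp)
  with 1 show ?thesis by eventually_elim (simp add: abs_le_iff)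
qed

section \<open>Continuous representatives\<close>

lemma (in Metric_space) continuous_of_sequences_metric:
  fixes f :: "'a \<Rightarrow> real"
  assumes "\<And>x \<sigma>. x \<in> M \<Longrightarrow> range \<sigma> \<subseteq> M \<Longrightarrow> limitin mtopology \<sigma> x sequentially \<Longrightarrow> (\<lambda>n. f (\<sigma> n)) \<longlonglongrightarrow> f x"
  shows "continuous_map mtopology euclideanreal f"
proof -
  have "closedin mtopology {x \<in> M. f x \<in> C}" if C: "closed C" for C
    unfolding metric_closedin_iff_sequentially_closed
  proof (intro conjI allI impI)
    fix \<sigma> l assume s: "range \<sigma> \<subseteq> {x \<in> M. f x \<in> C} \<and> limitin mtopology \<sigma> l sequentially"
    hence l: "l \<in> M" using limitin_mspace by blast
    have lim: "(\<lambda>n. f (\<sigma> n)) \<longlonglongrightarrow> f l" by (rule assms[OF l]) (use s in auto)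
    have "f l \<in> C" by (rule closed_sequentially[OF C _ lim]) (use s in auto)
    thus "l \<in> {x \<in> M. f x \<in> C}" using l by simp
  qed auto
  thus ?thesis by (auto simp: continuous_map_closedin)
qed

context dspace
begin

text \<open>Integrals depending on a point are treated by dominated convergence, a statement on
  sequences; metrizability makes sequences sufficient.\<close>

lemma continuous_of_sequences:
  fixes f :: "'a \<Rightarrow> real"
  assumes "\<And>x \<sigma>. x \<in> topspace X \<Longrightarrow> range \<sigma> \<subseteq> topspace X \<Longrightarrow> limitin X \<sigma> x sequentially \<Longrightarrow> (\<lambda>n. f (\<sigma> n)) \<longlonglongrightarrow> f x"
  shows "f \<in> C_space X"
proof -
  obtain S d where S: "Metric_space S d" and X: "X = Metric_space.mtopology S d"
    using metrizable by (auto simp: metrizable_space_def)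
  have "topspace X = S" unfolding X by (rule Metric_space.topspace_mtopology[OF S])
  with Metric_space.continuous_of_sequences_metric[OF S, of f] assms show ?thesis
    unfolding C_space_def X[symmetric] by simp
qed

lemma C_space_limit:
  "f \<in> C_space X \<Longrightarrow> limitin X \<sigma> x F \<Longrightarrow> ((\<lambda>n. f (\<sigma> n)) \<longlongrightarrow> f x) F"
  using continuous_map_limit[of X euclideanreal f] by (fastforce simp: C_space_def o_def)

lemma C_space_nbhd:
  assumes "f \<in> C_space X" "x \<in> topspace X" "0 < e"
  obtains N where "openin X N" "x \<in> N" "\<And>y. y \<in> N \<Longrightarrow> \<bar>f y - f x\<bar> < e"
proof (rule that[of "{y \<in> topspace X. f y \<in> ball (f x) e}"])
  show "openin X {y \<in> topspace X. f y \<in> ball (f x) e}"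
    by (rule openin_continuous_map_preimage[of X euclideanreal]) (use assms(1) in \<open>auto simp: C_space_def\<close>)
qed (use assms in \<open>auto simp: dist_real_def\<close>)

text \<open>Two neighbourhoods of a point meet in a set of positive measure, so the constants
  belonging to the tolerances \<open>(1/2)^n\<close> form a Cauchy sequence. Its limit is the value
  of the representative.\<close>

lemma continuous_representative:
  assumes U: "openin X U"
    and h: "\<And>x e. x \<in> U \<Longrightarrow> 0 < e \<Longrightarrow> \<exists>N a. openin X N \<and> x \<in> N \<and> (AE y in M. y \<in> N \<longrightarrow> \<bar>v y - a\<bar> \<le> e)"
  obtains w where "continuous_map (subtopology X U) euclideanreal w" "AE x in M. x \<in> U \<longrightarrow> v x = w x"
proof -
  let ?P = "\<lambda>x r. \<forall>e>0. \<exists>N. openin X N \<and> x \<in> N \<and> (AE y in M. y \<in> N \<longrightarrow> \<bar>v y - r\<bar> \<le> e)"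
  have both: "\<bar>a - b\<bar> \<le> e + e'" if "openin X N" "x \<in> N" "AE y in M. y \<in> N \<longrightarrow> \<bar>v y - a\<bar> \<le> e"
      "openin X N'" "x \<in> N'" "AE y in M. y \<in> N' \<longrightarrow> \<bar>v y - b\<bar> \<le> e'" for a b e e' x N N'
  proof -
    have *: "AE y in M. y \<in> N \<inter> N' \<longrightarrow> \<bar>v y - a\<bar> \<le> e \<and> \<bar>v y - b\<bar> \<le> e'"
      using that(3,6) by eventually_elim auto
    have "\<exists>y\<in>N \<inter> N'. \<bar>v y - a\<bar> \<le> e \<and> \<bar>v y - b\<bar> \<le> e'"
      by (rule AE_open_exists[OF openin_Int _ *]) (use that(1,2,4,5) in auto)
    thus ?thesis by (elim bexE conjE) linarith
  qed
  have "\<exists>r. ?P x r" if x: "x \<in> U" for x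
  proof -
    have "\<forall>n::nat. \<exists>N a. openin X N \<and> x \<in> N \<and> (AE y in M. y \<in> N \<longrightarrow> \<bar>v y - a\<bar> \<le> (1/2)^n)"
      by (intro allI h[OF x]) simp
    from choice[OF this] obtain N where "\<forall>n::nat. \<exists>a. openin X (N n) \<and> x \<in> N n \<and> (AE y in M. y \<in> N n \<longrightarrow> \<bar>v y - a\<bar> \<le> (1/2)^n)" ..
    from choice[OF this] obtain a where Na: "\<And>n. openin X (N n)" "\<And>n. x \<in> N n" "\<And>n::nat. AE y in M. y \<in> N n \<longrightarrow> \<bar>v y - a n\<bar> \<le> (1/2)^n"
      by auto
    have d: "\<bar>a m - a n\<bar> \<le> (1/2)^m + (1/2)^n" for m n by (rule both[OF Na Na])
    have "Cauchy a"
    proof (rule metric_CauchyI)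
      fix e :: real assume "0 < e"
      then obtain k where k: "(1/2::real)^k < e/2" using real_arch_pow_inv[of "e/2" "1/2"] by auto
      have pw: "(1/2::real)^m \<le> (1/2)^k" if "k \<le> m" for m using that by (intro power_decreasing) auto
      hence "dist (a m) (a n) < e" if "k \<le> m" "k \<le> n" for m n
        using d[of m n] k pw[OF that(1)] pw[OF that(2)] unfolding dist_real_def by linarith
      thus "\<exists>k. \<forall>m\<ge>k. \<forall>n\<ge>k. dist (a m) (a n) < e" by blast
    qed
    then obtain r where r: "a \<longlonglongrightarrow> r" using Cauchy_convergent convergent_def by blast
    show ?thesis
    proof (rule exI[of _ r], intro allI impI)
      fix e :: real assume "0 < e"
      have "(\<lambda>n. \<bar>a n - r\<bar> + (1/2)^n) \<longlonglongrightarrow> 0 + 0"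
        by (intro tendsto_add LIMSEQ_realpow_zero) (use r in \<open>auto simp: tendsto_rabs_zero_iff LIM_zero_iff\<close>)
      from order_tendstoD(2)[OF this, of e] \<open>0 < e\<close> obtain n where n: "\<bar>a n - r\<bar> + (1/2)^n < e"
        by (auto simp: eventually_sequentially)
      have "AE y in M. y \<in> N n \<longrightarrow> \<bar>v y - r\<bar> \<le> e" using Na(3)[of n] by eventually_elim (use n in auto)
      thus "\<exists>N. openin X N \<and> x \<in> N \<and> (AE y in M. y \<in> N \<longrightarrow> \<bar>v y - r\<bar> \<le> e)" using Na(1,2) by blast
    qed
  qed
  then obtain w where w: "\<And>x. x \<in> U \<Longrightarrow> ?P x (w x)" by metis
  have near: "\<exists>N. openin X N \<and> x \<in> N \<and> N \<subseteq> U \<and> (AE y in M. y \<in> N \<longrightarrow> \<bar>v y - w x\<bar> \<le> e) \<and> (\<forall>y\<in>N. \<bar>w y - w x\<bar> \<le> e + e)"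
    if x: "x \<in> U" and e: "0 < e" for x e
  proof -
    obtain N where N: "openin X N" "x \<in> N" "AE y in M. y \<in> N \<longrightarrow> \<bar>v y - w x\<bar> \<le> e" using w[OF x] e by blast
    have "\<bar>w y - w x\<bar> \<le> e + e" if y: "y \<in> N \<inter> U" for y
    proof -
      obtain N' where N': "openin X N'" "y \<in> N'" "AE z in M. z \<in> N' \<longrightarrow> \<bar>v z - w y\<bar> \<le> e" using w[of y] y e by blast
      show ?thesis using both[OF N' N(1) _ N(3)] y by blast
    qed
    moreover have "AE y in M. y \<in> N \<inter> U \<longrightarrow> \<bar>v y - w x\<bar> \<le> e" using N(3) by eventually_elim auto
    ultimately show ?thesis using N U x by (intro exI[of _ "N \<inter> U"]) auto
  qed
  have "continuous_map (subtopology X U) euclideanreal w"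
    unfolding continuous_map_def
  proof (intro conjI allI impI)
    fix S :: "real set" assume "openin euclideanreal S"
    hence S: "open S" by simp
    have "openin X {x \<in> U. w x \<in> S}"
    proof (subst openin_subopen, intro ballI)
      fix x assume x: "x \<in> {x \<in> U. w x \<in> S}"
      then obtain e where e: "0 < e" "ball (w x) e \<subseteq> S" using S open_contains_ball by blast
      obtain N where N: "openin X N" "x \<in> N" "N \<subseteq> U" "\<forall>y\<in>N. \<bar>w y - w x\<bar> \<le> e/3 + e/3" using near[of x "e/3"] x e by auto
      have "N \<subseteq> {x \<in> U. w x \<in> S}"
      proof
        fix y assume y: "y \<in> N"
        with N(4) have "\<bar>w y - w x\<bar> \<le> e/3 + e/3" by blast
          hence "w y \<in> ball (w x) e" using e(1) unfolding mem_ball dist_real_def by linarith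
        thus "y \<in> {x \<in> U. w x \<in> S}" using y N(3) e(2) by auto
      qed
      thus "\<exists>T. openin X T \<and> x \<in> T \<and> T \<subseteq> {x \<in> U. w x \<in> S}" using N by blast
    qed
    moreover have "{x \<in> topspace (subtopology X U). w x \<in> S} = {x \<in> U. w x \<in> S}" using openin_subset[OF U] by auto
    ultimately show "openin (subtopology X U) {x \<in> topspace (subtopology X U). w x \<in> S}"
      by (auto simp: openin_open_subtopology[OF U])
  qed auto
  moreover have "AE y in M. y \<in> U \<longrightarrow> v y = w y"
  proof -
    have "AE y in M. y \<in> U \<longrightarrow> \<bar>v y - w y\<bar> \<le> 3 * (1 / real (Suc n))" for n
    proof (rule AE_local)
      fix x assume "x \<in> U"
      then obtain N where N: "openin X N" "x \<in> N" "AE y in M. y \<in> N \<longrightarrow> \<bar>v y - w x\<bar> \<le> 1 / real (Suc n)"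
        "\<forall>y\<in>N. \<bar>w y - w x\<bar> \<le> 1 / real (Suc n) + 1 / real (Suc n)" using near[of x "1 / real (Suc n)"] by auto
      have "AE y in M. y \<in> N \<longrightarrow> \<bar>v y - w y\<bar> \<le> 3 * (1 / real (Suc n))"
        using N(3)
      proof eventually_elim
        case (elim y)
        show ?case
        proof
          assume y: "y \<in> N"
          have "\<bar>a - b\<bar> \<le> 3 * d" if "\<bar>a - c\<bar> \<le> d" "\<bar>b - c\<bar> \<le> d + d" for a b c d :: real using that by linarith
          from this[OF elim[rule_format, OF y] N(4)[rule_format, OF y]] show "\<bar>v y - w y\<bar> \<le> 3 * (1 / real (Suc n))" .
        qed
      qed
      with N(1,2) show "\<exists>N. openin X N \<and> x \<in> N \<and> (AE y in M. y \<in> N \<longrightarrow> \<bar>v y - w y\<bar> \<le> 3 * (1 / real (Suc n)))" by blast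
    qed
    hence "AE y in M. \<forall>n. y \<in> U \<longrightarrow> \<bar>v y - w y\<bar> \<le> 3 * (1 / real (Suc n))" by (simp only: AE_all_countable) simp
    thus ?thesis
    proof eventually_elim
      case (elim y)
      have "(\<lambda>n. 3 * (1 / real (Suc n))) \<longlonglongrightarrow> 0"
        by (intro tendsto_mult_right_zero) (use LIMSEQ_inverse_real_of_nat in \<open>simp add: inverse_eq_divide\<close>)
      from le_of_le_add_null[of "\<bar>v y - w y\<bar>" 0, OF _ this] elim show ?case by auto
    qed
  qed
  ultimately show thesis by (rule that)
qed

lemma bounded_C_L2:
  assumes "f \<in> C_c X" shows "f \<in> L2 M" "\<exists>C\<ge>0. \<forall>x\<in>topspace X. \<bar>f x\<bar> \<le> C"
proof -
  have K: "compactin X (supp f)" and fC: "f \<in> C_space X" using assms by (auto simp: C_c_alt)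
  have "compactin euclideanreal (f ` supp f)" by (rule image_compactin[OF K]) (use fC in \<open>simp add: C_space_def\<close>)
  hence "bounded (f ` supp f)" by (simp add: compact_imp_bounded)
  then obtain B where B: "\<And>y. y \<in> f ` supp f \<Longrightarrow> \<bar>y\<bar> \<le> B" by (auto simp: bounded_iff)
  have bd: "\<bar>f x\<bar> \<le> \<bar>B\<bar>" if x: "x \<in> topspace X" for x
  proof (cases "x \<in> supp f")
    case True thus ?thesis using B[of "f x"] by simp
  qed (use supp_zero[OF x, of f] in simp)
  thus "\<exists>C\<ge>0. \<forall>x\<in>topspace X. \<bar>f x\<bar> \<le> C" by (intro exI[of _ "\<bar>B\<bar>"]) auto
  have I: "(\<lambda>x. \<bar>B\<bar> * indicat_real (supp f) x) \<in> L2 M"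
    by (intro L2.scale_mem indicator_L2 compact_sets compact_finite K)
  show "f \<in> L2 M"
    by (rule L2_bound[OF I C_space_measurable[OF fC]], rule AE_I2)
      (use bd supp_zero[of _ f] in \<open>auto simp: indicator_def space_M\<close>)
qed

lemma feller_semi:
  assumes fel: "doubly_feller D" and f: "f \<in> L2 M" and C: "AE x in M. \<bar>f x\<bar> \<le> C" and t: "0 < t"
  obtains q where "q \<in> C_space X" "AE x in M. semi t f x = q x"
proof -
  have "f \<in> Linf M" using f C L2_measurable by (auto simp: Linf_def)
  then obtain q where q: "q \<in> C_space X" "AE x in M. q x = heat D t f x"
    using fel t unfolding doubly_feller_def by blast
  have "AE x in M. semi t f x = q x"
    using q(2) heat_eq_semi[OF less_imp_le[OF t] f] by eventually_elim simp
  with q(1) show thesis by (rule that)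
qed

text \<open>By \<open>res_semi_close\<close> the function lies within \<open>r * C\<close> of one
  that has a continuous representative, and \<open>r\<close> is at free disposal.\<close>

lemma res_continuous:
  assumes fel: "doubly_feller D" and f: "f \<in> L2 M" and C: "0 \<le> C" "AE x in M. \<bar>f x\<bar> \<le> C" and c: "0 < c"
  obtains k where "k \<in> C_space X" "AE x in M. J c f x = k x"
proof -
  have b1: "AE x in M. J c f x \<le> C" by (rule res_le_const[OF c f C(1)]) (use C(2) in auto)
  have "AE x in M. J c (\<lambda>x. - f x) x \<le> C" by (rule res_le_const[OF c L2.uminus_mem[OF f] C(1)]) (use C(2) in auto)
  with b1 res_uminus[OF c f] have bd: "AE x in M. \<bar>J c f x\<bar> \<le> C" by eventually_elim auto
  obtain w where w: "continuous_map (subtopology X (topspace X)) euclideanreal w" "AE x in M. x \<in> topspace X \<longrightarrow> J c f x = w x"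
  proof (rule continuous_representative[of "topspace X" "J c f"])
    fix x and e :: real assume x: "x \<in> topspace X" and e: "0 < e"
    define r where "r = e / (2 * (C + 1))"
    have r: "0 < r" "r * C \<le> e / 2" using e C(1) by (auto simp: r_def field_simps)
    obtain q where q: "q \<in> C_space X" "AE x in M. semi (c * r) (J c f) x = q x"
      by (rule feller_semi[OF fel res_L2[OF c f] bd, of "c * r"]) (use c r in simp, rule that)
    have "(\<lambda>x. exp (- r) * q x + 0 * q x) \<in> C_space X" by (intro C_space_lattice q)
    note qc = this
    obtain N where N: "openin X N" "x \<in> N" "\<And>y. y \<in> N \<Longrightarrow> \<bar>exp (- r) * q y + 0 * q y - (exp (- r) * q x + 0 * q x)\<bar> < e / 2"
      by (rule C_space_nbhd[OF qc x half_gt_zero[OF e]], rule that)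
    have "AE y in M. y \<in> N \<longrightarrow> \<bar>J c f y - exp (- r) * q x\<bar> \<le> e"
      using res_semi_close[OF f c less_imp_le[OF r(1)] C] q(2)
    proof eventually_elim
      case (elim y)
      show ?case
      proof
        assume "y \<in> N"
        from N(3)[OF this] elim r(2) show "\<bar>J c f y - exp (- r) * q x\<bar> \<le> e" by (simp, linarith)
      qed
    qed
    with N(1,2) show "\<exists>N a. openin X N \<and> x \<in> N \<and> (AE y in M. y \<in> N \<longrightarrow> \<bar>J c f y - a\<bar> \<le> e)" by blast
  qed (use openin_topspace that in blast)+
  have "AE x in M. J c f x = w x" using w(2) AE_space by eventually_elim (simp add: space_M)
  thus thesis using that[of w] w(1) by (simp add: C_space_def)
qed

end

section \<open>Pointwise convergence of resolvents\<close>

text \<open>The least multiple of \<open>1 / real (Suc n)\<close> strictly above \<open>r\<close>.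
  Strictness, also on the grid itself, is essential since the limits below are one-sided from the
  right.\<close>

definition ceil_step :: "nat \<Rightarrow> real \<Rightarrow> real" where
  "ceil_step n r = (real_of_int \<lfloor>real (Suc n) * r\<rfloor> + 1) / real (Suc n)"

lemma ceil_step_tendsto:
  fixes r :: real and w :: "real \<Rightarrow> real"
  assumes "(w \<longlongrightarrow> w r) (at_right r)" shows "(\<lambda>n. w (ceil_step n r)) \<longlonglongrightarrow> w r"
proof -
  have gt: "r < ceil_step n r" and le: "ceil_step n r \<le> r + 1 / real (Suc n)" for n
  proof -
    have "r * real (Suc n) < real_of_int \<lfloor>real (Suc n) * r\<rfloor> + 1"
      using real_of_int_floor_add_one_gt[of "real (Suc n) * r"] by (simp only: mult.commute)
    thus "r < ceil_step n r" unfolding ceil_step_def by (subst pos_less_divide_eq) auto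
    have "ceil_step n r \<le> (real (Suc n) * r + 1) / real (Suc n)"
      unfolding ceil_step_def by (intro divide_right_mono add_right_mono of_int_floor_le) simp
    also have "\<dots> = r + 1 / real (Suc n)" by (simp add: add_divide_distrib)
    finally show "ceil_step n r \<le> r + 1 / real (Suc n)" .
  qed
  have "(\<lambda>n. ceil_step n r) \<longlonglongrightarrow> r"
  proof (rule tendsto_sandwich[of "\<lambda>_. r" _ _ "\<lambda>n. r + 1 / real (Suc n)"])
    have "(\<lambda>n. r + inverse (real (Suc n))) \<longlonglongrightarrow> r + 0" by (intro tendsto_intros LIMSEQ_inverse_real_of_nat)
    thus "(\<lambda>n. r + 1 / real (Suc n)) \<longlonglongrightarrow> r" by (simp add: inverse_eq_divide)
    show "\<forall>\<^sub>F n in sequentially. r \<le> ceil_step n r" using gt less_imp_le by (intro always_eventually) blast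
  qed (use le in \<open>auto intro: always_eventually\<close>)
  hence "filterlim (\<lambda>n. ceil_step n r) (at_right r) sequentially"
    unfolding filterlim_at using gt by (auto intro!: always_eventually simp: less_imp_neq[symmetric])
  from filterlim_compose[OF assms this] show ?thesis .
qed

text \<open>Time is frozen at countably many grid values, where only measurability in
  \<open>x\<close> is needed; right-continuity recovers the function in the limit.\<close>

lemma right_continuous_measurable:
  fixes w :: "real \<Rightarrow> 'b \<Rightarrow> real"
  assumes m: "\<And>t. w t \<in> borel_measurable N"
    and rc: "\<And>t x. x \<in> space N \<Longrightarrow> ((\<lambda>s. w s x) \<longlongrightarrow> w t x) (at_right t)"
  shows "(\<lambda>(r, x). w (c * r) x) \<in> borel_measurable (lborel \<Otimes>\<^sub>M N)"
proof (rule borel_measurable_LIMSEQ_real)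
  fix p :: "real \<times> 'b" assume "p \<in> space (lborel \<Otimes>\<^sub>M N)"
  thus "(\<lambda>n. w (ceil_step n (c * fst p)) (snd p)) \<longlonglongrightarrow> (case p of (r, x) \<Rightarrow> w (c * r) x)"
    using ceil_step_tendsto[of "\<lambda>s. w s (snd p)" "c * fst p", OF rc] by (auto simp: space_pair_measure)
next
  fix n
  have "(\<lambda>p. (\<lambda>i p. w ((real_of_int i + 1) / real (Suc n)) (snd p)) \<lfloor>real (Suc n) * (c * fst p)\<rfloor> p) \<in> borel_measurable ((lborel :: real measure) \<Otimes>\<^sub>M N)"
  proof (rule measurable_compose_countable[where f = "\<lambda>i p. w ((real_of_int i + 1) / real (Suc n)) (snd p)"
        and g = "\<lambda>p. \<lfloor>real (Suc n) * (c * fst p)\<rfloor>"])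
    show "(\<lambda>p :: real \<times> 'b. w ((real_of_int i + 1) / real (Suc n)) (snd p)) \<in> borel_measurable ((lborel :: real measure) \<Otimes>\<^sub>M N)" for i
      by (rule measurable_compose[OF measurable_snd m])
    show "(\<lambda>p. \<lfloor>real (Suc n) * (c * fst p)\<rfloor>) \<in> (lborel :: real measure) \<Otimes>\<^sub>M N \<rightarrow>\<^sub>M count_space UNIV" by measurable
  qed
  thus "(\<lambda>p. w (ceil_step n (c * fst p)) (snd p)) \<in> borel_measurable ((lborel :: real measure) \<Otimes>\<^sub>M N)"
    by (simp add: ceil_step_def)
qed

context dspace
begin

lemma exp_minus_integrable: "integrable lborel (\<lambda>r::real. indicator {0..} r * exp (- r) * C)"
  and exp_minus_integral_eq: "(\<integral>r. indicator {0..} r * (exp (- r) * C) \<partial>lborel) = C" for C :: real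
  using exp_minus_integral by (auto simp: has_bochner_integral_iff mult.assoc[symmetric])

lemma C_c_C_0:
  assumes "f \<in> C_c X" shows "f \<in> C_0 X"
proof -
  have f: "f \<in> C_space X" "compactin X (supp f)" using assms by (auto simp: C_c_alt)
  have "compactin X {x \<in> topspace X. e \<le> \<bar>f x\<bar>}" if e: "0 < e" for e
  proof (rule closed_compactin[OF f(2)])
    show "{x \<in> topspace X. e \<le> \<bar>f x\<bar>} \<subseteq> supp f" using e supp_zero[of _ f] by force
    have "closedin X {x \<in> topspace X. f x \<in> {..- e} \<union> {e..}}"
      by (rule closedin_continuous_map_preimage[of X euclideanreal]) (use f(1) in \<open>auto simp: C_space_def\<close>)
    thus "closedin X {x \<in> topspace X. e \<le> \<bar>f x\<bar>}" by (rule back_subst[of "closedin X"]) auto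
  qed
  thus ?thesis using f(1) by (auto simp: C_0_def)
qed

text \<open>The Feller property gives pointwise continuity at time 0 only. At a later time
  \<open>t\<close> it is applied to \<open>u t\<close>, which again vanishes at infinity, and the
  flow starting there is identified with the shifted one by continuity and full support.\<close>

lemma feller_flow:
  assumes fel: "doubly_feller D" and f: "f \<in> C_c X"
  obtains u C where "\<And>t. 0 \<le> t \<Longrightarrow> u t \<in> C_space X" "\<And>t. 0 \<le> t \<Longrightarrow> AE x in M. u t x = semi t f x"
    "\<And>t x. 0 \<le> t \<Longrightarrow> x \<in> topspace X \<Longrightarrow> \<bar>u t x\<bar> \<le> C"
    "\<And>t x. 0 \<le> t \<Longrightarrow> x \<in> topspace X \<Longrightarrow> ((\<lambda>s. u s x) \<longlongrightarrow> u t x) (at_right t)"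
    "\<And>x. x \<in> topspace X \<Longrightarrow> u 0 x = f x" "0 \<le> C"
proof -
  have ex: "\<exists>u. (\<forall>t\<ge>0. u t \<in> C_0 X \<and> (AE x in M. u t x = heat D t g x)) \<and> (\<forall>x\<in>topspace X. ((\<lambda>t. u t x) \<longlongrightarrow> g x) (at_right 0))"
    if "g \<in> C_0 X" for g
    using fel that unfolding doubly_feller_def by blast
  obtain u where u0: "\<And>t. 0 \<le> t \<Longrightarrow> u t \<in> C_0 X" "\<And>t. 0 \<le> t \<Longrightarrow> AE x in M. u t x = heat D t f x"
    using ex[OF C_c_C_0[OF f]] by blast
  have uC: "u t \<in> C_space X" if "0 \<le> t" for t using u0(1)[OF that] by (simp add: C_0_def)
  note fL = bounded_C_L2(1)[OF f]
  obtain C where C: "0 \<le> C" "\<And>x. x \<in> topspace X \<Longrightarrow> \<bar>f x\<bar> \<le> C" using bounded_C_L2(2)[OF f] by blast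
  have us: "AE x in M. u t x = semi t f x" if t: "0 \<le> t" for t
    using u0(2)[OF t] heat_eq_semi[OF t fL] by eventually_elim simp
  have uL: "u t \<in> L2 M" if t: "0 \<le> t" for t
    by (rule L2_cong_AE[OF semi_L2[OF t fL] C_space_measurable[OF uC[OF t]]]) (use us[OF t] in \<open>auto\<close>)
  have fb: "AE x in M. \<bar>f x\<bar> \<le> C" using C(2) by (intro AE_I2) (simp add: space_M)
  have bd: "\<bar>u t x\<bar> \<le> C" if t: "0 \<le> t" and x: "x \<in> topspace X" for t x
  proof -
    have "(\<lambda>x. max (u t x) (0 * u t x + (-1) * u t x)) \<in> C_space X" by (intro C_space_lattice uC t)
    hence "max (u t x) (0 * u t x + (-1) * u t x) \<le> C"
    proof (rule AE_le_cont_imp_le[OF _ _ openin_topspace _ x])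
      show "(\<lambda>x. C) \<in> C_space X" by (rule C_space_lattice(5)[OF uC[OF order_refl] uC[OF order_refl]])
      show "AE x in M. x \<in> topspace X \<longrightarrow> max (u t x) (0 * u t x + - 1 * u t x) \<le> C"
        using us[OF t] semi_bounded[OF t fL fb C(1)] by eventually_elim auto
    qed
    thus ?thesis by (simp add: abs_le_iff)
  qed
  have u0f: "u 0 x = f x" if x: "x \<in> topspace X" for x
  proof (rule AE_eq_cont_imp_eq[OF uC _ _ x])
    show "f \<in> C_space X" using f by (simp add: C_c_alt)
    show "AE x in M. u 0 x = f x" using us[OF order_refl] semi_0[OF fL] by eventually_elim simp
  qed simp
  have rc: "((\<lambda>s. u s x) \<longlongrightarrow> u t x) (at_right t)" if t: "0 \<le> t" and x: "x \<in> topspace X" for t x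
  proof -
    obtain v where v: "\<And>s. 0 \<le> s \<Longrightarrow> v s \<in> C_0 X" "\<And>s. 0 \<le> s \<Longrightarrow> AE x in M. v s x = heat D s (u t) x"
      "\<And>x. x \<in> topspace X \<Longrightarrow> ((\<lambda>s. v s x) \<longlongrightarrow> u t x) (at_right 0)"
      using ex[OF u0(1)[OF t]] by blast
    have "v s x = u (s + t) x" if s: "0 \<le> s" for s
    proof (rule AE_eq_cont_imp_eq[OF _ _ _ x])
      show "v s \<in> C_space X" using v(1)[OF s] by (simp add: C_0_def)
      show "u (s + t) \<in> C_space X" using s t by (intro uC) simp
      show "AE x in M. v s x = u (s + t) x"
        using v(2)[OF s] heat_eq_semi[OF s uL[OF t]] semi_cong_AE[OF s uL[OF t] L2_measurable[OF semi_L2[OF t fL]] us[OF t]]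
          semi_add[OF s t fL] us[OF add_nonneg_nonneg[OF s t]] by eventually_elim simp
    qed
    hence "\<forall>\<^sub>F s in at_right 0. v s x = u (s + t) x" by (auto simp: eventually_at_filter)
    with v(3)[OF x] have "((\<lambda>s. u (s + t) x) \<longlongrightarrow> u t x) (at_right 0)" by (rule Lim_transform_eventually)
    thus ?thesis by (subst filterlim_at_right_to_0)
  qed
  show thesis by (rule that[OF uC us bd rc u0f C(1)])
qed

text \<open>The Laplace transform of the continuous flow, taken at each point, is a continuous
  version \<open>k c\<close> of \<open>J c f\<close>. As \<open>c\<close> tends to 0 dominated
  convergence gives the value at time 0; the convergence is pointwise and not uniform.\<close>

lemma res_pointwise:
  assumes fel: "doubly_feller D" and f: "f \<in> C_c X"
  obtains k where "\<And>c. 0 < c \<Longrightarrow> k c \<in> C_space X" "\<And>c. 0 < c \<Longrightarrow> AE x in M. J c f x = k c x"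
    "\<And>x. x \<in> topspace X \<Longrightarrow> (\<lambda>n. k (1 / real (Suc n)) x) \<longlonglongrightarrow> f x"
proof -
  obtain u C where u: "\<And>t. 0 \<le> t \<Longrightarrow> u t \<in> C_space X" "\<And>t. 0 \<le> t \<Longrightarrow> AE x in M. u t x = semi t f x"
    "\<And>t x. 0 \<le> t \<Longrightarrow> x \<in> topspace X \<Longrightarrow> \<bar>u t x\<bar> \<le> C"
    "\<And>t x. 0 \<le> t \<Longrightarrow> x \<in> topspace X \<Longrightarrow> ((\<lambda>s. u s x) \<longlongrightarrow> u t x) (at_right t)"
    "\<And>x. x \<in> topspace X \<Longrightarrow> u 0 x = f x" and C: "0 \<le> C"
    by (rule feller_flow[OF fel f]) (rule that)
  note fL = bounded_C_L2(1)[OF f]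
  \<comment> \<open>Extended by a constant to negative times, the flow is right-continuous on the
    whole line, as the measurability lemma requires.\<close>
  define w where "w t = u (max 0 t)" for t :: real
  have w: "w t \<in> C_space X" "x \<in> topspace X \<Longrightarrow> \<bar>w t x\<bar> \<le> C" for t x
    unfolding w_def using u(1,3) by auto
  have wr: "((\<lambda>s. w s x) \<longlongrightarrow> w t x) (at_right t)" if x: "x \<in> topspace X" for t x
  proof (cases "0 \<le> t")
    case True
    have "\<forall>\<^sub>F s in at_right t. u s x = w s x"
      using eventually_at_right_less[of t] by eventually_elim (use True in \<open>simp add: w_def\<close>)
    with u(4)[OF True x] show ?thesis using True by (simp add: w_def Lim_transform_eventually)
  next
    case False
    hence "\<forall>\<^sub>F s in at_right t. w t x = w s x"
      unfolding eventually_at_right_field by (intro exI[of _ 0]) (auto simp: w_def)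
    thus ?thesis by (rule Lim_transform_eventually[OF tendsto_const])
  qed
  let ?e = "\<lambda>r::real. indicator {0..} r * exp (- r)"
  define k where "k c x = (\<integral>r. ?e r * w (c * r) x \<partial>lborel)" for c x
  have meas: "(\<lambda>(r, x). w (c * r) x) \<in> borel_measurable (lborel \<Otimes>\<^sub>M restrict_space M A)" for c A
    by (rule right_continuous_measurable) (auto intro!: measurable_restrict_space1 C_space_measurable w wr simp: space_restrict_space space_M)
  have m1 [measurable]: "(\<lambda>r. w (c * r) x) \<in> borel_measurable lborel" if x: "x \<in> topspace X" for c x
    using measurable_compose[OF measurable_Pair2'[of x "restrict_space M UNIV" lborel] meas[of c UNIV]] x
    by (simp add: space_restrict_space space_M)
  have bd: "norm (?e r * w t x) \<le> ?e r * C" if "x \<in> topspace X" for t x r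
    using w(2)[OF that, of t] by (auto simp: indicator_def abs_mult)
  have kC: "k c \<in> C_space X" for c
  proof (rule continuous_of_sequences)
    fix x and \<sigma> :: "nat \<Rightarrow> 'a" assume x: "x \<in> topspace X" and s: "range \<sigma> \<subseteq> topspace X" "limitin X \<sigma> x sequentially"
    have s': "\<sigma> n \<in> topspace X" for n using s(1) by auto
    show "(\<lambda>n. k c (\<sigma> n)) \<longlonglongrightarrow> k c x" unfolding k_def
    proof (rule integral_dominated_convergence[OF _ _ exp_minus_integrable[of C]])
      show "AE r in lborel. (\<lambda>n. ?e r * w (c * r) (\<sigma> n)) \<longlonglongrightarrow> ?e r * w (c * r) x"
        by (intro AE_I2 tendsto_mult_left C_space_limit[OF w(1) s(2)])
    qed (use bd[OF s'] m1[OF x] m1[OF s'] in auto)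
  qed
  have klim: "(\<lambda>n. k (1 / real (Suc n)) x) \<longlonglongrightarrow> f x" if x: "x \<in> topspace X" for x
  proof -
    have "(\<lambda>n. k (1 / real (Suc n)) x) \<longlonglongrightarrow> (\<integral>r. ?e r * w 0 x \<partial>lborel)" unfolding k_def
    proof (rule integral_dominated_convergence[OF _ _ exp_minus_integrable[of C]])
      show "AE r in lborel. (\<lambda>n. ?e r * w (1 / real (Suc n) * r) x) \<longlonglongrightarrow> ?e r * w 0 x"
      proof (rule AE_I2)
        fix r :: real
        show "(\<lambda>n. ?e r * w (1 / real (Suc n) * r) x) \<longlonglongrightarrow> ?e r * w 0 x"
        proof (cases "0 < r")
          case True
          have "(\<lambda>n. inverse (real (Suc n)) * r) \<longlonglongrightarrow> 0" by (rule tendsto_mult_left_zero[OF LIMSEQ_inverse_real_of_nat])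
          hence "filterlim (\<lambda>n. 1 / real (Suc n) * r) (at_right 0) sequentially"
            unfolding filterlim_at using True by (auto simp: inverse_eq_divide intro!: always_eventually)
          thus ?thesis by (intro tendsto_mult_left filterlim_compose[OF wr[OF x]])
        qed (cases "r = 0", auto)
      qed
      show "(\<lambda>r. ?e r * w (1 / real (Suc n) * r) x) \<in> borel_measurable lborel" for n
        by (intro borel_measurable_times m1 x) auto
    qed (use bd[OF x] m1[OF x] in auto)
    thus ?thesis using exp_minus_integral_eq[of "w 0 x"] u(5)[OF x] by (simp add: w_def mult.assoc)
  qed
  have kJ: "AE x in M. J c f x = k c x" if c: "0 < c" for c
  proof -
    \<comment> \<open>The identity is proved near each point: on a neighbourhood of finite measure
      the bounded integrand is integrable for the product measure, and Fubini's theorem applies to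
      pairings with indicators.\<close>
    have "AE x in M. x \<in> topspace X \<longrightarrow> J c f x = k c x"
    proof (rule AE_local)
      fix x assume x: "x \<in> topspace X"
      obtain A where A: "openin X A" "{x} \<subseteq> A" "compactin X (X closure_of A)"
        by (rule compact_nbhd[of "{x}" "topspace X"]) (use x in auto)
      have Af: "emeasure M A < \<infinity>"
        using emeasure_mono[OF closure_of_subset[OF openin_subset[OF A(1)]] compact_sets[OF A(3)]] compact_finite[OF A(3)] by simp
      note As = open_sets[OF A(1)]
      define N where "N = restrict_space M A"
      interpret N: finite_measure N
        by (rule finite_measureI) (use Af As in \<open>simp add: N_def emeasure_restrict_space space_restrict_space\<close>)
      interpret pair_sigma_finite lborel N ..
      have spN: "x \<in> space N \<Longrightarrow> x \<in> topspace X" for x by (simp add: N_def space_restrict_space space_M)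
      have "AE x in N. J c f x = k c x"
      proof (rule AE_eq_of_integrals)
        show JL: "J c f \<in> L2 N" unfolding N_def by (rule L2_part[OF A(1) res_L2[OF c fL]])
        have kb: "\<bar>k c x\<bar> \<le> C" if "x \<in> topspace X" for x
        proof -
          have "integrable lborel (\<lambda>r. ?e r * w (c * r) x)"
          proof (rule Bochner_Integration.integrable_bound[OF exp_minus_integrable[of C]])
            show "(\<lambda>r. ?e r * w (c * r) x) \<in> borel_measurable lborel" by (intro borel_measurable_times m1 that) auto
            show "AE r in lborel. norm (?e r * w (c * r) x) \<le> norm (?e r * C)"
              by (intro AE_I2 order_trans[OF bd[OF that]]) simp
          qed
          hence "norm (k c x) \<le> (\<integral>r. ?e r * C \<partial>lborel)" unfolding k_def
            by (intro order_trans[OF integral_norm_bound integral_mono] integrable_norm exp_minus_integrable bd that)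
          thus ?thesis using exp_minus_integral_eq[of C] by (simp add: mult.assoc)
        qed
        show kL: "k c \<in> L2 N"
          by (rule finite_measure_L2_bounded[of _ _ C])
            (use N.finite_measure_axioms kb spN in \<open>auto simp: N_def intro!: measurable_restrict_space1 C_space_measurable kC AE_I2\<close>)
        fix B assume B: "B \<in> sets N" "emeasure N B < \<infinity>"
        have BM: "B \<in> sets M" "B \<subseteq> A" using B(1) As unfolding N_def by (auto simp: sets_restrict_space_iff)
        hence Bf: "emeasure M B < \<infinity>" using emeasure_mono[of B A M] As Af by simp
        note I = indicator_L2[OF BM(1) Bf]
        let ?F = "\<lambda>r x. ?e r * (w (c * r) x * indicat_real B x)"
        have zB: "zero_ext A (indicat_real B) = indicator B" "zero_ext A (\<lambda>x. g x * indicat_real B x) = (\<lambda>x. g x * indicator B x)" for g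
          using BM(2) by (auto simp: zero_ext_def indicator_def fun_eq_iff)
        have inN: "(\<integral>x. g x * indicat_real B x \<partial>N) = ip M g (indicator B)" for g
          unfolding N_def part_integral[OF A(1)] zB ip_def ..
        have "integrable (lborel \<Otimes>\<^sub>M N) (\<lambda>p. ?e (fst p) * C)"
        proof (rule Fubini_integrable)
          show "integrable lborel (\<lambda>r. \<integral>x. norm (?e (fst (r, x)) * C) \<partial>N)"
            using integrable_mult_left[OF exp_minus_integrable[of C], of "measure N (space N)"] C
            by (auto simp: abs_mult mult.commute)
        qed auto
        hence "integrable (lborel \<Otimes>\<^sub>M N) (\<lambda>(r, x). ?F r x)"
        proof (rule Bochner_Integration.integrable_bound)
          show "(\<lambda>(r, x). ?F r x) \<in> borel_measurable (lborel \<Otimes>\<^sub>M N)"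
            using meas[of c A] B(1) unfolding N_def[symmetric] split_beta' by measurable
          show "AE p in (lborel :: real measure) \<Otimes>\<^sub>M N. norm (case p of (r, x) \<Rightarrow> ?F r x) \<le> norm (?e (fst p) * C)"
          proof (rule AE_I2)
            fix p :: "real \<times> 'a" assume "p \<in> space (lborel \<Otimes>\<^sub>M N)"
            thus "norm (case p of (r, x) \<Rightarrow> ?F r x) \<le> norm (?e (fst p) * C)"
              using bd[OF spN, of "snd p" "fst p" "c * fst p"] C by (auto simp: space_pair_measure indicator_def)
          qed
        qed
        from Fubini_integral[OF this]
        have f1: "(\<integral>x. (\<integral>r. ?F r x \<partial>lborel) \<partial>N) = (\<integral>r. (\<integral>x. ?F r x \<partial>N) \<partial>lborel)" .
        have f2: "(\<integral>r. ?F r x \<partial>lborel) = k c x * indicat_real B x" for x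
          unfolding k_def mult.assoc[symmetric] by (rule integral_mult_left_zero)
        have f3: "(\<integral>x. ?F r x \<partial>N) = indicator {0..} r * (exp (- r) * ip M (semi (c * r) f) (indicator B))" for r
        proof (cases "0 \<le> r")
          case True
          hence cr: "0 \<le> c * r" using c by simp
          have "ip M (w (c * r)) (indicator B) = ip M (semi (c * r) f) (indicator B)"
            by (rule ip_cong_AE) (use cr u(2)[OF cr] C_space_measurable[OF u(1)[OF cr]] L2_measurable[OF semi_L2[OF cr fL]] L2_measurable[OF I] in \<open>auto simp: w_def\<close>)
          moreover have "(\<integral>x. ?F r x \<partial>N) = ?e r * ip M (w (c * r)) (indicator B)"
            by (simp only: integral_mult_right_zero inN)
          ultimately show ?thesis by simp
        qed simp
        have "(\<integral>x. k c x * indicat_real B x \<partial>N) = ip M (J c f) (indicator B)"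
          using f1 unfolding f2 f3 res_laplace[OF fL I c] .
        thus "ip N (J c f) (indicator B) = ip N (k c) (indicator B)" by (simp add: ip_def inN)
      qed
      hence "AE x in M. x \<in> A \<longrightarrow> J c f x = k c x" unfolding N_def part_AE[OF A(1)] .
      with A show "\<exists>N. openin X N \<and> x \<in> N \<and> (AE y in M. y \<in> N \<longrightarrow> J c f y = k c y)" by auto
    qed
    thus ?thesis using AE_space by eventually_elim (simp add: space_M)
  qed
  show thesis by (rule that[OF kC kJ klim])
qed

section \<open>Comparison of resolvents\<close>

text \<open>By the resolvent identity \<open>J a f\<close> is at least \<open>1 - c / a\<close>
  times \<open>J c (J a f)\<close>, and this factor is at least 1/2.\<close>

lemma res_median:
  assumes a: "0 < a" and c: "0 < c" "2 * c \<le> a" and f: "f \<in> L2 M" and pos: "AE x in M. 0 \<le> f x"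
  shows "AE x in M. J c (J a f) x \<le> 2 * J a f x"
proof -
  note J = res_L2[OF a f]
  let ?t = "1 - c / a"
  have t: "1/2 \<le> ?t" using a c by (simp add: field_simps)
  have "AE x in M. J c (\<lambda>x. ?t * J a f x + 0 * J a f x) x \<le> J c (\<lambda>x. (c / a) * f x + ?t * J a f x) x"
    by (rule res_mono[OF c(1) L2_lin[OF J J] L2_lin[OF f J]]) (rule eventually_mono[OF pos], use a c in simp)
  with res_identity[OF a c(1) f] res_lin[OF c(1) J J, of ?t 0] res_nonneg[OF c(1) J res_nonneg[OF a f pos]]
  show ?thesis
  proof eventually_elim
    case (elim x)
    have "1/2 * J c (J a f) x \<le> ?t * J c (J a f) x" using t elim(3) by (rule mult_right_mono)
    with elim show ?case by linarith
  qed
qed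

text \<open>The resolvents \<open>J\<^sub>a \<phi>\<close> of a bump function tend to \<open>\<phi>\<close> only pointwise; a minimum of finitely many
  of them is small on all of the compact set \<open>B\<close>, and it is still almost excessive.\<close>

lemma barrier:
  assumes fel: "doubly_feller D" and V: "openin X V" "x0 \<in> V" and B: "compactin X B" "B \<inter> V = {}" and d: "0 < d"
  obtains \<psi> a where "0 < a" "\<psi> \<in> C_space X" "\<psi> \<in> L2 M" "\<And>x. x \<in> topspace X \<Longrightarrow> 0 \<le> \<psi> x \<and> \<psi> x \<le> 1"
    "1 - d < \<psi> x0" "\<And>x. x \<in> B \<Longrightarrow> \<psi> x < d" "\<And>c. 0 < c \<Longrightarrow> c \<le> a \<Longrightarrow> AE x in M. J c \<psi> x \<le> 2 * \<psi> x"
proof -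
  have x0: "x0 \<in> topspace X" using V openin_subset by blast
  obtain \<phi> where p: "\<phi> \<in> C_c X" "supp \<phi> \<subseteq> V" "\<And>x. x \<in> topspace X \<Longrightarrow> 0 \<le> \<phi> x \<and> \<phi> x \<le> 1" "\<phi> x0 = 1"
    by (rule urysohn[of "{x0}" V]) (use V x0 in auto)
  note pL = bounded_C_L2(1)[OF p(1)]
  obtain k where k: "\<And>c. 0 < c \<Longrightarrow> k c \<in> C_space X" "\<And>c. 0 < c \<Longrightarrow> AE x in M. J c \<phi> x = k c x"
    "\<And>x. x \<in> topspace X \<Longrightarrow> (\<lambda>n. k (1 / real (Suc n)) x) \<longlonglongrightarrow> \<phi> x"
    by (rule res_pointwise[OF fel p(1)]) (rule that)
  \<comment> \<open>Collects the properties that pass to minima. The last one does so because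
    \<open>J c\<close> is monotone; an almost excessive function is all that survives, hence the
    factor 2.\<close>
  define P where "P \<psi> \<longleftrightarrow> \<psi> \<in> C_space X \<and> \<psi> \<in> L2 M \<and> (\<forall>x\<in>topspace X. 0 \<le> \<psi> x \<and> \<psi> x \<le> 1) \<and> 1 - d < \<psi> x0 \<and>
    (\<exists>a>0. \<forall>c. 0 < c \<longrightarrow> c \<le> a \<longrightarrow> (AE x in M. J c \<psi> x \<le> 2 * \<psi> x))" for \<psi>
  have pAE: "AE x in M. 0 \<le> \<phi> x" "AE x in M. \<phi> x \<le> 1" using p(3) by (auto intro!: AE_I2 simp: space_M)
  have Pk: "P (k a)" if a: "0 < a" and ax: "1 - d < k a x0" for a
  proof -
    have kL: "k a \<in> L2 M" by (rule L2_cong_AE[OF res_L2[OF a pL] C_space_measurable[OF k(1)[OF a]] k(2)[OF a]])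
    have 1: "AE x in M. x \<in> topspace X \<longrightarrow> 0 \<le> k a x" using k(2)[OF a] res_nonneg[OF a pL pAE(1)] by eventually_elim simp
    have 2: "AE x in M. x \<in> topspace X \<longrightarrow> k a x \<le> 1" using k(2)[OF a] res_le_const[OF a pL zero_le_one pAE(2)] by eventually_elim simp
    note cc = C_space_lattice(5)[OF k(1)[OF a] k(1)[OF a]]
    have "AE x in M. J c (k a) x \<le> 2 * k a x" if c: "0 < c" "c \<le> a / 2" for c
    proof -
      have "2 * c \<le> a" using c(2) by simp
      from res_median[OF a c(1) this pL pAE(1)] k(2)[OF a] res_cong_AE[OF c(1) kL L2_measurable[OF res_L2[OF a pL]] AE_symmetric[OF k(2)[OF a]]]
      show ?thesis by eventually_elim simp
    qed
    thus ?thesis unfolding P_def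
      using k(1)[OF a] kL ax a AE_le_cont_imp_le[OF cc k(1)[OF a] openin_topspace 1] AE_le_cont_imp_le[OF k(1)[OF a] cc openin_topspace 2]
      by (intro conjI exI[of _ "a / 2"]) auto
  qed
  have Pmin: "P (\<lambda>x. min (\<psi> x) (\<psi>' x))" if P: "P \<psi>" "P \<psi>'" for \<psi> \<psi>'
  proof -
    have L: "\<psi> \<in> L2 M" "\<psi>' \<in> L2 M" using P by (auto simp: P_def)
    note mL = L2_min[OF L]
    obtain a a' where a: "0 < a" "\<And>c. 0 < c \<Longrightarrow> c \<le> a \<Longrightarrow> AE x in M. J c \<psi> x \<le> 2 * \<psi> x"
      "0 < a'" "\<And>c. 0 < c \<Longrightarrow> c \<le> a' \<Longrightarrow> AE x in M. J c \<psi>' x \<le> 2 * \<psi>' x" using P unfolding P_def by blast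
    have "AE x in M. J c (\<lambda>x. min (\<psi> x) (\<psi>' x)) x \<le> 2 * min (\<psi> x) (\<psi>' x)" if c: "0 < c" "c \<le> min a a'" for c
      using res_mono[OF c(1) mL L(1)] res_mono[OF c(1) mL L(2)] a(2)[OF c(1)] a(4)[OF c(1)] c(2)
      by (auto elim!: eventually_elim2)
    thus ?thesis using P mL C_space_lattice(1)[of \<psi> \<psi>'] a(1,3) unfolding P_def
      by (intro conjI exI[of _ "min a a'"]) auto
  qed
  have lim0: "(\<lambda>n. k (1 / real (Suc n)) x0) \<longlonglongrightarrow> 1" using k(3)[OF x0] p(4) by simp
  obtain n0 where n0: "\<And>n. n0 \<le> n \<Longrightarrow> 1 - d < k (1 / real (Suc n)) x0"
    using order_tendstoD(1)[OF lim0, of "1 - d"] d by (auto simp: eventually_sequentially)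
  \<comment> \<open>On \<open>B\<close> the bump function vanishes, so each point of
    \<open>B\<close> lies in such a sublevel set. Indices from \<open>n0\<close> on keep the value
    at \<open>x0\<close> above \<open>1 - d\<close>.\<close>
  let ?G = "\<lambda>n. {x \<in> topspace X. k (1 / real (Suc n)) x < d}"
  have "\<exists>\<F>. finite \<F> \<and> \<F> \<subseteq> ?G ` {n0..} \<and> B \<subseteq> \<Union>\<F>"
  proof (rule compactinD[OF B(1)])
    fix W assume "W \<in> ?G ` {n0..}"
    then obtain n where W: "W = {x \<in> topspace X. k (1 / real (Suc n)) x \<in> {..<d}}" by auto
    show "openin X W" unfolding W
      by (rule openin_continuous_map_preimage[of X euclideanreal]) (use k(1)[of "1 / real (Suc n)"] in \<open>auto simp: C_space_def\<close>)
  next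
    show "B \<subseteq> \<Union> (?G ` {n0..})"
    proof
      fix x assume x: "x \<in> B"
      hence xt: "x \<in> topspace X" using B(1) compactin_subset_topspace by blast
      have "\<phi> x = 0" using supp_zero[OF xt, of \<phi>] p(2) B(2) x by blast
      hence l: "(\<lambda>n. k (1 / real (Suc n)) x) \<longlonglongrightarrow> 0" using k(3)[OF xt] by simp
      obtain n1 where "\<And>n. n1 \<le> n \<Longrightarrow> k (1 / real (Suc n)) x < d"
        using order_tendstoD(2)[OF l d] unfolding eventually_sequentially by blast
      hence "k (1 / real (Suc (max n0 n1))) x < d" "n0 \<le> max n0 n1" by simp_all
      thus "x \<in> \<Union> (?G ` {n0..})" using xt by auto
    qed
  qed
  then obtain \<F> where F: "finite \<F>" "\<F> \<subseteq> ?G ` {n0..}" "B \<subseteq> \<Union>\<F>" by blast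
  obtain I where I: "finite I" "I \<subseteq> {n0..}" "B \<subseteq> \<Union> (?G ` I)"
    using finite_subset_image[OF F(1,2)] F(3) by auto
  \<comment> \<open>\<open>n0\<close> is added so that the minimum is over a nonempty family even
    when \<open>I\<close> is empty.\<close>
  have "\<exists>\<psi>. P \<psi> \<and> (\<forall>n\<in>insert n0 I. \<forall>x. \<psi> x \<le> k (1 / real (Suc n)) x)"
    using I(1,2)
  proof (induction I)
    case empty
    show ?case using Pk[OF _ n0] by (intro exI[of _ "k (1 / real (Suc n0))"]) simp
  next
    case (insert m I)
    then obtain \<psi> where \<psi>: "P \<psi>" "\<forall>n\<in>insert n0 I. \<forall>x. \<psi> x \<le> k (1 / real (Suc n)) x" by auto
    hence "\<forall>n\<in>insert n0 (insert m I). \<forall>x. min (\<psi> x) (k (1 / real (Suc m)) x) \<le> k (1 / real (Suc n)) x"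
      by (auto intro: min.coboundedI1)
    with Pmin[OF \<psi>(1) Pk[OF _ n0, of m]] insert.prems show ?case
      by (intro exI[of _ "\<lambda>x. min (\<psi> x) (k (1 / real (Suc m)) x)"]) simp
  qed
  then obtain \<psi> where \<psi>: "P \<psi>" "\<And>n x. n \<in> I \<Longrightarrow> \<psi> x \<le> k (1 / real (Suc n)) x" by auto
  have sm: "\<psi> x < d" if xB: "x \<in> B" for x
  proof -
    obtain n where "n \<in> I" "k (1 / real (Suc n)) x < d" using subsetD[OF I(3) xB] by auto
    thus ?thesis using \<psi>(2)[of n x] by linarith
  qed
  obtain a where a: "0 < a" "\<And>c. 0 < c \<Longrightarrow> c \<le> a \<Longrightarrow> AE x in M. J c \<psi> x \<le> 2 * \<psi> x" using \<psi>(1) unfolding P_def by blast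
  have b: "\<psi> \<in> C_space X" "\<psi> \<in> L2 M" "\<And>x. x \<in> topspace X \<Longrightarrow> 0 \<le> \<psi> x \<and> \<psi> x \<le> 1" "1 - d < \<psi> x0"
    using \<psi>(1) unfolding P_def by auto
  show thesis by (rule that[OF a(1) b sm a(2)])
qed

text \<open>With \<open>\<eta> = J\<^sub>c \<psi>\<close> for a barrier \<open>\<psi>\<close>, the difference of the resolvents plus \<open>C \<eta>\<close> is at most \<open>C\<close> on \<open>V\<close>:
  its excess over \<open>C\<close> vanishes where \<open>\<psi>\<close> is small, so that the part \<open>q\<close> of the excess inside \<open>V\<close> is an
  admissible test function, and by strong locality it does not interact with the part outside.\<close>

lemma res_comparison_nonneg:
  assumes fel: "doubly_feller D" and U: "openin X U" and x0: "x0 \<in> U" and e: "0 < e" and c1: "0 < c1"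
  obtains c N where "0 < c" "c < c1" "openin X N" "x0 \<in> N"
    "\<And>F. F \<in> L2 M \<Longrightarrow> AE x in M. 0 \<le> F x \<Longrightarrow> AE x in M. F x \<le> 1 \<Longrightarrow>
      AE x in M. x \<in> N \<longrightarrow> \<bar>J c F x - zero_ext U (res (part_space D U) c F) x\<bar> \<le> e"
proof -
  \<comment> \<open>With \<open>d \<le> 1/4\<close> the constant \<open>C\<close> below is at most
    2, so the final error \<open>C * (2 * d)\<close> is at most \<open>4 * d\<close>, hence at most
    \<open>e\<close>.\<close>
  define d where "d = min (e / 4) (1 / 4)"
  have d: "0 < d" "4 * d \<le> e" "4 * d \<le> 1" using e by (auto simp: d_def)
  have x0t: "x0 \<in> topspace X" using U x0 openin_subset by blast
  obtain V where V: "openin X V" "x0 \<in> V" "compactin X (X closure_of V)" "X closure_of V \<subseteq> U"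
    by (rule compact_nbhd[of "{x0}" U]) (use U x0 x0t in auto)
  have VU: "V \<subseteq> U" using closure_of_subset[OF openin_subset[OF V(1)]] V(4) by blast
  let ?B = "X closure_of V - V"
  have B: "compactin X ?B"
    by (rule closed_compactin[OF V(3)]) (use V(1) in \<open>auto intro: closedin_diff\<close>)
  obtain \<psi> a where \<psi>: "0 < a" "\<psi> \<in> C_space X" "\<psi> \<in> L2 M" "\<And>x. x \<in> topspace X \<Longrightarrow> 0 \<le> \<psi> x \<and> \<psi> x \<le> 1"
    "1 - d < \<psi> x0" "\<And>x. x \<in> ?B \<Longrightarrow> \<psi> x < d" "\<And>c. 0 < c \<Longrightarrow> c \<le> a \<Longrightarrow> AE x in M. J c \<psi> x \<le> 2 * \<psi> x"
    by (rule barrier[OF fel V(1,2) B _ d(1)]) (blast, rule that)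
  obtain \<theta> where t: "\<theta> \<in> C_c X" "\<And>x. x \<in> topspace X \<Longrightarrow> 0 \<le> \<theta> x \<and> \<theta> x \<le> 1" "\<theta> x0 = 1"
    by (rule urysohn[of "{x0}" "topspace X"]) (use x0t in auto)
  \<comment> \<open>Pointwise convergence of resolvents is available for compactly supported
    functions. The product has the value \<open>\<psi> x0\<close> at \<open>x0\<close> and lies
    below \<open>\<psi>\<close>, so its resolvent bounds \<open>\<eta>\<close> from below near
    \<open>x0\<close>.\<close>
  let ?p = "\<lambda>x. \<theta> x * \<psi> x"
  have "compactin X (supp ?p)"
    by (rule supp_subset(1)[of "supp \<theta>" ?p]) (use t(1) supp_zero[of _ \<theta>] in \<open>auto simp: C_c_alt\<close>)
  hence p: "?p \<in> C_c X" using t(1) \<psi>(2) C_space_lattice(4)[of \<theta> \<psi>] by (auto simp: C_c_alt)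
  obtain k where k: "\<And>c. 0 < c \<Longrightarrow> k c \<in> C_space X" "\<And>c. 0 < c \<Longrightarrow> AE x in M. J c ?p x = k c x"
    "\<And>x. x \<in> topspace X \<Longrightarrow> (\<lambda>n. k (1 / real (Suc n)) x) \<longlonglongrightarrow> ?p x"
    by (rule res_pointwise[OF fel p]) (rule that)
  have lim0: "(\<lambda>n. k (1 / real (Suc n)) x0) \<longlonglongrightarrow> \<psi> x0" using k(3)[OF x0t] t(3) by simp
  have "\<forall>\<^sub>F n in sequentially. 1 / real (Suc n) < min c1 a"
    using order_tendstoD(2)[OF LIMSEQ_inverse_real_of_nat, of "min c1 a"] c1 \<psi>(1) by (simp add: inverse_eq_divide)
  with order_tendstoD(1)[OF lim0 \<psi>(5)] have "\<forall>\<^sub>F n in sequentially. 1 - d < k (1 / real (Suc n)) x0 \<and> 1 / real (Suc n) < min c1 a"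
    by (rule eventually_conj)
  then obtain n where n: "1 - d < k (1 / real (Suc n)) x0" "1 / real (Suc n) < min c1 a" by (auto simp: eventually_sequentially)
  define c where "c = 1 / real (Suc n)"
  have c: "0 < c" "c < c1" "c \<le> a" "1 - d < k c x0" using n by (auto simp: c_def)
  obtain N where N: "openin X N" "x0 \<in> N" "\<And>y. y \<in> N \<Longrightarrow> \<bar>k c y - k c x0\<bar> < d"
    by (rule C_space_nbhd[OF k(1)[OF c(1)] x0t d(1)], rule that)
  define \<eta> where "\<eta> = J c \<psi>"
  have \<eta>: "\<eta> \<in> fdom D" "\<eta> \<in> L2 M" unfolding \<eta>_def by (intro res_mem res_L2 c \<psi>)+
  have \<psi>AE: "AE x in M. 0 \<le> \<psi> x" "AE x in M. \<psi> x \<le> 1" using \<psi>(4) by (auto intro!: AE_I2 simp: space_M)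
  have \<eta>AE: "AE x in M. \<eta> x \<le> 2 * \<psi> x" "AE x in M. 0 \<le> \<eta> x" "AE x in M. \<eta> x \<le> 1"
    unfolding \<eta>_def using \<psi>(7)[OF c(1,3)] res_nonneg[OF c(1) \<psi>(3) \<psi>AE(1)] res_le_const[OF c(1) \<psi>(3) zero_le_one \<psi>AE(2)] by auto
  have near: "AE x in M. x \<in> N \<longrightarrow> 1 - 2 * d \<le> \<eta> x"
  proof -
    have "AE x in M. J c ?p x \<le> \<eta> x" unfolding \<eta>_def
    proof (rule res_mono[OF c(1) bounded_C_L2(1)[OF p] \<psi>(3)])
      show "AE x in M. ?p x \<le> \<psi> x"
        using t(2) \<psi>(4) by (intro AE_I2) (simp add: space_M mult_left_le_one_le)
    qed
    with k(2)[OF c(1)] show ?thesis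
    proof eventually_elim
      case (elim x)
      show ?case
      proof
        assume "x \<in> N"
        from N(3)[OF this] elim c(4) show "1 - 2 * d \<le> \<eta> x" by linarith
      qed
    qed
  qed
  \<comment> \<open>Chosen so that \<open>1 + 2 * d * C = C\<close>: where
    \<open>\<psi> < d\<close>, the barrier has \<open>\<eta> \<le> 2 * \<psi>\<close>, hence
    \<open>y\<close> stays below \<open>1 + 2 * d * C\<close> and has no excess over
    \<open>C\<close>.\<close>
  define C where "C = 1 / (1 - 2 * d)"
  have C: "1 + 2 * d * C = C" "C - C * (1 - 2 * d) \<le> e" "1 \<le> C" "0 \<le> C"
  proof -
    show "1 + 2 * d * C = C" "1 \<le> C" "0 \<le> C" using d by (auto simp: C_def field_simps)
    have "C \<le> 2" using d by (simp add: C_def field_simps)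
    hence "C * (2 * d) \<le> 2 * (2 * d)" using d by (intro mult_right_mono) auto
    moreover have "C - C * (1 - 2 * d) = C * (2 * d)" by (simp add: algebra_simps)
    ultimately show "C - C * (1 - 2 * d) \<le> e" using d by linarith
  qed
  \<comment> \<open>The excess can be nonzero in the closure of \<open>V\<close> only here. As
    \<open>\<psi> < d\<close> on the boundary, this compact set lies in the interior, and a cutoff
    equal to 1 on it separates the two parts of the excess.\<close>
  let ?K = "X closure_of V - {x \<in> topspace X. \<psi> x < d}"
  have "openin X {x \<in> topspace X. \<psi> x \<in> {..<d}}"
    by (rule openin_continuous_map_preimage[of X euclideanreal]) (use \<psi>(2) in \<open>auto simp: C_space_def\<close>)
  hence Kc: "closedin X ?K" by (intro closedin_diff) auto
  have KK: "compactin X ?K" by (rule closed_compactin[OF V(3) _ Kc]) auto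
  have KV: "?K \<subseteq> V" using \<psi>(6) closure_of_subset_topspace[of X V] by blast
  obtain \<kappa> where ch: "\<kappa> \<in> fdom D" "\<kappa> \<in> C_c X" "supp \<kappa> \<subseteq> V" "\<And>x. x \<in> topspace X \<Longrightarrow> 0 \<le> \<kappa> x \<and> \<kappa> x \<le> 1" "\<And>x. x \<in> ?K \<Longrightarrow> \<kappa> x = 1"
    by (rule cutoff[OF KK V(1) KV], rule that)
  have chU: "\<kappa> \<in> core U" unfolding core_def using ch(1-3) VU by auto
  have cmp: "AE x in M. x \<in> N \<inter> V \<longrightarrow> \<bar>J c F x - zero_ext U (res (part_space D U) c F) x\<bar> \<le> e"
    if F: "F \<in> L2 M" and F0: "AE x in M. 0 \<le> F x" and F1: "AE x in M. F x \<le> 1" for F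
  proof -
    let ?z = "zero_ext U (res (part_space D U) c F)"
    note zp = part_res_part[OF U c(1) F]
    note z = part_mem[OF zp] and Jm = res_mem[OF c(1) F]
    let ?y0 = "\<lambda>x. J c F x - ?z x"
    define y where "y = (\<lambda>x. ?y0 x + C * \<eta> x)"
    have y0: "?y0 \<in> fdom D" by (rule E.diff_mem[OF Jm z])
    have ym: "y \<in> fdom D" unfolding y_def by (intro E.add_mem y0 E.scale_mem \<eta>)
    have y0AE: "AE x in M. 0 \<le> ?y0 x" "AE x in M. ?y0 x \<le> 1"
      using part_res_le[OF U c(1) F F0] part_res_nonneg[OF U c(1) F F0] res_le_const[OF c(1) F zero_le_one F1] by auto
    define E0 where "E0 = (\<lambda>x. max (y x - C) 0)"
    have E0: "E0 \<in> fdom D" unfolding E0_def by (rule excess_mem[OF C(4) ym])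
    have E0z: "AE x in M. \<psi> x < d \<longrightarrow> E0 x = 0"
      using \<eta>AE(1) y0AE(2)
    proof eventually_elim
      case (elim x)
      show ?case
      proof
        assume "\<psi> x < d"
        hence "C * \<eta> x \<le> C * (2 * d)" using elim C by (intro mult_left_mono) auto
        thus "E0 x = 0" using elim C(1) by (simp add: E0_def y_def mult.commute)
      qed
    qed
    have E0b: "AE x in M. E0 x \<le> 1 + C"
      using \<eta>AE(3) y0AE(2)
    proof eventually_elim
      case (elim x)
      have "C * \<eta> x \<le> C * 1" using elim C by (intro mult_left_mono) auto
      hence "y x - C \<le> 1" using elim unfolding y_def by linarith
      thus ?case using C(4) by (simp add: E0_def)
    qed
    \<comment> \<open>On \<open>?K\<close> this function is at least the bound \<open>1 + C\<close>
      of the excess, so taking the minimum with it does not change the excess there. The summand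
      with coefficient 0 only fits the shape of \<open>core_lin\<close>.\<close>
    let ?b = "\<lambda>x. (1 + C) * \<kappa> x + 0 * \<kappa> x"
    have b: "?b \<in> core U" by (rule core_lin[OF chU chU])
    define q where "q = (\<lambda>x. min (E0 x) (?b x))"
    have q: "q \<in> fdom D" unfolding q_def by (rule min_mem[OF E0 coreD(1)[OF b]])
    have qAE: "AE x in M. 0 \<le> q x \<and> q x \<le> ?b x"
      using C(4) ch(4) by (intro AE_I2) (simp add: q_def E0_def space_M)
    have qU: "q \<in> part_closure D U" by (rule part_closure_below_core[OF q b qAE])
    have qE: "AE x in M. (x \<in> V \<longrightarrow> q x = E0 x) \<and> (x \<notin> ?K \<longrightarrow> q x = 0)"
      using E0z E0b AE_space
    proof eventually_elim
      case (elim x)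
      have xt: "x \<in> topspace X" using elim by (simp add: space_M)
      have E: "0 \<le> E0 x" by (simp add: E0_def)
      consider "x \<in> ?K" | "x \<notin> ?K" "x \<in> V" | "x \<notin> V" by blast
      thus ?case
      proof cases
        case 1 thus ?thesis using ch(5)[OF 1] elim(2) by (simp add: q_def)
      next
        case 2
        hence "\<psi> x < d" using closure_of_subset[OF openin_subset[OF V(1)]] xt by blast
        thus ?thesis using elim(1) C(4) ch(4)[OF xt] by (simp add: q_def)
      next
        case 3
        hence "\<kappa> x = 0" using supp_zero[OF xt, of \<kappa>] ch(3) by blast
        thus ?thesis using E 3 KV by (simp add: q_def)
      qed
    qed
    let ?q' = "\<lambda>x. E0 x - q x"
    have q': "?q' \<in> fdom D" by (rule E.diff_mem[OF E0 q])
    have "form D ?q' q = 0"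
    proof -
      have "msupport X M q \<subseteq> ?K"
      proof -
        have "AE x in M. x \<in> topspace X - ?K \<longrightarrow> q x = 0" using qE by eventually_elim blast
        hence "topspace X - ?K \<subseteq> \<Union>{W. openin X W \<and> (AE x in M. x \<in> W \<longrightarrow> q x = 0)}"
          using Kc by (intro Union_upper) (simp add: closedin_def)
        thus ?thesis unfolding msupport_def by blast
      qed
      hence "AE x in M. x \<in> msupport X M q \<longrightarrow> ?q' x = 0" using qE KV by (auto elim!: eventually_mono)
      thus ?thesis by (intro local[unfolded strongly_local_def, rule_format, OF q' q] exI[of _ 0])
    qed
    moreover have "0 \<le> form D (\<lambda>x. min (y x) C) q"
      by (rule form_reflection_nonneg[OF cut_mem[OF C(4) ym] q C(4)])
        (use qAE in \<open>eventually_elim, auto simp: q_def E0_def min_def max_def split: if_splits\<close>)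
    \<comment> \<open>\<open>y\<close> is split into its cut at \<open>C\<close>, the outer excess
      \<open>?q'\<close> and the inner excess \<open>q\<close>. Against \<open>q\<close> the first
      pairs nonnegatively by reflection, the second vanishes by strong locality, and the third gives
      the energy of \<open>q\<close>.\<close>
    moreover have "form D y q = form D (\<lambda>x. min (y x) C + (?q' x + q x)) q"
      by (rule arg_cong[where f = "\<lambda>h. form D h q"]) (auto simp: E0_def fun_eq_iff)
    moreover have "\<dots> = form D (\<lambda>x. min (y x) C) q + (form D ?q' q + form D q q)"
      using cut_mem[OF C(4) ym] q q' by (simp only: E.add_left E.add_mem)
    ultimately have fy: "0 \<le> form D y q" using E.nonneg[OF q] by simp
    note qL = fdom_L2[OF q] and yL = fdom_L2[OF ym] and L = fdom_L2[OF Jm] fdom_L2[OF z] \<eta>(2)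
    \<comment> \<open>The two resolvents of \<open>F\<close> solve the same equation against
      \<open>q\<close>, so their contributions cancel; only \<open>C * \<eta>\<close> is left, with
      right side \<open>C * \<psi>\<close>.\<close>
    have "c * form D y q + ip M y q = C * ip M \<psi> q"
    proof -
      have "c * form D y q + ip M y q = (c * form D (J c F) q + ip M (J c F) q) - (c * form D ?z q + ip M ?z q) + C * (c * form D \<eta> q + ip M \<eta> q)"
        unfolding y_def using Jm z \<eta> q L qL by (simp add: E.bilin E.mem L2.bilin L2.mem algebra_simps)
      also have "\<dots> = C * ip M \<psi> q"
        using res_eq[OF c(1) F q] part_res_eq[OF U c(1) F qU] res_eq[OF c(1) \<psi>(3) q] by (simp add: \<eta>_def)
      finally show ?thesis .
    qed
    hence "ip M y q \<le> C * ip M \<psi> q" using fy c(1) by (smt (verit) mult_nonneg_nonneg)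
    hence ipn: "ip M (\<lambda>x. y x - C * \<psi> x) q \<le> 0" using yL \<psi>(3) qL by (simp add: L2.bilin L2.mem)
    have "AE x in M. q x = 0"
    proof (rule ip_nonpos_imp_zero_AE[OF qL _ ipn])
      show "(\<lambda>x. y x - C * \<psi> x) \<in> L2 M" by (intro L2.diff_mem L2.scale_mem yL \<psi>)
      show "AE x in M. (q x)\<^sup>2 \<le> (y x - C * \<psi> x) * q x"
        using qAE \<psi>AE(2)
      proof eventually_elim
        case (elim x)
        show ?case
        proof (cases "q x = 0")
          case False
          hence "0 < q x" using elim by simp
          hence "q x \<le> y x - C" by (auto simp: q_def E0_def)
          moreover have "C * \<psi> x \<le> C * 1" using elim C by (intro mult_left_mono) auto
          ultimately have "q x \<le> y x - C * \<psi> x" by simp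
          thus ?thesis unfolding power2_eq_square using elim by (intro mult_right_mono) auto
        qed simp
      qed
    qed
    with qE near y0AE(1) show ?thesis
    proof eventually_elim
      case (elim x)
      show ?case
      proof
        assume x: "x \<in> N \<inter> V"
        hence "E0 x = 0" "1 - 2 * d \<le> \<eta> x" using elim by auto
        hence "y x \<le> C" "C * (1 - 2 * d) \<le> C * \<eta> x" using C by (auto simp: E0_def intro: mult_left_mono)
        thus "\<bar>?y0 x\<bar> \<le> e" using elim(3) C(2) unfolding y_def by linarith
      qed
    qed
  qed
  show thesis by (rule that[OF c(1,2) openin_Int[OF N(1) V(1)] _ cmp]) (use N V in auto)
qed

text \<open>Positive and negative parts of \<open>F\<close>, scaled by \<open>1 / B\<close>, lie
  between 0 and 1; each contributes half of the error.\<close>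

lemma res_comparison:
  assumes fel: "doubly_feller D" and U: "openin X U" and x0: "x0 \<in> U" and e: "0 < e" and c1: "0 < c1" and B: "0 < B"
  obtains c N where "0 < c" "c < c1" "openin X N" "x0 \<in> N"
    "\<And>F. F \<in> L2 M \<Longrightarrow> AE x in M. \<bar>F x\<bar> \<le> B \<Longrightarrow>
      AE x in M. x \<in> N \<longrightarrow> \<bar>J c F x - zero_ext U (res (part_space D U) c F) x\<bar> \<le> e"
proof -
  have e': "0 < e / (2 * B)" using e B by simp
  obtain c N where c: "0 < c" "c < c1" and N: "openin X N" "x0 \<in> N" and
    h: "\<And>F. F \<in> L2 M \<Longrightarrow> AE x in M. 0 \<le> F x \<Longrightarrow> AE x in M. F x \<le> 1 \<Longrightarrow>
      AE x in M. x \<in> N \<longrightarrow> \<bar>J c F x - zero_ext U (res (part_space D U) c F) x\<bar> \<le> e / (2 * B)"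
    by (rule res_comparison_nonneg[OF fel U x0 e' c1], rule that)
  interpret P: dspace "part_space D U" by (rule dspace_part[OF U])
  have "AE x in M. x \<in> N \<longrightarrow> \<bar>J c F x - zero_ext U (res (part_space D U) c F) x\<bar> \<le> e"
    if F: "F \<in> L2 M" and FB: "AE x in M. \<bar>F x\<bar> \<le> B" for F
  proof -
    let ?p = "\<lambda>x. max (1 / B * F x) 0" and ?n = "\<lambda>x. max ((- 1 / B) * F x) 0"
    have p: "?p \<in> L2 M" and n: "?n \<in> L2 M" by (intro L2_max0 L2.scale_mem F)+
    have hp: "AE x in M. x \<in> N \<longrightarrow> \<bar>J c ?p x - zero_ext U (res (part_space D U) c ?p) x\<bar> \<le> e / (2 * B)"
      by (rule h[OF p], simp, rule eventually_mono[OF FB], use B in \<open>auto simp: field_simps abs_le_iff\<close>)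
    have hn: "AE x in M. x \<in> N \<longrightarrow> \<bar>J c ?n x - zero_ext U (res (part_space D U) c ?n) x\<bar> \<le> e / (2 * B)"
      by (rule h[OF n], simp, rule eventually_mono[OF FB], use B in \<open>auto simp: field_simps abs_le_iff\<close>)
    have Fe: "(\<lambda>x. B * ?p x + (- B) * ?n x) = F" using B by (auto simp: fun_eq_iff max_def field_simps)
    have "AE x in restrict_space M U. res (part_space D U) c F x = B * res (part_space D U) c ?p x + (- B) * res (part_space D U) c ?n x"
      using P.res_lin[OF c(1), of ?p ?n B "- B", unfolded part_space_simps, OF L2_part[OF U p] L2_part[OF U n]] unfolding Fe .
    hence "AE x in M. x \<in> U \<longrightarrow> res (part_space D U) c F x = B * res (part_space D U) c ?p x + (- B) * res (part_space D U) c ?n x"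
      unfolding part_AE[OF U] .
    with res_lin[OF c(1) p n, of B "- B"] hp hn show ?thesis unfolding Fe
    proof eventually_elim
      case (elim x)
      let ?R = "\<lambda>F. zero_ext U (res (part_space D U) c F) x"
      have R: "?R F = B * ?R ?p + (- B) * ?R ?n" using elim(4) by (simp add: zero_ext_def)
      show ?case
      proof
        assume x: "x \<in> N"
        have "J c F x - ?R F = B * (J c ?p x - ?R ?p) - B * (J c ?n x - ?R ?n)" unfolding R elim(1) by (simp add: algebra_simps)
        moreover have s: "\<bar>B * a\<bar> \<le> e / 2" if "\<bar>a\<bar> \<le> e / (2 * B)" for a
          using mult_left_mono[OF that, of B] B by (simp add: abs_mult)
        ultimately show "\<bar>J c F x - ?R F\<bar> \<le> e" using s[OF elim(2)[rule_format, OF x]] s[OF elim(3)[rule_format, OF x]] by linarith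
      qed
    qed
  qed
  with c N show thesis by (rule that)
qed

section \<open>Continuity of the semigroup on open subsets\<close>

lemma C_space_abs_le:
  assumes w: "w \<in> C_space X" and B: "AE x in M. \<bar>w x\<bar> \<le> B" and x: "x \<in> topspace X"
  shows "\<bar>w x\<bar> \<le> B"
proof -
  have "(\<lambda>x. max (w x) (0 * w x + (-1) * w x)) \<in> C_space X" by (intro C_space_lattice w)
  hence "max (w x) (0 * w x + (-1) * w x) \<le> B"
    by (rule AE_le_cont_imp_le[OF _ C_space_lattice(5)[OF w w] openin_topspace _ x])
      (rule eventually_mono[OF B], simp add: abs_le_iff)
  thus ?thesis by (simp add: abs_le_iff)
qed

text \<open>For \<open>v = P\<^sub>t\<^sub>/\<^sub>2 u\<close> the difference \<open>v - J\<^sub>c v = P\<^sub>t\<^sub>/\<^sub>2 (u - J\<^sub>c u)\<close> is uniformly small by ultracontractivity.\<close>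

lemma part_semi_continuous:
  assumes fel: "doubly_feller D" and U: "openin X U" and fin: "finite_measure (restrict_space M U)"
    and uc: "ultracontractive (part_space D U)" and f: "f \<in> L2 (restrict_space M U)" and t: "0 < t"
  obtains w where "w \<in> C_b (subtopology X U)" "AE x in restrict_space M U. cform.semi (part_space D U) t f x = w x"
proof -
  let ?P = "part_space D U" and ?N = "restrict_space M U"
  interpret P: dspace ?P by (rule dspace_part[OF U])
  interpret PF: fmform ?P by (intro fmform.intro fmform_axioms.intro P.mform_axioms) (simp add: fin)
  have t2: "0 < t / 2" "0 \<le> t / 2" using t by auto
  obtain C where C: "0 \<le> C" "\<And>v. v \<in> L2 ?N \<Longrightarrow> AE x in ?N. \<bar>P.semi (t / 2) v x\<bar> \<le> C * l2n ?N v"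
    using PF.ultracontractive_bound[OF uc t2(1)] unfolding part_space_simps by blast
  define u where "u = P.semi (t / 2) f"
  define v where "v = P.semi (t / 2) u"
  have u: "u \<in> L2 ?N" unfolding u_def using P.semi_L2[OF t2(2), of f] f by simp
  have v: "v \<in> L2 ?N" unfolding v_def using P.semi_L2[OF t2(2), of u] u by simp
  have vt: "AE x in ?N. P.semi t f x = v x" using P.semi_add[OF t2(2) t2(2), of f, unfolded part_space_simps, OF f] by (simp add: u_def v_def)
  define B where "B = C * l2n ?N u + 1"
  have B: "0 < B" "AE x in ?N. \<bar>v x\<bar> \<le> B"
    unfolding B_def v_def using C(1) u by (auto intro!: add_nonneg_pos mult_nonneg_nonneg eventually_mono[OF C(2)[OF u]])
  have close: "AE x in ?N. \<bar>v x - P.J c v x\<bar> \<le> C * l2d ?N (P.J c u) u" if c: "0 < c" for c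
  proof -
    have J: "P.J c u \<in> L2 ?N" using P.res_L2[OF c, of u] u by simp
    have "AE x in ?N. P.semi (t / 2) (\<lambda>x. P.J c u x - u x) x = P.J c v x - v x"
      using P.semi_diff[OF t2(2), of "P.J c u" u, unfolded part_space_simps, OF J u]
        P.semi_res_commute[OF t2(2) c, of u, unfolded part_space_simps, OF u]
      unfolding v_def by eventually_elim simp
    with C(2)[OF L2.diff_mem[OF J u]] show ?thesis by eventually_elim (simp add: abs_minus_commute)
  qed
  let ?F = "zero_ext U v"
  have F: "?F \<in> L2 M" using v part_L2[OF U] by simp
  have FB: "AE x in M. \<bar>?F x\<bar> \<le> B" using B unfolding part_AE[OF U] by (auto simp: zero_ext_def)
  have Fv: "AE x in ?N. P.J c ?F x = P.J c v x" if c: "0 < c" for c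
    by (rule P.res_cong_AE[OF c, of ?F v, unfolded part_space_simps, OF L2_part[OF U F] L2_measurable[OF v]])
      (simp add: part_AE[OF U] zero_ext_def)
  obtain w where w: "continuous_map (subtopology X U) euclideanreal w" "AE x in M. x \<in> U \<longrightarrow> v x = w x"
  proof (rule continuous_representative[OF U, of v])
    fix x and e :: real assume x: "x \<in> U" and e: "0 < e"
    have xt: "x \<in> topspace X" using x U openin_subset by blast
    \<comment> \<open>\<open>c1\<close> is fixed before the comparison is called, so that the
      \<open>c\<close> it returns also makes \<open>v\<close> close to its resolvent. With the
      oscillation of the continuous representative \<open>k\<close>, three errors of
      \<open>e / 4\<close> arise.\<close>
    have "((\<lambda>h. C * l2d ?N (P.J h u) u) \<longlongrightarrow> 0) (at_right 0)"
      using P.res_tendsto[of u] u by (intro tendsto_mult_right_zero) simp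
    from order_tendstoD(2)[OF this, of "e / 4"] e
    obtain c1 where c1: "0 < c1" "\<And>h. 0 < h \<Longrightarrow> h < c1 \<Longrightarrow> C * l2d ?N (P.J h u) u < e / 4"
      by (auto simp: eventually_at_right_field)
    have e4: "0 < e / 4" using e by simp
    obtain c N where c: "0 < c" "c < c1" and N: "openin X N" "x \<in> N" and
      h: "\<And>F. F \<in> L2 M \<Longrightarrow> AE x in M. \<bar>F x\<bar> \<le> B \<Longrightarrow> AE x in M. x \<in> N \<longrightarrow> \<bar>J c F x - zero_ext U (res (part_space D U) c F) x\<bar> \<le> e / 4"
      by (rule res_comparison[OF fel U x e4 c1(1) B(1)], rule that)
    obtain k where k: "k \<in> C_space X" "AE x in M. J c ?F x = k x"
      by (rule res_continuous[OF fel F less_imp_le[OF B(1)] FB c(1)], rule that)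
    obtain N2 where N2: "openin X N2" "x \<in> N2" "\<And>y. y \<in> N2 \<Longrightarrow> \<bar>k y - k x\<bar> < e / 4"
      by (rule C_space_nbhd[OF k(1) xt e4], rule that)
    have "AE y in M. y \<in> N \<inter> N2 \<inter> U \<longrightarrow> \<bar>v y - k x\<bar> \<le> e"
      using h[OF F FB] k(2) close[OF c(1), unfolded part_AE[OF U]] Fv[OF c(1), unfolded part_AE[OF U]]
    proof eventually_elim
      case (elim y)
      show ?case
      proof
        assume y: "y \<in> N \<inter> N2 \<inter> U"
        hence "\<bar>J c ?F y - P.J c ?F y\<bar> \<le> e / 4" "\<bar>v y - P.J c v y\<bar> < e / 4" "P.J c ?F y = P.J c v y" "\<bar>k y - k x\<bar> < e / 4"
          using elim c1(2)[OF c] N2(3)[of y] by (auto simp: zero_ext_def)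
        thus "\<bar>v y - k x\<bar> \<le> e" using elim(2) by linarith
      qed
    qed
    with N N2 x U show "\<exists>N a. openin X N \<and> x \<in> N \<and> (AE y in M. y \<in> N \<longrightarrow> \<bar>v y - a\<bar> \<le> e)"
      by (intro exI[of _ "N \<inter> N2 \<inter> U"] exI[of _ "k x"]) auto
  qed (rule that)
  have wN: "AE x in ?N. v x = w x" using w(2) unfolding part_AE[OF U] .
  have wC: "w \<in> C_space (subtopology X U)" using w(1) by (simp add: C_space_def)
  have wB: "AE x in ?N. \<bar>w x\<bar> \<le> B" using wN B(2) by eventually_elim simp
  from P.C_space_abs_le[of w B, unfolded part_space_simps, OF wC wB] have "w \<in> C_b (subtopology X U)"
    using wC unfolding C_b_def by blast
  moreover have "AE x in ?N. P.semi t f x = w x" using vt wN by eventually_elim simp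
  ultimately show thesis by (rule that)
qed

end

section \<open>Weakly subharmonic functions\<close>

text \<open>For nonnegative \<open>v\<close> in the operator domain,
  \<open>exp (- s * lam) * ip M (semi s v) w\<close> is at least its value at 0; the sign of its
  right derivative there is the claim. Symmetry puts the time evolution on the smooth
  \<open>v\<close>, and \<open>res_tendsto_E1\<close> extends the inequality to all
  \<open>\<phi>\<close>.\<close>

lemma (in mform) excessive_form:
  assumes w: "w \<in> fdom D" and ex: "\<And>t. 0 < t \<Longrightarrow> AE x in M. w x \<le> exp (- t * lam) * semi t w x"
    and p: "\<phi> \<in> fdom D" "AE x in M. 0 \<le> \<phi> x"
  shows "form D w \<phi> + lam * ip M w \<phi> \<le> 0"
proof -
  note wL = fdom_L2[OF w]
  have G: "form D w v + lam * ip M w v \<le> 0" if gr: "operator_graph D v h" and v0: "AE x in M. 0 \<le> v x" for v h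
  proof -
    note v = graph_L2(1)[OF gr]
    let ?m = "\<lambda>s. exp (- s * lam) * ip M (semi s v) w"
    have "(?m has_real_derivative exp (- 0 * lam) * (- ip M (semi 0 h) w) + exp (- 0 * lam) * (- lam) * ip M (semi 0 v) w) (at 0 within {0..})"
      by (rule derivative_eq_intros ip_semi_derivative[OF gr wL] refl)+ (simp_all add: algebra_simps)
    hence lim: "((\<lambda>s. (?m s - ?m 0) / (s - 0)) \<longlongrightarrow> - ip M (semi 0 h) w - lam * ip M (semi 0 v) w) (at 0 within {0..})"
      unfolding has_field_derivative_iff by simp
    have z: "ip M (semi 0 u) w = ip M w u" if u: "u \<in> L2 M" for u
      using ip_cong_AE[OF L2_measurable[OF semi_L2[OF order_refl u]] L2_measurable[OF u] L2_measurable[OF wL] L2_measurable[OF wL] semi_0[OF u]]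
        L2.sym[OF u wL] by simp
    have "0 \<le> - ip M (semi 0 h) w - lam * ip M (semi 0 v) w"
    proof (rule tendsto_lowerbound[OF lim])
      show "at (0::real) within {0..} \<noteq> bot" by (simp add: at_within_Ici_at_right)
      have "0 \<le> (?m s - ?m 0) / (s - 0)" if s: "0 < s" for s
      proof -
        note s0 = less_imp_le[OF s] and sw = semi_L2[OF less_imp_le[OF s] wL]
        have "ip M w v \<le> ip M (\<lambda>x. exp (- s * lam) * semi s w x) v" unfolding ip_def
          by (rule integral_mono_AE)
            (use ex[OF s] v0 wL v sw in \<open>auto intro!: L2_integrable_mult L2.scale_mem elim!: eventually_elim2 intro: mult_right_mono\<close>)
        also have "\<dots> = ?m s" using semi_sym[OF s0 wL v] L2.sym[OF wL semi_L2[OF s0 v]] by (simp add: L2.scale_left sw v)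
        finally show ?thesis using s z[OF v] by simp
      qed
      thus "\<forall>\<^sub>F s in at 0 within {0..}. 0 \<le> (?m s - ?m 0) / (s - 0)"
        by (auto simp: eventually_at_filter)
    qed
    moreover have "form D w v = ip M w h"
      using gr E.sym[OF w] L2.sym[OF graph_L2(2)[OF gr] wL] w unfolding operator_graph_ip by simp
    ultimately show ?thesis using z[OF v] z[OF graph_L2(2)[OF gr]] by simp
  qed
  obtain v h where v: "\<And>n::nat. operator_graph D (v n) (h n)" "\<And>n. AE x in M. 0 \<le> v n x" "(\<lambda>n. E1.N (\<lambda>x. v n x - \<phi> x)) \<longlonglongrightarrow> 0"
    by (rule res_tendsto_E1[OF p], rule that)
  have vm: "v n \<in> fdom D" for n using v(1) by (simp add: operator_graph_def)
  have "(\<lambda>n. form D (v n) w + lam * ip M (v n) w) \<longlonglongrightarrow> form D \<phi> w + lam * ip M \<phi> w"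
    by (intro tendsto_add tendsto_mult_left E.N_tendsto_B[OF vm p(1) w E1_tendsto_E[OF vm p(1) v(3)]]
      L2.N_tendsto_B[OF fdom_L2[OF vm] fdom_L2[OF p(1)] wL E1_tendsto_l2n[OF vm p(1) v(3)]])
  hence "form D \<phi> w + lam * ip M \<phi> w \<le> 0"
    using G[OF v(1,2)] E.sym[OF vm w] L2.sym[OF fdom_L2[OF vm] wL] by (intro LIMSEQ_le_const2) auto
  thus ?thesis using E.sym[OF p(1) w] L2.sym[OF fdom_L2[OF p(1)] wL] by simp
qed

context dspace
begin

lemma msupport_subset:
  assumes K: "closedin X K" and z: "AE x in M. x \<notin> K \<longrightarrow> v x = 0" shows "msupport X M v \<subseteq> K"
proof -
  have "AE x in M. x \<in> topspace X - K \<longrightarrow> v x = 0" using z by eventually_elim blast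
  hence "topspace X - K \<subseteq> \<Union>{W. openin X W \<and> (AE x in M. x \<in> W \<longrightarrow> v x = 0)}"
    using K by (intro Union_upper) (simp add: closedin_def)
  thus ?thesis unfolding msupport_def by blast
qed

lemma closedin_msupport: "closedin X (msupport X M v)"
  unfolding msupport_def by (intro closedin_diff closedin_topspace openin_Union) auto

lemma strongly_local_zero:
  assumes "u \<in> fdom D" "v \<in> fdom D" "openin X W" "msupport X M v \<subseteq> W" "AE x in M. x \<in> W \<longrightarrow> u x = c"
  shows "form D u v = 0"
proof (intro local[unfolded strongly_local_def, rule_format, OF assms(1,2)] exI)
  show "AE x in M. x \<in> msupport X M v \<longrightarrow> u x = c" using assms(5) by eventually_elim (use assms(4) in blast)
qed

text \<open>Strong locality makes the description in \<open>form_loc\<close> unambiguous: two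
  representatives differ by a function that vanishes near the support of
  \<open>\<phi>\<close>.\<close>

lemma form_loc_eq:
  assumes p: "\<phi> \<in> fdom D" and h: "h \<in> fdom D" and W: "openin X W" "msupport X M \<phi> \<subseteq> W" and eq: "AE x in M. x \<in> W \<longrightarrow> f x = h x"
  shows "form_loc D f \<phi> = form D h \<phi>"
  unfolding form_loc_def
proof (rule the_equality)
  fix r assume "\<exists>h\<in>fdom D. \<exists>W. openin X W \<and> msupport X M \<phi> \<subseteq> W \<and> (AE x in M. x \<in> W \<longrightarrow> f x = h x) \<and> r = form D h \<phi>"
  then obtain h' W' where h': "h' \<in> fdom D" "openin X W'" "msupport X M \<phi> \<subseteq> W'" "AE x in M. x \<in> W' \<longrightarrow> f x = h' x" "r = form D h' \<phi>"
    by blast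
  have "form D (\<lambda>x. h' x - h x) \<phi> = 0"
  proof (rule strongly_local_zero[OF E.diff_mem[OF h'(1) h] p])
    show "openin X (W \<inter> W')" "msupport X M \<phi> \<subseteq> W \<inter> W'" using W h' by auto
    show "AE x in M. x \<in> W \<inter> W' \<longrightarrow> h' x - h x = 0" using eq h'(4) by eventually_elim auto
  qed
  thus "r = form D h \<phi>" using h' h p by (simp add: E.diff_left)
qed (use h W eq in blast)

lemma F_loc_rep:
  assumes f: "f \<in> F_loc D" and p: "\<phi> \<in> F_c D"
  obtains h W where "h \<in> fdom D" "openin X W" "msupport X M \<phi> \<subseteq> W" "AE x in M. x \<in> W \<longrightarrow> f x = h x"
    "compactin X (X closure_of W)"
proof -
  have pm: "\<phi> \<in> fdom D" "compactin X (msupport X M \<phi>)" using p by (auto simp: F_c_def)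
  obtain W where W: "openin X W" "msupport X M \<phi> \<subseteq> W" "compactin X (X closure_of W)"
    by (rule compact_nbhd[OF pm(2) openin_topspace]) (use compactin_subset_topspace[OF pm(2)] in auto)
  then obtain h where "h \<in> fdom D" "AE x in M. x \<in> W \<longrightarrow> f x = h x" using f unfolding F_loc_def relcompact_open_def by blast
  thus thesis using that W by blast
qed

lemma integral_F_c:
  assumes p: "\<phi> \<in> fdom D" and W: "msupport X M \<phi> \<subseteq> W" and eq: "AE x in M. x \<in> W \<longrightarrow> f x = h x"
    and f: "f \<in> borel_measurable M" and h: "h \<in> borel_measurable M"
  shows "(\<integral>x. f x * \<phi> x \<partial>M) = ip M h \<phi>"
  unfolding ip_def
proof (rule integral_cong_AE)
  show "AE x in M. f x * \<phi> x = h x * \<phi> x"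
    using eq msupport_AE[OF openin_topspace L2_measurable[OF fdom_L2[OF p]]] by eventually_elim (use W in auto)
qed (intro borel_measurable_times f h L2_measurable[OF fdom_L2[OF p]])+

lemma F_locI:
  assumes f: "f \<in> borel_measurable M"
    and h: "\<And>U. relcompact_open X U \<Longrightarrow> \<exists>h\<in>fdom D. AE x in M. x \<in> U \<longrightarrow> f x = h x"
  shows "f \<in> F_loc D"
proof -
  have "set_integrable M K (\<lambda>x. (f x)\<^sup>2)" if K: "compactin X K" for K
  proof -
    obtain W where W: "openin X W" "K \<subseteq> W" "compactin X (X closure_of W)"
      by (rule compact_nbhd[OF K openin_topspace]) (use compactin_subset_topspace[OF K] in auto)
    then obtain v where v: "v \<in> fdom D" "AE x in M. x \<in> W \<longrightarrow> f x = v x" using h[of W] by (auto simp: relcompact_open_def)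
    have vi: "set_integrable M K (\<lambda>x. (v x)\<^sup>2)" unfolding set_integrable_def
      using integrable_mult_indicator[OF compact_sets[OF K] L2_integrable_sq[OF fdom_L2[OF v(1)]]] .
    note [measurable] = f L2_measurable[OF fdom_L2[OF v(1)]] compact_sets[OF K]
    have "integrable M (\<lambda>x. indicat_real K x *\<^sub>R (f x)\<^sup>2) \<longleftrightarrow> integrable M (\<lambda>x. indicat_real K x *\<^sub>R (v x)\<^sup>2)"
    proof (rule integrable_cong_AE)
      show "AE x in M. indicat_real K x *\<^sub>R (f x)\<^sup>2 = indicat_real K x *\<^sub>R (v x)\<^sup>2"
        using v(2) by eventually_elim (use W(2) in \<open>auto simp: indicator_def\<close>)
    qed measurable
    with vi show ?thesis by (simp add: set_integrable_def)
  qed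
  with f h show ?thesis by (auto simp: F_loc_def L2loc_def)
qed

lemma F_loc_measurable: "f \<in> F_loc D \<Longrightarrow> f \<in> borel_measurable M"
  by (simp add: F_loc_def L2loc_def)

lemma weakly_subharmonic_add:
  assumes g: "weakly_subharmonic D lam g" and w: "w \<in> fdom D"
    and le: "\<And>\<phi>. \<phi> \<in> fdom D \<Longrightarrow> AE x in M. 0 \<le> \<phi> x \<Longrightarrow> form D w \<phi> + lam * ip M w \<phi> \<le> 0"
  shows "weakly_subharmonic D lam (\<lambda>x. w x + g x)"
proof -
  have gF: "g \<in> F_loc D" using g by (simp add: weakly_subharmonic_def)
  note wm = L2_measurable[OF fdom_L2[OF w]] and gm = F_loc_measurable[OF gF]
  have "(\<lambda>x. w x + g x) \<in> F_loc D"
  proof (rule F_locI)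
    fix U assume "relcompact_open X U"
    then obtain h where "h \<in> fdom D" "AE x in M. x \<in> U \<longrightarrow> g x = h x" using gF by (auto simp: F_loc_def)
    thus "\<exists>h\<in>fdom D. AE x in M. x \<in> U \<longrightarrow> w x + g x = h x"
      using E.add_mem[OF w] by (intro bexI[of _ "\<lambda>x. w x + h x"]) auto
  qed (use wm gm in measurable)
  moreover have "form_loc D (\<lambda>x. w x + g x) \<phi> + lam * (\<integral>x. (w x + g x) * \<phi> x \<partial>M) \<le> 0"
    if p: "\<phi> \<in> F_c D" and p0: "AE x in M. 0 \<le> \<phi> x" for \<phi>
  proof -
    have pm: "\<phi> \<in> fdom D" using p by (simp add: F_c_def)
    obtain h W where h: "h \<in> fdom D" "openin X W" "msupport X M \<phi> \<subseteq> W" "AE x in M. x \<in> W \<longrightarrow> g x = h x"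
      by (rule F_loc_rep[OF gF p])
    note hL = fdom_L2[OF h(1)] and wL = fdom_L2[OF w] and pL = fdom_L2[OF pm]
    note hw = E.add_mem[OF w h(1)]
    have eq: "AE x in M. x \<in> W \<longrightarrow> w x + g x = w x + h x" using h(4) by eventually_elim simp
    have "form_loc D g \<phi> + lam * (\<integral>x. g x * \<phi> x \<partial>M) \<le> 0" using g p p0 by (simp add: weakly_subharmonic_def)
    hence "form D h \<phi> + lam * ip M h \<phi> \<le> 0"
      unfolding form_loc_eq[OF pm h] integral_F_c[OF pm h(3,4) gm L2_measurable[OF hL]] .
    with le[OF pm p0] show ?thesis
      unfolding form_loc_eq[OF pm hw h(2,3) eq] integral_F_c[OF pm h(3) eq borel_measurable_add[OF wm gm] L2_measurable[OF L2.add_mem[OF wL hL]]]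
      by (simp add: E.add_left L2.add_left w h(1) pm wL hL pL algebra_simps)
  qed
  ultimately show ?thesis by (simp add: weakly_subharmonic_def)
qed

text \<open>Near the support of a test function the constant is represented by a multiple of a
  cutoff \<open>\<eta>\<close> equal to 1 there, whose form with the test function is 0 by strong
  locality.\<close>

lemma weakly_subharmonic_add_const:
  assumes g: "weakly_subharmonic D 0 g" shows "weakly_subharmonic D 0 (\<lambda>x. g x + C)"
proof -
  have gF: "g \<in> F_loc D" using g by (simp add: weakly_subharmonic_def)
  have cut: "\<exists>\<eta>\<in>fdom D. \<forall>x\<in>X closure_of W. \<eta> x = 1" if W: "compactin X (X closure_of W)" for W
    by (rule cutoff[OF W openin_topspace closure_of_subset_topspace]) blast
  have "(\<lambda>x. g x + C) \<in> F_loc D"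
  proof (rule F_locI)
    fix U assume U: "relcompact_open X U"
    then obtain h where h: "h \<in> fdom D" "AE x in M. x \<in> U \<longrightarrow> g x = h x" using gF by (auto simp: F_loc_def)
    obtain \<eta> where e: "\<eta> \<in> fdom D" "\<forall>x\<in>X closure_of U. \<eta> x = 1" using cut U by (auto simp: relcompact_open_def)
    have "AE x in M. x \<in> U \<longrightarrow> g x + C = h x + C * \<eta> x"
      using h(2) by eventually_elim (use e(2) closure_of_subset[OF openin_subset] U in \<open>auto simp: relcompact_open_def\<close>)
    thus "\<exists>h\<in>fdom D. AE x in M. x \<in> U \<longrightarrow> g x + C = h x"
      using E.add_mem[OF h(1) E.scale_mem[OF e(1)]] by (intro bexI)
  qed (use F_loc_measurable[OF gF] in measurable)
  moreover have "form_loc D (\<lambda>x. g x + C) \<phi> \<le> 0" if p: "\<phi> \<in> F_c D" and p0: "AE x in M. 0 \<le> \<phi> x" for \<phi>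
  proof -
    have pm: "\<phi> \<in> fdom D" using p by (simp add: F_c_def)
    obtain h W where h: "h \<in> fdom D" "openin X W" "msupport X M \<phi> \<subseteq> W" "AE x in M. x \<in> W \<longrightarrow> g x = h x"
      and Wc: "compactin X (X closure_of W)" by (rule F_loc_rep[OF gF p])
    obtain \<eta> where e: "\<eta> \<in> fdom D" "\<forall>x\<in>X closure_of W. \<eta> x = 1" using cut[OF Wc] by blast
    have e1: "x \<in> W \<Longrightarrow> \<eta> x = 1" for x using e(2) closure_of_subset[OF openin_subset[OF h(2)]] by blast
    have "form D \<eta> \<phi> = 0" by (rule strongly_local_zero[OF e(1) pm h(2,3)]) (use e1 in \<open>auto intro!: AE_I2\<close>)
    moreover have "form_loc D (\<lambda>x. g x + C) \<phi> = form D (\<lambda>x. h x + C * \<eta> x) \<phi>"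
      by (rule form_loc_eq[OF pm E.add_mem[OF h(1) E.scale_mem[OF e(1)]] h(2,3)])
        (use h(4) e1 in \<open>auto elim!: eventually_mono\<close>)
    moreover have "form_loc D g \<phi> + 0 * (\<integral>x. g x * \<phi> x \<partial>M) \<le> 0" using g p p0 unfolding weakly_subharmonic_def by blast
    hence "form D h \<phi> \<le> 0" unfolding form_loc_eq[OF pm h] by simp
    ultimately show ?thesis by (simp add: E.add_left E.scale_left E.scale_mem h(1) e(1) pm)
  qed
  ultimately show ?thesis by (simp add: weakly_subharmonic_def)
qed

lemma part_closure_clamp:
  assumes h: "h \<in> fdom D" and e: "\<eta> \<in> core V" "\<And>x. x \<in> topspace X \<Longrightarrow> 0 \<le> \<eta> x" and B: "0 \<le> B"
  shows "(\<lambda>x. max (min (h x) (B * \<eta> x)) (- (B * \<eta> x))) \<in> part_closure D V"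
proof -
  have b: "(\<lambda>x. B * \<eta> x + 0 * \<eta> x) \<in> core V" by (rule core_lin[OF e(1) e(1)])
  have c: "1 * min (max a 0) (b + 0 * e) + -1 * min (max (- a) 0) (b + 0 * e) = max (min a b) (- b)" if "0 \<le> b" for a b e :: real
    using that by (auto simp: min_def max_def)
  have "(\<lambda>x. min (max (u x) 0) (B * \<eta> x + 0 * \<eta> x)) \<in> part_closure D V" if u: "u \<in> fdom D" for u
    by (rule part_closure_below_core[OF min_mem[OF max0_mem[OF u] coreD(1)[OF b]] b])
      (use e(2) B in \<open>auto intro!: AE_I2 simp: space_M\<close>)
  from part_closure_lin[OF this[OF h] this[OF E.uminus_mem[OF h]], of 1 "-1"]
  show ?thesis
  proof (rule part_closure_cong_AE)
    show "AE x in M. 1 * min (max (h x) 0) (B * \<eta> x + 0 * \<eta> x) + -1 * min (max (- h x) 0) (B * \<eta> x + 0 * \<eta> x) =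
        max (min (h x) (B * \<eta> x)) (- (B * \<eta> x))"
      by (intro AE_I2 c mult_nonneg_nonneg B e(2)) (simp add: space_M)
  qed (use L2_measurable[OF fdom_L2[OF h]] L2_measurable[OF fdom_L2[OF coreD(1)[OF e(1)]]] in measurable)
qed

text \<open>The local representatives of \<open>g\<close> have to lie in the domain of the part,
  that is, to come from the core of \<open>V\<close>. Clamping by a multiple of a cutoff achieves
  this without products; where the cutoff is 1 the bound on \<open>g\<close> makes the clamp
  ineffective.\<close>

lemma weakly_subharmonic_part:
  assumes g: "weakly_subharmonic D lam g" and B: "AE x in M. \<bar>g x\<bar> \<le> B" and V: "relcompact_open X V"
  shows "weakly_subharmonic (part_space D V) lam g"
proof -
  have Vo: "openin X V" and Vc: "compactin X (X closure_of V)" using V by (auto simp: relcompact_open_def)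
  interpret P: dspace "part_space D V" by (rule dspace_part[OF Vo])
  have gF: "g \<in> F_loc D" using g by (simp add: weakly_subharmonic_def)
  note gm = F_loc_measurable[OF gF]
  have gV: "g \<in> F_loc (part_space D V)"
  proof (rule P.F_locI)
    show "g \<in> borel_measurable P.M" using gm by (simp add: measurable_restrict_space1)
    fix U assume "relcompact_open P.X U"
    hence U: "openin (subtopology X V) U" "compactin X (subtopology X V closure_of U)" "subtopology X V closure_of U \<subseteq> V"
      by (simp_all add: relcompact_open_def compactin_subtopology)
    obtain h0 where h0: "h0 \<in> fdom D" "AE x in M. x \<in> V \<longrightarrow> g x = h0 x" using gF V by (auto simp: F_loc_def)
    obtain \<eta> where e: "\<eta> \<in> fdom D" "\<eta> \<in> C_c X" "supp \<eta> \<subseteq> V" "\<And>x. x \<in> topspace X \<Longrightarrow> 0 \<le> \<eta> x \<and> \<eta> x \<le> 1" "\<And>x. x \<in> subtopology X V closure_of U \<Longrightarrow> \<eta> x = 1"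
      by (rule cutoff[OF U(2) Vo U(3)], rule that)
    define h where "h = (\<lambda>x. max (min (h0 x) (\<bar>B\<bar> * \<eta> x)) (- (\<bar>B\<bar> * \<eta> x)))"
    have h: "h \<in> part_closure D V" unfolding h_def
      by (rule part_closure_clamp[OF h0(1)]) (use e in \<open>auto simp: core_def\<close>)
    have "AE x in M. x \<in> V \<longrightarrow> x \<in> U \<longrightarrow> g x = h x"
      using h0(2) B
    proof eventually_elim
      case (elim x)
      show ?case
      proof (intro impI)
        assume x: "x \<in> V" "x \<in> U"
        have "\<eta> x = 1" by (rule e(5)[OF subsetD[OF closure_of_subset[OF openin_subset[OF U(1)]] x(2)]])
        thus "g x = h x" using elim x by (auto simp: h_def max_def min_def)
      qed
    qed
    hence "AE x in restrict_space M V. x \<in> U \<longrightarrow> g x = h x" unfolding part_AE[OF Vo] .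
    thus "\<exists>h\<in>fdom (part_space D V). AE x in P.M. x \<in> U \<longrightarrow> g x = h x"
      unfolding part_space_simps(2) using part_closure_zero_ext(2)[OF Vo h] by (intro bexI[of _ h]) simp_all
  qed
  moreover have "form_loc (part_space D V) g \<phi> + lam * (\<integral>x. g x * \<phi> x \<partial>P.M) \<le> 0"
    if p: "\<phi> \<in> F_c (part_space D V)" and p0: "AE x in P.M. 0 \<le> \<phi> x" for \<phi>
  proof -
    let ?p = "zero_ext V \<phi>"
    have pm: "\<phi> \<in> fdom (part_space D V)" using p by (simp add: F_c_def)
    hence pV: "?p \<in> fdom D" by (simp add: part_mem)
    let ?K = "msupport (subtopology X V) (restrict_space M V) \<phi>"
    have K: "compactin X ?K" "?K \<subseteq> V" using p by (auto simp: F_c_def compactin_subtopology)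
    have "\<phi> \<in> borel_measurable (restrict_space M V)" using L2_measurable[OF P.fdom_L2[OF pm]] by simp
    hence "AE x in restrict_space M V. x \<notin> ?K \<longrightarrow> \<phi> x = 0" using P.msupport_AE[OF openin_topspace, of \<phi>, unfolded part_space_simps] by blast
    hence "AE x in M. x \<notin> ?K \<longrightarrow> ?p x = 0" unfolding part_AE[OF Vo] by eventually_elim (simp add: zero_ext_def)
    hence ms: "msupport X M ?p \<subseteq> ?K" by (rule msupport_subset[OF compact_closed[OF K(1)]])
    have pc: "?p \<in> F_c D" using pV closed_compactin[OF K(1) ms closedin_msupport] by (simp add: F_c_def)
    have pp: "AE x in M. 0 \<le> ?p x"
      using p0 unfolding part_space_simps part_AE[OF Vo] by eventually_elim (simp add: zero_ext_def)
    obtain h W where h: "h \<in> fdom (part_space D V)" "openin P.X W" "msupport P.X P.M \<phi> \<subseteq> W" "AE x in P.M. x \<in> W \<longrightarrow> g x = h x"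
      by (rule P.F_loc_rep[OF gV p])
    have Wo: "openin X W" "W \<subseteq> V" using h(2) by (auto simp: openin_open_subtopology[OF Vo])
    have zh: "zero_ext V h \<in> fdom D" using h(1) by (simp add: part_mem)
    have eq: "AE x in M. x \<in> W \<longrightarrow> g x = zero_ext V h x"
      using h(4) unfolding part_space_simps part_AE[OF Vo] by eventually_elim (use Wo in \<open>auto simp: zero_ext_def\<close>)
    have "form_loc (part_space D V) g \<phi> = form_loc D g ?p"
      unfolding P.form_loc_eq[OF pm h] part_space_simps
      by (rule form_loc_eq[OF pV zh Wo(1) _ eq, symmetric]) (use ms h(3) in auto)
    moreover have "(\<integral>x. g x * \<phi> x \<partial>P.M) = (\<integral>x. g x * ?p x \<partial>M)"
      unfolding part_space_simps part_integral[OF Vo] by (rule arg_cong[where f = "integral\<^sup>L M"]) (auto simp: zero_ext_def)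
    ultimately show ?thesis using g pc pp by (simp add: weakly_subharmonic_def)
  qed
  ultimately show ?thesis by (simp add: weakly_subharmonic_def)
qed

end

section \<open>Shift defective functions\<close>

text \<open>L1 convergence gives a null limit along a subsequence, and monotonicity extends it to
  the whole sequence.\<close>

lemma AE_decreasing_tendsto_zero:
  fixes a :: "nat \<Rightarrow> 'b \<Rightarrow> real"
  assumes i: "\<And>k. integrable N (a k)" and dec: "\<And>k. AE x in N. a (Suc k) x \<le> a k x" and pos: "\<And>k. AE x in N. 0 \<le> a k x"
    and lim: "(\<lambda>k. \<integral>x. a k x \<partial>N) \<longlonglongrightarrow> 0"
  shows "AE x in N. (\<lambda>k. a k x) \<longlonglongrightarrow> 0"
proof -
  have "(\<integral>x. norm (a k x) \<partial>N) = (\<integral>x. a k x \<partial>N)" for k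
    by (rule integral_cong_AE) (use i[of k] pos[of k] in \<open>auto intro: borel_measurable_integrable\<close>)
  then obtain r where r: "strict_mono r" "AE x in N. (\<lambda>k. a (r k) x) \<longlonglongrightarrow> 0"
    using tendsto_L1_AE_subseq[of N a] i lim by auto
  have "AE x in N. \<forall>k. a (Suc k) x \<le> a k x \<and> 0 \<le> a k x"
    unfolding AE_all_countable using dec pos by (auto elim!: eventually_elim2)
  with r(2) show ?thesis
  proof eventually_elim
    case (elim x)
    obtain L where L: "(\<lambda>k. a k x) \<longlonglongrightarrow> L"
      by (rule decseq_convergent[of "\<lambda>k. a k x" 0]) (use elim in \<open>auto simp: decseq_Suc_iff\<close>)
    from LIMSEQ_unique[OF LIMSEQ_subseq_LIMSEQ[OF L r(1), unfolded o_def] elim(1)] L show ?case by simp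
  qed
qed

context dspace
begin

lemma C_b_L2:
  assumes "finite_measure M" "f \<in> C_b X" shows "f \<in> L2 M" "integrable M f"
proof -
  obtain B where B: "f \<in> C_space X" "\<forall>x\<in>topspace X. \<bar>f x\<bar> \<le> B" using assms(2) by (auto simp: C_b_def)
  show "f \<in> L2 M" by (rule finite_measure_L2_bounded[OF assms(1) C_space_measurable[OF B(1)], of B]) (use B(2) in \<open>auto intro!: AE_I2 simp: space_M\<close>)
  thus "integrable M f" by (rule finite_measure_L2_integrable[OF assms(1)])
qed

lemma C_b_lin:
  assumes "f \<in> C_b X" "g \<in> C_b X" shows "(\<lambda>x. a * f x + b * g x) \<in> C_b X"
proof -
  obtain B B' where B: "\<And>x. x \<in> topspace X \<Longrightarrow> \<bar>f x\<bar> \<le> B" "\<And>x. x \<in> topspace X \<Longrightarrow> \<bar>g x\<bar> \<le> B'" using assms by (auto simp: C_b_def)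
  have "\<bar>a * f x + b * g x\<bar> \<le> \<bar>a\<bar> * B + \<bar>b\<bar> * B'" if "x \<in> topspace X" for x
    by (rule order_trans[OF abs_triangle_ineq]) (use B that in \<open>auto simp: abs_mult intro!: add_mono mult_left_mono\<close>)
  thus ?thesis using C_space_lattice(3)[of f g a b] assms by (auto simp: C_b_def)
qed

text \<open>Constants are not \<open>\<lambda>\<close>-harmonic if \<open>\<lambda> > 0\<close>, but then letting \<open>t \<rightarrow> \<infinity>\<close> shows \<open>w \<le> 0\<close>.\<close>

lemma excessive_bound:
  assumes fin: "finite_measure M" and w: "w \<in> C_b X" and lam: "0 \<le> lam"
    and ex: "\<And>t. 0 < t \<Longrightarrow> AE x in M. w x \<le> exp (- t * lam) * semi t w x"
  obtains C where "0 \<le> C" "AE x in M. w x \<le> C" "lam = 0 \<or> C = 0"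
proof -
  obtain B where B: "\<And>x. x \<in> topspace X \<Longrightarrow> \<bar>w x\<bar> \<le> B" using w by (auto simp: C_b_def)
  have wB: "AE x in M. \<bar>w x\<bar> \<le> \<bar>B\<bar>" using B by (intro AE_I2) (force simp: space_M)
  show thesis
  proof (cases "lam = 0")
    case True
    show thesis by (rule that[of "\<bar>B\<bar>"]) (use wB True in \<open>auto elim: eventually_mono\<close>)
  next
    case False
    let ?e = "\<lambda>n. exp (- real (Suc n) * lam) * \<bar>B\<bar>"
    have "AE x in M. w x \<le> ?e n" for n
    proof -
      have "AE x in M. semi (real (Suc n)) w x \<le> \<bar>B\<bar>"
        by (rule semi_le_const[OF _ C_b_L2(1)[OF fin w]]) (use wB in \<open>auto elim: eventually_mono\<close>)
      moreover have "0 < real (Suc n)" by simp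
      from ex[OF this] have "AE x in M. w x \<le> exp (- real (Suc n) * lam) * semi (real (Suc n)) w x" .
      ultimately show ?thesis
      proof eventually_elim
        case (elim x)
        show ?case by (rule order_trans[OF elim(2) mult_left_mono[OF elim(1)]]) simp
      qed
    qed
    hence "AE x in M. \<forall>n. w x \<le> ?e n" by (simp only: AE_all_countable) simp
    moreover have "?e \<longlonglongrightarrow> 0"
    proof (rule tendsto_mult_left_zero)
      have "(\<lambda>n. exp (- lam) ^ Suc n) \<longlonglongrightarrow> 0"
        using False lam by (intro LIMSEQ_Suc LIMSEQ_realpow_zero) auto
      thus "(\<lambda>n. exp (- real (Suc n) * lam)) \<longlonglongrightarrow> 0"         unfolding exp_of_nat_mult[symmetric] by (simp only: mult_minus_left mult_minus_right)
    qed
    ultimately have "AE x in M. w x \<le> 0" by (auto elim!: eventually_mono intro: LIMSEQ_le_const)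
    thus thesis by (intro that[of 0]) auto
  qed
qed

text \<open>Domination \<open>P.semi t \<le> semi t\<close> holds on nonnegative functions only, and
  \<open>w\<close> may be positive. Subtracting \<open>C\<close> makes \<open>C - w\<close>
  nonnegative, and the semigroup does not increase the constant \<open>C\<close>, so the defect
  inequality passes to \<open>V\<close> for \<open>w - C\<close>, that is, with corrector
  \<open>g + C\<close>.\<close>

lemma shift_corrector_part:
  assumes fin: "finite_measure M" and w: "w \<in> C_b X" and lam: "0 \<le> lam"
    and ex: "\<And>t. 0 < t \<Longrightarrow> AE x in M. w x \<le> exp (- t * lam) * semi t w x"
    and g: "g \<in> C_b X" "weakly_harmonic D lam g" and V: "relcompact_open X V"
  shows "\<exists>G. shift_corrector D lam (\<lambda>x. w x + g x) V G"
proof -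
  have Vo: "openin X V" using V by (auto simp: relcompact_open_def)
  interpret P: dspace "part_space D V" by (rule dspace_part[OF Vo])
  obtain C where C: "0 \<le> C" "AE x in M. w x \<le> C" "lam = 0 \<or> C = 0" by (rule excessive_bound[OF fin w lam], rule ex, assumption, rule that)
  have "C_b X \<subseteq> C_b P.X" using openin_subset[OF Vo]
    by (auto simp: C_b_def C_space_def continuous_map_from_subtopology)
  moreover have "(\<lambda>x. 1 * g x + 1 * C) \<in> C_b X" by (intro C_b_lin g) (use C_space_lattice(5)[of g g C] g(1) in \<open>auto simp: C_b_def\<close>)
  ultimately have G: "(\<lambda>x. g x + C) \<in> C_b P.X" by auto
  obtain B where "\<And>x. x \<in> topspace X \<Longrightarrow> \<bar>g x\<bar> \<le> B" using g(1) by (auto simp: C_b_def)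
  hence gB: "AE x in M. \<bar>g x\<bar> \<le> B" "AE x in M. \<bar>- g x\<bar> \<le> B" by (auto intro!: AE_I2 simp: space_M)
  have "weakly_subharmonic (part_space D V) lam g" "weakly_subharmonic (part_space D V) lam (\<lambda>x. - g x)"
    by (rule weakly_subharmonic_part[OF _ gB(1) V] weakly_subharmonic_part[OF _ gB(2) V], use g(2) in \<open>simp add: weakly_harmonic_def\<close>)+
  hence H: "weakly_harmonic (part_space D V) lam (\<lambda>x. g x + C)"
    using P.weakly_subharmonic_add_const[of g C] P.weakly_subharmonic_add_const[of "\<lambda>x. - g x" "- C"] C(3)
    by (cases "lam = 0") (auto simp: weakly_harmonic_def)
  let ?n = "\<lambda>x. C - w x"
  note wL = C_b_L2(1)[OF fin w] and cL = finite_measure_L2_const[OF fin, of C]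
  note nL = L2.diff_mem[OF cL wL]
  have S: "AE x in restrict_space M V. w x + g x - (g x + C) \<le> exp (- t * lam) * heat (part_space D V) t (\<lambda>y. w y + g y - (g y + C)) x"
    if t: "0 < t" for t
  proof -
    note t0 = less_imp_le[OF t]
    have e: "(\<lambda>y. w y + g y - (g y + C)) = (\<lambda>x. - ?n x)" by auto
    note nP = L2_part[OF Vo nL]
    have n0: "AE x in M. 0 \<le> ?n x" using C(2) by eventually_elim simp
    have "AE x in M. semi t (\<lambda>x. C) x \<le> C" by (rule semi_le_const[OF t0 cL C(1)]) simp
    with semi_diff[OF t0 cL wL] ex[OF t] part_semi_le[OF Vo t0 nL n0]
    have "AE x in M. x \<in> V \<longrightarrow> exp (- t * lam) * P.semi t ?n x \<le> ?n x"
    proof eventually_elim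
      case (elim x)
      show ?case
      proof
        assume "x \<in> V"
        hence "exp (- t * lam) * P.semi t ?n x \<le> exp (- t * lam) * (C - semi t w x)"
          using elim by (intro mult_left_mono) auto
        moreover have "exp (- t * lam) * C \<le> 1 * C" using C(1) t lam by (intro mult_right_mono) auto
        ultimately show "exp (- t * lam) * P.semi t ?n x \<le> ?n x" using elim(2) by (simp add: right_diff_distrib)
      qed
    qed
    hence "AE x in restrict_space M V. exp (- t * lam) * P.semi t ?n x \<le> ?n x" unfolding part_AE[OF Vo] .
    with P.heat_eq_semi[OF t0, of "\<lambda>x. - ?n x", unfolded part_space_simps, OF L2.uminus_mem[OF nP]]
      P.semi_uminus[OF t0, of ?n, unfolded part_space_simps, OF nP]
    show ?thesis unfolding e by eventually_elim simp
  qed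
  show ?thesis using G H S unfolding shift_corrector_def part_space_simps(1,2) by blast
qed

text \<open>An infimum of continuous functions is upper semicontinuous everywhere; the hypotheses on
  monotonicity and limits are used only to identify it almost everywhere.\<close>

lemma usc_INF:
  assumes F: "\<And>k. 1 \<le> k \<Longrightarrow> F k \<in> C_space X"
    and lim: "AE x in M. (\<forall>k\<ge>1. F (Suc k) x \<le> F k x) \<and> (\<lambda>k. F k x) \<longlonglongrightarrow> f x"
  shows "usc_representative D f (\<lambda>x. INF k\<in>{1..}. ereal (F k x))"
  unfolding usc_representative_def upper_semicontinuous_def
proof (intro conjI ballI allI)
  fix x show "(INF k\<in>{1..}. ereal (F k x)) < \<infinity>" by (rule le_less_trans[OF INF_lower[of 1]]) auto
next
  fix a
  have "openin X {x \<in> topspace X. ereal (F k x) < a}" if "1 \<le> k" for k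
  proof -
    have "openin X {x \<in> topspace X. F k x \<in> {r. ereal r < a}}"
    proof (rule openin_continuous_map_preimage[of X euclideanreal])
      show "openin euclideanreal {r. ereal r < a}" by (cases a) (auto simp: lessThan_def[symmetric])
    qed (use F[OF that] in \<open>simp add: C_space_def\<close>)
    thus ?thesis by simp
  qed
  hence "openin X (\<Union>k\<in>{1..}. {x \<in> topspace X. ereal (F k x) < a})" by (intro openin_Union) auto
  moreover have "(\<Union>k\<in>{1..}. {x \<in> topspace X. ereal (F k x) < a}) = {x \<in> topspace X. (INF k\<in>{1..}. ereal (F k x)) < a}"
    by (auto simp: INF_less_iff)
  ultimately show "openin X {x \<in> topspace X. (INF k\<in>{1..}. ereal (F k x)) < a}" by simp
next
  show "AE x in M. (INF k\<in>{1..}. ereal (F k x)) = ereal (f x)"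
    using lim
  proof eventually_elim
    case (elim x)
    have dec: "F m x \<le> F k x" if "k \<le> m" "1 \<le> k" for k m
      using that by (induction m rule: dec_induct) (use elim in \<open>auto intro: order_trans\<close>)
    have "f x \<le> F k x" if "1 \<le> k" for k
      by (rule LIMSEQ_le_const2[of "\<lambda>m. F m x"]) (use elim dec that in auto)
    hence "ereal (f x) \<le> (INF k\<in>{1..}. ereal (F k x))" by (intro INF_greatest) auto
    moreover have "(INF k\<in>{1..}. ereal (F k x)) \<le> ereal (f x)"
      by (rule LIMSEQ_le_const[of "\<lambda>k. ereal (F k x)"]) (use elim in \<open>auto intro!: exI[of _ 1] INF_lower\<close>)
    ultimately show ?case by simp
  qed
qed

text \<open>The time is halved. The first half makes an integrable function bounded by
  ultracontractivity, hence square integrable; the second half gives continuity and membership in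
  the form domain.\<close>

lemma heat_regular:
  assumes fel: "doubly_feller D" and U: "openin X U" and fin: "finite_measure (restrict_space M U)"
    and uc: "ultracontractive (part_space D U)" and h: "integrable (restrict_space M U) h" and t: "0 < t"
  shows "\<exists>w. w \<in> C_b (subtopology X U) \<and> w \<in> fdom (part_space D U) \<and> (AE x in restrict_space M U. heat (part_space D U) t h x = w x)"
proof -
  let ?P = "part_space D U" and ?N = "restrict_space M U"
  interpret P: dspace ?P by (rule dspace_part[OF U])
  interpret PF: fmform ?P by (intro fmform.intro fmform_axioms.intro P.mform_axioms) (simp add: fin)
  have t2: "0 < t / 2" "0 \<le> t / 2" using t by auto
  let ?u = "heat ?P (t / 2) h"
  have "?u \<in> Linf ?N" using uc t2(1) h by (auto simp: ultracontractive_def L1_def)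
  then obtain C where "?u \<in> borel_measurable ?N" "AE x in ?N. \<bar>?u x\<bar> \<le> C" unfolding Linf_def by blast
  hence u: "?u \<in> L2 ?N" by (rule finite_measure_L2_bounded[OF fin])
  obtain w where w: "w \<in> C_b (subtopology X U)" "AE x in ?N. P.semi (t / 2) ?u x = w x"
    by (rule part_semi_continuous[OF fel U fin uc u t2(1)])
  have wm: "w \<in> borel_measurable ?N" using P.C_space_measurable[of w] w(1) by (simp add: C_b_def)
  have "w \<in> fdom ?P" using P.fdom_cong_AE[OF P.semi_mem[OF t2(1), of ?u], of w, unfolded part_space_simps(1,2), OF u wm w(2)] .
  moreover have "AE x in ?N. heat ?P t h x = w x"
    using w(2) P.heat_eq_semi[OF t2(2), of ?u, unfolded part_space_simps, OF u]
      PF.heat_add[OF t2(2) t2(2), of h, unfolded part_space_simps, OF h] by eventually_elim simp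
  ultimately show ?thesis using w(1) by blast
qed

text \<open>\<open>D\<close> is meant to be the Feller space on the larger open set; the
  approximants live on its part \<open>P\<close> on \<open>U\<close>.\<close>

lemma heat_approximants:
  assumes fel: "doubly_feller D" and U: "openin X U" and fin: "finite_measure (meas (part_space D U))"
    and uc: "ultracontractive (part_space D U)" and lam: "0 \<le> lam"
    and corr: "shift_corrector D lam f U g" and h: "integrable (meas (part_space D U)) (\<lambda>y. f y - g y)"
  shows "\<exists>F :: nat \<Rightarrow> 'a \<Rightarrow> real.
     (\<forall>k\<ge>1.
        (AE x in meas (part_space D U).
           F k x = exp (- lam / real k) * heat (part_space D U) (1 / real k) (\<lambda>y. f y - g y) x + g x) \<and>
        F k \<in> F_loc (part_space D U) \<inter> C_b (topo (part_space D U)) \<and>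
        locally_shift_defective (part_space D U) lam (F k) \<and>
        weakly_subharmonic (part_space D U) lam (F k)) \<and>
     (AE x in meas (part_space D U). (\<forall>k\<ge>1. F (Suc k) x \<le> F k x) \<and> (\<lambda>k. F k x) \<longlonglongrightarrow> f x) \<and>
     usc_representative (part_space D U) f (\<lambda>x. INF k\<in>{1..}. ereal (F k x))"
proof -
  define P where "P = part_space D U"
  interpret P: dspace P unfolding P_def by (rule dspace_part[OF U])
  interpret PF: fmform P by (intro fmform.intro fmform_axioms.intro P.mform_axioms) (use fin in \<open>simp add: P_def\<close>)
  let ?h = "\<lambda>y. f y - g y" and ?H = "\<lambda>t. heat P t (\<lambda>y. f y - g y)"
  have hi: "integrable P.M ?h" using h by (simp add: P_def)
  have g: "g \<in> C_b P.X" "weakly_harmonic P lam g" and sd: "\<And>t. 0 < t \<Longrightarrow> AE x in P.M. ?h x \<le> exp (- t * lam) * ?H t x"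
    using corr unfolding shift_corrector_def P_def by blast+
  have "\<forall>t\<in>{0<..}. \<exists>w. w \<in> C_b P.X \<and> w \<in> fdom P \<and> (AE x in P.M. ?H t x = w x)"
    using heat_regular[OF fel U _ uc, of ?h] fin h unfolding P_def part_space_simps(1,2) by blast
  from bchoice[OF this] obtain w where w: "\<And>t. 0 < t \<Longrightarrow> w t \<in> C_b P.X" "\<And>t. 0 < t \<Longrightarrow> w t \<in> fdom P"
    "\<And>t. 0 < t \<Longrightarrow> AE x in P.M. ?H t x = w t x" by auto
  have Hi: "integrable P.M (?H t)" if "0 \<le> t" for t by (rule PF.heat_L1(1)[OF that hi])
  \<comment> \<open>The semigroup at time \<open>s\<close> is applied to the defect inequality, so
    \<open>exp (- t * lam) * ?H t\<close> increases with \<open>t\<close>. Excessivity of the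
    approximants and their monotonicity in \<open>k\<close> are both instances.\<close>
  have shift: "AE x in P.M. ?H s x \<le> exp (- t * lam) * ?H (s + t) x" if s: "0 \<le> s" and t: "0 < t" for s t
    using PF.heat_mono_scale[OF s hi Hi[OF less_imp_le[OF t]] exp_gt_zero sd[OF t]] PF.heat_add[OF s less_imp_le[OF t] hi]
    by eventually_elim simp
  have wex: "AE x in P.M. w s x \<le> exp (- t * lam) * P.semi t (w s) x" if s: "0 < s" and t: "0 < t" for s t
  proof -
    note t0 = less_imp_le[OF t] and s0 = less_imp_le[OF s]
    note wL = P.C_b_L2(1)[OF PF.fin w(1)[OF s]]
    have HL: "?H s \<in> L2 P.M"
      by (rule L2_cong_AE[OF wL borel_measurable_integrable[OF Hi[OF s0]] AE_symmetric[OF w(3)[OF s]]])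
    show ?thesis
      using shift[OF s0 t] PF.heat_add[OF t0 s0 hi] P.heat_eq_semi[OF t0 HL] P.semi_cong_AE[OF t0 HL L2_measurable[OF wL] w(3)[OF s]] w(3)[OF s]
      by eventually_elim (simp add: add.commute)
  qed
  let ?c = "\<lambda>k. exp (- lam / real k)"
  define W where "W k = (\<lambda>x. ?c k * w (1 / real k) x)" for k :: nat
  define F where "F k = (\<lambda>x. W k x + g x)" for k :: nat
  have W: "W k \<in> C_b P.X" "W k \<in> fdom P" "AE x in P.M. W k x = ?c k * ?H (1 / real k) x"
    "\<And>t. 0 < t \<Longrightarrow> AE x in P.M. W k x \<le> exp (- t * lam) * P.semi t (W k) x" if k: "1 \<le> k" for k
  proof -
    have s: "0 < 1 / real k" using k by simp
    show "W k \<in> C_b P.X" using P.C_b_lin[OF w(1)[OF s] w(1)[OF s], of "?c k" 0] by (simp add: W_def)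
    show "W k \<in> fdom P" unfolding W_def by (rule P.E.scale_mem[OF w(2)[OF s]])
    show "AE x in P.M. W k x = ?c k * ?H (1 / real k) x" using w(3)[OF s] by eventually_elim (simp add: W_def)
    fix t :: real assume t: "0 < t"
    show "AE x in P.M. W k x \<le> exp (- t * lam) * P.semi t (W k) x"
      using wex[OF s t] P.semi_scale[OF less_imp_le[OF t] P.C_b_L2(1)[OF PF.fin w(1)[OF s]], of "?c k"] unfolding W_def
    proof eventually_elim
      case (elim x)
      have "?c k * w (1 / real k) x \<le> ?c k * (exp (- t * lam) * P.semi t (w (1 / real k)) x)"
        using elim(1) by (intro mult_left_mono) auto
      thus ?case unfolding elim(2) by (simp only: mult.left_commute)
    qed
  qed
  have FCb: "F k \<in> C_b P.X" if "1 \<le> k" for k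
    using P.C_b_lin[OF W(1)[OF that] g(1), of 1 1] by (simp add: F_def)
  have sub: "weakly_subharmonic P lam (F k)" if k: "1 \<le> k" for k
    unfolding F_def by (rule P.weakly_subharmonic_add[OF _ W(2)[OF k] P.excessive_form[OF W(2)[OF k] W(4)[OF k]]])
      (use g(2) in \<open>simp_all add: weakly_harmonic_def\<close>)
  have sdF: "locally_shift_defective P lam (F k)" if k: "1 \<le> k" for k
    unfolding locally_shift_defective_def
  proof (intro conjI allI impI)
    note FL = P.C_b_L2[OF PF.fin FCb[OF k]]
    have "integrable P.M (\<lambda>x. indicat_real K x *\<^sub>R F k x)" if "compactin P.X K" for K
      by (rule integrable_mult_indicator[OF P.compact_sets[OF that] FL(2)])
    with L2_measurable[OF FL(1)] show "F k \<in> L1loc P.X P.M" unfolding L1loc_def set_integrable_def by blast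
    fix V assume "relcompact_open P.X V"
    thus "\<exists>G. shift_corrector P lam (F k) V G"
      unfolding F_def by (intro P.shift_corrector_part[OF PF.fin W(1)[OF k] lam _ g] W(4)[OF k])
  qed
  have ge: "AE x in P.M. f x \<le> F k x" if k: "1 \<le> k" for k
  proof -
    have "0 < 1 / real k" using k by simp
    from sd[OF this] W(3)[OF k] show ?thesis by eventually_elim (simp add: F_def)
  qed
  have dec: "AE x in P.M. F (Suc k) x \<le> F k x" if k: "1 \<le> k" for k
  proof -
    \<comment> \<open>The time between consecutive approximants; the exponential factors then
      multiply to the one belonging to \<open>1 / k\<close>.\<close>
    let ?t = "1 / real k - 1 / real (Suc k)"
    have t: "0 < ?t" using k by (simp add: frac_less2)
    have e: "?c (Suc k) * exp (- ?t * lam) = ?c k" unfolding mult_exp_exp by (simp add: algebra_simps diff_divide_distrib)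
    have "1 / real (Suc k) + ?t = 1 / real k" by simp
    with shift[OF _ t, of "1 / real (Suc k)"] have "AE x in P.M. ?H (1 / real (Suc k)) x \<le> exp (- ?t * lam) * ?H (1 / real k) x"
      by (simp only: zero_le_divide_1_iff of_nat_0_le_iff)
    moreover have "1 \<le> Suc k" by simp
    note W(3)[OF k] W(3)[OF this]
    ultimately show ?thesis
    proof eventually_elim
      case (elim x)
      from elim(1) have "?c (Suc k) * ?H (1 / real (Suc k)) x \<le> ?c (Suc k) * (exp (- ?t * lam) * ?H (1 / real k) x)"
        by (intro mult_left_mono) auto
      thus ?case using elim(2,3) unfolding mult.assoc[symmetric] e by (simp add: F_def)
    qed
  qed
  have lim: "AE x in P.M. (\<lambda>k. F k x) \<longlonglongrightarrow> f x"
  proof -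
    \<comment> \<open>Nonnegative and decreasing in \<open>k\<close>, with integrals tending to 0 by
      L1 continuity. The index is shifted because the approximants start at
      \<open>k = 1\<close>.\<close>
    let ?a = "\<lambda>k x. W (Suc k) x - ?h x"
    have Wi: "integrable P.M (W (Suc k))" for k by (rule P.C_b_L2(2)[OF PF.fin W(1)]) simp
    have s0: "(\<lambda>k. 1 / real (Suc k)) \<longlonglongrightarrow> 0" using LIMSEQ_inverse_real_of_nat by (simp add: inverse_eq_divide)
    hence s: "filterlim (\<lambda>k. 1 / real (Suc k)) (at_right 0) sequentially"
      unfolding filterlim_at by (auto intro!: always_eventually)
    have "(\<lambda>k. (\<integral>x. ?H (1 / real (Suc k)) x \<partial>P.M) - (\<integral>x. ?h x \<partial>P.M)) \<longlonglongrightarrow> 0"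
    proof (rule Lim_null_comparison[OF always_eventually[OF allI] filterlim_compose[OF PF.heat_tendsto_L1[OF hi] s]])
      fix k
      have Hk: "integrable P.M (?H (1 / real (Suc k)))" by (rule Hi) simp
      show "norm ((\<integral>x. ?H (1 / real (Suc k)) x \<partial>P.M) - (\<integral>x. ?h x \<partial>P.M)) \<le> (\<integral>x. \<bar>?H (1 / real (Suc k)) x - ?h x\<bar> \<partial>P.M)"
        unfolding Bochner_Integration.integral_diff[OF Hk hi, symmetric] real_norm_def by (rule integral_abs_bound)
    qed
    hence "(\<lambda>k. (\<integral>x. ?H (1 / real (Suc k)) x \<partial>P.M)) \<longlonglongrightarrow> (\<integral>x. ?h x \<partial>P.M)" by (rule LIM_zero_cancel)
    moreover have "(\<lambda>k. exp (- lam * (1 / real (Suc k)))) \<longlonglongrightarrow> exp (- lam * 0)" by (intro tendsto_intros s0)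
    ultimately have "(\<lambda>k. exp (- lam * (1 / real (Suc k))) * (\<integral>x. ?H (1 / real (Suc k)) x \<partial>P.M) - (\<integral>x. ?h x \<partial>P.M))
        \<longlonglongrightarrow> exp (- lam * 0) * (\<integral>x. ?h x \<partial>P.M) - (\<integral>x. ?h x \<partial>P.M)" by (intro tendsto_diff tendsto_mult tendsto_const)
    moreover have "(\<integral>x. ?a k x \<partial>P.M) = exp (- lam * (1 / real (Suc k))) * (\<integral>x. ?H (1 / real (Suc k)) x \<partial>P.M) - (\<integral>x. ?h x \<partial>P.M)" for k
    proof -
      have "(\<integral>x. W (Suc k) x \<partial>P.M) = (\<integral>x. ?c (Suc k) * ?H (1 / real (Suc k)) x \<partial>P.M)"
        by (rule integral_cong_AE) (use Wi[of k] Hi[of "1 / real (Suc k)"] W(3)[of "Suc k"] in auto)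
      thus ?thesis unfolding Bochner_Integration.integral_diff[OF Wi hi] by simp
    qed
    ultimately have l: "(\<lambda>k. \<integral>x. ?a k x \<partial>P.M) \<longlonglongrightarrow> 0" by simp
    have "AE x in P.M. (\<lambda>k. ?a k x) \<longlonglongrightarrow> 0"
    proof (rule AE_decreasing_tendsto_zero[OF _ _ _ l])
      show "integrable P.M (?a k)" for k by (rule Bochner_Integration.integrable_diff[OF Wi hi])
      show "AE x in P.M. ?a (Suc k) x \<le> ?a k x" for k using dec[of "Suc k"] by (simp add: F_def)
      show "AE x in P.M. 0 \<le> ?a k x" for k using ge[of "Suc k"] by (simp add: F_def algebra_simps)
    qed
    thus ?thesis
    proof eventually_elim
      case (elim x)
      have "(\<lambda>k. F (Suc k) x - f x) \<longlonglongrightarrow> 0" using elim by (simp add: F_def algebra_simps)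
      hence "(\<lambda>k. F (Suc k) x) \<longlonglongrightarrow> f x" by (simp add: LIM_zero_iff)
      thus ?case by (rule LIMSEQ_imp_Suc)
    qed
  qed
  have "AE x in P.M. \<forall>k\<in>{1..}. F (Suc k) x \<le> F k x" using dec by (intro AE_ball_countable[THEN iffD2]) auto
  with lim have mono: "AE x in P.M. (\<forall>k\<ge>1. F (Suc k) x \<le> F k x) \<and> (\<lambda>k. F k x) \<longlonglongrightarrow> f x"
    by eventually_elim auto
  have "AE x in P.M. F k x = ?c k * ?H (1 / real k) x + g x" if "1 \<le> k" for k
    using W(3)[OF that] by eventually_elim (simp add: F_def)
  moreover have "usc_representative P f (\<lambda>x. INF k\<in>{1..}. ereal (F k x))"
    by (rule P.usc_INF[OF _ mono]) (use FCb in \<open>simp add: C_b_def\<close>)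
  moreover have "F k \<in> F_loc P \<inter> C_b P.X" if "1 \<le> k" for k
    using sub[OF that] FCb[OF that] by (simp add: weakly_subharmonic_def)
  ultimately show ?thesis unfolding P_def[symmetric] using sub sdF mono by (intro exI[of _ F] conjI allI impI)
qed

text \<open>Representatives on overlapping sets agree only almost everywhere. The infimum over all
  sets containing the point is still upper semicontinuous, and countability of the cover keeps the
  exceptional set null.\<close>

lemma usc_glue:
  assumes U: "\<And>n::nat. openin X (U n)" "topspace X \<subseteq> (\<Union>n. U n)" and h: "\<And>n. usc_representative (part_space D (U n)) f (h n)"
  shows "usc_representative D f (\<lambda>x. INF n\<in>{n. x \<in> U n}. h n x)"
  unfolding usc_representative_def upper_semicontinuous_def
proof (intro conjI ballI allI)
  have sub: "topspace (subtopology X (U n)) = U n" for n using openin_subset[OF U(1)] by auto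
  note hh = h[unfolded usc_representative_def upper_semicontinuous_def part_space_simps part_AE[OF U(1)] sub]
  fix x assume "x \<in> topspace X"
  then obtain n where n: "x \<in> U n" using U(2) by blast
  hence "(INF n\<in>{n. x \<in> U n}. h n x) \<le> h n x" by (intro INF_lower) simp
  also have "\<dots> < \<infinity>" using hh n by blast
  finally show "(INF n\<in>{n. x \<in> U n}. h n x) < \<infinity>" .
next
  have sub: "topspace (subtopology X (U n)) = U n" for n using openin_subset[OF U(1)] by auto
  note hh = h[unfolded usc_representative_def upper_semicontinuous_def part_space_simps part_AE[OF U(1)] sub]
  fix a
  have "openin X {x \<in> U n. h n x < a}" for n using hh[of n] by (simp add: openin_open_subtopology[OF U(1)])
  hence "openin X (\<Union>n. {x \<in> U n. h n x < a})" by (intro openin_Union) auto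
  moreover have "(\<Union>n. {x \<in> U n. h n x < a}) = {x \<in> topspace X. (INF n\<in>{n. x \<in> U n}. h n x) < a}"
    using openin_subset[OF U(1)] by (auto simp: INF_less_iff)
  ultimately show "openin X {x \<in> topspace X. (INF n\<in>{n. x \<in> U n}. h n x) < a}" by simp
next
  have "AE x in M. x \<in> U n \<longrightarrow> h n x = ereal (f x)" for n
    using h[of n] unfolding usc_representative_def part_space_simps part_AE[OF U(1)] by blast
  hence "AE x in M. \<forall>n. x \<in> U n \<longrightarrow> h n x = ereal (f x)" by (simp add: AE_all_countable)
  thus "AE x in M. (INF n\<in>{n. x \<in> U n}. h n x) = ereal (f x)"
    using AE_space
  proof eventually_elim
    case (elim x)
    have "{n. x \<in> U n} \<noteq> {}" using elim(2) U(2) by (auto simp: space_M)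
    hence "(INF n\<in>{n. x \<in> U n}. ereal (f x)) = ereal (f x)" by (rule INF_const)
    moreover have "(INF n\<in>{n. x \<in> U n}. h n x) = (INF n\<in>{n. x \<in> U n}. ereal (f x))"
      by (intro INF_cong refl) (use elim(1) in auto)
    ultimately show ?case by simp
  qed
qed

end

theorem lemma4p7:
  fixes D :: "'a form_space" and lam :: real and f :: "'a \<Rightarrow> real"
  assumes "strongly_local_dirichlet_space D"
    and "locally_smoothing D"
    and "0 \<le> lam"
    and "locally_shift_defective D lam f"
  shows "(\<forall>U g. relcompact_open (topo D) U \<and> shift_corrector D lam f U g \<longrightarrow>
            (\<exists>F :: nat \<Rightarrow> 'a \<Rightarrow> real.
               (\<forall>k\<ge>1.
                  (AE x in meas (part_space D U).
                     F k x = exp (- lam / real k)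
                               * heat (part_space D U) (1 / real k) (\<lambda>y. f y - g y) x + g x) \<and>
                  F k \<in> F_loc (part_space D U) \<inter> C_b (topo (part_space D U)) \<and>
                  locally_shift_defective (part_space D U) lam (F k) \<and>
                  weakly_subharmonic (part_space D U) lam (F k)) \<and>
               (AE x in meas (part_space D U).
                  (\<forall>k\<ge>1. F (Suc k) x \<le> F k x) \<and> (\<lambda>k. F k x) \<longlonglongrightarrow> f x) \<and>
               usc_representative (part_space D U) f (\<lambda>x. INF k\<in>{1..}. ereal (F k x))))
       \<and> (\<exists>h. usc_representative D f h)"
  (is "(\<forall>U g. ?hyp U g \<longrightarrow> ?concl U g) \<and> _")
proof -
  interpret dspace D by (rule dspace.intro[OF assms(1)])
  have main: "?concl U g" if Ug: "?hyp U g" for U g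
  proof -
    have U: "relcompact_open X U" "openin X U" "compactin X (X closure_of U)" using Ug by (auto simp: relcompact_open_def)
    obtain U' where U': "openin X U'" "U \<subseteq> U'" "doubly_feller (part_space D U')" and uc: "ultracontractive (part_space D U)"
      using assms(2) U(1) unfolding locally_smoothing_def by blast
    interpret D': dspace "part_space D U'" by (rule dspace_part[OF U'(1)])
    \<comment> \<open>The argument takes place in the Feller part on \<open>U'\<close>; its part on
      \<open>U\<close> is the part of \<open>D\<close> on \<open>U\<close>, so the corrector
      \<open>g\<close> carries over unchanged.\<close>
    note pp = part_part[OF U'(1) U(2) U'(2)]
    note Us = open_sets[OF U(2)]
    have cl: "U \<subseteq> X closure_of U" by (rule closure_of_subset[OF openin_subset[OF U(2)]])
    have "emeasure M U < \<infinity>"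
      using emeasure_mono[OF cl compact_sets[OF U(3)]] compact_finite[OF U(3)] by simp
    hence fin: "finite_measure (meas (part_space D U))"
      by (intro finite_measureI) (use Us in \<open>simp add: emeasure_restrict_space space_restrict_space\<close>)
    interpret P: dspace "part_space D U" by (rule dspace_part[OF U(2)])
    have fi: "integrable (restrict_space M U) f"
    proof -
      have "set_integrable M (X closure_of U) f" using assms(4) U(3) by (simp add: locally_shift_defective_def L1loc_def)
      hence "set_integrable M U f" by (rule set_integrable_subset[OF _ Us cl])
      thus ?thesis unfolding part_integrable[OF U(2)] zero_ext_scaleR set_integrable_def .
    qed
    have "g \<in> C_b P.X" using Ug by (simp add: shift_corrector_def)
    from Bochner_Integration.integrable_diff[OF _ P.C_b_L2(2)[OF fin this]] fi
    have "integrable (meas (part_space D U)) (\<lambda>y. f y - g y)" by simp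
    moreover have "shift_corrector (part_space D U') lam f U g" using Ug unfolding shift_corrector_def pp by blast
    moreover have "openin D'.X U" using U(2) U'(2) by (simp add: openin_open_subtopology[OF U'(1)])
    ultimately show ?thesis
      using D'.heat_approximants[OF U'(3), of U lam f g, unfolded pp] fin uc assms(3) by blast
  qed
  \<comment> \<open>The global representative is glued from a countable cover by relatively compact
    sets, each with a corrector of its own supplied by local shift defectivity.\<close>
  obtain U where U: "\<And>n::nat. relcompact_open X (U n)" "topspace X \<subseteq> (\<Union>n. U n)" by (rule relcompact_cover, rule that)
  have "\<exists>h. usc_representative (part_space D (U n)) f h" for n
    using main[of "U n"] U(1) assms(4) unfolding locally_shift_defective_def by blast
  then obtain h where "\<And>n. usc_representative (part_space D (U n)) f (h n)" by metis
  from usc_glue[OF _ U(2) this] U(1) have "\<exists>h. usc_representative D f h" unfolding relcompact_open_def by blast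
  with main show ?thesis by blast
qed

end
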